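(* Let $\Omega=(X,\mathcal L)$ be a lacunary strong parapolar space with minimum symplectic rank $2$. Let $\Xi$ be the family of symps and let $\Sigma$ be the family of maximal singular subspaces (not assumed to be projective or finite-dimensional). Then $\Omega$ is one of the following geometries: (S) a Segre geometry $\mathsf A_{2,1}( * )\times\mathsf A_{2,1}( * )$, i.e. the Cartesian product of two projective planes; (GQ) an imbrex geometry such that $(X,\Sigma)$ is a generalized quadrangle and each member of $\Xi$ is an ideal subquadrangle of $(X,\Sigma)$; (CP) the Cartesian product of a thick line with either an arbitrary linear space with thick lines, or an arbitrary polar space; (DPS) a dual polar space of rank $3$, that is, $\mathsf B_{3,3}( * )$.
   Context: A point-line geometry $\Omega=(X,\mathcal L)$ is a set $X$ of points with a set $\mathcal L$ of subsets of $X$ (lines), each of size at least 2, covering $X$. Distinct points on a common line are called collinear ($x\perp y$); $x^\perp$ is the set of points equal or collinear to $x$. A subspace is a set of points containing every line joining two of its collinear points; it is singular if its points are pairwise collinear. Distance and diameter are taken in the collinearity graph. A subspace is convex if it contains all points of all shortest paths between its points; the convex closure of a set is the intersection of all convex subspaces containing it. Polar space: a point-line geometry such that every line has at least three points; no point is collinear to all other points; every nested sequence of singular subspaces is finite; for every point $x$ and line $L$, either one or all points of $L$ are collinear to $x$. Its singular subspaces are projective spaces (including $\emptyset$, of dimension $-1$), and its rank is the integer $r\ge 2$ such that its maximal singular subspaces have dimension $r-1$ (only finite rank is considered). It is thick if every singular subspace of dimension $r-2$ lies in at least three maximal singular subspaces. Parapolar space: a point-line geometry $\Omega$ such that (PPS1)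 $\Omega$ is connected; for each line $L$ and point $p\notin L$, $p$ is collinear to none, one or all points of $L$; and some pair $(p,L)$ has $p$ collinear to no point of $L$; (PPS2) for non-collinear points $p,q$ with $p^\perp\cap q^\perp\neq\emptyset$, either the convex closure of $\{p,q\}$ is a polar space (called a symplecton or symp), or $p^\perp\cap q^\perp$ is a single point (then $p,q$ are called special); (PPS3) every line is contained in a symp. It is strong if it has no special pairs. Minimum symplectic rank $d$: the minimum of the ranks of the symps is $d$. Symplectic rank $d$: all symps have rank $d$. $k$-lacunary ($k\ge -1$ an integer): every symp has rank at least $k+1$, and no two symps intersect in precisely a $k$-dimensional singular subspace (the empty set has dimension $-1$). Lacunary: $k$-lacunary for some $k\ge -1$. Thick line: a line with at least three points. Linear space: a point-line geometry in which any two distinct points are on a unique line. $\mathsf A_{2,1}( * )$: any (axiomatic) projective plane. The Cartesian product of $(X_1,\mathcal L_1)$ and $(X_2,\mathcal L_2)$ has point set $X_1\times X_2$ and lines $\{p_1\}\times L_2$ and $L_1\times\{p_2\}$ with $p_i\in X_i$, $L_i\in\mathcal L_i$. $\mathsf B_{3,3}( * )$: the points are the singular planes of a thick polar space of rank $3$, and a line is the set of all singular planes containing a fixed line. An imbrex geometry is a strong parapolar space of diameter $2$ and symplectic rank $2$ such that every pair of symps which share a point $p$ and both intersect a certain line at points not collinear to $p$, share a line. An ideal subquadrangle of a generalized quadrangle is a subquadrangle such that every line of the ambient quadrangle through one of its points is (the extension of) a line of the subquadrangle. *)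

theory Defs
  imports "HOL.Hull" "HOL-Library.Extended_Nat"
begin

section \<open>Point-line geometries\<close>

record 'a geometry =
  Points :: "'a set"
  Lines :: "'a set set"

definition has_at_least :: "nat \<Rightarrow> 'a set \<Rightarrow> bool" where
  "has_at_least n A \<longleftrightarrow> infinite A \<or> n \<le> card A"

definition point_line_geometry :: "'a geometry \<Rightarrow> bool" where
  "point_line_geometry \<Gamma> \<longleftrightarrow>
     (\<forall>L\<in>Lines \<Gamma>. L \<subseteq> Points \<Gamma> \<and> has_at_least 2 L) \<and> \<Union>(Lines \<Gamma>) = Points \<Gamma>"

definition collinear_in :: "'a geometry \<Rightarrow> 'a \<Rightarrow> 'a \<Rightarrow> bool" where
  "collinear_in \<Gamma> x y \<longleftrightarrow> x \<noteq> y \<and> (\<exists>L\<in>Lines \<Gamma>. x \<in> L \<and> y \<in> L)"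

definition perp :: "'a geometry \<Rightarrow> 'a \<Rightarrow> 'a set" where
  "perp \<Gamma> x = {y \<in> Points \<Gamma>. y = x \<or> collinear_in \<Gamma> x y}"

definition pl_isomorphic :: "'a geometry \<Rightarrow> 'b geometry \<Rightarrow> bool" where
  "pl_isomorphic \<Gamma> \<Delta> \<longleftrightarrow>
     (\<exists>f. bij_betw f (Points \<Gamma>) (Points \<Delta>) \<and> (`) f ` Lines \<Gamma> = Lines \<Delta>)"

section \<open>Subspaces and dimension\<close>

definition pl_subspace :: "'a geometry \<Rightarrow> 'a set \<Rightarrow> bool" where
  "pl_subspace \<Gamma> S \<longleftrightarrow> S \<subseteq> Points \<Gamma> \<and>
     (\<forall>x\<in>S. \<forall>y\<in>S. \<forall>L\<in>Lines \<Gamma>. x \<noteq> y \<and> x \<in> L \<and> y \<in> L \<longrightarrow> L \<subseteq> S)"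

definition singular_subspace :: "'a geometry \<Rightarrow> 'a set \<Rightarrow> bool" where
  "singular_subspace \<Gamma> S \<longleftrightarrow> pl_subspace \<Gamma> S \<and>
     (\<forall>x\<in>S. \<forall>y\<in>S. x \<noteq> y \<longrightarrow> collinear_in \<Gamma> x y)"

definition maximal_singular_subspaces :: "'a geometry \<Rightarrow> 'a set set" where
  "maximal_singular_subspaces \<Gamma> =
     {S. singular_subspace \<Gamma> S \<and> (\<forall>T. singular_subspace \<Gamma> T \<and> S \<subseteq> T \<longrightarrow> T = S)}"

definition induced_geometry :: "'a geometry \<Rightarrow> 'a set \<Rightarrow> 'a geometry" where
  "induced_geometry \<Gamma> S = \<lparr>Points = S, Lines = {L \<in> Lines \<Gamma>. L \<subseteq> S}\<rparr>"

text \<open>The usual projective dimension: one less than the least number of points that generate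
  the subspace; in particular the empty subspace has dimension $-1$. It is only used for
  subspaces that are singular subspaces of polar spaces, hence projective spaces.\<close>

definition has_dim :: "'a geometry \<Rightarrow> 'a set \<Rightarrow> int \<Rightarrow> bool" where
  "has_dim \<Gamma> S n \<longleftrightarrow>
     (\<exists>A\<subseteq>S. finite A \<and> pl_subspace \<Gamma> hull A = S \<and> int (card A) = n + 1) \<and>
     (\<forall>A\<subseteq>S. finite A \<and> pl_subspace \<Gamma> hull A = S \<longrightarrow> n + 1 \<le> int (card A))"

section \<open>Distance and convexity\<close>

definition is_path :: "'a geometry \<Rightarrow> 'a \<Rightarrow> 'a list \<Rightarrow> 'a \<Rightarrow> bool" where
  "is_path \<Gamma> x xs y \<longleftrightarrow> xs \<noteq> [] \<and> set xs \<subseteq> Points \<Gamma> \<and>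
     successively (collinear_in \<Gamma>) xs \<and> hd xs = x \<and> last xs = y"

definition pl_distance :: "'a geometry \<Rightarrow> 'a \<Rightarrow> 'a \<Rightarrow> enat" where
  "pl_distance \<Gamma> x y = (INF xs\<in>{xs. is_path \<Gamma> x xs y}. enat (length xs - 1))"

definition pl_diameter :: "'a geometry \<Rightarrow> enat" where
  "pl_diameter \<Gamma> = (SUP x\<in>Points \<Gamma>. SUP y\<in>Points \<Gamma>. pl_distance \<Gamma> x y)"

definition pl_connected :: "'a geometry \<Rightarrow> bool" where
  "pl_connected \<Gamma> \<longleftrightarrow> (\<forall>x\<in>Points \<Gamma>. \<forall>y\<in>Points \<Gamma>. \<exists>xs. is_path \<Gamma> x xs y)"

definition is_shortest_path :: "'a geometry \<Rightarrow> 'a \<Rightarrow> 'a list \<Rightarrow> 'a \<Rightarrow> bool" where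
  "is_shortest_path \<Gamma> x xs y \<longleftrightarrow>
     is_path \<Gamma> x xs y \<and> enat (length xs - 1) = pl_distance \<Gamma> x y"

definition convex_subspace :: "'a geometry \<Rightarrow> 'a set \<Rightarrow> bool" where
  "convex_subspace \<Gamma> S \<longleftrightarrow> pl_subspace \<Gamma> S \<and>
     (\<forall>x\<in>S. \<forall>y\<in>S. \<forall>xs. is_shortest_path \<Gamma> x xs y \<longrightarrow> set xs \<subseteq> S)"

definition convex_closure :: "'a geometry \<Rightarrow> 'a set \<Rightarrow> 'a set" where
  "convex_closure \<Gamma> A = convex_subspace \<Gamma> hull A"

section \<open>Polar spaces\<close>

text \<open>The empty geometry, which satisfies all the other axioms vacuously, is excluded: it has no
  rank $r \ge 2$.\<close>

definition polar_space :: "'a geometry \<Rightarrow> bool" where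
  "polar_space \<Gamma> \<longleftrightarrow>
     point_line_geometry \<Gamma> \<and> Points \<Gamma> \<noteq> {} \<and>
     (\<forall>L\<in>Lines \<Gamma>. has_at_least 3 L) \<and>
     (\<forall>x\<in>Points \<Gamma>. \<exists>y\<in>Points \<Gamma>. y \<notin> perp \<Gamma> x) \<and>
     (\<forall>C. C \<subseteq> Collect (singular_subspace \<Gamma>) \<and> chain\<^sub>\<subseteq> C \<longrightarrow> finite C) \<and>
     (\<forall>x\<in>Points \<Gamma>. \<forall>L\<in>Lines \<Gamma>. (\<exists>!y. y \<in> L \<inter> perp \<Gamma> x) \<or> L \<subseteq> perp \<Gamma> x)"

definition polar_space_of_rank :: "'a geometry \<Rightarrow> nat \<Rightarrow> bool" where
  "polar_space_of_rank \<Gamma> r \<longleftrightarrow> polar_space \<Gamma> \<and> 2 \<le> r \<and>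
     (\<forall>M\<in>maximal_singular_subspaces \<Gamma>. has_dim \<Gamma> M (int r - 1))"

definition thick_polar_space_of_rank :: "'a geometry \<Rightarrow> nat \<Rightarrow> bool" where
  "thick_polar_space_of_rank \<Gamma> r \<longleftrightarrow> polar_space_of_rank \<Gamma> r \<and>
     (\<forall>S. singular_subspace \<Gamma> S \<and> has_dim \<Gamma> S (int r - 2) \<longrightarrow>
        has_at_least 3 {M \<in> maximal_singular_subspaces \<Gamma>. S \<subseteq> M})"

section \<open>Parapolar spaces\<close>

definition symps :: "'a geometry \<Rightarrow> 'a set set" where
  "symps \<Gamma> = {\<xi>. \<exists>p\<in>Points \<Gamma>. \<exists>q\<in>Points \<Gamma>.
     q \<notin> perp \<Gamma> p \<and> perp \<Gamma> p \<inter> perp \<Gamma> q \<noteq> {} \<and>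
     \<xi> = convex_closure \<Gamma> {p, q} \<and> polar_space (induced_geometry \<Gamma> \<xi>)}"

definition special_pair :: "'a geometry \<Rightarrow> 'a \<Rightarrow> 'a \<Rightarrow> bool" where
  "special_pair \<Gamma> p q \<longleftrightarrow> p \<in> Points \<Gamma> \<and> q \<in> Points \<Gamma> \<and> q \<notin> perp \<Gamma> p \<and>
     is_singleton (perp \<Gamma> p \<inter> perp \<Gamma> q)"

definition parapolar_space :: "'a geometry \<Rightarrow> bool" where
  "parapolar_space \<Gamma> \<longleftrightarrow>
     point_line_geometry \<Gamma> \<and>
     pl_connected \<Gamma> \<and>
     (\<forall>L\<in>Lines \<Gamma>. \<forall>p\<in>Points \<Gamma> - L.
        L \<inter> perp \<Gamma> p = {} \<or> is_singleton (L \<inter> perp \<Gamma> p) \<or> L \<subseteq> perp \<Gamma> p) \<and>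
     (\<exists>L\<in>Lines \<Gamma>. \<exists>p\<in>Points \<Gamma> - L. L \<inter> perp \<Gamma> p = {}) \<and>
     (\<forall>p\<in>Points \<Gamma>. \<forall>q\<in>Points \<Gamma>. q \<notin> perp \<Gamma> p \<and> perp \<Gamma> p \<inter> perp \<Gamma> q \<noteq> {} \<longrightarrow>
        polar_space (induced_geometry \<Gamma> (convex_closure \<Gamma> {p, q})) \<or>
        is_singleton (perp \<Gamma> p \<inter> perp \<Gamma> q)) \<and>
     (\<forall>L\<in>Lines \<Gamma>. \<exists>\<xi>\<in>symps \<Gamma>. L \<subseteq> \<xi>)"

definition strong_parapolar_space :: "'a geometry \<Rightarrow> bool" where
  "strong_parapolar_space \<Gamma> \<longleftrightarrow> parapolar_space \<Gamma> \<and> (\<nexists>p q. special_pair \<Gamma> p q)"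

definition symp_has_rank :: "'a geometry \<Rightarrow> 'a set \<Rightarrow> nat \<Rightarrow> bool" where
  "symp_has_rank \<Gamma> \<xi> r \<longleftrightarrow> polar_space_of_rank (induced_geometry \<Gamma> \<xi>) r"

definition minimum_symplectic_rank :: "'a geometry \<Rightarrow> nat \<Rightarrow> bool" where
  "minimum_symplectic_rank \<Gamma> d \<longleftrightarrow>
     (\<exists>\<xi>\<in>symps \<Gamma>. symp_has_rank \<Gamma> \<xi> d) \<and> (\<forall>\<xi>\<in>symps \<Gamma>. \<exists>r\<ge>d. symp_has_rank \<Gamma> \<xi> r)"

definition symplectic_rank :: "'a geometry \<Rightarrow> nat \<Rightarrow> bool" where
  "symplectic_rank \<Gamma> d \<longleftrightarrow> (\<forall>\<xi>\<in>symps \<Gamma>. symp_has_rank \<Gamma> \<xi> d)"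

definition k_lacunary :: "int \<Rightarrow> 'a geometry \<Rightarrow> bool" where
  "k_lacunary k \<Gamma> \<longleftrightarrow>
     (\<forall>\<xi>\<in>symps \<Gamma>. \<exists>r. k + 1 \<le> int r \<and> symp_has_rank \<Gamma> \<xi> r) \<and>
     (\<forall>\<xi>\<in>symps \<Gamma>. \<forall>\<zeta>\<in>symps \<Gamma>. \<xi> \<noteq> \<zeta> \<longrightarrow>
        \<not> (singular_subspace \<Gamma> (\<xi> \<inter> \<zeta>) \<and> has_dim \<Gamma> (\<xi> \<inter> \<zeta>) k))"

definition lacunary :: "'a geometry \<Rightarrow> bool" where
  "lacunary \<Gamma> \<longleftrightarrow> (\<exists>k\<ge>-1. k_lacunary k \<Gamma>)"

section \<open>The geometries of the classification\<close>

definition cartesian_product :: "'a geometry \<Rightarrow> 'b geometry \<Rightarrow> ('a \<times> 'b) geometry" where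
  "cartesian_product \<Gamma> \<Delta> = \<lparr>Points = Points \<Gamma> \<times> Points \<Delta>,
     Lines = {{p} \<times> M | p M. p \<in> Points \<Gamma> \<and> M \<in> Lines \<Delta>} \<union>
             {L \<times> {q} | L q. L \<in> Lines \<Gamma> \<and> q \<in> Points \<Delta>}\<rparr>"

definition linear_space :: "'a geometry \<Rightarrow> bool" where
  "linear_space \<Gamma> \<longleftrightarrow> point_line_geometry \<Gamma> \<and>
     (\<forall>x\<in>Points \<Gamma>. \<forall>y\<in>Points \<Gamma>. x \<noteq> y \<longrightarrow> (\<exists>!L. L \<in> Lines \<Gamma> \<and> x \<in> L \<and> y \<in> L))"

definition has_thick_lines :: "'a geometry \<Rightarrow> bool" where
  "has_thick_lines \<Gamma> \<longleftrightarrow> (\<forall>L\<in>Lines \<Gamma>. has_at_least 3 L)"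

text \<open>The last clause asks for four points no three of which are on a common line.\<close>

definition projective_plane :: "'a geometry \<Rightarrow> bool" where
  "projective_plane \<Gamma> \<longleftrightarrow> linear_space \<Gamma> \<and>
     (\<forall>L\<in>Lines \<Gamma>. \<forall>M\<in>Lines \<Gamma>. L \<inter> M \<noteq> {}) \<and>
     (\<exists>Q\<subseteq>Points \<Gamma>. card Q = 4 \<and> (\<forall>L\<in>Lines \<Gamma>. card (Q \<inter> L) \<le> 2))"

definition thick_line :: "'a geometry \<Rightarrow> bool" where
  "thick_line \<Gamma> \<longleftrightarrow> Lines \<Gamma> = {Points \<Gamma>} \<and> has_at_least 3 (Points \<Gamma>)"

definition generalized_quadrangle :: "'a geometry \<Rightarrow> bool" where
  "generalized_quadrangle \<Gamma> \<longleftrightarrow> point_line_geometry \<Gamma> \<and> Points \<Gamma> \<noteq> {} \<and>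
     (\<forall>L\<in>Lines \<Gamma>. \<forall>M\<in>Lines \<Gamma>. \<forall>x\<in>L \<inter> M. \<forall>y\<in>L \<inter> M. x \<noteq> y \<longrightarrow> L = M) \<and>
     (\<forall>p\<in>Points \<Gamma>. has_at_least 2 {L \<in> Lines \<Gamma>. p \<in> L}) \<and>
     (\<forall>L\<in>Lines \<Gamma>. \<forall>p\<in>Points \<Gamma> - L. \<exists>!q. q \<in> L \<and> collinear_in \<Gamma> p q)"

definition subquadrangle :: "'a geometry \<Rightarrow> 'a geometry \<Rightarrow> bool" where
  "subquadrangle \<Delta> \<Gamma> \<longleftrightarrow> generalized_quadrangle \<Delta> \<and> generalized_quadrangle \<Gamma> \<and>
     Points \<Delta> \<subseteq> Points \<Gamma> \<and> (\<forall>K\<in>Lines \<Delta>. \<exists>L\<in>Lines \<Gamma>. K = L \<inter> Points \<Delta>)"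

definition ideal_subquadrangle :: "'a geometry \<Rightarrow> 'a geometry \<Rightarrow> bool" where
  "ideal_subquadrangle \<Delta> \<Gamma> \<longleftrightarrow> subquadrangle \<Delta> \<Gamma> \<and>
     (\<forall>p\<in>Points \<Delta>. \<forall>L\<in>Lines \<Gamma>. p \<in> L \<longrightarrow> L \<inter> Points \<Delta> \<in> Lines \<Delta>)"

text \<open>A point equal to $p$ is not meant by ``not collinear to $p$'', so that phrase is read as
  ``outside $p^\perp$''.\<close>

definition imbrex_geometry :: "'a geometry \<Rightarrow> bool" where
  "imbrex_geometry \<Gamma> \<longleftrightarrow>
     strong_parapolar_space \<Gamma> \<and> pl_diameter \<Gamma> = 2 \<and> symplectic_rank \<Gamma> 2 \<and>
     (\<forall>\<xi>\<in>symps \<Gamma>. \<forall>\<zeta>\<in>symps \<Gamma>. \<forall>p\<in>\<xi> \<inter> \<zeta>. \<forall>L\<in>Lines \<Gamma>.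
        L \<inter> \<xi> - perp \<Gamma> p \<noteq> {} \<and> L \<inter> \<zeta> - perp \<Gamma> p \<noteq> {} \<longrightarrow>
        (\<exists>K\<in>Lines \<Gamma>. K \<subseteq> \<xi> \<inter> \<zeta>))"

definition singular_planes :: "'a geometry \<Rightarrow> 'a set set" where
  "singular_planes \<Gamma> = {\<pi>. singular_subspace \<Gamma> \<pi> \<and> has_dim \<Gamma> \<pi> 2}"

definition dual_polar_space_rank3 :: "'a geometry \<Rightarrow> 'a set geometry" where
  "dual_polar_space_rank3 \<Gamma> = \<lparr>Points = singular_planes \<Gamma>,
     Lines = {{\<pi> \<in> singular_planes \<Gamma>. L \<subseteq> \<pi>} | L. L \<in> Lines \<Gamma>}\<rparr>"

end

theory Submission
  imports Defs
begin

text \<open>A symp of rank 2 forces \<open>k \<le> 0\<close>. For \<open>k = -1\<close> any two symps meet. Then all symps have rank 2,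
  and a point outside a symp that is collinear with one of its points is collinear with a second one.
  So every maximal clique through a point of a symp meets this symp in a line, and the maximal
  cliques are the lines of a generalized quadrangle.

  For \<open>k = 0\<close> two symps that meet share a line. If some symp has rank at least 3, then the residues
  at points, restricted to the symps of higher rank, are covered by the case \<open>k = -1\<close>. It follows that all
  lines through some point \<open>x\<close> lie in a symp \<open>\<zeta>\<close>, except for one line \<open>T\<close>. This local product structure
  spreads over \<open>\<zeta>\<close>, and the geometry is \<open>T \<times> \<zeta>\<close>. If all symps have rank 2, then
  either every point outside a symp is collinear with two or more of its points, and the quadrangle
  argument applies again, or there are no triangles. In that last case a line
  in only two symps yields a local product, and otherwise the symps are the points, and the
  pencils of symps through a line are the lines, of a polar space of rank 3 whose planes are the
  points of the original geometry.

  The Segre geometries and the products of a line with a linear space fall under the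
  quadrangle case, so the corresponding alternatives of the theorem are never chosen.\<close>

section \<open>Polar spaces and symps\<close>

text \<open>The value k = 1 is impossible because a symp of rank 2 and the symp spanned by one of
  its lines and an outside neighbour meet in exactly that line. The passage from k = 0 to k = -1
  works because two symps through \<open>x\<close> share a line through \<open>x\<close>, which is a
  common point of their residues. A residue has lines as points, so the arguments live in abstract
  locales over a relation \<open>col\<close>, and rank enters only through \<open>rank2\<close>,
  which speaks of triangles and not of dimension. The hard point for k = -1 is
  \<open>not_singleton\<close>. In rank 2 no planes are given, since a maximal clique may be a
  single line. A point with only one neighbour in a symp is therefore used to build a clique larger
  than a line. In such a clique any two lines meet, because symps on them meet, and the
  nearest-point map from a symp into the clique can then be analysed. For k = 0 with mixed ranks the
  decisive fact is that only one symp of higher rank passes through \<open>x\<close>. The spreading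
  of local facts rests on connectedness, through \<open>near_symp\<close> and
  \<open>common_nbr\<close>.\<close>

text \<open>Here \<open>col x y\<close> means that \<open>x\<close> and \<open>y\<close> are equal or collinear. It is reflexive on the whole type,
  not only on the points.\<close>

locale collinearity =
  fixes col :: "'p \<Rightarrow> 'p \<Rightarrow> bool" and Ln :: "'p set set"
  assumes rf [simp]: "col x x"
    and sy: "col x y \<Longrightarrow> col y x"
    and ln_col: "l \<in> Ln \<Longrightarrow> a \<in> l \<Longrightarrow> b \<in> l \<Longrightarrow> col a b"
    and ln_thick: "l \<in> Ln \<Longrightarrow> \<exists>c\<in>l. c \<noteq> a \<and> c \<noteq> b"
    and ln_all: "l \<in> Ln \<Longrightarrow> a \<in> l \<Longrightarrow> b \<in> l \<Longrightarrow> a \<noteq> b \<Longrightarrow> col p a \<Longrightarrow> col p b \<Longrightarrow> c \<in> l \<Longrightarrow> col p c"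
begin

text \<open>The Buekenhout-Shult axioms for a subset of the ambient space, without finite rank. The
  alternative "one or all" is split: the third clause gives one, and \<open>ln_all\<close> turns two
  into all.\<close>

definition polar :: "'p set \<Rightarrow> bool" where
  "polar Q \<longleftrightarrow>
    (\<forall>a\<in>Q. \<forall>b\<in>Q. a \<noteq> b \<and> col a b \<longrightarrow> (\<exists>l\<in>Ln. a \<in> l \<and> b \<in> l)) \<and>
    (\<forall>l\<in>Ln. \<forall>a\<in>l \<inter> Q. \<forall>b\<in>l \<inter> Q. a \<noteq> b \<longrightarrow> l \<subseteq> Q) \<and>
    (\<forall>p\<in>Q. \<forall>l\<in>Ln. l \<subseteq> Q \<longrightarrow> (\<exists>a\<in>l. col p a)) \<and>
    (\<forall>p\<in>Q. \<exists>q\<in>Q. \<not> col p q)"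

lemma polar_line:
  assumes "polar Q" "a \<in> Q" "b \<in> Q" "a \<noteq> b" "col a b"
  obtains l where "l \<in> Ln" "a \<in> l" "b \<in> l" "l \<subseteq> Q"
  using assms unfolding polar_def by (metis IntI)

lemma polar_sub: "polar Q \<Longrightarrow> l \<in> Ln \<Longrightarrow> a \<in> l \<Longrightarrow> b \<in> l \<Longrightarrow> a \<in> Q \<Longrightarrow> b \<in> Q \<Longrightarrow> a \<noteq> b \<Longrightarrow> l \<subseteq> Q"
  unfolding polar_def by (metis IntI)

lemma polar_one: "polar Q \<Longrightarrow> p \<in> Q \<Longrightarrow> l \<in> Ln \<Longrightarrow> l \<subseteq> Q \<Longrightarrow> \<exists>a\<in>l. col p a"
  unfolding polar_def by metis

lemma polar_nd: "polar Q \<Longrightarrow> p \<in> Q \<Longrightarrow> \<exists>q\<in>Q. \<not> col p q"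
  unfolding polar_def by metis

text \<open>If the neighbours of \<open>x\<close> were all neighbours of \<open>y\<close>, they
  would see the whole line \<open>L\<close> through \<open>x\<close> and \<open>y\<close>
  (\<open>subL\<close>). A point \<open>n\<close> off the perp of \<open>x\<close> is then made to
  see two points of \<open>L\<close>, one of them through a point \<open>t\<close> collinear with
  \<open>x\<close>, and so it sees \<open>x\<close> after all.\<close>

lemma polar_sep:
  assumes Q: "polar Q" "x \<in> Q" "y \<in> Q" "x \<noteq> y"
  shows "\<exists>z\<in>Q. col z x \<and> \<not> col z y"
proof (rule ccontr)
  assume "\<not> ?thesis"
  then have sub: "\<And>z. z \<in> Q \<Longrightarrow> col z x \<Longrightarrow> col z y" by blast
  have "col x y" using sub Q by simp
  then obtain L where L: "L \<in> Ln" "x \<in> L" "y \<in> L" "L \<subseteq> Q" using polar_line Q by metis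
  have subL: "col z w" if "z \<in> Q" "col z x" "w \<in> L" for z w
    using that sub ln_all[of L x y z w] L Q(4) by blast
  obtain z where z: "z \<in> Q" "\<not> col y z" using polar_nd Q by blast
  have zx: "\<not> col z x" using z sub sy by metis
  obtain w where w: "w \<in> L" "col z w" using polar_one Q(1) z(1) L by blast
  have wQ: "w \<in> Q" using w L by blast
  have wz: "w \<noteq> z" using zx w L ln_col by blast
  obtain N where N: "N \<in> Ln" "z \<in> N" "w \<in> N" "N \<subseteq> Q" using polar_line[OF Q(1) z(1) wQ] w wz by metis
  obtain v where v: "v \<in> Q" "\<not> col w v" using polar_nd Q(1) wQ by blast
  have vx: "\<not> col v x" using subL[OF v(1) _ w(1)] v sy by metis
  obtain s where s: "s \<in> L" "col v s" using polar_one Q(1) v(1) L by blast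
  have sw: "s \<noteq> w" using s v sy by metis
  obtain n where n: "n \<in> N" "col v n" using polar_one Q(1) v(1) N by blast
  have nw: "n \<noteq> w" using n v sy by metis
  have nQ: "n \<in> Q" using n N by blast
  have nx: "\<not> col n x"
  proof
    assume "col n x"
    moreover have "col x w" using ln_col L w by blast
    ultimately have "col x z" using ln_all[of N n w x z] N n nw sy by metis
    then show False using zx sy by metis
  qed
  have vn: "v \<noteq> n" using v n N ln_col by blast
  obtain R where R: "R \<in> Ln" "v \<in> R" "n \<in> R" "R \<subseteq> Q" using polar_line[OF Q(1) v(1) nQ vn n(2)] by metis
  obtain t where t: "t \<in> R" "col x t" using polar_one Q(1,2) R by blast
  have tQ: "t \<in> Q" using t R by blast
  have tv: "t \<noteq> v" using t vx sy by metis
  have "col t s" using subL[OF tQ _ s(1)] t sy by metis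
  then have ns: "col s n" using ln_all[of R t v s n] R t tv s sy by metis
  have "col n w" using ln_col N n by blast
  then have "col n x" using ln_all[of L s w n x] L s w sw ns sy by metis
  then show False using nx by blast
qed

text \<open>Uniqueness of lines is not an axiom here. Seeing two points of either line means seeing
  both lines (\<open>colM\<close>, \<open>colL\<close>), so a point \<open>z\<close> of
  \<open>M\<close> off \<open>L\<close> can be told apart from a point \<open>l\<close> of
  \<open>L\<close> by \<open>polar_sep\<close>. One-or-all on the lines \<open>U\<close> and
  \<open>A\<close> defeats this separation.\<close>

lemma polar_uniq_sub:
  assumes Q: "polar Q" and L: "L \<in> Ln" "L \<subseteq> Q" and M: "M \<in> Ln" "M \<subseteq> Q"
    and xy: "x \<in> L" "y \<in> L" "x \<in> M" "y \<in> M" "x \<noteq> y"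
  shows "M \<subseteq> L"
proof
  fix z assume zM: "z \<in> M"
  show "z \<in> L"
  proof (rule ccontr)
    assume zL: "z \<notin> L"
    have zQ: "z \<in> Q" and xQ: "x \<in> Q" using zM M xy L by blast+
    have colM: "col p c" if "col p a" "col p b" "a \<in> L" "b \<in> L" "a \<noteq> b" "c \<in> M" for p a b c
      using that ln_all[OF L(1)] ln_all[OF M(1)] xy by metis
    have colL: "col p c" if "col p a" "col p b" "a \<in> M" "b \<in> M" "a \<noteq> b" "c \<in> L" for p a b c
      using that ln_all[OF L(1)] ln_all[OF M(1)] xy by metis
    have zx: "z \<noteq> x" "z \<noteq> y" using zL xy by auto
    obtain u where u: "u \<in> Q" "col u z" "\<not> col u x" using polar_sep[OF Q zQ xQ zx(1)] by blast
    obtain l where l: "l \<in> L" "col u l" using polar_one Q u(1) L by blast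
    have lz: "l \<noteq> z" using l zL by blast
    have lQ: "l \<in> Q" using l L by blast
    have lM: "l \<notin> M" using ln_all[OF M(1), of l z u x] l u xy zM lz by blast
    obtain w where w: "w \<in> Q" "col w z" "\<not> col w l" using polar_sep[OF Q zQ lQ] lz by blast
    have wx: "\<not> col w x"
    proof
      assume a: "col w x"
      then have "col w l" using colL[of w x z l] w xy zM zx l by blast
      then show False using w by blast
    qed
    have lx: "l \<noteq> x" using l u by blast
    have ul: "u \<noteq> l" using u l L ln_col xy by blast
    have uz: "u \<noteq> z" using u M xy zM ln_col by blast
    \<comment> \<open>replace \<open>u\<close> by a point of the line \<open>ul\<close> collinear with \<open>w\<close>\<close>
    obtain U where U: "U \<in> Ln" "u \<in> U" "l \<in> U" "U \<subseteq> Q" using polar_line[OF Q u(1) lQ ul l(2)] by metis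
    obtain a where a: "a \<in> U" "col w a" using polar_one Q w(1) U by blast
    have aQ: "a \<in> Q" using a U by blast
    have al: "a \<noteq> l" using a w by blast
    have zl: "col z l" using colM[of l x y z] ln_col L l xy zM sy by metis
    have az: "col z a" using ln_all[OF U(1,2,3) ul _ zl a(1)] u sy by metis
    have alc: "col a l" using ln_col U a by blast
    have ax: "\<not> col a x"
    proof
      assume "col a x"
      moreover have "col x l" using ln_col L l xy by blast
      ultimately have "col x u" using ln_all[OF U(1) a(1) U(3) al _ _ U(2)] sy by metis
      then show False using u sy by metis
    qed
    have aw: "a \<noteq> w" using alc w by blast
    obtain A where A: "A \<in> Ln" "a \<in> A" "w \<in> A" "A \<subseteq> Q" using polar_line[OF Q aQ w(1) aw] a sy by metis
    obtain t where t: "t \<in> A" "col x t" using polar_one Q xQ A by blast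
    have tz: "col z t" using ln_all[OF A(1,2,3) aw az _ t(1)] w sy by metis
    have "col t l" using colL[of t x z l] t tz xy zM zx l sy by metis
    moreover have "t \<noteq> a" using t ax sy by metis
    ultimately have "col l w" using ln_all[OF A(1) t(1) A(2) _ _ _ A(3)] alc sy by metis
    then show False using w sy by metis
  qed
qed

lemma polar_uniq:
  assumes "polar Q" "L \<in> Ln" "L \<subseteq> Q" "M \<in> Ln" "M \<subseteq> Q"
    "x \<in> L" "y \<in> L" "x \<in> M" "y \<in> M" "x \<noteq> y"
  shows "L = M"
  by (rule equalityI; rule polar_uniq_sub[of Q _ _ x y]) (use assms in auto)

text \<open>Only nondegeneracy needs an idea. A point \<open>r\<close> that sees \<open>a\<close>
  but not \<open>p\<close> is replaced by the point \<open>s\<close> of the line \<open>ra\<close>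
  that sees \<open>q\<close>. If \<open>p\<close> saw \<open>s\<close>, it would see the whole line
  and hence \<open>r\<close>.\<close>

lemma polar_residual:
  assumes Q: "polar Q" and a: "a \<in> Q" "q \<in> Q" "\<not> col a q"
  shows "polar {z \<in> Q. col z a \<and> col z q}" (is "polar ?R")
  unfolding polar_def
proof (intro conjI ballI impI)
  fix b c assume "b \<in> ?R" "c \<in> ?R" "b \<noteq> c \<and> col b c"
  then show "\<exists>l\<in>Ln. b \<in> l \<and> c \<in> l" by (metis (mono_tags, lifting) Q mem_Collect_eq polar_line)
next
  fix l b c assume l: "l \<in> Ln" "b \<in> l \<inter> ?R" "c \<in> l \<inter> ?R" "b \<noteq> c"
  then have "l \<subseteq> Q" using polar_sub[OF Q, of l b c] by blast
  moreover have "col z a" "col z q" if "z \<in> l" for z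
    using ln_all[of l b c a z] ln_all[of l b c q z] l that sy[of _ a] sy[of _ q] sy[of a] sy[of q] by simp_all
  ultimately show "l \<subseteq> ?R" by blast
next
  fix p l assume "p \<in> ?R" "l \<in> Ln" "l \<subseteq> ?R"
  then show "\<exists>a\<in>l. col p a" using polar_one[OF Q, of p l] by blast
next
  fix p assume "p \<in> ?R"
  then have p: "p \<in> Q" "col p a" "col p q" by auto
  then have "p \<noteq> a" using a by metis
  then obtain r where r: "r \<in> Q" "col r a" "\<not> col r p" using polar_sep[OF Q a(1) p(1)] by auto
  have ra: "r \<noteq> a" using r p sy by metis
  obtain l where l: "l \<in> Ln" "r \<in> l" "a \<in> l" "l \<subseteq> Q" using polar_line[OF Q r(1) a(1) ra r(2)] by metis
  obtain s where s: "s \<in> l" "col q s" using polar_one[OF Q a(2) l(1,4)] by metis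
  have sa: "s \<noteq> a" using s a sy by metis
  have "\<not> col p s" using ln_all[OF l(1) s(1) l(3) sa _ p(2) l(2)] r sy by metis
  moreover have "s \<in> ?R" using s l ln_col[OF l(1) s(1) l(3)] sy[OF s(2)] by auto
  ultimately show "\<exists>q\<in>?R. \<not> col p q" by metis
qed

text \<open>This says that \<open>l\<close> equals its double perp in \<open>Q\<close>. Different
  lines through \<open>a\<close> have different points in the perp of \<open>q\<close>, so
  \<open>l\<close> and the line \<open>ka\<close> become two points of the residual polar space,
  where \<open>polar_sep\<close> separates them.\<close>

lemma polar_line_closed:
  assumes Q: "polar Q" and l: "l \<in> Ln" "l \<subseteq> Q" and k: "k \<in> Q" "k \<notin> l" "\<forall>c\<in>l. col k c"
  shows "\<exists>n\<in>Q. (\<forall>c\<in>l. col n c) \<and> \<not> col n k"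
proof -
  obtain a where a: "a \<in> l" using ln_thick[OF l(1)] by blast
  obtain b where b: "b \<in> l" "b \<noteq> a" using ln_thick[OF l(1), of a a] by blast
  have aQ: "a \<in> Q" and bQ: "b \<in> Q" using a b l by blast+
  obtain q where q: "q \<in> Q" "\<not> col a q" using polar_nd[OF Q aQ] by blast
  let ?R = "{z \<in> Q. col z a \<and> col z q}"
  have R: "polar ?R" using polar_residual[OF Q aQ q] .
  obtain b' where b': "b' \<in> l" "col q b'" using polar_one[OF Q q(1) l] by blast
  have b'a: "b' \<noteq> a" using b' q sy by metis
  have ka: "k \<noteq> a" using k a by blast
  obtain m where m: "m \<in> Ln" "k \<in> m" "a \<in> m" "m \<subseteq> Q" using polar_line[OF Q k(1) aQ ka] k a by metis
  obtain k' where k': "k' \<in> m" "col q k'" using polar_one[OF Q q(1) m(1,4)] by blast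
  have k'a: "k' \<noteq> a" using k' q sy by metis
  have ne: "b' \<noteq> k'"
  proof
    assume "b' = k'"
    then have "l = m" using polar_uniq[OF Q l m(1,4) _ a _ m(3), of b'] b' k' b'a by blast
    then show False using k m by blast
  qed
  have "b' \<in> ?R" using ln_col[OF l(1) b'(1) a] b' l sy[OF b'(2)] by auto
  moreover have "k' \<in> ?R" using ln_col[OF m(1) k'(1) m(3)] k' m sy[OF k'(2)] by auto
  ultimately obtain n where n: "n \<in> ?R" "col n b'" "\<not> col n k'" using polar_sep[OF R] ne by blast
  have "col n c" if "c \<in> l" for c using ln_all[OF l(1) b'(1) a b'a n(2) _ that] n by blast
  moreover have "\<not> col n k" using ln_all[OF m(1,2,3) ka _ _ k'(1), of n] n by blast
  ultimately show ?thesis using n by blast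
qed

text \<open>The point \<open>u\<close> only ensures that the common perp of \<open>p\<close> and
  \<open>q\<close> is nonempty; \<open>polar\<close> alone allows a set without lines. The pair then
  comes from nondegeneracy of the residual.\<close>

lemma polar_noncol_pair:
  assumes Q: "polar Q" and p: "p \<in> Q" "q \<in> Q" "\<not> col p q" and u: "u \<in> Q" "u \<noteq> p" "col u p"
  obtains r s where "r \<in> Q" "s \<in> Q" "col r p" "col r q" "col s p" "col s q" "\<not> col r s"
proof -
  obtain l where l: "l \<in> Ln" "u \<in> l" "p \<in> l" "l \<subseteq> Q" using polar_line[OF Q u(1) p(1) u(2,3)] by metis
  obtain r where r: "r \<in> l" "col q r" using polar_one[OF Q p(2) l(1,4)] by blast
  have R: "polar {z \<in> Q. col z p \<and> col z q}" using polar_residual[OF Q p] .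
  have "r \<in> {z \<in> Q. col z p \<and> col z q}" using ln_col[OF l(1) r(1) l(3)] r l sy[OF r(2)] by auto
  then show thesis using polar_nd[OF R] that by blast
qed

end

section \<open>Symps as convex polar subspaces\<close>

locale symp_space = collinearity col Ln for col :: "'p \<Rightarrow> 'p \<Rightarrow> bool" and Ln :: "'p set set" +
  fixes P :: "'p set" and Sy :: "'p set set"
  assumes Sy_sub: "\<eta> \<in> Sy \<Longrightarrow> \<eta> \<subseteq> P"
    and Sy_polar: "\<eta> \<in> Sy \<Longrightarrow> polar \<eta>"
    and Sy_line: "\<eta> \<in> Sy \<Longrightarrow> p \<in> \<eta> \<Longrightarrow> \<exists>u\<in>\<eta>. u \<noteq> p \<and> col u p"
    and Sy_conv: "\<eta> \<in> Sy \<Longrightarrow> p \<in> \<eta> \<Longrightarrow> q \<in> \<eta> \<Longrightarrow> \<not> col p q \<Longrightarrow> r \<in> P \<Longrightarrow> col r p \<Longrightarrow> col r q \<Longrightarrow> r \<in> \<eta>"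
    and Sy_ex: "p \<in> P \<Longrightarrow> q \<in> P \<Longrightarrow> r \<in> P \<Longrightarrow> \<not> col p q \<Longrightarrow> col r p \<Longrightarrow> col r q \<Longrightarrow> \<exists>\<eta>\<in>Sy. p \<in> \<eta> \<and> q \<in> \<eta>"
    and P_Sy: "p \<in> P \<Longrightarrow> \<exists>\<eta>\<in>Sy. p \<in> \<eta>"
    and Ln_Sy: "l \<in> Ln \<Longrightarrow> \<exists>\<eta>\<in>Sy. l \<subseteq> \<eta>"
begin

lemma Sy_P: "\<eta> \<in> Sy \<Longrightarrow> p \<in> \<eta> \<Longrightarrow> p \<in> P"
  using Sy_sub by auto

lemma Ln_P: "l \<in> Ln \<Longrightarrow> p \<in> l \<Longrightarrow> p \<in> P"
  using Ln_Sy Sy_sub by (metis subsetD)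

lemma Sy_exE:
  assumes "p \<in> P" "q \<in> P" "r \<in> P" "\<not> col p q" "col r p" "col r q"
  obtains \<eta> where "\<eta> \<in> Sy" "p \<in> \<eta>" "q \<in> \<eta>" "r \<in> \<eta>"
proof -
  obtain \<eta> where "\<eta> \<in> Sy" "p \<in> \<eta>" "q \<in> \<eta>" using Sy_ex[OF assms] by metis
  then show thesis using that Sy_conv[OF _ _ _ assms(4,3,5,6)] by metis
qed

lemma Sy_noncol_pair:
  assumes "\<eta> \<in> Sy" "p \<in> \<eta>" "q \<in> \<eta>" "\<not> col p q"
  obtains r s where "r \<in> \<eta>" "s \<in> \<eta>" "col r p" "col r q" "col s p" "col s q" "\<not> col r s"
proof -
  obtain u where "u \<in> \<eta>" "u \<noteq> p" "col u p" using Sy_line[OF assms(1,2)] by metis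
  then show thesis using polar_noncol_pair[OF Sy_polar[OF assms(1)] assms(2-4)] that by metis
qed

lemma Sy_hit:
  assumes "\<eta> \<in> Sy" "p \<in> \<eta>" "a \<in> \<eta>" "b \<in> \<eta>" "a \<noteq> b" "col a b"
  obtains l c where "l \<in> Ln" "a \<in> l" "b \<in> l" "l \<subseteq> \<eta>" "c \<in> l" "col p c" "c \<in> \<eta>"
proof -
  obtain l where l: "l \<in> Ln" "a \<in> l" "b \<in> l" "l \<subseteq> \<eta>"
    using polar_line[OF Sy_polar[OF assms(1)] assms(3-6)] by metis
  obtain c where "c \<in> l" "col p c" using polar_one[OF Sy_polar[OF assms(1)] assms(2) l(1,4)] by metis
  then show thesis using that l by (metis subsetD)
qed

text \<open>A neighbour of \<open>p\<close> in \<eta> lies on a line through \<open>p\<close> with a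
  point that sees \<open>q\<close>. That point is in \<theta> by convexity, hence so is the line. A
  point not collinear with \<open>p\<close> has with it two noncollinear common neighbours, already
  known to be in \<theta>, and convexity applies again.\<close>

lemma Sy_subset:
  assumes S: "\<eta> \<in> Sy" "\<theta> \<in> Sy" and p: "p \<in> \<eta>" "q \<in> \<eta>" "p \<in> \<theta>" "q \<in> \<theta>" "\<not> col p q"
  shows "\<eta> \<subseteq> \<theta>"
proof -
  have step: "r \<in> \<theta>" if pq: "p \<in> \<eta>" "q \<in> \<eta>" "p \<in> \<theta>" "q \<in> \<theta>" "\<not> col p q" and r: "r \<in> \<eta>" "col r p" for p q r
  proof (cases "r = p \<or> col r q")
    case True
    then show ?thesis using Sy_conv[OF S(2) pq(3,4,5) Sy_P[OF S(1) r(1)] r(2)] pq(3) by metis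
  next
    case False
    then obtain l a where l: "l \<in> Ln" "r \<in> l" "p \<in> l" "l \<subseteq> \<eta>" "a \<in> l" "col q a" "a \<in> \<eta>"
      using Sy_hit[OF S(1) pq(2) r(1) pq(1) _ r(2)] by metis
    have "a \<noteq> p" using l pq sy by metis
    moreover have "a \<in> \<theta>" using Sy_conv[OF S(2) pq(3,4,5) Sy_P[OF S(1) l(7)]] l ln_col sy by metis
    ultimately have "l \<subseteq> \<theta>" using polar_sub[OF Sy_polar[OF S(2)] l(1) l(5) l(3)] pq by metis
    then show ?thesis using l by (metis subsetD)
  qed
  show ?thesis
  proof
    fix z assume z: "z \<in> \<eta>"
    show "z \<in> \<theta>"
    proof (cases "col z p")
      case True
      then show ?thesis using step p z by metis
    next
      case False
      obtain r s where rs: "r \<in> \<eta>" "s \<in> \<eta>" "col r z" "col r p" "col s z" "col s p" "\<not> col r s"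
        using Sy_noncol_pair[OF S(1) z p(1) False] by metis
      have "r \<in> \<theta>" "s \<in> \<theta>" using step[OF p] rs by metis+
      then show ?thesis using Sy_conv[OF S(2) _ _ rs(7) Sy_P[OF S(1) z]] rs sy by metis
    qed
  qed
qed

lemma Sy_eq:
  assumes "\<eta> \<in> Sy" "\<theta> \<in> Sy" "p \<in> \<eta>" "q \<in> \<eta>" "p \<in> \<theta>" "q \<in> \<theta>" "\<not> col p q"
  shows "\<eta> = \<theta>"
  using Sy_subset[OF assms] Sy_subset[OF assms(2,1) assms(5,6) assms(3,4) assms(7)] by (rule equalityI)

lemma Sy_perp_clique:
  assumes "\<eta> \<in> Sy" "p \<in> P" "p \<notin> \<eta>" "a \<in> \<eta>" "b \<in> \<eta>" "col p a" "col p b"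
  shows "col a b"
  using Sy_conv[OF assms(1,4,5) _ assms(2,6,7)] assms(3) by metis

lemma Sy_two:
  assumes "\<eta> \<in> Sy" "a \<in> \<eta>"
  obtains c d where "c \<in> \<eta>" "d \<in> \<eta>" "col c a" "col d a" "\<not> col c d"
proof -
  obtain z where "z \<in> \<eta>" "\<not> col a z" using polar_nd[OF Sy_polar[OF assms(1)] assms(2)] by metis
  then show thesis using Sy_noncol_pair[OF assms] that by metis
qed

lemma Sy_away:
  assumes "\<eta> \<in> Sy" "a \<in> \<eta>" "p \<in> P" "p \<notin> \<eta>"
  obtains c where "c \<in> \<eta>" "col c a" "\<not> col p c"
proof -
  obtain c d where cd: "c \<in> \<eta>" "d \<in> \<eta>" "col c a" "col d a" "\<not> col c d" using Sy_two[OF assms(1,2)] .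
  then have "\<not> col p c \<or> \<not> col p d" using Sy_conv[OF assms(1) cd(1,2,5) assms(3)] assms(4) by metis
  then show thesis using that cd by metis
qed

text \<open>In this locale \<open>col\<close> is not defined from \<open>Ln\<close>, so a line
  through two collinear points has to be found. A symp containing both points supplies it in
  \<open>pair_line\<close>.\<close>

lemma pair_Sy:
  assumes "a \<in> P" "b \<in> P" "col a b"
  obtains \<eta> where "\<eta> \<in> Sy" "a \<in> \<eta>" "b \<in> \<eta>"
proof -
  obtain \<eta> where e: "\<eta> \<in> Sy" "a \<in> \<eta>" using P_Sy assms by metis
  show thesis
  proof (cases "b \<in> \<eta>")
    case False
    obtain c where c: "c \<in> \<eta>" "col c a" "\<not> col b c" using Sy_away[OF e assms(2) False] .
    have "c \<in> P" using Sy_P e c by metis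
    then show ?thesis using Sy_exE[OF assms(2) _ assms(1) c(3) assms(3)] c(2) sy that by metis
  qed (use e that in metis)
qed

lemma pair_line:
  assumes "a \<in> P" "b \<in> P" "col a b" "a \<noteq> b"
  obtains l where "l \<in> Ln" "a \<in> l" "b \<in> l"
  using pair_Sy[OF assms(1-3)] polar_line[OF Sy_polar] assms(3,4) by metis

lemma Sy_ln: "\<eta> \<in> Sy \<Longrightarrow> l \<in> Ln \<Longrightarrow> a \<in> l \<Longrightarrow> b \<in> l \<Longrightarrow> a \<in> \<eta> \<Longrightarrow> b \<in> \<eta> \<Longrightarrow> a \<noteq> b \<Longrightarrow> l \<subseteq> \<eta>"
  using polar_sub[OF Sy_polar] by metis

lemma Sy_lnD:
  assumes "\<eta> \<in> Sy" "l \<in> Ln" "a \<in> l" "b \<in> l" "a \<in> \<eta>" "b \<in> \<eta>" "a \<noteq> b" "c \<in> l"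
  shows "c \<in> \<eta>"
  using Sy_ln[OF assms(1-7)] assms(8) by auto

lemma ln_uniq:
  assumes "l \<in> Ln" "m \<in> Ln" "a \<in> l" "b \<in> l" "a \<in> m" "b \<in> m" "a \<noteq> b"
  shows "l = m"
proof -
  obtain \<eta> where e: "\<eta> \<in> Sy" "l \<subseteq> \<eta>" using Ln_Sy assms by metis
  have "m \<subseteq> \<eta>" using Sy_ln[OF e(1) assms(2,5,6) _ _ assms(7)] e(2) assms(3,4) by auto
  then show ?thesis using polar_uniq[OF Sy_polar[OF e(1)] assms(1) e(2) assms(2) _ assms(3-7)] by metis
qed

text \<open>The dimension-free form of rank 2: lines are maximal singular subspaces. It makes sense
  in residues as well.\<close>

definition rank2 :: "'p set \<Rightarrow> bool" where
  "rank2 \<eta> \<longleftrightarrow> (\<forall>l\<in>Ln. l \<subseteq> \<eta> \<longrightarrow> (\<forall>p\<in>\<eta>. (\<forall>c\<in>l. col p c) \<longrightarrow> p \<in> l))"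

lemma rank2D:
  assumes "rank2 \<eta>" "\<eta> \<in> Sy" "l \<in> Ln" "a \<in> l" "b \<in> l" "a \<noteq> b" "a \<in> \<eta>" "b \<in> \<eta>" "p \<in> \<eta>" "col p a" "col p b"
  shows "p \<in> l"
proof -
  have "l \<subseteq> \<eta>" using Sy_ln[OF assms(2-5) assms(7,8,6)] .
  moreover have "\<forall>c\<in>l. col p c" using ln_all[OF assms(3-6) assms(10,11)] by metis
  ultimately show ?thesis using assms unfolding rank2_def by metis
qed

text \<open>A single plane spreads over the whole symp: lying in a plane passes from a point to all
  lines through it (\<open>s1\<close>) and so to its neighbours (\<open>s2\<close>), and any two
  points of a symp are joined by a path of length at most 2.\<close>

lemma plane_ex:
  assumes Z: "\<zeta> \<in> Sy" "\<not> rank2 \<zeta>" and m: "m \<in> Ln" "m \<subseteq> \<zeta>"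
  shows "\<exists>j\<in>\<zeta>. j \<notin> m \<and> (\<forall>c\<in>m. col j c)"
proof -
  \<comment> \<open>\<open>T v\<close> says that some plane of \<zeta> contains \<open>v\<close>,
    namely the one spanned by \<open>v\<close> and \<open>l\<close>.\<close>
  define T where "T v \<longleftrightarrow> v \<in> \<zeta> \<and> (\<exists>l\<in>Ln. l \<subseteq> \<zeta> \<and> v \<notin> l \<and> (\<forall>c\<in>l. col v c))" for v
  have s1: "\<exists>d\<in>\<zeta>. d \<notin> m \<and> (\<forall>c\<in>m. col d c)" if v: "T v" "v \<in> m" and m: "m \<in> Ln" "m \<subseteq> \<zeta>" for v m
  proof -
    obtain l where l: "l \<in> Ln" "l \<subseteq> \<zeta>" "v \<notin> l" "\<forall>c\<in>l. col v c" using v unfolding T_def by metis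
    obtain q where q: "q \<in> m" "q \<noteq> v" using ln_thick m by metis
    obtain d where d: "d \<in> l" "col q d" using polar_one[OF Sy_polar[OF Z(1)] _ l(1,2)] q m by (metis subsetD)
    have ok: "\<forall>c\<in>m. col e c" if "col e v" "col e w" "w \<in> m" "w \<noteq> v" for e w
      using ln_all[OF m(1) v(2) that(3) that(4)[symmetric] that(1,2)] by metis
    show ?thesis
    proof (cases "d \<in> m")
      case False
      then show ?thesis using ok[of d q] d q l sy by (metis subsetD)
    next
      case True
      obtain b where b: "b \<in> l" "b \<noteq> d" using ln_thick l by metis
      have "b \<notin> m" using ln_uniq[OF l(1) m(1) b(1) d(1) _ True b(2)] v l by metis
      then show ?thesis using ok[of b d] b d l True ln_col sy by (metis subsetD)
    qed
  qed
  have s2: "T w" if vw: "T v" "w \<in> \<zeta>" "col w v" for v w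
  proof (cases "w = v")
    case False
    have v: "v \<in> \<zeta>" using vw T_def by metis
    obtain m where m: "m \<in> Ln" "w \<in> m" "v \<in> m" "m \<subseteq> \<zeta>"
      using polar_line[OF Sy_polar[OF Z(1)] vw(2) v False vw(3)] by metis
    obtain d where d: "d \<in> \<zeta>" "d \<notin> m" "\<forall>c\<in>m. col d c" using s1[OF vw(1) m(3,1,4)] by metis
    have dv: "d \<noteq> v" using d m by metis
    obtain l where l: "l \<in> Ln" "d \<in> l" "v \<in> l" "l \<subseteq> \<zeta>"
      using polar_line[OF Sy_polar[OF Z(1)] d(1) v dv] d m by metis
    have "w \<notin> l" using ln_uniq[OF l(1) m(1) _ l(3) m(2,3) False] d l by metis
    moreover have "\<forall>c\<in>l. col w c" using ln_all[OF l(1,2,3) dv, of w] d m ln_col sy by metis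
    ultimately show ?thesis using l vw unfolding T_def by metis
  qed (use vw in simp)
  obtain v where v: "T v" using Z(2) unfolding rank2_def T_def by metis
  have vz: "v \<in> \<zeta>" using v T_def by metis
  obtain w where w: "w \<in> m" using ln_thick m by metis
  have wz: "w \<in> \<zeta>" using w m by auto
  have "T w"
  proof (cases "col w v")
    case False
    then obtain r s where "r \<in> \<zeta>" "col r w" "col r v" using Sy_noncol_pair[OF Z(1) wz vz] by metis
    then show ?thesis using s2[of v r] s2[of r w] v wz sy by metis
  qed (use s2 v wz in metis)
  then show ?thesis using s1[OF _ w m] by metis
qed

end

section \<open>Pairwise meeting symps: $(-1)$-lacunarity\<close>

locale meeting_symps = symp_space +
  assumes meet: "\<eta> \<in> Sy \<Longrightarrow> \<theta> \<in> Sy \<Longrightarrow> \<exists>x. x \<in> \<eta> \<and> x \<in> \<theta>"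
begin

text \<open>If a common point \<open>c\<close> of \<tau> and \<eta> does not see \<open>p\<close>,
  the point of the line \<open>ab\<close> that sees \<open>c\<close> is a common neighbour of
  \<open>c\<close> and \<open>p\<close>. Convexity puts it into \<tau>.\<close>

lemma clique_symp_meet:
  assumes "p \<in> P" "p \<notin> \<eta>" "\<eta> \<in> Sy" "a \<in> \<eta>" "b \<in> \<eta>" "a \<noteq> b" "col p a" "col p b" "\<tau> \<in> Sy" "p \<in> \<tau>"
  shows "\<exists>c. c \<in> \<tau> \<and> c \<in> \<eta> \<and> col c p"
proof -
  obtain c where c: "c \<in> \<tau>" "c \<in> \<eta>" using meet assms by metis
  have "col a b" using Sy_perp_clique[OF assms(3,1,2,4,5,7,8)] .
  then obtain l a' where l: "l \<in> Ln" "a \<in> l" "b \<in> l" "l \<subseteq> \<eta>" "a' \<in> l" "col c a'" "a' \<in> \<eta>"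
    using Sy_hit[OF assms(3) c(2) assms(4,5,6)] by metis
  have pa: "col a' p" using ln_all[OF l(1,2,3) assms(6,7,8) l(5)] sy by metis
  show ?thesis
  proof (cases "col c p")
    case False
    then have "a' \<in> \<tau>" using Sy_conv[OF assms(9) c(1) assms(10) False Sy_P[OF assms(3) l(7)]] l pa sy by metis
    then show ?thesis using l pa by metis
  qed (use c in metis)
qed

text \<open>It suffices that \<open>n\<close> lies in the symp \<tau> through \<open>u\<close> and
  \<open>j\<close>, for then \<open>l\<close> lies in \<tau>. Let \<open>q\<close> in \<tau> see
  \<open>j\<close> but not \<open>x\<close>. If \<open>q\<close> does not see \<open>n\<close>, a
  symp \<sigma> through both meets \<beta> in a neighbour of \<open>j\<close> by
  \<open>clique_symp_meet\<close>, and this forces \<open>x\<close> into \<sigma>. The pair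
  \<open>q\<close>, \<open>x\<close> then gives \<sigma> = \<tau>.\<close>

lemma transfer_collinear:
  assumes Z: "\<zeta> \<in> Sy" "\<beta> \<in> Sy"
    and xk: "x \<in> \<zeta>" "x \<in> \<beta>" "k \<in> \<zeta>" "k \<in> \<beta>"
    and u: "u \<in> \<beta>" "u \<notin> \<zeta>" "col u x" "\<not> col u k" "\<not> col u j"
    and j: "j \<in> \<zeta>" "j \<notin> \<beta>" "col j x" "col j k"
    and n: "n \<in> \<zeta>" "col n x" "col n j" "\<not> col n k"
    and H: "\<And>a. a \<in> \<zeta> \<Longrightarrow> a \<in> \<beta> \<Longrightarrow> col a n \<Longrightarrow> a = x"
    and l: "l \<in> Ln" "n \<in> l" "j \<in> l"
  shows "\<exists>n'\<in>l. n' \<in> \<zeta> \<and> col u n'"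
proof -
  have inP: "u \<in> P" "j \<in> P" "x \<in> P" "n \<in> P" "k \<in> P" using Sy_P Z u j xk n by metis+
  have xk': "x \<noteq> k" using u by metis
  have jx: "j \<noteq> x" using j xk by metis
  obtain \<tau> where t: "\<tau> \<in> Sy" "u \<in> \<tau>" "j \<in> \<tau>" "x \<in> \<tau>"
    using Sy_exE[OF inP(1,2,3) u(5)] u(3) j(3) sy by metis
  obtain q where q: "q \<in> \<tau>" "col q j" "\<not> col q x" using polar_sep[OF Sy_polar[OF t(1)] t(3,4) jx] by metis
  have qP: "q \<in> P" using Sy_P t q by metis
  have tz: "\<tau> \<noteq> \<zeta>" using t u by metis
  have nt: "n \<in> \<tau>"
  proof (cases "col q n")
    case True
    then show ?thesis using Sy_conv[OF t(1) q(1) t(4) q(3) inP(4)] n sy by metis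
  next
    case False
    obtain \<sigma> where s: "\<sigma> \<in> Sy" "q \<in> \<sigma>" "n \<in> \<sigma>" "j \<in> \<sigma>"
      using Sy_exE[OF qP inP(4,2) False] q(2) n(3) sy by metis
    obtain a where a: "a \<in> \<sigma>" "a \<in> \<beta>" "col a j"
      using clique_symp_meet[OF inP(2) j(2) Z(2) xk(2,4) xk' j(3,4) s(1,4)] by metis
    have aP: "a \<in> P" using Sy_P s a by metis
    have "x \<in> \<sigma>"
    proof (cases "a \<in> \<zeta>")
      case az: True
      show ?thesis
      proof (cases "col a n")
        case True
        then show ?thesis using H az a by metis
      next
        case False
        then have "\<sigma> = \<zeta>" using Sy_eq[OF s(1) Z(1) a(1) s(3) az n(1)] by metis
        then have "\<tau> = \<zeta>" using Sy_eq[OF t(1) Z(1) q(1) t(4) _ xk(1) q(3)] s by metis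
        then show ?thesis using tz by metis
      qed
    next
      case az: False
      have ax: "col a x" "col a k"
        using Sy_perp_clique[OF Z(2) inP(2) j(2) a(2)] xk j a sy by metis+
      have "\<not> col a n"
        using Sy_conv[OF Z(1) n(1) xk(3) n(4) aP] az ax by metis
      then show ?thesis using Sy_conv[OF s(1) a(1) s(3) _ inP(3)] ax n sy by metis
    qed
    then have "\<sigma> = \<tau>" using Sy_eq[OF s(1) t(1) s(2) _ q(1) t(4) q(3)] by metis
    then show ?thesis using s by metis
  qed
  have "n \<noteq> j" using n j by metis
  then have "l \<subseteq> \<tau>" using Sy_ln[OF t(1) l nt t(3)] by metis
  then obtain n' where "n' \<in> l" "col u n'" using polar_one[OF Sy_polar[OF t(1)] t(2) l(1)] by metis
  then show ?thesis using Sy_lnD[OF Z(1) l n(1) j(1) \<open>n \<noteq> j\<close>] by metis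
qed

end

context meeting_symps
begin

text \<open>With \<open>x\<close> as only neighbour, \<zeta> and the symp \<beta> through
  \<open>p\<close> and \<open>k\<close> share only points of the line \<open>kx\<close>. A plane on
  this line gives \<open>j\<close>, and \<open>polar_line_closed\<close> gives \<open>n\<close>. By
  \<open>transfer_collinear\<close>, \<open>p\<close> sees a point of the line \<open>nj\<close>,
  which must be \<open>x\<close>. So \<open>k\<close> sees two points of that line and hence
  \<open>n\<close>, a contradiction.\<close>

lemma not_singleton_big:
  assumes Z: "\<zeta> \<in> Sy" "\<not> rank2 \<zeta>" and p: "p \<in> P" "p \<notin> \<zeta>" and x: "x \<in> \<zeta>" "col p x"
  shows "\<exists>x'\<in>\<zeta>. x' \<noteq> x \<and> col p x'"
proof (rule ccontr)
  assume "\<not> ?thesis"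
  then have uniq: "\<And>z. z \<in> \<zeta> \<Longrightarrow> col p z \<Longrightarrow> z = x" by metis
  obtain k where k: "k \<in> \<zeta>" "k \<noteq> x" "col k x" using Sy_line[OF Z(1) x(1)] by metis
  have pk: "\<not> col p k" using uniq k by metis
  have xP: "x \<in> P" and kP: "k \<in> P" using Sy_P[OF Z(1)] x k by metis+
  obtain \<beta> where b: "\<beta> \<in> Sy" "p \<in> \<beta>" "k \<in> \<beta>" "x \<in> \<beta>"
    using Sy_exE[OF p(1) kP xP pk] x(2) k(3) sy by metis
  have bz: "\<beta> \<noteq> \<zeta>" using b p by metis
  obtain K where K: "K \<in> Ln" "k \<in> K" "x \<in> K" "K \<subseteq> \<zeta>"
    using polar_line[OF Sy_polar[OF Z(1)] k(1) x(1) k(2,3)] by metis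
  obtain j where j: "j \<in> \<zeta>" "j \<notin> K" "\<forall>c\<in>K. col j c" using plane_ex[OF Z K(1,4)] by metis
  have jk: "col j k" "col j x" using j K by metis+
  have common: "\<exists>m\<in>Ln. a \<in> m \<and> k \<in> m \<and> x \<in> m" if a: "a \<in> \<zeta>" "a \<in> \<beta>" "a \<noteq> k" for a
  proof -
    have "col a k" using Sy_eq[OF b(1) Z(1) a(2) b(3) a(1) k(1)] bz by metis
    then obtain m c where m: "m \<in> Ln" "a \<in> m" "k \<in> m" "m \<subseteq> \<beta>" "c \<in> m" "col p c" "c \<in> \<beta>"
      using Sy_hit[OF b(1,2) a(2) b(3) a(3)] by metis
    have "c \<in> \<zeta>" using Sy_lnD[OF Z(1) m(1,2,3) a(1) k(1) a(3) m(5)] .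
    then show ?thesis using uniq m by metis
  qed
  have jb: "j \<notin> \<beta>"
  proof
    assume "j \<in> \<beta>"
    then obtain m where m: "m \<in> Ln" "j \<in> m" "k \<in> m" "x \<in> m" using common j K by metis
    then show False using ln_uniq[OF m(1) K(1) m(3,4) K(2,3) k(2)] j by metis
  qed
  have jx: "j \<noteq> x" using j K by metis
  obtain J where J: "J \<in> Ln" "j \<in> J" "x \<in> J" "J \<subseteq> \<zeta>"
    using polar_line[OF Sy_polar[OF Z(1)] j(1) x(1) jx jk(2)] by metis
  have kJ: "k \<notin> J" using ln_uniq[OF J(1) K(1) _ J(3) K(2,3) k(2)] J j by metis
  have "\<forall>c\<in>J. col k c" using ln_all[OF J(1,2,3) jx sy[OF jk(1)] k(3)] by metis
  then obtain n where n: "n \<in> \<zeta>" "\<forall>c\<in>J. col n c" "\<not> col n k"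
    using polar_line_closed[OF Sy_polar[OF Z(1)] J(1,4) k(1) kJ] by metis
  have nx: "col n x" "col n j" using n J by metis+
  have nj: "n \<noteq> j" using n jk by metis
  obtain l where l: "l \<in> Ln" "n \<in> l" "j \<in> l" "l \<subseteq> \<zeta>"
    using polar_line[OF Sy_polar[OF Z(1)] n(1) j(1) nj nx(2)] by metis
  have H: "a = x" if a: "a \<in> \<zeta>" "a \<in> \<beta>" "col a n" for a
  proof (rule ccontr)
    assume ax: "a \<noteq> x"
    have "a \<noteq> k" using a n sy by metis
    then obtain m where m: "m \<in> Ln" "a \<in> m" "k \<in> m" "x \<in> m" using common a by metis
    then show False using ln_all[OF m(1,2,4) ax sy[OF a(3)] nx(1) m(3)] n by metis
  qed
  have pj: "\<not> col p j" using uniq j jx by metis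
  obtain n' where n': "n' \<in> l" "n' \<in> \<zeta>" "col p n'"
    using transfer_collinear[OF Z(1) b(1) x(1) b(4) k(1) b(3) b(2) p(2) x(2) pk pj j(1) jb jk(2,1) n(1) nx n(3) H l(1-3)] by metis
  have "x \<in> l" using uniq n' by metis
  then have "col k n" using ln_all[OF l(1) l(3) _ jx sy[OF jk(1)] k(3) l(2)] by metis
  then show False using n sy by metis
qed

text \<open>Noncollinear points \<open>j\<close>, \<open>j2\<close> in the perp of the common line
  lead, through \<open>transfer_collinear\<close>, to neighbours \<open>n1\<close>,
  \<open>n2\<close> of \<open>u\<close> on two lines through \<open>n\<close>. As \<open>u\<close>
  is outside \<zeta>, these are collinear, and this collinearity passes back to \<open>j\<close> and
  \<open>j2\<close>.\<close>

lemma no_mixed_line: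
  assumes X: "\<xi> \<in> Sy" "rank2 \<xi>" and Z: "\<zeta> \<in> Sy" "\<not> rank2 \<zeta>"
    and bk: "b \<in> \<xi>" "b \<in> \<zeta>" "k \<in> \<xi>" "k \<in> \<zeta>" "b \<noteq> k"
  shows False
proof -
  have ne: "\<xi> \<noteq> \<zeta>" using X Z by metis
  have cl: "col a c" if "a \<in> \<xi>" "a \<in> \<zeta>" "c \<in> \<xi>" "c \<in> \<zeta>" for a c
    using Sy_eq[OF X(1) Z(1) that(1,3,2,4)] ne by metis
  have cbk: "col b k" using cl bk by metis
  obtain u where u: "u \<in> \<xi>" "col u b" "\<not> col u k" using polar_sep[OF Sy_polar[OF X(1)] bk(1,3,5)] by metis
  have uz: "u \<notin> \<zeta>" using cl u bk by metis
  have uP: "u \<in> P" using Sy_P X u by metis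
  obtain K where K: "K \<in> Ln" "b \<in> K" "k \<in> K" "K \<subseteq> \<zeta>"
    using polar_line[OF Sy_polar[OF Z(1)] bk(2,4,5) cbk] by metis
  have KX: "c \<in> K" if "c \<in> \<xi>" "col c b" "col c k" for c
    using rank2D[OF X(2,1) K(1-3) bk(5,1,3) that] .
  obtain j where j: "j \<in> \<zeta>" "j \<notin> K" "\<forall>c\<in>K. col j c" using plane_ex[OF Z K(1,4)] by metis
  obtain j2 where j2: "j2 \<in> \<zeta>" "\<forall>c\<in>K. col j2 c" "\<not> col j2 j"
    using polar_line_closed[OF Sy_polar[OF Z(1)] K(1,4) j] by metis
  have j2K: "j2 \<notin> K" using j j2 sy by metis
  \<comment> \<open>Moving \<open>e\<close> along the line \<open>ek\<close> to the point
    \<open>i\<close> that sees \<open>v\<close> keeps it off \<xi> and out of the perp of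
    \<open>u\<close>. So \<open>i\<close> can take the role of \<open>j\<close> in
    \<open>transfer_collinear\<close>.\<close>
  have shift: "\<exists>i m. i \<in> \<zeta> \<and> m \<in> Ln \<and> i \<in> m \<and> k \<in> m \<and> e \<in> m \<and> i \<noteq> k \<and> col v i \<and> col i b \<and> col i k \<and> i \<notin> \<xi> \<and> \<not> col u i"
    if e: "e \<in> \<zeta>" "e \<notin> K" "\<forall>c\<in>K. col e c" and v: "v \<in> \<zeta>" "\<not> col v k" for e v
  proof -
    have ek: "e \<noteq> k" "col e k" "col e b" using e K by metis+
    obtain m i where m: "m \<in> Ln" "e \<in> m" "k \<in> m" "m \<subseteq> \<zeta>" "i \<in> m" "col v i" "i \<in> \<zeta>"
      using Sy_hit[OF Z(1) v(1) e(1) bk(4) ek(1,2)] by metis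
    have ik: "i \<noteq> k" using v m by metis
    have ib: "col i b" using ln_all[OF m(1,2,3) ek(1) sy[OF ek(3)] cbk m(5)] sy by metis
    have ikc: "col i k" using ln_col[OF m(1,5,3)] .
    have iX: "i \<notin> \<xi>"
    proof
      assume "i \<in> \<xi>"
      then have "i \<in> K" using KX ib ikc by metis
      then have "m = K" using ln_uniq[OF m(1) K(1) m(5,3) _ K(3) ik] by metis
      then show False using e m by metis
    qed
    have "\<not> col u i"
      using Sy_conv[OF X(1) u(1) bk(3) u(3) Sy_P[OF Z(1) m(7)]] iX ikc sy by metis
    then show ?thesis using m ik ib ikc iX by metis
  qed
  have shot: "\<exists>n'\<in>l. n' \<in> \<zeta> \<and> col u n'"
    if i: "i \<in> \<zeta>" "i \<notin> \<xi>" "col i b" "col i k" "\<not> col u i" and v: "v \<in> \<zeta>" "col v b" "\<not> col v k" "col v i"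
      and l: "l \<in> Ln" "v \<in> l" "i \<in> l" for i v l
  proof -
    have "a = b" if a: "a \<in> \<zeta>" "a \<in> \<xi>" "col a v" for a
    proof (rule ccontr)
      assume ab: "a \<noteq> b"
      have "a \<in> K" using KX cl a bk by metis
      then have "col v k" using ln_all[OF K(1) _ K(2) ab sy[OF a(3)] v(2) K(3)] by metis
      then show False using v by metis
    qed
    then show ?thesis
      using transfer_collinear[OF Z(1) X(1) bk(2,1,4,3) u(1) uz u(2,3) i(5) i(1,2,3,4) v(1,2,4,3) _ l] by metis
  qed
  obtain n0 where n0: "n0 \<in> \<zeta>" "col n0 b" "\<not> col n0 k" using polar_sep[OF Sy_polar[OF Z(1)] bk(2,4,5)] by metis
  \<comment> \<open>If \<open>u\<close> happens to see \<open>n0\<close>, a third point of the line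
    from \<open>n0\<close> to some \<open>i\<close> not seen by \<open>u\<close> is taken
    instead.\<close>
  obtain n where n: "n \<in> \<zeta>" "col n b" "\<not> col n k" "\<not> col u n"
  proof (cases "col u n0")
    case True
    obtain i where i: "i \<in> \<zeta>" "col n0 i" "col i b" "col i k" "\<not> col u i" using shift[OF j n0(1,3)] by metis
    have ni: "n0 \<noteq> i" using n0 i by metis
    obtain l where l: "l \<in> Ln" "n0 \<in> l" "i \<in> l" "l \<subseteq> \<zeta>"
      using polar_line[OF Sy_polar[OF Z(1)] n0(1) i(1) ni i(2)] by metis
    obtain n where n: "n \<in> l" "n \<noteq> n0" "n \<noteq> i" using ln_thick[OF l(1)] by metis
    have "n \<in> \<zeta>" using n l by auto
    moreover have "col n b" using ln_all[OF l(1-3) ni sy[OF n0(2)] sy[OF i(3)] n(1)] sy by metis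
    moreover have "\<not> col n k"
      using ln_all[OF l(1) n(1) l(3) n(3) _ sy[OF i(4)] l(2)] n0 sy by metis
    moreover have "\<not> col u n"
      using ln_all[OF l(1) n(1) l(2) n(2) _ True l(3)] i by metis
    ultimately show thesis using that by metis
  qed (use n0 that in metis)
  obtain i1 m1 where i1: "i1 \<in> \<zeta>" "m1 \<in> Ln" "i1 \<in> m1" "k \<in> m1" "j \<in> m1" "i1 \<noteq> k" "col n i1" "col i1 b" "col i1 k" "i1 \<notin> \<xi>" "\<not> col u i1"
    using shift[OF j n(1,3)] by metis
  obtain i2 m2 where i2: "i2 \<in> \<zeta>" "m2 \<in> Ln" "i2 \<in> m2" "k \<in> m2" "j2 \<in> m2" "i2 \<noteq> k" "col n i2" "col i2 b" "col i2 k" "i2 \<notin> \<xi>" "\<not> col u i2"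
    using shift[OF j2(1) j2K j2(2) n(1,3)] by metis
  have ni: "n \<noteq> i1" "n \<noteq> i2" using n i1 i2 by metis+
  obtain l1 where l1: "l1 \<in> Ln" "n \<in> l1" "i1 \<in> l1" "l1 \<subseteq> \<zeta>"
    using polar_line[OF Sy_polar[OF Z(1)] n(1) i1(1) ni(1) i1(7)] by metis
  obtain l2 where l2: "l2 \<in> Ln" "n \<in> l2" "i2 \<in> l2" "l2 \<subseteq> \<zeta>"
    using polar_line[OF Sy_polar[OF Z(1)] n(1) i2(1) ni(2) i2(7)] by metis
  obtain n1 where n1: "n1 \<in> l1" "n1 \<in> \<zeta>" "col u n1"
    using shot[OF i1(1,10,8,9,11) n(1,2,3) i1(7) l1(1-3)] by metis
  obtain n2 where n2: "n2 \<in> l2" "n2 \<in> \<zeta>" "col u n2"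
    using shot[OF i2(1,10,8,9,11) n(1,2,3) i2(7) l2(1-3)] by metis
  have nn: "n1 \<noteq> n" "n2 \<noteq> n" using n n1 n2 by metis+
  have c12: "col n1 n2" using Sy_perp_clique[OF Z(1) uP uz n1(2) n2(2) n1(3) n2(3)] .
  have "col n2 i1" using ln_all[OF l1(1) n1(1) l1(2) nn(1) sy[OF c12] _ l1(3)] ln_col[OF l2(1) n2(1) l2(2)] by metis
  then have "col i1 i2" using ln_all[OF l2(1) n2(1) l2(2) nn(2) _ sy[OF i1(7)] l2(3)] sy by metis
  then have "col i2 j" using ln_all[OF i1(2,3,4,6) _ i2(9) i1(5)] sy by metis
  then have "col j j2" using ln_all[OF i2(2,3,4,6) _ _ i2(5)] j K sy by metis
  then show False using j2 sy by metis
qed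

text \<open>The symp \<tau> joins a line of \<xi> and a line of \<zeta> through a common point, so
  it shares a line with each. Whatever the rank of \<tau>, one of the two contradicts
  \<open>no_mixed_line\<close>.\<close>

lemma rank2_all:
  assumes X: "\<xi> \<in> Sy" "rank2 \<xi>" and Z: "\<zeta> \<in> Sy"
  shows "rank2 \<zeta>"
proof (rule ccontr)
  assume nz: "\<not> rank2 \<zeta>"
  obtain x where x: "x \<in> \<xi>" "x \<in> \<zeta>" using meet[OF X(1) Z] by metis
  obtain m where m: "m \<in> \<zeta>" "m \<noteq> x" "col m x" using Sy_line[OF Z x(2)] by metis
  have mX: "m \<notin> \<xi>" using no_mixed_line[OF X Z nz x] m by metis
  have mP: "m \<in> P" using Sy_P Z m by metis
  obtain k where k: "k \<in> \<xi>" "col k x" "\<not> col m k" using Sy_away[OF X(1) x(1) mP mX] .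
  have kx: "k \<noteq> x" using k m by metis
  obtain \<tau> where t: "\<tau> \<in> Sy" "m \<in> \<tau>" "k \<in> \<tau>" "x \<in> \<tau>"
    using Sy_exE[OF mP Sy_P[OF X(1) k(1)] Sy_P[OF X(1) x(1)] k(3)] m(3) k(2) sy by metis
  show False
  proof (cases "rank2 \<tau>")
    case True
    show False using no_mixed_line[OF t(1) True Z nz t(4) x(2) t(2) m(1)] m by metis
  next
    case False
    show False using no_mixed_line[OF X t(1) False x(1) t(4) k(1) t(3)] kx by metis
  qed
qed

end

section \<open>Symps of rank 2 and maximal cliques\<close>

locale symp_space_rank2 = symp_space +
  assumes r2: "\<eta> \<in> Sy \<Longrightarrow> rank2 \<eta>"
begin

lemma rank2_triangle:
  assumes "\<eta> \<in> Sy" "l \<in> Ln" "a \<in> l" "b \<in> l" "a \<noteq> b" "a \<in> \<eta>" "b \<in> \<eta>" "p \<in> \<eta>" "col p a" "col p b"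
  shows "p \<in> l"
  using rank2D[OF r2[OF assms(1)] assms] .

text \<open>Noncollinear \<open>c\<close> and \<open>d\<close> would put all four points into one
  symp, and there rank 2 confines common neighbours of \<open>a\<close> and \<open>b\<close> to the
  line \<open>ab\<close>.\<close>

lemma perp_pair_clique:
  assumes ab: "a \<in> P" "b \<in> P" "a \<noteq> b" "col a b" and c: "c \<in> P" "col c a" "col c b" and d: "d \<in> P" "col d a" "col d b"
  shows "col c d"
proof (rule ccontr)
  assume n: "\<not> col c d"
  obtain \<eta> where e: "\<eta> \<in> Sy" "c \<in> \<eta>" "d \<in> \<eta>" "a \<in> \<eta>"
    using Sy_exE[OF c(1) d(1) ab(1) n] c d sy by metis
  have b: "b \<in> \<eta>" using Sy_conv[OF e(1-3) n ab(2)] c d sy by metis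
  obtain l where l: "l \<in> Ln" "a \<in> l" "b \<in> l" using pair_line[OF ab(1,2,4,3)] .
  have "c \<in> l" using rank2_triangle[OF e(1) l ab(3) e(4) b e(2) c(2,3)] .
  moreover have "d \<in> l" using rank2_triangle[OF e(1) l ab(3) e(4) b e(3) d(2,3)] .
  ultimately show False using n ln_col[OF l(1)] by metis
qed

text \<open>The perp of a collinear pair is already a maximal clique by
  \<open>perp_pair_clique\<close>, so no maximality clause and no choice principle is needed. By
  \<open>max_clique_in\<close> any two of its points may serve as the pair.\<close>

definition max_clique :: "'a set \<Rightarrow> bool" where
  "max_clique S \<longleftrightarrow> (\<exists>a b. a \<in> P \<and> b \<in> P \<and> a \<noteq> b \<and> col a b \<and> S = {c \<in> P. col c a \<and> col c b})"

lemma max_cliqueI: "a \<in> P \<Longrightarrow> b \<in> P \<Longrightarrow> a \<noteq> b \<Longrightarrow> col a b \<Longrightarrow> max_clique {c \<in> P. col c a \<and> col c b}"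
  unfolding max_clique_def by metis

lemma max_clique_P: "max_clique S \<Longrightarrow> c \<in> S \<Longrightarrow> c \<in> P"
  unfolding max_clique_def by auto

lemma max_clique_col:
  assumes "max_clique S" "c \<in> S" "d \<in> S" shows "col c d"
proof -
  obtain a b where ab: "a \<in> P" "b \<in> P" "a \<noteq> b" "col a b" "S = {c \<in> P. col c a \<and> col c b}"
    using assms(1) unfolding max_clique_def by metis
  show ?thesis by (rule perp_pair_clique[OF ab(1-4)]) (use assms ab in auto)
qed

lemma max_clique_in:
  assumes S: "max_clique S" "c \<in> S" "d \<in> S" "c \<noteq> d" and e: "e \<in> P" "col e c" "col e d"
  shows "e \<in> S"
proof -
  obtain a b where ab: "a \<in> P" "b \<in> P" "a \<noteq> b" "col a b" "S = {c \<in> P. col c a \<and> col c b}"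
    using S(1) unfolding max_clique_def by metis
  have abS: "a \<in> S" "b \<in> S" using ab sy[OF ab(4)] by auto
  have cd: "c \<in> P" "d \<in> P" "col c d" using max_clique_P[OF S(1)] max_clique_col[OF S(1)] S by metis+
  have "col e a" using perp_pair_clique[OF cd(1,2) S(4) cd(3) e ab(1)] max_clique_col[OF S(1) abS(1)] S by metis
  moreover have "col e b" using perp_pair_clique[OF cd(1,2) S(4) cd(3) e ab(2)] max_clique_col[OF S(1) abS(2)] S by metis
  ultimately show ?thesis using ab e by auto
qed

lemma max_clique_ln:
  assumes S: "max_clique S" "c \<in> S" "d \<in> S" "c \<noteq> d" and l: "l \<in> Ln" "c \<in> l" "d \<in> l"
  shows "l \<subseteq> S"
proof
  fix e assume "e \<in> l"
  then show "e \<in> S" using max_clique_in[OF S Ln_P[OF l(1)]] ln_col[OF l(1)] l by metis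
qed

text \<open>A maximal clique larger than a line. The form with a line missing each point is the one
  that its uses require.\<close>

definition planar_clique :: "'a set \<Rightarrow> bool" where
  "planar_clique S \<longleftrightarrow> max_clique S \<and> (\<forall>s\<in>S. \<exists>l\<in>Ln. l \<subseteq> S \<and> s \<notin> l)"

lemma planar_cliqueI:
  assumes S: "max_clique S" and l: "l \<in> Ln" "l \<subseteq> S" and c: "c \<in> S" "c \<notin> l"
  shows "planar_clique S"
  unfolding planar_clique_def
proof (intro conjI ballI)
  fix s assume s: "s \<in> S"
  show "\<exists>l\<in>Ln. l \<subseteq> S \<and> s \<notin> l"
  proof (cases "s \<in> l")
    case True
    obtain a where a: "a \<in> l" "a \<noteq> s" using ln_thick[OF l(1)] by metis
    have aS: "a \<in> S" using a l by auto
    have ac: "a \<noteq> c" using a c by metis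
    obtain m where m: "m \<in> Ln" "a \<in> m" "c \<in> m"
      using pair_line[OF max_clique_P[OF S aS] max_clique_P[OF S c(1)] max_clique_col[OF S aS c(1)] ac] .
    have "s \<notin> m" using ln_uniq[OF l(1) m(1) a(1) True m(2) _ a(2)] c m by metis
    then show ?thesis using max_clique_ln[OF S aS c(1) ac m] m by metis
  qed (use l in metis)
qed (rule S)

end

section \<open>Rank 2 with meeting symps: cliques larger than a line\<close>

locale meeting_symps_rank2 = meeting_symps + symp_space_rank2
begin

text \<open>Symps on the two lines share a point \<open>u\<close>. If \<open>u\<close> sees
  different points on \<open>l\<close> and \<open>m\<close>, it belongs to \<open>S\<close>, and
  rank 2 in each of the two symps puts it on both lines.\<close>

lemma lines_meet:
  assumes S: "max_clique S" and l: "l \<in> Ln" "l \<subseteq> S" and m: "m \<in> Ln" "m \<subseteq> S"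
  shows "\<exists>d. d \<in> l \<and> d \<in> m"
proof -
  obtain \<beta> where b: "\<beta> \<in> Sy" "l \<subseteq> \<beta>" using Ln_Sy[OF l(1)] by metis
  obtain \<beta>' where b': "\<beta>' \<in> Sy" "m \<subseteq> \<beta>'" using Ln_Sy[OF m(1)] by metis
  obtain u where u: "u \<in> \<beta>" "u \<in> \<beta>'" using meet[OF b(1) b'(1)] by metis
  obtain d where d: "d \<in> l" "col u d" using polar_one[OF Sy_polar[OF b(1)] u(1) l(1) b(2)] by metis
  obtain d' where d': "d' \<in> m" "col u d'" using polar_one[OF Sy_polar[OF b'(1)] u(2) m(1) b'(2)] by metis
  have dS: "d \<in> S" "d' \<in> S" using d d' l m by auto
  have uP: "u \<in> P" using Sy_P b u by metis
  show ?thesis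
  proof (cases "d = d'")
    case False
    then have uS: "u \<in> S" using max_clique_in[OF S dS False uP d(2) d'(2)] by metis
    have "u \<in> n" if n: "n \<in> Ln" "n \<subseteq> S" "n \<subseteq> \<gamma>" "\<gamma> \<in> Sy" "u \<in> \<gamma>" for n \<gamma>
    proof -
      obtain e where e: "e \<in> n" using ln_thick n by metis
      obtain e' where e': "e' \<in> n" "e' \<noteq> e" using ln_thick n by metis
      show ?thesis using rank2_triangle[OF n(4,1) e e'(1) e'(2)[symmetric]] max_clique_col[OF S uS] e e' n by (metis subsetD)
    qed
    then show ?thesis using l m b b' u by metis
  qed (use d d' in metis)
qed

text \<open>A symp \<beta> on a line \<open>l\<close> of \<open>S\<close> missing \<open>s\<close>
  meets \<eta> in some \<open>u\<close>. If \<open>u\<close> saw \<open>s\<close>, it would lie in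
  \<open>S\<close>, hence equal \<open>s\<close>, and rank 2 in \<beta> would put \<open>s\<close>
  on \<open>l\<close>. So the point of \<open>l\<close> seen by \<open>u\<close> is a common
  neighbour of \<open>u\<close> and \<open>s\<close>, and convexity places it in \<eta>.\<close>

lemma planar_clique_meets_symp:
  assumes S: "planar_clique S" "s \<in> S" and e: "\<eta> \<in> Sy" "s \<in> \<eta>"
  shows "\<exists>s'\<in>S. s' \<in> \<eta> \<and> s' \<noteq> s"
proof (rule ccontr)
  assume "\<not> ?thesis"
  then have no: "\<And>t. t \<in> S \<Longrightarrow> t \<in> \<eta> \<Longrightarrow> t = s" by metis
  have mS: "max_clique S" using S planar_clique_def by metis
  obtain l where l: "l \<in> Ln" "l \<subseteq> S" "s \<notin> l" using S planar_clique_def by metis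
  obtain \<beta> where b: "\<beta> \<in> Sy" "l \<subseteq> \<beta>" using Ln_Sy[OF l(1)] by metis
  obtain u where u: "u \<in> \<eta>" "u \<in> \<beta>" using meet[OF e(1) b(1)] by metis
  obtain d where d: "d \<in> l" "col u d" using polar_one[OF Sy_polar[OF b(1)] u(2) l(1) b(2)] by metis
  obtain d' where d': "d' \<in> l" "d' \<noteq> d" using ln_thick[OF l(1)] by metis
  have dS: "d \<in> S" "d' \<in> S" and db: "d \<in> \<beta>" "d' \<in> \<beta>" using d d' l b by auto
  have ds: "d \<noteq> s" using d l by metis
  have uP: "u \<in> P" using Sy_P b u by metis
  have us: "\<not> col u s"
  proof
    assume "col u s"
    then have "u \<in> S" using max_clique_in[OF mS dS(1) S(2) ds uP d(2)] by metis
    then have "s \<in> \<beta>" using no u by metis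
    then show False
      using rank2_triangle[OF b(1) l(1) d(1) d'(1) d'(2)[symmetric] db] max_clique_col[OF mS S(2)] dS l by metis
  qed
  have "d \<in> \<eta>" using Sy_conv[OF e(1) u(1) e(2) us max_clique_P[OF mS dS(1)] sy[OF d(2)] max_clique_col[OF mS dS(1) S(2)]] .
  then show False using no dS ds by metis
qed

text \<open>Each point \<open>v\<close> of \<sigma> has exactly one neighbour \<open>f v\<close> in
  \<open>S\<close>. Fibres of \<open>f\<close> are cliques, and a line of \<sigma> is contracted or
  mapped onto a line of \<open>S\<close>. Images of two uncontracted lines meet by
  \<open>lines_meet\<close>, which creates nontrivial fibres. If the fibre of \<open>x\<close> were
  trivial, each line through \<open>x\<close> could carry only one other point with a fibre leaving
  that line, and for two such lines this is contradictory.\<close>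

lemma planar_clique_shared_nbr:
  assumes S: "planar_clique S" and s: "\<sigma> \<in> Sy" "\<And>c. c \<in> \<sigma> \<Longrightarrow> c \<notin> S"
    and v0: "v0 \<in> \<sigma>" "c0 \<in> S" "col v0 c0" and x: "x \<in> \<sigma>"
  shows "\<exists>c\<in>S. col x c \<and> (\<exists>v\<in>\<sigma>. v \<noteq> x \<and> col v c)"
proof -
  have mS: "max_clique S" using S planar_clique_def by metis
  have sP: "\<And>v. v \<in> \<sigma> \<Longrightarrow> v \<in> P" using Sy_P[OF s(1)] .
  \<comment> \<open>A symp on \<open>g\<close> and \<open>c\<close> contains a second point of
    \<open>S\<close>, hence a line of \<open>S\<close>, and \<open>g\<close> sees a point of that
    line.\<close>
  have step: "\<exists>c\<in>S. col g c" if v: "v \<in> \<sigma>" "c \<in> S" "col v c" and g: "g \<in> \<sigma>" "col g v" for v c g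
  proof (cases "col g c")
    case False
    obtain \<tau> where t: "\<tau> \<in> Sy" "g \<in> \<tau>" "c \<in> \<tau>" "v \<in> \<tau>"
      using Sy_exE[OF sP[OF g(1)] max_clique_P[OF mS v(2)] sP[OF v(1)] False] g v sy by metis
    obtain c' where c': "c' \<in> S" "c' \<in> \<tau>" "c' \<noteq> c" using planar_clique_meets_symp[OF S v(2) t(1,3)] by metis
    obtain l d where "l \<in> Ln" "c' \<in> l" "c \<in> l" "d \<in> l" "col g d"
      using Sy_hit[OF t(1,2) c'(2) t(3) c'(3) max_clique_col[OF mS c'(1) v(2)]] by metis
    then show ?thesis using max_clique_ln[OF mS c'(1) v(2) c'(3)] by (metis subsetD)
  qed (use v in metis)
  have near_symp: "\<exists>c\<in>S. col v c" if v: "v \<in> \<sigma>" for v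
  proof (cases "col v v0")
    case False
    obtain r t where "r \<in> \<sigma>" "col r v" "col r v0" using Sy_noncol_pair[OF s(1) v v0(1) False] by metis
    then show ?thesis using step v v0 sy by metis
  qed (use step[OF v0] v in metis)
  define f where "f v = (SOME c. c \<in> S \<and> col v c)" for v
  have f: "f v \<in> S \<and> col v (f v)" if v: "v \<in> \<sigma>" for v
    unfolding f_def using someI_ex[of "\<lambda>c. c \<in> S \<and> col v c"] near_symp[OF v] by metis
  have fS: "f v \<in> S" and fc: "col v (f v)" if "v \<in> \<sigma>" for v using f that by metis+
  have fu: "f v = c" if "v \<in> \<sigma>" "c \<in> S" "col v c" for v c
    using max_clique_in[OF mS fS[OF that(1)] that(2) _ sP[OF that(1)] fc[OF that(1)] that(3)] s(2)[OF that(1)] by metis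
  have fns: "f v \<notin> \<sigma>" and fP: "f v \<in> P" if "v \<in> \<sigma>" for v using s(2) fS[OF that] max_clique_P[OF mS] by metis+
  have f1: "col v w" if "v \<in> \<sigma>" "w \<in> \<sigma>" "f v = f w" for v w
    using Sy_perp_clique[OF s(1) fP fns that(1,2)] fc that sy by metis
  have fline: "f e = f a" if l: "l \<in> Ln" "l \<subseteq> \<sigma>" "a \<in> l" "b \<in> l" "a \<noteq> b" "f a = f b" "e \<in> l" for l a b e
  proof -
    have m: "a \<in> \<sigma>" "b \<in> \<sigma>" "e \<in> \<sigma>" using l by auto
    have "col (f a) e" using ln_all[OF l(1,3,4,5) _ _ l(7)] fc[OF m(1)] fc[OF m(2)] l(6) sy by metis
    then show ?thesis using fu[OF m(3) fS[OF m(1)]] sy by metis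
  qed
  \<comment> \<open>One symp contains both \<open>G\<close> and \<open>l\<close>. One-or-all in it,
    applied in both directions, shows that \<open>f\<close> maps \<open>G\<close> onto and into
    \<open>l\<close>.\<close>
  have f2: "(\<exists>e\<in>G. f e = d)" "g \<in> G \<longrightarrow> f g \<in> l"
    if G: "G \<in> Ln" "G \<subseteq> \<sigma>" "a \<in> G" "b \<in> G" "f a \<noteq> f b" and l: "l \<in> Ln" "f a \<in> l" "f b \<in> l" and d: "d \<in> l" for G a b l d g
  proof -
    have m: "a \<in> \<sigma>" "b \<in> \<sigma>" using G by auto
    have n: "\<not> col a (f b)" using fu[OF m(1) fS[OF m(2)]] G by metis
    have cab: "col b a" using ln_col G by metis
    obtain \<tau> where t: "\<tau> \<in> Sy" "a \<in> \<tau>" "f b \<in> \<tau>" "b \<in> \<tau>"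
      using Sy_exE[OF sP[OF m(1)] fP[OF m(2)] sP[OF m(2)] n cab fc[OF m(2)]] by metis
    have fa: "f a \<in> \<tau>"
      using Sy_conv[OF t(1-3) n fP[OF m(1)] sy[OF fc[OF m(1)]] max_clique_col[OF mS fS[OF m(1)] fS[OF m(2)]]] .
    have ab: "a \<noteq> b" using G by metis
    have Gt: "G \<subseteq> \<tau>" using Sy_ln[OF t(1) G(1,3,4) t(2,4) ab] .
    have lt: "l \<subseteq> \<tau>" using Sy_ln[OF t(1) l fa t(3) G(5)] .
    have lS: "l \<subseteq> S" using max_clique_ln[OF mS fS[OF m(1)] fS[OF m(2)] G(5) l] .
    have dt: "d \<in> \<tau>" using d lt by auto
    obtain e where e: "e \<in> G" "col d e" using polar_one[OF Sy_polar[OF t(1)] dt G(1) Gt] by metis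
    have es: "e \<in> \<sigma>" and dS: "d \<in> S" using e G d lS by auto
    then show "\<exists>e\<in>G. f e = d" using e fu[OF es dS sy[OF e(2)]] by metis
    show "g \<in> G \<longrightarrow> f g \<in> l"
    proof
      assume g: "g \<in> G"
      have gt: "g \<in> \<tau>" and gs: "g \<in> \<sigma>" using g Gt G by auto
      obtain d' where d': "d' \<in> l" "col g d'" using polar_one[OF Sy_polar[OF t(1)] gt l(1) lt] by metis
      have "d' \<in> S" using d' lS by auto
      then show "f g \<in> l" using fu[OF gs _ d'(2)] d' by metis
    qed
  qed
  have fmeet: "\<exists>g\<in>G. \<exists>h\<in>H. f g = f h"
    if G: "G \<in> Ln" "G \<subseteq> \<sigma>" "a \<in> G" "b \<in> G" "f a \<noteq> f b" and H: "H \<in> Ln" "H \<subseteq> \<sigma>" "c \<in> H" "d \<in> H" "f c \<noteq> f d" for G a b H c d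
  proof -
    have m: "a \<in> \<sigma>" "b \<in> \<sigma>" "c \<in> \<sigma>" "d \<in> \<sigma>" using G H by auto
    obtain l where l: "l \<in> Ln" "f a \<in> l" "f b \<in> l"
      using pair_line[OF fP[OF m(1)] fP[OF m(2)] max_clique_col[OF mS fS[OF m(1)] fS[OF m(2)]] G(5)] .
    obtain k where k: "k \<in> Ln" "f c \<in> k" "f d \<in> k"
      using pair_line[OF fP[OF m(3)] fP[OF m(4)] max_clique_col[OF mS fS[OF m(3)] fS[OF m(4)]] H(5)] .
    have "l \<subseteq> S" "k \<subseteq> S"
      using max_clique_ln[OF mS fS[OF m(1)] fS[OF m(2)] G(5) l] max_clique_ln[OF mS fS[OF m(3)] fS[OF m(4)] H(5) k] by metis+
    then obtain e where e: "e \<in> l" "e \<in> k" using lines_meet[OF mS l(1) _ k(1)] by metis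
    then show ?thesis using f2(1)[OF G l e(1)] f2(1)[OF H k e(2)] by metis
  qed
  show ?thesis
  proof (rule ccontr)
    assume "\<not> ?thesis"
    then have inj: "\<And>v. v \<in> \<sigma> \<Longrightarrow> f v = f x \<Longrightarrow> v = x" using fS[OF x] fc[OF x] fc by metis
    \<comment> \<open>at most one point of a line \<open>G\<close> through \<open>x\<close> lies on a line that is constant under \<open>f\<close>\<close>
    have one: "g = g'"
      if G: "G \<in> Ln" "G \<subseteq> \<sigma>" "x \<in> G" "g \<in> G" "g' \<in> G" "g \<noteq> x" "g' \<noteq> x"
        and v: "v \<in> \<sigma>" "v \<notin> G" "f v = f g" and v': "v' \<in> \<sigma>" "v' \<notin> G" "f v' = f g'" for G g g' v v'
    proof (rule ccontr)
      assume gg: "g \<noteq> g'"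
      have m: "g \<in> \<sigma>" "g' \<in> \<sigma>" using G by auto
      have c: "col v g" "col v' g'" using f1 v v' m by metis+
      have fg: "f g \<noteq> f g'" using fline[OF G(1,2,4,5) gg _ G(3)] inj[OF m(1)] G by metis
      have vg: "v \<noteq> g" using v G by metis
      obtain V v2 where V: "V \<in> Ln" "v \<in> V" "g \<in> V" "V \<subseteq> \<sigma>" "v2 \<in> V" "col v' v2" "v2 \<in> \<sigma>"
        using Sy_hit[OF s(1) v'(1) v(1) m(1) vg c(1)] by metis
      have fV: "f e = f g" if "e \<in> V" for e using fline[OF V(1,4,2,3) vg v(3) that] v by metis
      have v2g: "v2 \<noteq> g" using rank2_triangle[OF s(1) G(1,4,5) gg m v'(1) _ c(2)] v' V by metis
      have v2v': "v2 \<noteq> v'" using fV[OF V(5)] v' fg by metis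
      obtain R where R: "R \<in> Ln" "v2 \<in> R" "v' \<in> R" "R \<subseteq> \<sigma>"
        using polar_line[OF Sy_polar[OF s(1)] V(7) v'(1) v2v'] V(6) sy by metis
      obtain l where l: "l \<in> Ln" "f g \<in> l" "f g' \<in> l"
        using pair_line[OF fP[OF m(1)] fP[OF m(2)] max_clique_col[OF mS fS[OF m(1)] fS[OF m(2)]] fg] .
      have fx: "f x \<in> l" using f2(2)[OF G(1,2,4,5) fg l l(2)] G by metis
      obtain r where r: "r \<in> R" "f r = f x"
        using f2(1)[OF R(1,4,2,3) _ l(1) _ _ fx] fV[OF V(5)] v'(3) fg l R by metis
      have "r = x" using inj r R by (metis subsetD)
      then have "col x v2" using ln_col R r by metis
      then have "x \<in> V" using rank2_triangle[OF s(1) V(1,5,3) v2g V(7) m(1) x] ln_col[OF G(1,3,4)] by metis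
      then have "f x = f g" using fV by metis
      then show False using inj m G by metis
    qed
    obtain a b where ab: "a \<in> \<sigma>" "b \<in> \<sigma>" "col a x" "col b x" "\<not> col a b" using Sy_two[OF s(1) x] .
    have abx: "a \<noteq> x" "b \<noteq> x" using ab sy by metis+
    obtain G1 where G1: "G1 \<in> Ln" "a \<in> G1" "x \<in> G1" "G1 \<subseteq> \<sigma>"
      using polar_line[OF Sy_polar[OF s(1)] ab(1) x abx(1) ab(3)] by metis
    obtain G2 where G2: "G2 \<in> Ln" "b \<in> G2" "x \<in> G2" "G2 \<subseteq> \<sigma>"
      using polar_line[OF Sy_polar[OF s(1)] ab(2) x abx(2) ab(4)] by metis
    have dis: "y = x" if "y \<in> G1" "y \<in> G2" for y
      using ln_uniq[OF G1(1) G2(1) that(1) G1(3) that(2) G2(3)] ab ln_col[OF G1(1)] G1 G2 by metis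
    have cross: "y \<in> K" if "K \<in> Ln" "K \<subseteq> \<sigma>" "x \<in> K" "h \<in> K" "h \<noteq> x" "y \<in> \<sigma>" "col y x" "col y h" for K h y
      using rank2_triangle[OF s(1) that(1,4,3,5) _ x that(6,8,7)] that by (metis subsetD)
    have f2x: "f h \<noteq> f x" if "h \<in> \<sigma>" "h \<noteq> x" for h using inj that by metis
    \<comment> \<open>a nonconstant line through a point of \<open>H\<close> yields a constant line meeting \<open>G\<close>\<close>
    have hit: "\<exists>g w. g \<in> G \<and> g \<noteq> x \<and> w \<in> Z \<and> w \<notin> G \<and> f w = f g"
      if GH: "G \<in> Ln" "G \<subseteq> \<sigma>" "x \<in> G" "a' \<in> G" "a' \<noteq> x" "H \<in> Ln" "H \<subseteq> \<sigma>" "x \<in> H" "\<And>y. y \<in> G \<Longrightarrow> y \<in> H \<Longrightarrow> y = x"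
        and h: "h \<in> H" "h \<noteq> x" and Z: "Z \<in> Ln" "Z \<subseteq> \<sigma>" "h \<in> Z" "z \<in> Z" "z \<notin> H" "f h \<noteq> f z" for G H a' h Z z
    proof -
      have a': "a' \<in> \<sigma>" using GH(2,4) by auto
      have xZ: "x \<notin> Z" using ln_uniq[OF Z(1) GH(6) Z(3) _ h(1) GH(8) h(2)] Z by metis
      obtain g w where gw: "g \<in> G" "w \<in> Z" "f g = f w"
        using fmeet[OF GH(1,2,4,3) f2x[OF a' GH(5)] Z(1-4) Z(6)] by metis
      have ws: "w \<in> \<sigma>" using gw Z by auto
      have gx: "g \<noteq> x" using inj[OF ws] gw xZ by metis
      have "w \<notin> G"
      proof
        assume w: "w \<in> G"
        have "col w x" "col w h" using ln_col[OF GH(1) w GH(3)] ln_col[OF Z(1) gw(2) Z(3)] by metis+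
        then have "w \<in> H" using cross[OF GH(6,7,8) h ws] by metis
        then show False using GH(9) w gw xZ by metis
      qed
      then show ?thesis using gw gx by metis
    qed
    \<comment> \<open>By \<open>one\<close>, of two points of \<open>H\<close> other than
      \<open>x\<close> at least one lies on an uncontracted line leaving \<open>H\<close>; then
      \<open>hit\<close> applies to that line.\<close>
    have Vex: "\<exists>g w. g \<in> G \<and> g \<noteq> x \<and> w \<in> \<sigma> \<and> w \<notin> G \<and> f w = f g"
      if GH: "G \<in> Ln" "G \<subseteq> \<sigma>" "x \<in> G" "a' \<in> G" "a' \<noteq> x" "H \<in> Ln" "H \<subseteq> \<sigma>" "x \<in> H" "\<And>y. y \<in> G \<Longrightarrow> y \<in> H \<Longrightarrow> y = x" for G H a'
    proof -
      obtain h where h: "h \<in> H" "h \<noteq> x" using ln_thick[OF GH(6)] by metis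
      obtain h' where h': "h' \<in> H" "h' \<noteq> x" "h' \<noteq> h" using ln_thick[OF GH(6)] by metis
      have out: "\<exists>z. z \<in> \<sigma> \<and> z \<notin> H \<and> col z k" if "k \<in> H" for k
      proof -
        have "k \<in> \<sigma>" using that GH(7) by auto
        then obtain c d where "c \<in> \<sigma>" "d \<in> \<sigma>" "col c k" "col d k" "\<not> col c d" using Sy_two[OF s(1)] by metis
        then show ?thesis using ln_col[OF GH(6)] by metis
      qed
      obtain z where z: "z \<in> \<sigma>" "z \<notin> H" "col z h" using out h by metis
      obtain z' where z': "z' \<in> \<sigma>" "z' \<notin> H" "col z' h'" using out h' by metis
      have "f z \<noteq> f h \<or> f z' \<noteq> f h'" using one[OF GH(6-8) h(1) h'(1) h(2) h'(2) z(1,2) _ z'(1,2)] h' by metis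
      moreover have "\<exists>g w. g \<in> G \<and> g \<noteq> x \<and> w \<in> \<sigma> \<and> w \<notin> G \<and> f w = f g"
        if k: "k \<in> H" "k \<noteq> x" and y: "y \<in> \<sigma>" "y \<notin> H" "col y k" "f y \<noteq> f k" for k y
      proof -
        have ks: "k \<in> \<sigma>" and yk: "y \<noteq> k" using k y GH(7) by auto
        obtain Z where Z: "Z \<in> Ln" "y \<in> Z" "k \<in> Z" "Z \<subseteq> \<sigma>"
          using polar_line[OF Sy_polar[OF s(1)] y(1) ks yk y(3)] by metis
        then show ?thesis using hit[OF GH k Z(1,4,3,2) y(2)] y by (metis subsetD)
      qed
      ultimately show ?thesis using h h' z z' by metis
    qed
    obtain g1 v1 where g1: "g1 \<in> G1" "g1 \<noteq> x" "v1 \<in> \<sigma>" "v1 \<notin> G1" "f v1 = f g1"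
      using Vex[OF G1(1,4,3,2) abx(1) G2(1,4,3) dis] by metis
    have dis': "\<And>y. y \<in> G2 \<Longrightarrow> y \<in> G1 \<Longrightarrow> y = x" using dis by metis
    obtain g2 v2 where g2: "g2 \<in> G2" "g2 \<noteq> x" "v2 \<in> \<sigma>" "v2 \<notin> G2" "f v2 = f g2"
      using Vex[OF G2(1,4,3,2) abx(2) G1(1,4,3) dis'] by metis
    have gs: "g1 \<in> \<sigma>" "g2 \<in> \<sigma>" using g1 g2 G1 G2 by auto
    have far: "\<not> col h g2" if "h \<in> G1" "h \<noteq> x" for h
      using cross[OF G1(1,4,3) that gs(2)] ln_col[OF G2(1) g2(1) G2(3)] dis g2 sy by metis
    have fne: "f g1 \<noteq> f g2" using f1 gs far g1 by metis
    have v1g: "v1 \<noteq> g1" using g1 by metis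
    obtain V1 z where V1: "V1 \<in> Ln" "v1 \<in> V1" "g1 \<in> V1" "V1 \<subseteq> \<sigma>" "z \<in> V1" "col g2 z" "z \<in> \<sigma>"
      using Sy_hit[OF s(1) gs(2) g1(3) gs(1) v1g f1[OF g1(3) gs(1) g1(5)]] by metis
    have fz: "f z = f g1" using fline[OF V1(1,4,2,3) v1g g1(5) V1(5)] g1 by metis
    have zg2: "g2 \<noteq> z" using fz fne by metis
    obtain Z0 where Z0: "Z0 \<in> Ln" "g2 \<in> Z0" "z \<in> Z0" "Z0 \<subseteq> \<sigma>"
      using polar_line[OF Sy_polar[OF s(1)] gs(2) V1(7) zg2 V1(6)] by metis
    have zg1: "z \<noteq> g1" using far g1 V1 sy by metis
    have zG2: "z \<notin> G2"
    proof
      assume zG: "z \<in> G2"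
      have "col z x" "col z g1" using ln_col[OF G2(1) zG G2(3)] ln_col[OF V1(1,5,3)] by metis+
      then have "z \<in> G1" using cross[OF G1(1,4,3) g1(1,2) V1(7)] by metis
      then have "z = x" using dis zG by metis
      then show False using fz inj gs g1 by metis
    qed
    \<comment> \<open>A third point of \<open>G1\<close> closes the configuration. The line
      \<open>Y\<close> from \<open>h\<close> to \<open>Z0\<close> is not contracted, so
      \<open>hit\<close> finds on it a point \<open>w\<close> with image \<open>f g2\<close>. Then
      \<open>g2\<close> sees \<open>w\<close> and \<open>y\<close>, and so sees \<open>h\<close>
      unless \<open>w = y\<close>, where \<open>Z0\<close> would be contracted.\<close>
    obtain h where h: "h \<in> G1" "h \<noteq> x" "h \<noteq> g1" using ln_thick[OF G1(1)] by metis
    have hs: "h \<in> \<sigma>" using h G1 by auto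
    obtain y where y: "y \<in> Z0" "col h y" using polar_one[OF Sy_polar[OF s(1)] hs Z0(1,4)] by metis
    have ys: "y \<in> \<sigma>" using y Z0 by auto
    have yg2: "y \<noteq> g2" using far h y by metis
    have yG1: "y \<notin> G1"
    proof
      assume yG: "y \<in> G1"
      have "col y x" "col y g2" using ln_col[OF G1(1) yG G1(3)] ln_col[OF Z0(1) y(1) Z0(2)] by metis+
      then have "y \<in> G2" using cross[OF G2(1,4,3) g2(1,2) ys] by metis
      then have "y = x" using dis yG by metis
      then have "Z0 = G2" using ln_uniq[OF Z0(1) G2(1) y(1) Z0(2) _ g2(1) yg2] G2 by metis
      then show False using zG2 Z0 by metis
    qed
    have hy: "h \<noteq> y" using yG1 h by metis
    have fhy: "f h \<noteq> f y"
      using one[OF G1(1,4,3) g1(1) h(1) g1(2) h(2) g1(3-5) ys yG1] h by metis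
    obtain Y where Y: "Y \<in> Ln" "h \<in> Y" "y \<in> Y" "Y \<subseteq> \<sigma>"
      using polar_line[OF Sy_polar[OF s(1)] hs ys hy y(2)] by metis
    obtain g w where w: "g \<in> G2" "g \<noteq> x" "w \<in> Y" "w \<notin> G2" "f w = f g"
      using hit[OF G2(1,4,3,2) abx(2) G1(1,4,3) dis' h(1,2) Y(1,4,2,3) yG1 fhy] by metis
    have ws: "w \<in> \<sigma>" using w Y by auto
    have "g = g2" using one[OF G2(1,4,3) w(1) g2(1) w(2) g2(2) ws w(4,5) g2(3-5)] .
    then have fw: "f w = f g2" using w by metis
    have wg: "col g2 w" using f1[OF gs(2) ws] fw by metis
    show False
    proof (cases "w = y")
      case True
      have "f z = f g2" using fline[OF Z0(1,4,2) y(1) yg2[symmetric] _ Z0(3)] fw True by metis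
      then show False using fz fne by metis
    next
      case False
      have "col g2 y" using ln_col[OF Z0(1,2) y(1)] .
      then have "col g2 h" using ln_all[OF Y(1) w(3) Y(3) False wg _ Y(2)] by metis
      then show False using far h sy by metis
    qed
  qed
qed

end

context meeting_symps_rank2
begin

text \<open>Otherwise each line \<open>nw\<close> of the described kind lies in one symp only.
  Applied to two symps \<zeta>1, \<zeta>2 on \<open>M\<close> and two points \<open>p\<close>,
  \<open>p'\<close> of \<open>M\<close>, this makes \<open>n1\<close>, \<open>n2\<close> collinear
  and \<open>e1\<close>, \<open>e2\<close> collinear, since a symp joining such a pair would equal
  both \<zeta>1 and \<zeta>2. The quadrangle of these four points spans a symp through
  \<open>k1\<close> and \<open>k2\<close>. This symp is \<xi>, but it contains the neighbour
  \<open>n1\<close> of \<open>p\<close>.\<close>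

lemma two_symps_on_line:
  assumes p: "p \<in> P" "p \<notin> \<xi>" and X: "\<xi> \<in> Sy" "x \<in> \<xi>" "col p x"
    and uniq: "\<And>z. z \<in> \<xi> \<Longrightarrow> col p z \<Longrightarrow> z = x"
    and M: "M \<in> Ln" "p \<in> M" "x \<in> M"
  shows "\<exists>w k \<zeta> \<upsilon> n. w \<in> M \<and> w \<noteq> x \<and> k \<in> \<xi> \<and> k \<noteq> x \<and> col k x \<and> \<zeta> \<in> Sy \<and> w \<in> \<zeta> \<and> x \<in> \<zeta> \<and> k \<in> \<zeta> \<and>
    n \<in> \<zeta> \<and> col n w \<and> \<not> col n x \<and> \<upsilon> \<in> Sy \<and> n \<in> \<upsilon> \<and> w \<in> \<upsilon> \<and> \<upsilon> \<noteq> \<zeta>"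
proof (rule ccontr)
  assume N: "\<not> ?thesis"
  have A: "\<upsilon> = \<zeta>" if "w \<in> M" "w \<noteq> x" "k \<in> \<xi>" "k \<noteq> x" "col k x" "\<zeta> \<in> Sy" "w \<in> \<zeta>" "x \<in> \<zeta>" "k \<in> \<zeta>"
    "n \<in> \<zeta>" "col n w" "\<not> col n x" "\<upsilon> \<in> Sy" "n \<in> \<upsilon>" "w \<in> \<upsilon>" for w k \<zeta> n \<upsilon>
    using N that by metis
  have px: "p \<noteq> x" using p X by metis
  have xP: "x \<in> P" using Sy_P X by metis
  obtain k1 k2 where k: "k1 \<in> \<xi>" "k2 \<in> \<xi>" "col k1 x" "col k2 x" "\<not> col k1 k2" using Sy_two[OF X(1,2)] .
  have kx: "k1 \<noteq> x" "k2 \<noteq> x" using k sy by metis+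
  have pk: "\<not> col p k1" "\<not> col p k2" using uniq k kx by metis+
  obtain \<zeta>1 where z1: "\<zeta>1 \<in> Sy" "p \<in> \<zeta>1" "k1 \<in> \<zeta>1" "x \<in> \<zeta>1"
    using Sy_exE[OF p(1) Sy_P[OF X(1) k(1)] xP pk(1)] X(3) k(3) sy by metis
  obtain \<zeta>2 where z2: "\<zeta>2 \<in> Sy" "p \<in> \<zeta>2" "k2 \<in> \<zeta>2" "x \<in> \<zeta>2"
    using Sy_exE[OF p(1) Sy_P[OF X(1) k(2)] xP pk(2)] X(3) k(4) sy by metis
  have z12: "\<zeta>1 \<noteq> \<zeta>2" using Sy_eq[OF z1(1) X(1) z1(3) _ k(1,2,5)] z2 z1 p by metis
  obtain p' where p': "p' \<in> M" "p' \<noteq> x" "p' \<noteq> p" using ln_thick[OF M(1)] by metis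
  have pz: "p' \<in> \<zeta>1" "p' \<in> \<zeta>2"
    using Sy_lnD[OF z1(1) M z1(2,4) px p'(1)] Sy_lnD[OF z2(1) M z2(2,4) px p'(1)] .
  have pk': "\<not> col p' k" if "k \<in> \<xi>" "k \<noteq> x" for k
  proof
    assume c: "col p' k"
    have p'P: "p' \<in> P" using Ln_P M p' by metis
    have p'X: "p' \<notin> \<xi>"
    proof
      assume "p' \<in> \<xi>"
      then have "p \<in> \<xi>" using Sy_lnD[OF X(1) M(1) p'(1) M(3) _ X(2) p'(2) M(2)] by metis
      then show False using p by metis
    qed
    have "col x k" using Sy_perp_clique[OF X(1) p'P p'X X(2) that(1)] ln_col[OF M(1) p'(1) M(3)] c by metis
    then have "col k p" using ln_all[OF M(1) p'(1) M(3) p'(2) sy[OF c] _ M(2)] sy by metis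
    then show False using uniq that sy by metis
  qed
  have ex: "\<exists>n e E. n \<in> \<zeta> \<and> col n p \<and> \<not> col n x \<and> col n k \<and> E \<in> Ln \<and> k \<in> E \<and> n \<in> E \<and> e \<in> E \<and> e \<in> \<zeta> \<and> col e p' \<and> \<not> col e x \<and> e \<noteq> n"
    if z: "\<zeta> \<in> Sy" "p \<in> \<zeta>" "k \<in> \<zeta>" "x \<in> \<zeta>" and k: "k \<in> \<xi>" "col k x" "k \<noteq> x" "\<not> col p k" for \<zeta> k
  proof -
    obtain r s where rs: "r \<in> \<zeta>" "s \<in> \<zeta>" "col r p" "col r k" "col s p" "col s k" "\<not> col r s"
      using Sy_noncol_pair[OF z(1-3) k(4)] .
    obtain K where K: "K \<in> Ln" "k \<in> K" "x \<in> K" "K \<subseteq> \<xi>"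
      using polar_line[OF Sy_polar[OF X(1)] k(1) X(2) k(3,2)] by metis
    have kill: "e = x" if "e \<in> \<zeta>" "col e x" "col e k" "col e p \<or> col e p'" for e
    proof -
      have "e \<in> K" using rank2_triangle[OF z(1) K(1-3) k(3) z(3,4) that(1,3,2)] .
      then have "e \<in> \<xi>" using K by auto
      then show ?thesis using uniq pk' that(4) sy by metis
    qed
    obtain n where n: "n \<in> \<zeta>" "col n p" "col n k" "\<not> col n x"
      using kill[of r] kill[of s] rs by metis
    have nk: "n \<noteq> k" using n k by metis
    have p'z: "p' \<in> \<zeta>" using Sy_lnD[OF z(1) M z(2,4) px p'(1)] .
    obtain E e where E: "E \<in> Ln" "n \<in> E" "k \<in> E" "E \<subseteq> \<zeta>" "e \<in> E" "col p' e" "e \<in> \<zeta>"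
      using Sy_hit[OF z(1) p'z n(1) z(3) nk n(3)] by metis
    have "\<not> col e x"
    proof
      assume "col e x"
      then have "e = x" using kill[OF E(7)] ln_col[OF E(1,5,3)] E(6) sy by metis
      then show False using n ln_col[OF E(1,2,5)] by metis
    qed
    moreover have "e \<noteq> n"
    proof
      assume "e = n"
      then have "col n x" using ln_all[OF M(1) p'(1) M(2) p'(3) _ n(2) M(3)] E(6) sy by metis
      then show False using n by metis
    qed
    ultimately show ?thesis using n E sy by metis
  qed
  obtain n1 e1 E1 where 1: "n1 \<in> \<zeta>1" "col n1 p" "\<not> col n1 x" "col n1 k1" "E1 \<in> Ln" "k1 \<in> E1" "n1 \<in> E1" "e1 \<in> E1" "e1 \<in> \<zeta>1" "col e1 p'" "\<not> col e1 x" "e1 \<noteq> n1"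
    using ex[OF z1 k(1,3) kx(1) pk(1)] by metis
  obtain n2 e2 E2 where 2: "n2 \<in> \<zeta>2" "col n2 p" "\<not> col n2 x" "col n2 k2" "E2 \<in> Ln" "k2 \<in> E2" "n2 \<in> E2" "e2 \<in> E2" "e2 \<in> \<zeta>2" "col e2 p'" "\<not> col e2 x" "e2 \<noteq> n2"
    using ex[OF z2 k(2,4) kx(2) pk(2)] by metis
  have inP: "n1 \<in> P" "n2 \<in> P" "e1 \<in> P" "e2 \<in> P" "p' \<in> P"
    using Sy_P[OF z1(1)] Sy_P[OF z2(1)] 1 2 pz by metis+
  have both: "col a b" if w: "w \<in> M" "w \<noteq> x" "w \<in> \<zeta>1" "w \<in> \<zeta>2" and a: "a \<in> \<zeta>1" "col a w" "\<not> col a x" and b: "b \<in> \<zeta>2" "col b w" "\<not> col b x" for a b w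
  proof (rule ccontr)
    assume n: "\<not> col a b"
    obtain \<upsilon> where u: "\<upsilon> \<in> Sy" "a \<in> \<upsilon>" "b \<in> \<upsilon>" "w \<in> \<upsilon>"
      using Sy_exE[OF Sy_P[OF z1(1) a(1)] Sy_P[OF z2(1) b(1)] Sy_P[OF z1(1) w(3)] n] a b sy by metis
    have "\<upsilon> = \<zeta>1" using A[OF w(1,2) k(1) kx(1) k(3) z1(1) w(3) z1(4,3) a u(1,2,4)] .
    moreover have "\<upsilon> = \<zeta>2" using A[OF w(1,2) k(2) kx(2) k(4) z2(1) w(4) z2(4,3) b u(1,3,4)] .
    ultimately show False using z12 by metis
  qed
  have nn: "col n1 n2" using both[OF M(2) px z1(2) z2(2) 1(1-3) 2(1-3)] .
  have ee: "col e1 e2" using both[OF p'(1,2) pz 1(9-11) 2(9-11)] .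
  have ne: "\<not> col n1 e2"
  proof
    assume "col n1 e2"
    then have "col n1 k2" using ln_all[OF 2(5,7,8) 2(12)[symmetric] nn _ 2(6)] by metis
    then have "n1 \<in> \<zeta>2" using Sy_conv[OF z2(1,2,3) pk(2) inP(1) 1(2)] by metis
    then show False using Sy_eq[OF z1(1) z2(1) 1(1) z1(4) _ z2(4) 1(3)] z12 by metis
  qed
  have n2e2: "col n2 e2" using ln_col[OF 2(5,7,8)] .
  obtain \<theta> where t: "\<theta> \<in> Sy" "n1 \<in> \<theta>" "e2 \<in> \<theta>" "n2 \<in> \<theta>"
    using Sy_exE[OF inP(1,4,2) ne sy[OF nn] n2e2] by metis
  have e1t: "e1 \<in> \<theta>" using Sy_conv[OF t(1-3) ne inP(3) ln_col[OF 1(5,8,7)] ee] .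
  have k1t: "k1 \<in> \<theta>" using Sy_lnD[OF t(1) 1(5,8,7) e1t t(2) 1(12,6)] .
  have k2t: "k2 \<in> \<theta>" using Sy_lnD[OF t(1) 2(5,8,7) t(3,4) 2(12,6)] .
  have "\<theta> = \<xi>" using Sy_eq[OF t(1) X(1) k1t k2t k(1,2,5)] .
  then show False using uniq t 1 sy rf by metis
qed

text \<open>Two planar cliques are produced in turn. The symp \<upsilon> meets \<xi> in a point
  \<open>u\<close>, and this yields the clique \<open>S\<close> on \<open>m\<close>,
  \<open>k'\<close> and \<open>u\<close>. Applying \<open>planar_clique_shared_nbr\<close> to
  \<open>S\<close> yields a second clique \<open>S'\<close> through \<open>w\<close>. Applying it to
  \<open>S'\<close> and \<xi> gives \<open>w\<close> a neighbour in \<xi> other than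
  \<open>x\<close>, against \<open>uw\<close>.\<close>

lemma not_singleton_rank2:
  assumes p: "p \<in> P" "p \<notin> \<xi>" and X: "\<xi> \<in> Sy" "x \<in> \<xi>" "col p x"
  shows "\<exists>x'\<in>\<xi>. x' \<noteq> x \<and> col p x'"
proof (rule ccontr)
  assume "\<not> ?thesis"
  then have uniq: "\<And>z. z \<in> \<xi> \<Longrightarrow> col p z \<Longrightarrow> z = x" by metis
  have px: "p \<noteq> x" using p X by metis
  have xP: "x \<in> P" using Sy_P X by metis
  obtain M where M: "M \<in> Ln" "p \<in> M" "x \<in> M" using pair_line[OF p(1) xP X(3) px] .
  obtain w k \<zeta> \<upsilon> n where w: "w \<in> M" "w \<noteq> x" and k: "k \<in> \<xi>" "k \<noteq> x" "col k x"
    and z: "\<zeta> \<in> Sy" "w \<in> \<zeta>" "x \<in> \<zeta>" "k \<in> \<zeta>" and n: "n \<in> \<zeta>" "col n w" "\<not> col n x"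
    and v: "\<upsilon> \<in> Sy" "n \<in> \<upsilon>" "w \<in> \<upsilon>" "\<upsilon> \<noteq> \<zeta>"
    using two_symps_on_line[OF p X uniq M] by metis
  have wX: "w \<notin> \<xi>"
  proof
    assume "w \<in> \<xi>"
    then have "p \<in> \<xi>" using Sy_lnD[OF X(1) M(1) w(1) M(3) _ X(2) w(2) M(2)] by metis
    then show False using p by metis
  qed
  have wP: "w \<in> P" using Sy_P z by metis
  have wx: "col w x" using ln_col M w by metis
  have uw: "c = x" if c: "c \<in> \<xi>" "col w c" for c
  proof -
    have "col c x" using Sy_perp_clique[OF X(1) wP wX c(1) X(2) c(2) wx] .
    then have "col c p" using ln_all[OF M(1) w(1) M(3) w(2) sy[OF c(2)] _ M(2)] by metis
    then show ?thesis using uniq c sy by metis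
  qed
  obtain u where u: "u \<in> \<upsilon>" "u \<in> \<xi>" using meet[OF v(1) X(1)] by metis
  have uwn: "\<not> col u w"
  proof
    assume "col u w"
    then have "u = x" using uw u sy by metis
    then show False using Sy_eq[OF v(1) z(1) v(2) _ n(1) z(3) n(3)] u v by metis
  qed
  have nw: "n \<noteq> w" using n wx by metis
  obtain N m where N: "N \<in> Ln" "n \<in> N" "w \<in> N" "N \<subseteq> \<upsilon>" "m \<in> N" "col u m" "m \<in> \<upsilon>"
    using Sy_hit[OF v(1) u(1) v(2,3) nw n(2)] by metis
  have mz: "m \<in> \<zeta>" using Sy_lnD[OF z(1) N(1,2,3) n(1) z(2) nw N(5)] .
  have mw: "m \<noteq> w" using uwn N by metis
  have mx: "\<not> col m x" using ln_all[OF N(1,5,3) mw _ sy[OF wx] N(2)] n sy by metis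
  obtain K k' where K: "K \<in> Ln" "k \<in> K" "x \<in> K" "K \<subseteq> \<zeta>" "k' \<in> K" "col m k'" "k' \<in> \<zeta>"
    using Sy_hit[OF z(1) mz z(4,3) k(2,3)] by metis
  have k'X: "k' \<in> \<xi>" using Sy_lnD[OF X(1) K(1-3) k(1) X(2) k(2) K(5)] .
  have k'x: "k' \<noteq> x" "col k' x" using mx K ln_col[OF K(1,5,3)] by metis+
  have mP: "m \<in> P" using Sy_P z mz by metis
  have mX: "m \<notin> \<xi>" using uw mx ln_col[OF N(1,3,5)] rf by metis
  have uk: "u \<noteq> k'"
  proof
    assume "u = k'"
    then show False using Sy_eq[OF v(1) z(1) u(1) v(3) _ z(2) uwn] K v by metis
  qed
  have uk': "col u k'" using Sy_perp_clique[OF X(1) mP mX u(2) k'X] N K sy by metis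
  have k'P: "k' \<in> P" and uP: "u \<in> P" using Sy_P X k'X u by metis+
  have mk: "m \<noteq> k'" using mX k'X by metis
  define S where "S = {c \<in> P. col c m \<and> col c k'}"
  have S: "max_clique S" unfolding S_def using max_cliqueI[OF mP k'P mk K(6)] .
  have inS: "m \<in> S" "k' \<in> S" "u \<in> S" unfolding S_def using mP k'P uP N K uk' sy by auto
  obtain Y where Y: "Y \<in> Ln" "u \<in> Y" "k' \<in> Y" "Y \<subseteq> \<xi>"
    using polar_line[OF Sy_polar[OF X(1)] u(2) k'X uk uk'] by metis
  have YS: "Y \<subseteq> S" using max_clique_ln[OF S inS(3,2) uk Y(1-3)] .
  have mY: "m \<notin> Y" using mX Y by auto
  have pS: "planar_clique S" using planar_cliqueI[OF S Y(1) YS inS(1) mY] .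
  have xS: "x \<notin> S" unfolding S_def using mx sy by auto
  have xk': "c = k'" if "c \<in> S" "col x c" for c
    using max_clique_in[OF S that(1) inS(2) _ xP that(2) sy[OF k'x(2)]] xS by metis
  obtain j where j: "j \<in> \<xi>" "col j x" "\<not> col j k'"
    using polar_sep[OF Sy_polar[OF X(1)] X(2) k'X k'x(1)[symmetric]] by metis
  have wj: "\<not> col w j" using uw j k'x sy by metis
  obtain \<sigma> where s: "\<sigma> \<in> Sy" "w \<in> \<sigma>" "j \<in> \<sigma>" "x \<in> \<sigma>"
    using Sy_exE[OF wP Sy_P[OF X(1) j(1)] xP wj] wx j sy by metis
  \<comment> \<open>A common point would bring a line of \<open>S\<close> into \<sigma>. On that
    line \<open>x\<close> sees a point, which must be \<open>k'\<close>, and \<open>j\<close>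
    together with \<open>k'\<close> would give \<sigma> = \<xi>.\<close>
  have sS: "c \<notin> S" if c: "c \<in> \<sigma>" for c
  proof
    assume cS: "c \<in> S"
    obtain c' where c': "c' \<in> S" "c' \<in> \<sigma>" "c' \<noteq> c" using planar_clique_meets_symp[OF pS cS s(1) c] by metis
    obtain l d where l: "l \<in> Ln" "c' \<in> l" "c \<in> l" "d \<in> l" "col x d" "d \<in> \<sigma>"
      using Sy_hit[OF s(1,4) c'(2) c c'(3) max_clique_col[OF S c'(1) cS]] by metis
    have "d \<in> S" using max_clique_ln[OF S c'(1) cS c'(3) l(1-3)] l by auto
    then have "k' \<in> \<sigma>" using xk' l by metis
    then have "\<sigma> = \<xi>" using Sy_eq[OF s(1) X(1) s(3) _ j(1) k'X j(3)] by metis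
    then show False using s wX by metis
  qed
  obtain c w' where c: "c \<in> S" "col w c" "w' \<in> \<sigma>" "w' \<noteq> w" "col w' c"
    using planar_clique_shared_nbr[OF pS s(1) sS s(4) inS(2) sy[OF k'x(2)] s(2)] by metis
  have xc: "\<not> col x c" using xk' uw c k'X k'x by metis
  have cs: "c \<notin> \<sigma>" and cP: "c \<in> P" and wc: "w \<noteq> c" using sS c max_clique_P[OF S] s by metis+
  have ww: "col w' w" using Sy_perp_clique[OF s(1) cP cs c(3) s(2)] c sy by metis
  define S' where "S' = {d \<in> P. col d w \<and> col d c}"
  have S': "max_clique S'" unfolding S'_def using max_cliqueI[OF wP cP wc c(2)] .
  have w'P: "w' \<in> P" using Sy_P s c by metis
  have inS': "w \<in> S'" "w' \<in> S'" "c \<in> S'" unfolding S'_def using wP cP w'P c ww sy by auto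
  obtain V where V: "V \<in> Ln" "w' \<in> V" "w \<in> V" "V \<subseteq> \<sigma>"
    using polar_line[OF Sy_polar[OF s(1)] c(3) s(2) c(4) ww] by metis
  have VS: "V \<subseteq> S'" using max_clique_ln[OF S' inS'(2,1) c(4) V(1-3)] .
  have cV: "c \<notin> V" using cs V by auto
  have pS': "planar_clique S'" using planar_cliqueI[OF S' V(1) VS inS'(3) cV] .
  have xS': "x \<notin> S'" unfolding S'_def using xc by auto
  have xw: "d = w" if "d \<in> S'" "col x d" for d
    using max_clique_in[OF S' that(1) inS'(1) _ xP that(2) sy[OF wx]] xS' by metis
  have XS': "d \<notin> S'" if d: "d \<in> \<xi>" for d
  proof
    assume dS: "d \<in> S'"
    obtain d' where d': "d' \<in> S'" "d' \<in> \<xi>" "d' \<noteq> d" using planar_clique_meets_symp[OF pS' dS X(1) d] by metis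
    obtain l e where l: "l \<in> Ln" "d' \<in> l" "d \<in> l" "e \<in> l" "col x e" "e \<in> \<xi>"
      using Sy_hit[OF X(1,2) d'(2) d d'(3) max_clique_col[OF S' d'(1) dS]] by metis
    have "e \<in> S'" using max_clique_ln[OF S' d'(1) dS d'(3) l(1-3)] l by auto
    then show False using xw l wX by metis
  qed
  obtain e x' where e: "e \<in> S'" "col x e" "x' \<in> \<xi>" "x' \<noteq> x" "col x' e"
    using planar_clique_shared_nbr[OF pS' X(1) XS' X(2) inS'(1) sy[OF wx] X(2)] by metis
  then show False using xw uw sy by metis
qed

end

lemma (in meeting_symps) not_singleton:
  assumes p: "p \<in> P" "p \<notin> \<xi>" and X: "\<xi> \<in> Sy" "x \<in> \<xi>" "col p x"
  shows "\<exists>x'\<in>\<xi>. x' \<noteq> x \<and> col p x'"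
proof (cases "rank2 \<xi>")
  case True
  interpret meeting_symps_rank2 col Ln P Sy
    by unfold_locales (use rank2_all[OF X(1) True] in metis)
  show ?thesis using not_singleton_rank2[OF p X] .
next
  case False
  then show ?thesis using not_singleton_big[OF X(1) False p X(2,3)] by metis
qed

section \<open>Meeting symps share a line: $0$-lacunarity\<close>

locale symps_share_line = symp_space +
  assumes meet0: "\<eta> \<in> Sy \<Longrightarrow> \<theta> \<in> Sy \<Longrightarrow> \<eta> \<noteq> \<theta> \<Longrightarrow> x \<in> \<eta> \<Longrightarrow> x \<in> \<theta> \<Longrightarrow> \<exists>y. y \<in> \<eta> \<and> y \<in> \<theta> \<and> y \<noteq> x"
    and conn: "S \<subseteq> P \<Longrightarrow> s \<in> S \<Longrightarrow> (\<And>p q. p \<in> S \<Longrightarrow> q \<in> P \<Longrightarrow> col q p \<Longrightarrow> q \<in> S) \<Longrightarrow> S = P"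
    and Sy_ne: "\<eta> \<in> Sy \<Longrightarrow> \<exists>x. x \<in> \<eta>"
begin

lemma Sy_clique:
  assumes "\<eta> \<in> Sy" "\<theta> \<in> Sy" "\<eta> \<noteq> \<theta>" "a \<in> \<eta>" "b \<in> \<eta>" "a \<in> \<theta>" "b \<in> \<theta>"
  shows "col a b"
  using Sy_eq[OF assms(1,2,4-7)] assms(3) by metis

lemma meet_hit:
  assumes e: "\<eta> \<in> Sy" "\<theta> \<in> Sy" "\<eta> \<noteq> \<theta>" "x \<in> \<eta>" "x \<in> \<theta>" and p: "p \<in> \<eta>"
  obtains l c d where "l \<in> Ln" "x \<in> l" "c \<in> l" "d \<in> l" "d \<noteq> x" "l \<subseteq> \<eta>" "l \<subseteq> \<theta>" "col p c" "c \<in> \<eta>" "c \<in> \<theta>" "d \<in> \<eta>" "d \<in> \<theta>"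
proof -
  obtain y where y: "y \<in> \<eta>" "y \<in> \<theta>" "y \<noteq> x" using meet0[OF e] by metis
  obtain l c where l: "l \<in> Ln" "y \<in> l" "x \<in> l" "l \<subseteq> \<eta>" "c \<in> l" "col p c" "c \<in> \<eta>"
    using Sy_hit[OF e(1) p y(1) e(4) y(3) Sy_clique[OF e(1-3) y(1) e(4) y(2) e(5)]] .
  have lt: "l \<subseteq> \<theta>" using Sy_ln[OF e(2) l(1-3) y(2) e(5) y(3)] .
  then have "c \<in> \<theta>" using l by auto
  then show thesis using that[OF l(1,3,5,2) y(3) l(4) lt l(6,7) _ y(1,2)] by metis
qed

text \<open>The property spreads along collinearity. If \<open>p\<close> sees \<open>z\<close> in
  \<eta> and \<open>q\<close> is next to \<open>p\<close>, the symp through \<open>q\<close> and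
  \<open>z\<close> shares with \<eta> a line, on which \<open>q\<close> sees a point.\<close>

lemma near_symp:
  assumes e: "\<eta> \<in> Sy" and p: "p \<in> P"
  shows "\<exists>z\<in>\<eta>. col p z"
proof -
  let ?S = "{p \<in> P. \<exists>z\<in>\<eta>. col p z}"
  obtain x where x: "x \<in> \<eta>" using Sy_ne[OF e] by metis
  have "?S = P"
  proof (rule conn)
    show "?S \<subseteq> P" by auto
    show "x \<in> ?S" using x Sy_P[OF e x] by (auto intro: bexI[of _ x])
  next
    fix p q assume "p \<in> ?S" and q: "q \<in> P" "col q p"
    then obtain z where z: "p \<in> P" "z \<in> \<eta>" "col p z" by auto
    have "\<exists>z\<in>\<eta>. col q z"
    proof (cases "col q z")
      case False
      obtain \<tau> where t: "\<tau> \<in> Sy" "q \<in> \<tau>" "z \<in> \<tau>" "p \<in> \<tau>"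
        using Sy_exE[OF q(1) Sy_P[OF e z(2)] z(1) False] q z sy by metis
      show ?thesis
      proof (cases "\<tau> = \<eta>")
        case True
        then show ?thesis using t rf by metis
      next
        case False
        then show ?thesis using meet_hit[OF t(1) e False t(3) z(2) t(2)] by metis
      qed
    qed (use z in metis)
    then show "q \<in> ?S" using q by auto
  qed
  then show ?thesis using p by auto
qed

end

section \<open>Points with two neighbours in a symp\<close>

locale symps_share_line_rank2 = symps_share_line + symp_space_rank2
begin

definition two_nbrs :: "'a set \<Rightarrow> 'a \<Rightarrow> bool" where
  "two_nbrs \<xi> p \<longleftrightarrow> p \<in> P \<and> p \<notin> \<xi> \<and> (\<exists>a b. a \<in> \<xi> \<and> b \<in> \<xi> \<and> a \<noteq> b \<and> col p a \<and> col p b)"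

lemma two_nbrsI: "p \<in> P \<Longrightarrow> p \<notin> \<xi> \<Longrightarrow> a \<in> \<xi> \<Longrightarrow> b \<in> \<xi> \<Longrightarrow> a \<noteq> b \<Longrightarrow> col p a \<Longrightarrow> col p b \<Longrightarrow> two_nbrs \<xi> p"
  unfolding two_nbrs_def by metis

text \<open>If \<open>n\<close> sees \<open>a\<close> or \<open>b\<close>, that point and
  \<open>g\<close> are two neighbours. Otherwise the symp on \<open>n\<close> and \<open>b\<close>
  contains \<open>p\<close> and shares with \<xi> a line through \<open>b\<close>, which provides a
  neighbour \<open>v\<close>. If \<open>v\<close> were \<open>g\<close>, rank 2 would put
  \<open>g\<close> on the line \<open>ab\<close>, all of which \<open>p\<close> sees.\<close>

lemma two_nbrs_near:
  assumes X: "\<xi> \<in> Sy" and p: "p \<in> P" "p \<notin> \<xi>" "a \<in> \<xi>" "b \<in> \<xi>" "a \<noteq> b" "col p a" "col p b"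
    and g: "g \<in> \<xi>" "col g a" "\<not> col p g" and n: "n \<in> P" "n \<notin> \<xi>" "col n p" "col n g"
  shows "two_nbrs \<xi> n"
proof -
  have ag: "a \<noteq> g" "b \<noteq> g" using p g by metis+
  consider "col n a" | "col n b" | "\<not> col n a" "\<not> col n b" by metis
  then show ?thesis
  proof cases
    case 1
    then show ?thesis using two_nbrsI[OF n(1,2) p(3) g(1) ag(1) _ n(4)] by metis
  next
    case 2
    then show ?thesis using two_nbrsI[OF n(1,2) p(4) g(1) ag(2) _ n(4)] by metis
  next
    case 3
    obtain \<tau> where t: "\<tau> \<in> Sy" "n \<in> \<tau>" "b \<in> \<tau>" "p \<in> \<tau>"
      using Sy_exE[OF n(1) Sy_P[OF X p(4)] p(1) 3(2)] n p sy by metis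
    have tX: "\<tau> \<noteq> \<xi>" using t n by metis
    obtain l v d where v: "l \<in> Ln" "b \<in> l" "v \<in> l" "d \<in> l" "d \<noteq> b" "l \<subseteq> \<tau>" "l \<subseteq> \<xi>" "col n v" "v \<in> \<tau>" "v \<in> \<xi>"
      using meet_hit[OF t(1) X tX t(3) p(4) t(2)] by metis
    have "v \<noteq> g"
    proof
      assume "v = g"
      then have gb: "col g b" using ln_col[OF v(1,3,2)] by metis
      have cab: "col a b" using Sy_perp_clique[OF X p(1,2,3,4,6,7)] .
      obtain m where m: "m \<in> Ln" "a \<in> m" "b \<in> m" "m \<subseteq> \<xi>"
        using polar_line[OF Sy_polar[OF X] p(3,4,5) cab] .
      have "g \<in> m" using rank2_triangle[OF X m(1-3) p(5,3,4) g(1,2) gb] .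
      then have "col p g" using ln_all[OF m(1-3) p(5-7)] by metis
      then show False using g by metis
    qed
    then show ?thesis using two_nbrsI[OF n(1,2) v(10) g(1) _ v(8) n(4)] by metis
  qed
qed

text \<open>If \<open>q\<close> misses \<open>a\<close>, the symp on \<open>q\<close> and
  \<open>a\<close> shares with \<xi> a line on which \<open>q\<close> sees some \<open>g\<close>. By
  rank 2, \<open>p\<close> cannot see \<open>g\<close> without lying on that line. So
  \<open>two_nbrs_near\<close> applies with \<open>n = q\<close>.\<close>

lemma two_nbrs_step:
  assumes X: "\<xi> \<in> Sy" and p: "two_nbrs \<xi> p" and q: "q \<in> P" "q \<notin> \<xi>" "col q p"
  shows "two_nbrs \<xi> q"
proof -
  have main: "two_nbrs \<xi> q" if p: "p \<in> P" "p \<notin> \<xi>" "a \<in> \<xi>" "b \<in> \<xi>" "a \<noteq> b" "col p a" "col p b" and qa: "\<not> col q a" for a b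
  proof -
    obtain \<tau> where t: "\<tau> \<in> Sy" "q \<in> \<tau>" "a \<in> \<tau>" "p \<in> \<tau>"
      using Sy_exE[OF q(1) Sy_P[OF X p(3)] p(1) qa] q p sy by metis
    have tX: "\<tau> \<noteq> \<xi>" using t q by metis
    obtain l g d where g: "l \<in> Ln" "a \<in> l" "g \<in> l" "d \<in> l" "d \<noteq> a" "l \<subseteq> \<tau>" "l \<subseteq> \<xi>" "col q g" "g \<in> \<tau>" "g \<in> \<xi>"
      using meet_hit[OF t(1) X tX t(3) p(3) t(2)] by metis
    have ag: "a \<noteq> g" using g qa by metis
    have "\<not> col p g"
    proof
      assume c: "col p g"
      have "p \<in> l" using rank2_triangle[OF t(1) g(1-3) ag t(3) g(9) t(4) p(6) c] .
      then show False using g p by auto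
    qed
    then show ?thesis using two_nbrs_near[OF X p g(10) ln_col[OF g(1,3,2)] _ q g(8)] by metis
  qed
  obtain a b where a: "p \<in> P" "p \<notin> \<xi>" "a \<in> \<xi>" "b \<in> \<xi>" "a \<noteq> b" "col p a" "col p b" using p two_nbrs_def by metis
  show ?thesis
  proof (cases "col q a \<and> col q b")
    case True
    then show ?thesis using two_nbrsI[OF q(1,2) a(3-5)] by metis
  next
    case False
    then show ?thesis using main[OF a] main[OF a(1,2,4,3) a(5)[symmetric] a(7,6)] by metis
  qed
qed

text \<open>The property has to be carried along paths that avoid \<xi>: first to a point next to
  the neighbour \<open>z\<close> of \<open>q\<close>, then to \<open>q\<close>.\<close>

lemma two_nbrs_all:
  assumes X: "\<xi> \<in> Sy" and p: "two_nbrs \<xi> p" and q: "q \<in> P" "q \<notin> \<xi>"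
  shows "two_nbrs \<xi> q"
proof -
  obtain z where z: "z \<in> \<xi>" "col q z" using near_symp[OF X q(1)] by metis
  have zP: "z \<in> P" using Sy_P[OF X z(1)] .
  obtain a b where a: "p \<in> P" "p \<notin> \<xi>" "a \<in> \<xi>" "b \<in> \<xi>" "a \<noteq> b" "col p a" "col p b" using p two_nbrs_def by metis
  \<comment> \<open>Two different symps meet in a clique, so of two noncollinear common neighbours
    of \<open>c\<close> and \<open>d\<close> at least one is off \<xi>.\<close>
  have out: "\<exists>n. n \<in> \<tau> \<and> n \<notin> \<xi> \<and> col n c \<and> col n d"
    if h: "\<tau> \<in> Sy" "\<tau> \<noteq> \<xi>" "c \<in> \<tau>" "d \<in> \<tau>" "\<not> col c d" for \<tau> c d
  proof -
    obtain r s where "r \<in> \<tau>" "s \<in> \<tau>" "col r c" "col r d" "col s c" "col s d" "\<not> col r s"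
      using Sy_noncol_pair[OF h(1,3-5)] .
    then show ?thesis using Sy_clique[OF h(1) X h(2)] by metis
  qed
  obtain p' where p': "two_nbrs \<xi> p'" "col p' z"
  proof (cases "col p z")
    case False
    have cab: "col a b" using Sy_perp_clique[OF X a(1,2,3,4,6,7)] .
    obtain l c where l: "l \<in> Ln" "a \<in> l" "b \<in> l" "l \<subseteq> \<xi>" "c \<in> l" "col z c" "c \<in> \<xi>"
      using Sy_hit[OF X z(1) a(3-5) cab] .
    have collinearity: "col p e" if "e \<in> l" for e using ln_all[OF l(1-3) a(5-7) that] .
    obtain e where e: "e \<in> l" "e \<noteq> c" using ln_thick[OF l(1)] by metis
    have eX: "e \<in> \<xi>" using e l by auto
    obtain \<tau> where t: "\<tau> \<in> Sy" "p \<in> \<tau>" "z \<in> \<tau>" "c \<in> \<tau>"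
      using Sy_exE[OF a(1) zP Sy_P[OF X l(7)] False] collinearity[OF l(5)] l(6) sy by metis
    have tX: "\<tau> \<noteq> \<xi>" using t a by metis
    obtain n where n: "n \<in> \<tau>" "n \<notin> \<xi>" "col n p" "col n z" using out[OF t(1) tX t(2,3) False] by metis
    have "two_nbrs \<xi> n"
      using two_nbrs_near[OF X a(1,2) l(7) eX e(2)[symmetric] collinearity[OF l(5)] collinearity[OF e(1)] z(1) l(6) False Sy_P[OF t(1) n(1)] n(2,3,4)] .
    then show thesis using that n by metis
  qed (use that p in metis)
  show ?thesis
  proof (cases "col q p'")
    case True
    then show ?thesis using two_nbrs_step[OF X p'(1) q] by metis
  next
    case False
    have p'P: "p' \<in> P" "p' \<notin> \<xi>" using p' two_nbrs_def by metis+
    obtain \<tau> where t: "\<tau> \<in> Sy" "q \<in> \<tau>" "p' \<in> \<tau>" "z \<in> \<tau>"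
      using Sy_exE[OF q(1) p'P(1) zP False] z p' sy by metis
    have tX: "\<tau> \<noteq> \<xi>" using t q by metis
    obtain n where n: "n \<in> \<tau>" "n \<notin> \<xi>" "col n q" "col n p'" using out[OF t(1) tX t(2,3) False] by metis
    have "two_nbrs \<xi> n" using two_nbrs_step[OF X p'(1) Sy_P[OF t(1) n(1)] n(2,4)] .
    then show ?thesis using two_nbrs_step[OF X _ q] n sy by metis
  qed
qed

text \<open>Between meeting symps the roles can be exchanged: a suitable \<open>w\<close> in \<eta>
  has besides \<open>x\<close> a second neighbour \<open>t\<close> in \<xi>, and \<open>t\<close>
  lies off \<eta> with the neighbours \<open>x\<close> and \<open>w\<close> there. Arbitrary symps
  are linked by a third one through \<open>near_symp\<close>. Hence the property holds for all symps
  and outside points or for none.\<close>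

lemma two_nbrs_everywhere:
  assumes X: "\<xi> \<in> Sy" "two_nbrs \<xi> p" and e: "\<eta> \<in> Sy" "q \<in> P" "q \<notin> \<eta>"
  shows "two_nbrs \<eta> q"
proof -
  have move: "\<exists>t. two_nbrs \<eta> t" if X: "\<xi> \<in> Sy" "two_nbrs \<xi> p" and e: "\<eta> \<in> Sy" "x \<in> \<xi>" "x \<in> \<eta>" for \<xi> p \<eta> x
  proof (cases "\<xi> = \<eta>")
    case False
    obtain y where y: "y \<in> \<xi>" "y \<in> \<eta>" "y \<noteq> x" using meet0[OF X(1) e(1) False e(2,3)] by metis
    have xy: "col x y" using Sy_clique[OF X(1) e(1) False e(2) y(1) e(3) y(2)] .
    obtain w where w: "w \<in> \<eta>" "col w x" "\<not> col w y"
      using polar_sep[OF Sy_polar[OF e(1)] e(3) y(2) y(3)[symmetric]] by metis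
    have wX: "w \<notin> \<xi>" using Sy_clique[OF X(1) e(1) False _ y(1) w(1) y(2)] w by metis
    have wP: "w \<in> P" using Sy_P[OF e(1) w(1)] .
    obtain a b where "a \<in> \<xi>" "b \<in> \<xi>" "a \<noteq> b" "col w a" "col w b"
      using two_nbrs_all[OF X wP wX] two_nbrs_def by metis
    then obtain t where t: "t \<in> \<xi>" "t \<noteq> x" "col w t" by metis
    have tx: "col t x" using Sy_perp_clique[OF X(1) wP wX t(1) e(2) t(3) w(2)] .
    have te: "t \<notin> \<eta>"
    proof
      assume te: "t \<in> \<eta>"
      have ty: "col y t" using Sy_clique[OF X(1) e(1) False y(1) t(1) y(2) te] .
      obtain l where l: "l \<in> Ln" "t \<in> l" "x \<in> l" "l \<subseteq> \<xi>"
        using polar_line[OF Sy_polar[OF X(1)] t(1) e(2) t(2) tx] .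
      have "y \<in> l" using rank2_triangle[OF X(1) l(1-3) t(2,1) e(2) y(1) ty] xy sy by metis
      then have "col w y" using ln_all[OF l(1-3) t(2,3) w(2)] by metis
      then show False using w by metis
    qed
    have "x \<noteq> w" using w xy by metis
    then show ?thesis using two_nbrsI[OF Sy_P[OF X(1) t(1)] te e(3) w(1) _ tx sy[OF t(3)]] by metis
  qed (use that in metis)
  obtain z where z: "z \<in> \<xi>" using Sy_ne[OF X(1)] by metis
  have zP: "z \<in> P" using Sy_P[OF X(1) z] .
  obtain w where w: "w \<in> \<eta>" "col z w" using near_symp[OF e(1) zP] by metis
  obtain \<tau> where t: "\<tau> \<in> Sy" "z \<in> \<tau>" "w \<in> \<tau>" using pair_Sy[OF zP Sy_P[OF e(1) w(1)] w(2)] .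
  obtain t1 where "two_nbrs \<tau> t1" using move[OF X t(1) z t(2)] by metis
  then obtain t2 where "two_nbrs \<eta> t2" using move[OF t(1) _ e(1) t(3) w(1)] by metis
  then show ?thesis using two_nbrs_all[OF e(1) _ e(2,3)] by metis
qed

end

section \<open>The residue at a point\<close>

context symps_share_line
begin

definition high_rank :: "'a set \<Rightarrow> bool" where
  "high_rank \<zeta> \<longleftrightarrow> \<zeta> \<in> Sy \<and> \<not> rank2 \<zeta>"

text \<open>The residue at \<open>x\<close>: its points are the lines through \<open>x\<close> in symps of rank at least 3, its lines
  the planar pencils of such lines, given by a line \<open>l\<close> of the plane missing \<open>x\<close>.\<close>

definition residue_col :: "'a \<Rightarrow> 'a set \<Rightarrow> 'a set \<Rightarrow> bool" where
  "residue_col x L M \<longleftrightarrow> L = M \<or> L \<in> Ln \<and> x \<in> L \<and> M \<in> Ln \<and> x \<in> M \<and> (\<forall>a\<in>L. \<forall>b\<in>M. col a b)"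

definition residue_of :: "'a \<Rightarrow> 'a set \<Rightarrow> 'a set set" where
  "residue_of x Q = {L \<in> Ln. x \<in> L \<and> L \<subseteq> Q}"

definition res_line :: "'a \<Rightarrow> 'a set \<Rightarrow> 'a set set" where
  "res_line x l = {L \<in> Ln. x \<in> L \<and> (\<exists>z\<in>l. z \<in> L)}"

definition residue_symps :: "'a \<Rightarrow> 'a set set set" where
  "residue_symps x = {residue_of x \<zeta> | \<zeta>. high_rank \<zeta> \<and> x \<in> \<zeta>}"

definition residue_lines :: "'a \<Rightarrow> 'a set set set" where
  "residue_lines x = {res_line x l | l. l \<in> Ln \<and> x \<notin> l \<and> (\<forall>z\<in>l. col x z) \<and> (\<exists>\<zeta>. high_rank \<zeta> \<and> x \<in> \<zeta> \<and> l \<subseteq> \<zeta>)}"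

lemma residue_ofI: "L \<in> Ln \<Longrightarrow> x \<in> L \<Longrightarrow> L \<subseteq> Q \<Longrightarrow> L \<in> residue_of x Q"
  and residue_ofD: "L \<in> residue_of x Q \<Longrightarrow> L \<in> Ln" "L \<in> residue_of x Q \<Longrightarrow> x \<in> L" "L \<in> residue_of x Q \<Longrightarrow> L \<subseteq> Q"
  unfolding residue_of_def by auto

lemma res_lineI: "L \<in> Ln \<Longrightarrow> x \<in> L \<Longrightarrow> z \<in> l \<Longrightarrow> z \<in> L \<Longrightarrow> L \<in> res_line x l"
  unfolding res_line_def by auto

lemma res_lineE:
  assumes "L \<in> res_line x l"
  obtains z where "L \<in> Ln" "x \<in> L" "z \<in> l" "z \<in> L"
  using assms unfolding res_line_def by auto

lemma residue_linesE:
  assumes "A \<in> residue_lines x"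
  obtains l \<zeta> where "A = res_line x l" "l \<in> Ln" "x \<notin> l" "\<And>z. z \<in> l \<Longrightarrow> col x z" "high_rank \<zeta>" "x \<in> \<zeta>" "l \<subseteq> \<zeta>"
  using assms unfolding residue_lines_def by auto

lemma residue_linesI: "l \<in> Ln \<Longrightarrow> x \<notin> l \<Longrightarrow> (\<And>z. z \<in> l \<Longrightarrow> col x z) \<Longrightarrow> high_rank \<zeta> \<Longrightarrow> x \<in> \<zeta> \<Longrightarrow> l \<subseteq> \<zeta> \<Longrightarrow> res_line x l \<in> residue_lines x"
  unfolding residue_lines_def by auto

lemma high_rankD: "high_rank \<zeta> \<Longrightarrow> \<zeta> \<in> Sy" "high_rank \<zeta> \<Longrightarrow> \<not> rank2 \<zeta>"
  unfolding high_rank_def by auto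

lemma residue_col_imp: "residue_col x L M \<Longrightarrow> L \<in> Ln \<Longrightarrow> a \<in> L \<Longrightarrow> b \<in> M \<Longrightarrow> col a b"
  using ln_col[of L a b] unfolding residue_col_def by auto

lemma residue_colI:
  assumes L: "L \<in> Ln" "x \<in> L" "a \<in> L" "a \<noteq> x" and M: "M \<in> Ln" "x \<in> M" "b \<in> M" "b \<noteq> x" and ab: "col a b"
  shows "residue_col x L M"
proof -
  have "col c d" if c: "c \<in> L" and d: "d \<in> M" for c d
  proof -
    have xb: "col b x" using ln_col[OF M(1,3,2)] .
    have bc: "col b c" using ln_all[OF L(1,3,2,4) sy[OF ab] xb c] .
    have "col c x" using ln_col[OF L(1) c L(2)] .
    then show ?thesis using ln_all[OF M(1,3,2,4) sy[OF bc] _ d] by metis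
  qed
  then show ?thesis unfolding residue_col_def using L M by auto
qed

lemma ln_other: "L \<in> Ln \<Longrightarrow> \<exists>a\<in>L. a \<noteq> x"
  using ln_thick by metis

lemma line_in:
  assumes "\<zeta> \<in> Sy" "x \<in> \<zeta>" "a \<in> \<zeta>" "a \<noteq> x" "col a x"
  obtains L where "L \<in> residue_of x \<zeta>" "a \<in> L"
proof -
  obtain l where "l \<in> Ln" "a \<in> l" "x \<in> l" "l \<subseteq> \<zeta>"
    using polar_line[OF Sy_polar[OF assms(1)] assms(3,2,4,5)] .
  then show thesis using that residue_ofI by metis
qed

lemma residue_lines_col:
  assumes "A \<in> residue_lines x" "L \<in> A" "M \<in> A"
  shows "residue_col x L M"
proof -
  obtain l \<zeta> where l: "A = res_line x l" "l \<in> Ln" "x \<notin> l" using residue_linesE[OF assms(1)] by metis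
  obtain z where z: "L \<in> Ln" "x \<in> L" "z \<in> l" "z \<in> L" using res_lineE assms l by metis
  obtain w where w: "M \<in> Ln" "x \<in> M" "w \<in> l" "w \<in> M" using res_lineE assms l by metis
  show ?thesis using residue_colI[OF z(1,2,4) _ w(1,2,4)] ln_col[OF l(2) z(3) w(3)] l z w by metis
qed

lemma residue_pl: "collinearity (residue_col x) (residue_lines x)"
proof
  show "residue_col x L L" for L unfolding residue_col_def by simp
  show "residue_col x M L" if "residue_col x L M" for L M using that sy unfolding residue_col_def by metis
  show "residue_col x L M" if "A \<in> residue_lines x" "L \<in> A" "M \<in> A" for A L M using residue_lines_col that by metis
next
  fix A L M assume A: "A \<in> residue_lines x"
  obtain l \<zeta> where l: "A = res_line x l" "l \<in> Ln" "x \<notin> l" "\<And>z. z \<in> l \<Longrightarrow> col x z" "high_rank \<zeta>" "x \<in> \<zeta>" "l \<subseteq> \<zeta>"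
    using residue_linesE[OF A] by metis
  have inj: "z = w" if "N \<in> Ln" "x \<in> N" "z \<in> l" "w \<in> l" "z \<in> N" "w \<in> N" for N z w
    using ln_uniq[OF that(1) l(2) that(5,6,3,4)] that l by metis
  obtain a where a: "\<And>w. L \<in> Ln \<Longrightarrow> x \<in> L \<Longrightarrow> w \<in> l \<Longrightarrow> w \<in> L \<Longrightarrow> w = a" using inj by metis
  obtain b where b: "\<And>w. M \<in> Ln \<Longrightarrow> x \<in> M \<Longrightarrow> w \<in> l \<Longrightarrow> w \<in> M \<Longrightarrow> w = b" using inj by metis
  obtain c where c: "c \<in> l" "c \<noteq> a" "c \<noteq> b" using ln_thick[OF l(2)] by metis
  have cx: "c \<noteq> x" using c l by metis
  have cz: "c \<in> \<zeta>" using c l by auto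
  obtain C where C: "C \<in> residue_of x \<zeta>" "c \<in> C"
    using line_in[OF high_rankD(1)[OF l(5)] l(6) cz cx sy[OF l(4)[OF c(1)]]] .
  have "C \<in> A" unfolding l(1) using res_lineI[OF residue_ofD(1,2)[OF C(1)] c(1) C(2)] .
  moreover have "C \<noteq> L" using a[OF _ _ c(1)] residue_ofD(1,2)[OF C(1)] C(2) c by metis
  moreover have "C \<noteq> M" using b[OF _ _ c(1)] residue_ofD(1,2)[OF C(1)] C(2) c by metis
  ultimately show "\<exists>C\<in>A. C \<noteq> L \<and> C \<noteq> M" by metis
next
  fix A L M N K assume A: "A \<in> residue_lines x" "L \<in> A" "M \<in> A" "L \<noteq> M" and N: "residue_col x N L" "residue_col x N M" and K: "K \<in> A"
  obtain l \<zeta> where l: "A = res_line x l" "l \<in> Ln" "x \<notin> l" using residue_linesE[OF A(1)] by metis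
  obtain z where z: "L \<in> Ln" "x \<in> L" "z \<in> l" "z \<in> L" using res_lineE A l by metis
  obtain w where w: "M \<in> Ln" "x \<in> M" "w \<in> l" "w \<in> M" using res_lineE A l by metis
  obtain v where v: "K \<in> Ln" "x \<in> K" "v \<in> l" "v \<in> K" using res_lineE K l by metis
  have zw: "z \<noteq> w" using ln_uniq[OF z(1) w(1) z(4) z(2) _ w(2)] w z A l by metis
  show "residue_col x N K"
  proof (cases "N = L \<or> N = M")
    case True
    then show ?thesis using residue_lines_col[OF A(1)] A K by metis
  next
    case False
    then have Nx: "N \<in> Ln" "x \<in> N" using N unfolding residue_col_def by auto
    obtain n where n: "n \<in> N" "n \<noteq> x" using ln_other[OF Nx(1)] by metis
    have "col n v" using ln_all[OF l(2) z(3) w(3) zw residue_col_imp[OF N(1) Nx(1) n(1) z(4)] residue_col_imp[OF N(2) Nx(1) n(1) w(4)] v(3)] .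
    then show ?thesis using residue_colI[OF Nx n v(1,2,4)] v l by metis
  qed
qed

text \<open>Each axiom is tested on points other than \<open>x\<close> of the lines involved. By
  \<open>residue_colI\<close>, one such pair of collinear points already makes two lines through
  \<open>x\<close> collinear. Nondegeneracy is \<open>polar_sep\<close> at \<open>x\<close>.\<close>

lemma residue_polar:
  assumes Z: "high_rank \<zeta>" and x: "x \<in> \<zeta>"
  shows "collinearity.polar (residue_col x) (residue_lines x) (residue_of x \<zeta>)"
proof -
  interpret R: collinearity "residue_col x" "residue_lines x" by (rule residue_pl)
  have ZS: "\<zeta> \<in> Sy" using high_rankD Z by metis
  show ?thesis
    unfolding R.polar_def
  proof (intro conjI ballI impI)
    fix L M assume L: "L \<in> residue_of x \<zeta>" and M: "M \<in> residue_of x \<zeta>" and LM: "L \<noteq> M \<and> residue_col x L M"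
    note L' = residue_ofD[OF L] and M' = residue_ofD[OF M]
    obtain a where a: "a \<in> L" "a \<noteq> x" using ln_other[OF L'(1)] by metis
    obtain b where b: "b \<in> M" "b \<noteq> x" using ln_other[OF M'(1)] by metis
    have ab: "col a b" using residue_col_imp[OF _ L'(1) a(1) b(1)] LM by metis
    have ne: "a \<noteq> b" using ln_uniq[OF L'(1) M'(1) a(1) L'(2) _ M'(2) a(2)] b LM by metis
    have abz: "a \<in> \<zeta>" "b \<in> \<zeta>" using a b L'(3) M'(3) by auto
    obtain l where l: "l \<in> Ln" "a \<in> l" "b \<in> l" "l \<subseteq> \<zeta>"
      using polar_line[OF Sy_polar[OF ZS] abz ne ab] .
    have xl: "x \<notin> l" using ln_uniq[OF L'(1) l(1) a(1) L'(2) l(2) _ a(2)] ln_uniq[OF M'(1) l(1) b(1) M'(2) l(3) _ b(2)] LM by metis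
    have xz: "col x z" if "z \<in> l" for z
      using ln_all[OF l(1-3) ne ln_col[OF L'(1,2) a(1)] ln_col[OF M'(1,2) b(1)] that] .
    show "\<exists>A\<in>residue_lines x. L \<in> A \<and> M \<in> A"
      using residue_linesI[OF l(1) xl xz Z x l(4)] res_lineI[OF L'(1,2) l(2) a(1)] res_lineI[OF M'(1,2) l(3) b(1)] by metis
  next
    fix A L M assume A: "A \<in> residue_lines x" "L \<in> A \<inter> residue_of x \<zeta>" "M \<in> A \<inter> residue_of x \<zeta>" "L \<noteq> M"
    obtain l where l: "A = res_line x l" "l \<in> Ln" "x \<notin> l" using residue_linesE[OF A(1)] by metis
    have LM: "L \<in> A" "L \<subseteq> \<zeta>" "M \<in> A" "M \<subseteq> \<zeta>" using A(2,3) by (auto dest: residue_ofD(3))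
    obtain z where z: "L \<in> Ln" "x \<in> L" "z \<in> l" "z \<in> L" using res_lineE LM l by metis
    obtain w where w: "M \<in> Ln" "x \<in> M" "w \<in> l" "w \<in> M" using res_lineE LM l by metis
    have zw: "z \<noteq> w" using ln_uniq[OF z(1) w(1) z(4) z(2) _ w(2)] w z A l by metis
    have zwz: "z \<in> \<zeta>" "w \<in> \<zeta>" using z w LM by auto
    have lz: "l \<subseteq> \<zeta>" using Sy_ln[OF ZS l(2) z(3) w(3) zwz zw] .
    show "A \<subseteq> residue_of x \<zeta>"
    proof
      fix K assume "K \<in> A"
      then obtain v where v: "K \<in> Ln" "x \<in> K" "v \<in> l" "v \<in> K" using res_lineE l by metis
      have "v \<in> \<zeta>" "v \<noteq> x" using v lz l by auto
      then have "K \<subseteq> \<zeta>" using Sy_ln[OF ZS v(1,4,2) _ x] by metis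
      then show "K \<in> residue_of x \<zeta>" using residue_ofI v by metis
    qed
  next
    fix N A assume N: "N \<in> residue_of x \<zeta>" and A: "A \<in> residue_lines x" "A \<subseteq> residue_of x \<zeta>"
    obtain l \<theta> where l: "A = res_line x l" "l \<in> Ln" "x \<notin> l" "\<And>z. z \<in> l \<Longrightarrow> col x z" "high_rank \<theta>" "x \<in> \<theta>" "l \<subseteq> \<theta>"
      using residue_linesE[OF A(1)] by metis
    have ex: "\<exists>L. L \<in> A \<and> L \<in> Ln \<and> x \<in> L \<and> z \<in> L \<and> z \<in> \<zeta>" if z: "z \<in> l" for z
    proof -
      have zx: "z \<in> \<theta>" "z \<noteq> x" using z l by auto
      obtain L where L: "L \<in> residue_of x \<theta>" "z \<in> L" using line_in[OF high_rankD(1)[OF l(5)] l(6) zx sy[OF l(4)[OF z]]] .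
      have LA: "L \<in> A" unfolding l(1) using res_lineI[OF residue_ofD(1,2)[OF L(1)] z L(2)] .
      then have "L \<subseteq> \<zeta>" using A(2) residue_ofD(3) by (metis subsetD)
      then have "z \<in> \<zeta>" using L by auto
      then show ?thesis using LA L residue_ofD(1,2) by metis
    qed
    have lz: "l \<subseteq> \<zeta>" using ex by auto
    obtain n where n: "n \<in> N" "n \<noteq> x" using ln_other residue_ofD(1)[OF N] by metis
    have nz: "n \<in> \<zeta>" using n residue_ofD(3)[OF N] by auto
    obtain z where z: "z \<in> l" "col n z" using polar_one[OF Sy_polar[OF ZS] nz l(2) lz] by metis
    obtain L where L: "L \<in> A" "L \<in> Ln" "x \<in> L" "z \<in> L" using ex[OF z(1)] by metis
    have "residue_col x N L" using residue_colI[OF residue_ofD(1,2)[OF N] n L(2-4) _ z(2)] z l by metis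
    then show "\<exists>L\<in>A. residue_col x N L" using L by metis
  next
    fix N assume N: "N \<in> residue_of x \<zeta>"
    obtain n where n: "n \<in> N" "n \<noteq> x" using ln_other residue_ofD(1)[OF N] by metis
    have nz: "n \<in> \<zeta>" using n residue_ofD(3)[OF N] by auto
    obtain q where q: "q \<in> \<zeta>" "col q x" "\<not> col q n" using polar_sep[OF Sy_polar[OF ZS] x nz n(2)[symmetric]] by metis
    have qx: "q \<noteq> x" using q ln_col[OF residue_ofD(1)[OF N] residue_ofD(2)[OF N] n(1)] by metis
    obtain M where M: "M \<in> residue_of x \<zeta>" "q \<in> M" using line_in[OF ZS x q(1) qx q(2)] .
    have "\<not> residue_col x N M" using residue_col_imp[OF _ residue_ofD(1)[OF N] n(1) M(2)] q sy by metis
    then show "\<exists>M\<in>residue_of x \<zeta>. \<not> residue_col x N M" using M by metis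
  qed
qed

text \<open>The line through \<open>x\<close> given by \<open>meet0\<close> is the common point
  required by \<open>meet\<close>. The restriction to \<open>high_rank\<close> ensures that the
  residue of a symp contains lines (\<open>plane_ex\<close>). It is preserved: a symp spanned by two
  noncollinear points of the residue with a common neighbour contains a plane.\<close>

lemma residue_sp_m: "meeting_symps (residue_col x) (residue_lines x) (\<Union>(residue_symps x)) (residue_symps x)"
proof -
  interpret R: collinearity "residue_col x" "residue_lines x" by (rule residue_pl)
  have RSE: "\<exists>\<zeta>. A = residue_of x \<zeta> \<and> high_rank \<zeta> \<and> x \<in> \<zeta> \<and> \<zeta> \<in> Sy" if "A \<in> residue_symps x" for A
    using that high_rankD unfolding residue_symps_def by auto
  have RPD: "N \<in> Ln" "x \<in> N" if "N \<in> \<Union>(residue_symps x)" for N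
    using that unfolding residue_symps_def by (auto dest: residue_ofD)
  show ?thesis
  proof
    fix A assume A: "A \<in> residue_symps x"
    show "A \<subseteq> \<Union>(residue_symps x)" using A by auto
    obtain \<zeta> where z: "A = residue_of x \<zeta>" "high_rank \<zeta>" "x \<in> \<zeta>" "\<zeta> \<in> Sy" using RSE[OF A] by metis
    show "R.polar A" unfolding z(1) using residue_polar[OF z(2,3)] .
    show "\<exists>U\<in>A. U \<noteq> L \<and> residue_col x U L" if L: "L \<in> A" for L
    proof -
      have L': "L \<in> Ln" "x \<in> L" "L \<subseteq> \<zeta>" using L unfolding z(1) by (auto dest: residue_ofD)
      obtain j where j: "j \<in> \<zeta>" "j \<notin> L" "\<forall>c\<in>L. col j c" using plane_ex[OF z(4) high_rankD(2)[OF z(2)] L'(1,3)] by metis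
      have jx: "j \<noteq> x" "col j x" using j L' by auto
      obtain J where J: "J \<in> residue_of x \<zeta>" "j \<in> J" using line_in[OF z(4,3) j(1) jx] .
      obtain a where a: "a \<in> L" "a \<noteq> x" using ln_other[OF L'(1)] by metis
      have "residue_col x J L" using residue_colI[OF residue_ofD(1,2)[OF J(1)] J(2) jx(1) L'(1,2) a] j a by metis
      then show ?thesis using J j z by metis
    qed
    show "N \<in> A" if LM: "L \<in> A" "M \<in> A" "\<not> residue_col x L M" and N: "N \<in> \<Union>(residue_symps x)" "residue_col x N L" "residue_col x N M" for L M N
    proof -
      note L = residue_ofD[OF LM(1)[unfolded z(1)]] and M = residue_ofD[OF LM(2)[unfolded z(1)]] and N' = RPD[OF N(1)]
      obtain a where a: "a \<in> L" "a \<noteq> x" using ln_other[OF L(1)] by metis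
      obtain b where b: "b \<in> M" "b \<noteq> x" using ln_other[OF M(1)] by metis
      obtain n where n: "n \<in> N" "n \<noteq> x" using ln_other[OF N'(1)] by metis
      have ab: "\<not> col a b" using residue_colI[OF L(1,2) a M(1,2) b] LM by metis
      have abz: "a \<in> \<zeta>" "b \<in> \<zeta>" using a b L M by auto
      have "n \<in> \<zeta>"
        using Sy_conv[OF z(4) abz ab Ln_P[OF N'(1) n(1)] residue_col_imp[OF N(2) N'(1) n(1) a(1)] residue_col_imp[OF N(3) N'(1) n(1) b(1)]] .
      then have "N \<subseteq> \<zeta>" using Sy_ln[OF z(4) N'(1) n(1) N'(2) _ z(3) n(2)] by metis
      then show ?thesis unfolding z(1) using residue_ofI N' by metis
    qed
    show "\<exists>z. z \<in> A \<and> z \<in> B" if B: "B \<in> residue_symps x" for B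
    proof -
      obtain \<theta> where t: "B = residue_of x \<theta>" "high_rank \<theta>" "x \<in> \<theta>" "\<theta> \<in> Sy" using RSE[OF B] by metis
      show ?thesis
      proof (cases "\<zeta> = \<theta>")
        case True
        obtain u where u: "u \<in> \<zeta>" "u \<noteq> x" "col u x" using Sy_line[OF z(4,3)] by metis
        then show ?thesis using line_in[OF z(4,3) u] z t True by metis
      next
        case False
        obtain l where l: "l \<in> Ln" "x \<in> l" "l \<subseteq> \<zeta>" "l \<subseteq> \<theta>" using meet_hit[OF z(4) t(4) False z(3) t(3) z(3)] by metis
        then show ?thesis using z t residue_ofI by metis
      qed
    qed
  next
    fix L M N assume P: "L \<in> \<Union>(residue_symps x)" "M \<in> \<Union>(residue_symps x)" "N \<in> \<Union>(residue_symps x)" and LM: "\<not> residue_col x L M" and N: "residue_col x N L" "residue_col x N M"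
    note L' = RPD[OF P(1)] and M' = RPD[OF P(2)] and N' = RPD[OF P(3)]
    obtain a where a: "a \<in> L" "a \<noteq> x" using ln_other[OF L'(1)] by metis
    obtain b where b: "b \<in> M" "b \<noteq> x" using ln_other[OF M'(1)] by metis
    obtain n where n: "n \<in> N" "n \<noteq> x" using ln_other[OF N'(1)] by metis
    have ab: "\<not> col a b" using residue_colI[OF L' a M' b] LM by metis
    have na: "col n a" "col n b" using residue_col_imp[OF N(1) N'(1) n(1) a(1)] residue_col_imp[OF N(2) N'(1) n(1) b(1)] .
    obtain \<eta> where e: "\<eta> \<in> Sy" "a \<in> \<eta>" "b \<in> \<eta>" "x \<in> \<eta>"
      using Sy_exE[OF Ln_P[OF L'(1) a(1)] Ln_P[OF M'(1) b(1)] Ln_P[OF L'] ab ln_col[OF L'(1,2) a(1)] ln_col[OF M'(1,2) b(1)]] .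
    have ne: "n \<in> \<eta>" using Sy_conv[OF e(1-3) ab Ln_P[OF N'(1) n(1)] na] .
    have "\<not> rank2 \<eta>"
    proof
      assume r: "rank2 \<eta>"
      have "n \<in> L" using rank2D[OF r e(1) L'(1) a(1) L'(2) a(2) e(2,4) ne na(1) ln_col[OF N'(1) n(1) N'(2)]] .
      then have "N = L" using ln_uniq[OF N'(1) L'(1) n(1) N'(2) _ L'(2) n(2)] by metis
      then show False using LM N by metis
    qed
    then have be: "high_rank \<eta>" unfolding high_rank_def using e by metis
    have "L \<in> residue_of x \<eta>" "M \<in> residue_of x \<eta>"
      using residue_ofI[OF L'] Sy_ln[OF e(1) L'(1) a(1) L'(2) e(2,4) a(2)] residue_ofI[OF M'] Sy_ln[OF e(1) M'(1) b(1) M'(2) e(3,4) b(2)] by metis+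
    then show "\<exists>A\<in>residue_symps x. L \<in> A \<and> M \<in> A" using be e unfolding residue_symps_def by auto
  next
    show "\<exists>A\<in>residue_symps x. L \<in> A" if "L \<in> \<Union>(residue_symps x)" for L using that by auto
  next
    fix A assume A: "A \<in> residue_lines x"
    obtain l \<zeta> where l: "A = res_line x l" "l \<in> Ln" "x \<notin> l" "\<And>z. z \<in> l \<Longrightarrow> col x z" "high_rank \<zeta>" "x \<in> \<zeta>" "l \<subseteq> \<zeta>"
      using residue_linesE[OF A(1)] by metis
    have "A \<subseteq> residue_of x \<zeta>"
    proof
      fix K assume "K \<in> A"
      then obtain v where v: "K \<in> Ln" "x \<in> K" "v \<in> l" "v \<in> K" using res_lineE l by metis
      have "v \<in> \<zeta>" "v \<noteq> x" using v l by auto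
      then have "K \<subseteq> \<zeta>" using Sy_ln[OF high_rankD(1)[OF l(5)] v(1,4,2) _ l(6)] by metis
      then show "K \<in> residue_of x \<zeta>" using residue_ofI v by metis
    qed
    then show "\<exists>B\<in>residue_symps x. A \<subseteq> B" using l unfolding residue_symps_def by auto
  qed
qed

text \<open>\<open>not_singleton\<close> in the residue, restated for points. That the second
  neighbour is another line through \<open>x\<close> becomes the condition that \<open>v\<close> is
  off the line \<open>ux\<close>.\<close>

lemma residue_not_singleton:
  assumes z: "high_rank \<zeta>" "x \<in> \<zeta>" and t: "high_rank \<tau>" "x \<in> \<tau>" "t \<in> \<tau>" "t \<notin> \<zeta>" "col t x"
    and u: "u \<in> \<zeta>" "u \<noteq> x" "col u x" "col u t"
  shows "\<exists>v\<in>\<zeta>. col v x \<and> col v t \<and> (\<forall>l\<in>Ln. x \<in> l \<and> u \<in> l \<longrightarrow> v \<notin> l)"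
proof -
  interpret R: meeting_symps "residue_col x" "residue_lines x" "\<Union>(residue_symps x)" "residue_symps x" by (rule residue_sp_m)
  have tx: "t \<noteq> x" using t z by metis
  obtain T where T: "T \<in> residue_of x \<tau>" "t \<in> T" using line_in[OF high_rankD(1)[OF t(1)] t(2,3) tx t(5)] .
  obtain U where U: "U \<in> residue_of x \<zeta>" "u \<in> U" using line_in[OF high_rankD(1)[OF z(1)] z(2) u(1-3)] .
  have TP: "T \<in> \<Union>(residue_symps x)" using T t unfolding residue_symps_def by auto
  have Tz: "T \<notin> residue_of x \<zeta>" using T t residue_ofD(3) by (metis subsetD)
  have zS: "residue_of x \<zeta> \<in> residue_symps x" using z unfolding residue_symps_def by auto
  have TU: "residue_col x T U" using residue_colI[OF residue_ofD(1,2)[OF T(1)] T(2) tx residue_ofD(1,2)[OF U(1)] U(2) u(2)] u sy by metis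
  obtain V where V: "V \<in> residue_of x \<zeta>" "V \<noteq> U" "residue_col x T V" using R.not_singleton[OF TP Tz zS U(1) TU] by metis
  obtain v where v: "v \<in> V" "v \<noteq> x" using ln_other[OF residue_ofD(1)[OF V(1)]] by metis
  have "l = U" if "l \<in> Ln" "x \<in> l" "u \<in> l" for l
    using ln_uniq[OF that(1) residue_ofD(1)[OF U(1)] that(2,3) residue_ofD(2)[OF U(1)] U(2)] u by metis
  moreover have "v \<notin> U" using ln_uniq[OF residue_ofD(1)[OF U(1)] residue_ofD(1)[OF V(1)] _ residue_ofD(2)[OF U(1)] v(1) residue_ofD(2)[OF V(1)] v(2)] V by metis
  moreover have "v \<in> \<zeta>" using v residue_ofD(3)[OF V(1)] by auto
  moreover have "col v x" using ln_col[OF residue_ofD(1)[OF V(1)] v(1) residue_ofD(2)[OF V(1)]] .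
  moreover have "col v t" using residue_col_imp[OF V(3) residue_ofD(1)[OF T(1)] T(2) v(1)] sy by metis
  ultimately show ?thesis by metis
qed

end

section \<open>Symps of rank 2 meeting symps of higher rank\<close>

context symps_share_line
begin

lemma line_through:
  assumes "\<eta> \<in> Sy" "a \<in> \<eta>" "b \<in> \<eta>" "a \<noteq> b" "col a b"
  obtains l where "l \<in> Ln" "a \<in> l" "b \<in> l" "l \<subseteq> \<eta>"
  using polar_line[OF Sy_polar[OF assms(1)] assms(2-5)] .

lemma perp_noncol:
  assumes Z: "high_rank \<zeta>" and ab: "a \<in> \<zeta>" "b \<in> \<zeta>" "a \<noteq> b" "col a b" and l: "l \<in> Ln" "a \<in> l" "b \<in> l"
  obtains e f where "e \<in> \<zeta>" "f \<in> \<zeta>" "\<not> col e f" "\<forall>c\<in>l. col e c" "\<forall>c\<in>l. col f c" "e \<notin> l" "f \<notin> l"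
proof -
  have ZS: "\<zeta> \<in> Sy" using high_rankD Z by metis
  have lz: "l \<subseteq> \<zeta>" using Sy_ln[OF ZS l ab(1-3)] .
  obtain e where e: "e \<in> \<zeta>" "e \<notin> l" "\<forall>c\<in>l. col e c" using plane_ex[OF ZS high_rankD(2)[OF Z] l(1) lz] by metis
  obtain f where f: "f \<in> \<zeta>" "\<forall>c\<in>l. col f c" "\<not> col f e"
    using polar_line_closed[OF Sy_polar[OF ZS] l(1) lz e] by metis
  have "f \<notin> l" using e f sy by metis
  then show thesis using that e f sy by metis
qed

text \<open>Otherwise \<open>not_singleton\<close> in the residue gives a pencil of lines collinear with the line
  \<open>xt\<close>, and this pencil contains a line that is also collinear with a common line of the two symps.\<close>

lemma rank2_line_far:
  assumes X: "\<xi> \<in> Sy" "rank2 \<xi>" "x \<in> \<xi>" "t \<in> \<xi>" "col t x" and Z: "high_rank \<zeta>" "x \<in> \<zeta>" "t \<notin> \<zeta>"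
    and z: "z \<in> \<zeta>" "col z x" "col z t"
  shows "z = x"
proof (rule ccontr)
  assume zx: "z \<noteq> x"
  have ZS: "\<zeta> \<in> Sy" using high_rankD Z by metis
  have ne: "\<xi> \<noteq> \<zeta>" using X Z by metis
  have tx: "t \<noteq> x" using Z by metis
  obtain k where k: "k \<in> \<xi>" "k \<in> \<zeta>" "k \<noteq> x" using meet0[OF X(1) ZS ne X(3) Z(2)] by metis
  have kx: "col k x" using Sy_clique[OF X(1) ZS ne k(1) X(3) k(2) Z(2)] .
  obtain K where K: "K \<in> Ln" "k \<in> K" "x \<in> K" "K \<subseteq> \<zeta>" using line_through[OF ZS k(2) Z(2) k(3) kx] .
  have KX: "e \<in> K" if "e \<in> \<xi>" "col e x" "col e k" for e
    using rank2D[OF X(2,1) K(1-3) k(3) k(1) X(3) that(1,3,2)] .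
  have tk: "\<not> col t k" using KX[OF X(4,5)] K Z by auto
  obtain T where T: "T \<in> Ln" "t \<in> T" "x \<in> T" "T \<subseteq> \<xi>" using line_through[OF X(1,4,3) tx X(5)] .
  have TX: "e = x" if e: "e \<in> \<xi>" "e \<in> \<zeta>" "col e x" "col e t" for e
  proof (rule ccontr)
    assume ex: "e \<noteq> x"
    have "e \<in> T" using rank2D[OF X(2,1) T(1-3) tx X(4,3) e(1,4,3)] .
    then have "t \<in> \<zeta>" using Sy_lnD[OF ZS T(1) _ T(3) e(2) Z(2) ex T(2)] by metis
    then show False using Z by metis
  qed
  have zP: "z \<in> P" using Sy_P[OF ZS z(1)] .
  have zk: "\<not> col z k"
    using Sy_conv[OF X(1) X(4) k(1) tk zP z(3)] TX[OF _ z] zx by metis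
  obtain e where e: "e \<in> \<zeta>" "e \<notin> K" "\<forall>c\<in>K. col e c"
    using plane_ex[OF ZS high_rankD(2)[OF Z(1)] K(1,4)] by metis
  have ek: "e \<noteq> k" "col e k" "col e x" using e K by metis+
  obtain E j where E: "E \<in> Ln" "e \<in> E" "k \<in> E" "E \<subseteq> \<zeta>" "j \<in> E" "col z j" "j \<in> \<zeta>"
    using Sy_hit[OF ZS z(1) e(1) k(2) ek(1,2)] .
  have jx: "j \<noteq> x" using ln_uniq[OF E(1) K(1) _ E(3) K(3,2) k(3)[symmetric]] E e by metis
  have jk: "j \<noteq> k" using E zk by metis
  have jcx: "col j x" using ln_all[OF E(1-3) ek(1) sy[OF ek(3)] sy[OF kx] E(5)] sy by metis
  have jck: "col j k" using ln_col[OF E(1,5,3)] .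
  have jP: "j \<in> P" using Sy_P[OF ZS E(7)] .
  have tj: "\<not> col t j"
  proof
    assume c: "col t j"
    have jX: "j \<in> \<xi>" using Sy_conv[OF X(1) X(4) k(1) tk jP sy[OF c] jck] .
    show False using TX[OF jX E(7) jcx sy[OF c]] jx by metis
  qed
  have inP: "t \<in> P" "x \<in> P" using Sy_P X by metis+
  obtain \<tau> where t: "\<tau> \<in> Sy" "t \<in> \<tau>" "j \<in> \<tau>" "x \<in> \<tau>"
    using Sy_exE[OF inP(1) jP inP(2) tj] X(5) jcx sy by metis
  have zt: "z \<in> \<tau>" using Sy_conv[OF t(1-3) tj zP z(3) E(6)] .
  have bt: "high_rank \<tau>"
  proof (rule ccontr)
    assume "\<not> high_rank \<tau>"
    then have r: "rank2 \<tau>" using t high_rank_def by metis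
    have "z \<in> T" using rank2D[OF r t(1) T(1-3) tx t(2,4) zt z(3,2)] .
    then have "t \<in> \<zeta>" using Sy_lnD[OF ZS T(1) _ T(3) z(1) Z(2) zx T(2)] by metis
    then show False using Z by metis
  qed
  obtain v where v: "v \<in> \<zeta>" "col v x" "col v t" "\<forall>l\<in>Ln. x \<in> l \<and> z \<in> l \<longrightarrow> v \<notin> l"
    using residue_not_singleton[OF Z(1,2) bt t(4,2) Z(3) X(5) z(1) zx z(2,3)] by metis
  have zv: "z \<noteq> v" using v pair_line[OF zP inP(2) z(2) zx] by metis
  have zvc: "col z v" using Sy_perp_clique[OF ZS inP(1) Z(3) z(1) v(1)] z v sy by metis
  obtain l c where l: "l \<in> Ln" "z \<in> l" "v \<in> l" "l \<subseteq> \<zeta>" "c \<in> l" "col k c" "c \<in> \<zeta>"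
    using Sy_hit[OF ZS k(2) z(1) v(1) zv zvc] .
  have cx: "col c x" using ln_all[OF l(1-3) zv sy[OF z(2)] sy[OF v(2)] l(5)] sy by metis
  have ct: "col c t" using ln_all[OF l(1-3) zv sy[OF z(3)] sy[OF v(3)] l(5)] sy by metis
  have cP: "c \<in> P" using Sy_P[OF ZS l(7)] .
  have cX: "c \<in> \<xi>" using Sy_conv[OF X(1) X(4) k(1) tk cP ct sy[OF l(6)]] .
  have "c = x" using TX[OF cX l(7) cx ct] .
  then show False using v(4) l by metis
qed

text \<open>The mixed configuration: \<xi> and \<zeta> share the line \<open>xk\<close>, and the
  line \<open>xt\<close> of \<xi> leaves \<zeta>. In the end this line becomes the fibre of a
  product.\<close>

definition setting :: "'a set \<Rightarrow> 'a set \<Rightarrow> 'a \<Rightarrow> 'a \<Rightarrow> 'a \<Rightarrow> bool" where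
  "setting \<xi> \<zeta> x k t \<longleftrightarrow> \<xi> \<in> Sy \<and> rank2 \<xi> \<and> high_rank \<zeta> \<and> x \<in> \<xi> \<and> x \<in> \<zeta> \<and> k \<in> \<xi> \<and> k \<in> \<zeta> \<and> k \<noteq> x \<and> t \<in> \<xi> \<and> col t x \<and> t \<notin> \<zeta>"

lemma settingD:
  assumes "setting \<xi> \<zeta> x k t"
  shows "\<xi> \<in> Sy" "rank2 \<xi>" "high_rank \<zeta>" "x \<in> \<xi>" "x \<in> \<zeta>" "k \<in> \<xi>" "k \<in> \<zeta>" "k \<noteq> x" "t \<in> \<xi>" "col t x" "t \<notin> \<zeta>"
    "\<zeta> \<in> Sy" "col k x" "t \<noteq> x" "\<not> col t k" "x \<in> P" "k \<in> P" "t \<in> P" "\<xi> \<noteq> \<zeta>"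
proof -
  show 1: "\<xi> \<in> Sy" "rank2 \<xi>" "high_rank \<zeta>" "x \<in> \<xi>" "x \<in> \<zeta>" "k \<in> \<xi>" "k \<in> \<zeta>" "k \<noteq> x" "t \<in> \<xi>" "col t x" "t \<notin> \<zeta>"
    using assms unfolding setting_def by auto
  show 2: "\<zeta> \<in> Sy" using high_rankD 1 by metis
  show ne: "\<xi> \<noteq> \<zeta>" using 1 by metis
  show kx: "col k x" using Sy_clique[OF 1(1) 2 ne 1(6,4,7,5)] .
  show "t \<noteq> x" using 1 by metis
  show "x \<in> P" "k \<in> P" "t \<in> P" using Sy_P[OF 1(1)] 1 by metis+
  obtain K where K: "K \<in> Ln" "k \<in> K" "x \<in> K" "K \<subseteq> \<zeta>" using line_through[OF 2 1(7,5,8) kx] .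
  show "\<not> col t k" using rank2D[OF 1(2,1) K(1-3) 1(8,6,4,9) _ 1(10)] K 1(11) by auto
qed

text \<open>Suppose that \<open>z\<close> sees \<open>k\<close>. A symp of higher rank on
  \<open>t\<close> and \<open>z\<close> would not contain \<open>k\<close>, but its point
  \<open>z\<close> would see the line \<open>xk\<close> of \<xi>, against
  \<open>rank2_line_far\<close>. For other \<open>z\<close> the same argument is repeated from a
  point \<open>j\<close> that sees \<open>x\<close>, \<open>k\<close> and \<open>z\<close>.\<close>

lemma setting_rank2:
  assumes S: "setting \<xi> \<zeta> x k t" and z: "z \<in> \<zeta>" "col z x" "z \<noteq> x"
  shows "\<not> col t z" and "\<exists>\<tau>. \<tau> \<in> Sy \<and> rank2 \<tau> \<and> t \<in> \<tau> \<and> z \<in> \<tau> \<and> x \<in> \<tau>"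
proof -
  note D = settingD[OF S]
  have far: "\<not> col t u" if "u \<in> \<zeta>" "col u x" "u \<noteq> x" for u
    using rank2_line_far[OF D(1,2,4,9,10,3,5,11) that(1,2)] that(3) sy by metis
  show "\<not> col t z" using far z by metis
  have ex: "\<exists>\<tau>. \<tau> \<in> Sy \<and> t \<in> \<tau> \<and> u \<in> \<tau> \<and> x \<in> \<tau>" if u: "u \<in> \<zeta>" "col u x" "u \<noteq> x" for u
    using Sy_exE[OF D(18) Sy_P[OF D(12) u(1)] D(16) far[OF u]] D(10) u(2) sy by metis
  have near_symp: "rank2 \<tau>" if u: "u \<in> \<zeta>" "col u x" "u \<noteq> x" "col u k" and t: "\<tau> \<in> Sy" "t \<in> \<tau>" "u \<in> \<tau>" "x \<in> \<tau>" for u \<tau>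
  proof (rule ccontr)
    assume "\<not> rank2 \<tau>"
    then have b: "high_rank \<tau>" using t high_rank_def by metis
    have "k \<notin> \<tau>"
    proof
      assume "k \<in> \<tau>"
      then have "\<tau> = \<xi>" using Sy_eq[OF t(1) D(1) t(2) _ D(9,6,15)] by metis
      then show False using b high_rankD D by metis
    qed
    then show False using rank2_line_far[OF D(1,2,4,6,13) b t(4) _ t(3) u(2,4)] u by metis
  qed
  show "\<exists>\<tau>. \<tau> \<in> Sy \<and> rank2 \<tau> \<and> t \<in> \<tau> \<and> z \<in> \<tau> \<and> x \<in> \<tau>"
  proof (cases "col z k")
    case True
    then show ?thesis using ex[OF z] near_symp[OF z True] by metis
  next
    case False
    obtain \<tau> where t: "\<tau> \<in> Sy" "t \<in> \<tau>" "z \<in> \<tau>" "x \<in> \<tau>" using ex[OF z] by metis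
    obtain K where K: "K \<in> Ln" "k \<in> K" "x \<in> K" "K \<subseteq> \<zeta>" using line_through[OF D(12) D(7,5,8,13)] .
    obtain e where e: "e \<in> \<zeta>" "e \<notin> K" "\<forall>c\<in>K. col e c"
      using plane_ex[OF D(12) high_rankD(2)[OF D(3)] K(1,4)] by metis
    have ek: "e \<noteq> k" "col e k" "col e x" using e K by metis+
    obtain E j where E: "E \<in> Ln" "e \<in> E" "k \<in> E" "E \<subseteq> \<zeta>" "j \<in> E" "col z j" "j \<in> \<zeta>"
      using Sy_hit[OF D(12) z(1) e(1) D(7) ek(1,2)] .
    have jx: "j \<noteq> x" using ln_uniq[OF E(1) K(1) _ E(3) K(3,2) D(8)[symmetric]] E e by metis
    have jcx: "col j x" using ln_all[OF E(1-3) ek(1) sy[OF ek(3)] sy[OF D(13)] E(5)] sy by metis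
    have jck: "col j k" using ln_col[OF E(1,5,3)] .
    obtain \<theta> where h: "\<theta> \<in> Sy" "t \<in> \<theta>" "j \<in> \<theta>" "x \<in> \<theta>" using ex[OF E(7) jcx jx] by metis
    have r: "rank2 \<theta>" using near_symp[OF E(7) jcx jx jck h] .
    have "rank2 \<tau>"
    proof (rule ccontr)
      assume n: "\<not> rank2 \<tau>"
      then have b: "high_rank \<tau>" using t high_rank_def by metis
      have "j \<notin> \<tau>"
      proof
        assume "j \<in> \<tau>"
        then have "\<tau> = \<theta>" using Sy_eq[OF t(1) h(1) t(2) _ h(2,3) far[OF E(7) jcx jx]] by metis
        then show False using n r by metis
      qed
      then show False using rank2_line_far[OF h(1) r h(4,3) jcx b t(4) _ t(3) z(2) E(6)] z by metis
    qed
    then show ?thesis using t by metis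
  qed
qed

lemma setting_point_rank2:
  assumes S: "setting \<xi> \<zeta> x k t" and r: "r \<in> \<zeta>" "col r x" and e: "high_rank \<eta>" "x \<in> \<eta>" "r \<notin> \<eta>"
    and c: "c \<in> \<eta>" "col c x" "col c r"
  shows "c = x"
proof -
  have rx: "r \<noteq> x" using e by metis
  obtain \<theta> where h: "\<theta> \<in> Sy" "rank2 \<theta>" "r \<in> \<theta>" "x \<in> \<theta>" using setting_rank2(2)[OF S r rx] by metis
  show ?thesis using rank2_line_far[OF h(1,2,4,3) r(2) e c] .
qed

text \<open>With a further neighbour \<open>z\<close>, the symp \<eta> through \<open>m\<close> and
  a suitable \<open>y\<close> contains the plane on \<open>L\<close> and \<open>y\<close>, so it has
  higher rank. A neighbour \<open>r\<close> of \<open>x\<close> in \<zeta> off \<eta> sees a point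
  \<open>c\<close> of the line \<open>yz\<close>. \<open>setting_point_rank2\<close> forces
  \<open>c = x\<close>, and then \<open>y\<close> would lie on \<open>L\<close>.\<close>

lemma setting_far:
  assumes S: "setting \<xi> \<zeta> x k t" and m: "m \<in> P" "col m x" "m \<notin> \<zeta>" and z: "z \<in> \<zeta>" "col z x" "col m z"
  shows "z = x"
proof (rule ccontr)
  assume zx: "z \<noteq> x"
  note D = settingD[OF S]
  obtain L where L: "L \<in> Ln" "z \<in> L" "x \<in> L" "L \<subseteq> \<zeta>" using line_through[OF D(12) z(1) D(5) zx z(2)] .
  obtain e f where ef: "e \<in> \<zeta>" "f \<in> \<zeta>" "\<not> col e f" "\<forall>c\<in>L. col e c" "\<forall>c\<in>L. col f c" "e \<notin> L" "f \<notin> L"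
    using perp_noncol[OF D(3) z(1) D(5) zx z(2) L(1-3)] .
  have "\<not> col m e \<or> \<not> col m f" using Sy_perp_clique[OF D(12) m(1,3) ef(1,2)] ef by metis
  then obtain y where y: "y \<in> \<zeta>" "\<not> col m y" "\<forall>c\<in>L. col y c" "y \<notin> L" using ef by metis
  have yzx: "col y z" "col y x" "y \<noteq> z" "y \<noteq> x" using y L by metis+
  obtain \<eta> where e: "\<eta> \<in> Sy" "m \<in> \<eta>" "y \<in> \<eta>" "x \<in> \<eta>"
    using Sy_exE[OF m(1) Sy_P[OF D(12) y(1)] D(16) y(2)] m(2) yzx(2) sy by metis
  have ze: "z \<in> \<eta>" using Sy_conv[OF e(1-3) y(2) Sy_P[OF D(12) z(1)]] z(3) yzx(1) sy by metis
  have be: "high_rank \<eta>"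
  proof (rule ccontr)
    assume "\<not> high_rank \<eta>"
    then have r: "rank2 \<eta>" using e high_rank_def by metis
    show False using rank2D[OF r e(1) L(1-3) zx ze e(4,3) yzx(1,2)] y by metis
  qed
  have ne: "\<eta> \<noteq> \<zeta>" using e m by metis
  obtain a b where ab: "a \<in> \<zeta>" "b \<in> \<zeta>" "col a x" "col b x" "\<not> col a b" using Sy_two[OF D(12,5)] .
  have "a \<notin> \<eta> \<or> b \<notin> \<eta>" using Sy_clique[OF D(12) e(1) ne[symmetric] ab(1,2)] ab by metis
  then obtain r where r: "r \<in> \<zeta>" "col r x" "r \<notin> \<eta>" using ab by metis
  obtain l c where l: "l \<in> Ln" "y \<in> l" "z \<in> l" "l \<subseteq> \<zeta>" "c \<in> l" "col r c" "c \<in> \<zeta>"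
    using Sy_hit[OF D(12) r(1) y(1) z(1) yzx(3,1)] .
  have le: "l \<subseteq> \<eta>" using Sy_ln[OF e(1) l(1-3) e(3) ze yzx(3)] .
  have ce: "c \<in> \<eta>" using le l by auto
  have cx: "col c x" using ln_all[OF l(1-3) yzx(3) sy[OF yzx(2)] sy[OF z(2)] l(5)] sy by metis
  have "c = x" using setting_point_rank2[OF S r(1,2) be e(4) r(3) ce cx sy[OF l(6)]] .
  then show False using ln_uniq[OF l(1) L(1) l(3) _ L(2,3) zx] l y by metis
qed

text \<open>A second symp of higher rank shares with \<zeta> a line \<open>L\<close> through
  \<open>x\<close>. The perp of \<open>L\<close> in \<zeta> contains noncollinear points, so one of
  them is off \<eta>; it sees all of \<open>L\<close>, against
  \<open>setting_point_rank2\<close>.\<close>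

lemma setting_big_unique:
  assumes S: "setting \<xi> \<zeta> x k t" and e: "high_rank \<eta>" "x \<in> \<eta>"
  shows "\<eta> = \<zeta>"
proof (rule ccontr)
  assume ne: "\<eta> \<noteq> \<zeta>"
  note D = settingD[OF S]
  have eS: "\<eta> \<in> Sy" using high_rankD e by metis
  obtain c where c: "c \<in> \<eta>" "c \<in> \<zeta>" "c \<noteq> x" using meet0[OF eS D(12) ne e(2) D(5)] by metis
  have cx: "col c x" using Sy_clique[OF eS D(12) ne c(1) e(2) c(2) D(5)] .
  obtain L where L: "L \<in> Ln" "c \<in> L" "x \<in> L" "L \<subseteq> \<zeta>" using line_through[OF D(12) c(2) D(5) c(3) cx] .
  obtain a b where ab: "a \<in> \<zeta>" "b \<in> \<zeta>" "\<not> col a b" "\<forall>d\<in>L. col a d" "\<forall>d\<in>L. col b d"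
    using perp_noncol[OF D(3) c(2) D(5) c(3) cx L(1-3)] by metis
  have "a \<notin> \<eta> \<or> b \<notin> \<eta>" using Sy_clique[OF eS D(12) ne _ _ ab(1,2)] ab by metis
  then obtain r where r: "r \<in> \<zeta>" "r \<notin> \<eta>" "\<forall>d\<in>L. col r d" using ab by metis
  have "col r x" "col c r" using r L sy by metis+
  then show False using setting_point_rank2[OF S r(1) _ e r(2) c(1) cx] c by metis
qed

text \<open>The point \<open>n\<close> is \<open>j\<close> carried along when \<open>x\<close> moves
  to \<open>u\<close>. The symps on \<open>u\<close>, \<open>j\<close> and on \<open>j\<close>,
  \<open>r\<close> share \<open>j\<close>, hence a line, and \<open>n\<close> is its point that sees
  \<open>u\<close>.\<close>

lemma setting_translate:
  assumes S: "setting \<xi> \<zeta> x k u" and j: "j \<in> \<zeta>" "col j x" "col j k" "j \<notin> \<xi>"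
    and r: "r \<in> \<xi>" "col r u" "\<not> col r x"
  shows "\<exists>n. n \<in> P \<and> n \<notin> \<xi> \<and> n \<notin> \<zeta> \<and> col n j \<and> col n u \<and> col n r \<and> \<not> col n x"
proof -
  note D = settingD[OF S]
  have jx: "j \<noteq> x" using j D by metis
  obtain \<beta> where b: "\<beta> \<in> Sy" "rank2 \<beta>" "u \<in> \<beta>" "j \<in> \<beta>" "x \<in> \<beta>" using setting_rank2(2)[OF S j(1,2) jx] by metis
  have uj: "\<not> col u j" using setting_rank2(1)[OF S j(1,2) jx] .
  obtain K b0 where K: "K \<in> Ln" "k \<in> K" "x \<in> K" "K \<subseteq> \<xi>" "b0 \<in> K" "col r b0" "b0 \<in> \<xi>"
    using Sy_hit[OF D(1) r(1) D(6,4,8,13)] .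
  have bx: "b0 \<noteq> x" using K r by metis
  have Kz: "K \<subseteq> \<zeta>" using Sy_ln[OF D(12) K(1-3) D(7,5,8)] .
  have uK: "c = x" if "c \<in> K" "col u c" for c
    using ln_all[OF K(1) that(1) K(3) _ that(2) D(10) K(2)] D(15) by metis
  have jK: "col j c" if "c \<in> K" for c using ln_all[OF K(1-3) D(8) j(3,2) that] .
  have jP: "j \<in> P" using Sy_P[OF D(12) j(1)] .
  have rP: "r \<in> P" and bP: "b0 \<in> P" using Sy_P[OF D(1)] r K by metis+
  have jr: "\<not> col j r"
  proof
    assume c: "col j r"
    have "j \<in> \<xi>" using Sy_conv[OF D(1) r(1) D(4) r(3) jP c j(2)] .
    then show False using j by metis
  qed
  obtain \<gamma> where g: "\<gamma> \<in> Sy" "j \<in> \<gamma>" "r \<in> \<gamma>" "b0 \<in> \<gamma>"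
    using Sy_exE[OF jP rP bP jr sy[OF jK[OF K(5)]] sy[OF K(6)]] .
  have gX: "\<gamma> \<noteq> \<xi>" using g j by metis
  have gx: "x \<notin> \<gamma>" using Sy_eq[OF g(1) D(1) g(3) _ r(1) D(4) r(3)] gX by metis
  have bg: "\<beta> \<noteq> \<gamma>" using b gx by metis
  have bX: "\<beta> \<noteq> \<xi>" using b j by metis
  obtain l n d where l: "l \<in> Ln" "j \<in> l" "n \<in> l" "d \<in> l" "d \<noteq> j" "l \<subseteq> \<beta>" "l \<subseteq> \<gamma>" "col u n" "n \<in> \<beta>" "n \<in> \<gamma>"
    using meet_hit[OF b(1) g(1) bg b(4) g(2) b(3)] by metis
  have nj: "n \<noteq> j" using l uj by metis
  have njc: "col n j" using ln_col[OF l(1,3,2)] .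
  have nx: "\<not> col n x"
  proof
    assume c: "col n x"
    have "x \<in> l" using rank2D[OF b(2,1) l(1,3,2) nj l(9) b(4,5) sy[OF c] sy[OF j(2)]] .
    then show False using l gx by auto
  qed
  have nX: "n \<notin> \<xi>" using Sy_clique[OF b(1) D(1) bX l(9) b(5) _ D(4)] nx by metis
  have nP: "n \<in> P" using Sy_P[OF b(1) l(9)] .
  have rb: "r \<noteq> b0" using uK[OF K(5)] r bx sy by metis
  obtain m v where m: "m \<in> Ln" "r \<in> m" "b0 \<in> m" "m \<subseteq> \<gamma>" "v \<in> m" "col n v" "v \<in> \<gamma>"
    using Sy_hit[OF g(1) l(10) g(3,4) rb K(6)] .
  have vX: "v \<in> \<xi>" using Sy_lnD[OF D(1) m(1-3) r(1) K(7) rb m(5)] .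
  have uv: "col u v" using Sy_perp_clique[OF D(1) nP nX D(9) vX sy[OF l(8)] m(6)] .
  have "v = r"
  proof (rule ccontr)
    assume "v \<noteq> r"
    then have "col u b0" using ln_all[OF m(1,5,2) _ uv sy[OF r(2)] m(3)] by metis
    then show False using uK[OF K(5)] bx by metis
  qed
  then have nr: "col n r" using m by metis
  have "n \<notin> \<zeta>"
  proof
    assume nz: "n \<in> \<zeta>"
    obtain c where c: "c \<in> K" "col n c" using polar_one[OF Sy_polar[OF D(12)] nz K(1) Kz] by metis
    have cX: "c \<in> \<xi>" using c K by auto
    have "col u c" using Sy_perp_clique[OF D(1) nP nX D(9) cX sy[OF l(8)] c(2)] .
    then show False using uK c nx by metis
  qed
  then show ?thesis using nP nX njc l nr nx sy by metis
qed

text \<open>Translates \<open>n\<close>, \<open>m\<close> of noncollinear points \<open>j\<close>,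
  \<open>i\<close> in the perp of \<open>K\<close> are noncollinear and have \<open>u\<close> and
  \<open>r\<close> as common neighbours. The symp they span contains the line \<open>ur\<close>, and
  rank 2 would put \<open>n\<close> on that line, hence into \<xi>.\<close>

lemma setting_big_line:
  assumes S: "setting \<xi> \<zeta> x k u" and r: "r \<in> \<xi>" "col r u" "\<not> col r x"
  shows "\<exists>\<eta>. high_rank \<eta> \<and> u \<in> \<eta> \<and> r \<in> \<eta>"
proof -
  note D = settingD[OF S]
  obtain K where K: "K \<in> Ln" "k \<in> K" "x \<in> K" "K \<subseteq> \<xi>" using line_through[OF D(1,6,4,8,13)] .
  have Kz: "K \<subseteq> \<zeta>" using Sy_ln[OF D(12) K(1-3) D(7,5,8)] .
  obtain j i where ji: "j \<in> \<zeta>" "i \<in> \<zeta>" "\<not> col j i" "\<forall>c\<in>K. col j c" "\<forall>c\<in>K. col i c" "j \<notin> K" "i \<notin> K"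
    using perp_noncol[OF D(3,7,5,8,13) K(1-3)] .
  have nX: "e \<notin> \<xi>" if "e \<in> \<zeta>" "\<forall>c\<in>K. col e c" "e \<notin> K" for e
    using rank2D[OF D(2,1) K(1-3) D(8,6,4)] that K by metis
  have jk: "col j x" "col j k" "col i x" "col i k" using ji K by metis+
  have jX: "j \<notin> \<xi>" "i \<notin> \<xi>" using nX ji by metis+
  obtain n where n: "n \<in> P" "n \<notin> \<xi>" "n \<notin> \<zeta>" "col n j" "col n u" "col n r" "\<not> col n x"
    using setting_translate[OF S ji(1) jk(1,2) jX(1) r] by metis
  obtain m where m: "m \<in> P" "m \<notin> \<xi>" "m \<notin> \<zeta>" "col m i" "col m u" "col m r" "\<not> col m x"
    using setting_translate[OF S ji(2) jk(3,4) jX(2) r] by metis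
  have rP: "r \<in> P" using Sy_P[OF D(1) r(1)] .
  have inP: "j \<in> P" "i \<in> P" using Sy_P[OF D(12)] ji by metis+
  have ru: "r \<noteq> u" using r D by metis
  \<comment> \<open>If \<open>n\<close> and \<open>m\<close> were collinear, a symp through
    \<open>j\<close> and \<open>m\<close> would provide a point \<open>l\<close> of \<zeta> that
    sees \<open>m\<close> and \<open>i\<close> but not \<open>x\<close>. For the point
    \<open>c\<close> of \<open>K\<close> seen by \<open>l\<close>, the symp through \<open>m\<close>
    and \<open>c\<close> contains \<open>l\<close> and \<open>i\<close>, so it has higher rank. As
    \<open>i\<close> sees both \<open>c\<close> and \<open>x\<close>, this contradicts
    \<open>rank2_line_far\<close> for the line \<open>cx\<close>.\<close>
  have nm: "\<not> col n m"
  proof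
    assume c: "col n m"
    have jm: "\<not> col j m" using Sy_perp_clique[OF D(12) m(1,3) ji(1,2) _ m(4)] ji sy by metis
    obtain \<tau> where t: "\<tau> \<in> Sy" "j \<in> \<tau>" "m \<in> \<tau>" "n \<in> \<tau>" using Sy_exE[OF inP(1) m(1) n(1) jm n(4) c] .
    have tz: "\<tau> \<noteq> \<zeta>" using t m by metis
    obtain L l d where l: "L \<in> Ln" "j \<in> L" "l \<in> L" "d \<in> L" "d \<noteq> j" "L \<subseteq> \<tau>" "L \<subseteq> \<zeta>" "col m l" "l \<in> \<tau>" "l \<in> \<zeta>"
      using meet_hit[OF t(1) D(12) tz t(2) ji(1) t(3)] by metis
    have lj: "l \<noteq> j" using l jm sy by metis
    have ljc: "col l j" using ln_col[OF l(1,3,2)] .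
    have li: "col l i" using Sy_perp_clique[OF D(12) m(1,3) l(10) ji(2) l(8) m(4)] .
    have ix: "i \<noteq> x" using ji K by metis
    obtain \<beta> where b: "\<beta> \<in> Sy" "rank2 \<beta>" "u \<in> \<beta>" "i \<in> \<beta>" "x \<in> \<beta>" using setting_rank2(2)[OF S ji(2) jk(3) ix] by metis
    have ui: "\<not> col u i" using setting_rank2(1)[OF S ji(2) jk(3) ix] .
    have mb: "m \<in> \<beta>" using Sy_conv[OF b(1,3,4) ui m(1,5,4)] .
    have lP: "l \<in> P" using Sy_P[OF D(12) l(10)] .
    have lx: "\<not> col l x"
    proof
      assume lx: "col l x"
      have lb: "l \<in> \<beta>" using Sy_conv[OF b(1) mb b(5) m(7) lP sy[OF l(8)] lx] .
      obtain I where I: "I \<in> Ln" "i \<in> I" "x \<in> I" "I \<subseteq> \<beta>" using line_through[OF b(1,4,5) ix jk(3)] .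
      have lI: "l \<in> I" using rank2D[OF b(2,1) I(1-3) ix b(4,5) lb li lx] .
      have "l = x" using ln_all[OF I(1) lI I(3) _ sy[OF ljc] jk(1) I(2)] ji by metis
      then show False using l m by metis
    qed
    obtain c where c: "c \<in> K" "col l c" using polar_one[OF Sy_polar[OF D(12)] l(10) K(1) Kz] by metis
    have cx: "c \<noteq> x" using c lx by metis
    have cX: "c \<in> \<xi>" and cz: "c \<in> \<zeta>" using c K Kz by auto
    have cP: "c \<in> P" using Sy_P[OF D(1) cX] .
    have max_clique: "\<not> col m c"
    proof
      assume "col m c"
      then have "col u c" using Sy_perp_clique[OF D(1) m(1,2) D(9) cX m(5)] by metis
      then show False using ln_all[OF K(1) c(1) K(3) cx _ D(10) K(2)] D(15) by metis
    qed
    have ic: "col i c" using ji c by metis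
    obtain \<delta> where d: "\<delta> \<in> Sy" "m \<in> \<delta>" "c \<in> \<delta>" "l \<in> \<delta>" using Sy_exE[OF m(1) cP lP max_clique sy[OF l(8)] c(2)] .
    have id: "i \<in> \<delta>" using Sy_conv[OF d(1-3) max_clique inP(2) sy[OF m(4)] ic] .
    have dx: "x \<notin> \<delta>"
    proof
      assume "x \<in> \<delta>"
      then have "\<delta> = \<zeta>" using Sy_eq[OF d(1) D(12) d(4) _ l(10) D(5) lx] by metis
      then show False using d m by metis
    qed
    have ic': "i \<noteq> c" using ji c by metis
    have bd: "high_rank \<delta>"
    proof (rule ccontr)
      assume "\<not> high_rank \<delta>"
      then have r2: "rank2 \<delta>" using d high_rank_def by metis
      obtain I where I: "I \<in> Ln" "i \<in> I" "c \<in> I" "I \<subseteq> \<delta>" using line_through[OF d(1) id d(3) ic' ic] .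
      have lI: "l \<in> I" using rank2D[OF r2 d(1) I(1-3) ic' id d(3,4) li c(2)] .
      have "col x l" using ln_all[OF I(1-3) ic' sy[OF jk(3)] ln_col[OF K(1,3) c(1)] lI] .
      then show False using lx sy by metis
    qed
    show False using rank2_line_far[OF D(1,2) cX D(4) ln_col[OF K(1,3) c(1)] bd d(3) dx id ic jk(3)] ic' by metis
  qed
  obtain \<eta> where e: "\<eta> \<in> Sy" "n \<in> \<eta>" "m \<in> \<eta>" "u \<in> \<eta>" using Sy_exE[OF n(1) m(1) D(18) nm] n m sy by metis
  have re: "r \<in> \<eta>" using Sy_conv[OF e(1-3) nm rP] n m sy by metis
  have "high_rank \<eta>"
  proof (rule ccontr)
    assume "\<not> high_rank \<eta>"
    then have r2: "rank2 \<eta>" using e high_rank_def by metis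
    obtain R where R: "R \<in> Ln" "r \<in> R" "u \<in> R" "R \<subseteq> \<xi>" using line_through[OF D(1) r(1) D(9) ru r(2)] .
    have "n \<in> R" using rank2D[OF r2 e(1) R(1-3) ru re e(4,2) n(6,5)] .
    then show False using R n by auto
  qed
  then show ?thesis using e re by metis
qed

text \<open>The base point is moved from \<open>x\<close> to \<open>t\<close>. By
  \<open>setting_big_line\<close> the line \<open>tr\<close> lies in a symp \<eta> of higher rank,
  which gives a setting at \<open>t\<close> with \<open>x\<close> as the outside point. From there
  the line \<open>xy\<close> also lies in a symp of higher rank, and at \<open>x\<close> this can
  only be \<zeta>.\<close>

lemma setting_grid:
  assumes S: "setting \<xi> \<zeta> x k t" and T: "T \<in> Ln" "t \<in> T" "x \<in> T" and y: "y \<in> \<xi>" "col y x" "y \<notin> \<zeta>"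
  shows "y \<in> T"
proof (rule ccontr)
  assume yT: "y \<notin> T"
  note D = settingD[OF S]
  have yt: "\<not> col y t" using rank2D[OF D(2,1) T D(14) D(9,4) y(1) _ y(2)] yT by metis
  obtain a b where ab: "a \<in> \<xi>" "b \<in> \<xi>" "col a t" "col a k" "col b t" "col b k" "\<not> col a b"
    using Sy_noncol_pair[OF D(1,9,6,15)] .
  have rank2_triangle: "a = x" if "a \<in> \<xi>" "col a t" "col a k" "col a x" for a
  proof (rule ccontr)
    assume ax: "a \<noteq> x"
    have "a \<in> T" using rank2D[OF D(2,1) T D(14) D(9,4) that(1,2,4)] .
    then have "col k t" using ln_all[OF T(1) _ T(3) ax sy[OF that(3)] D(13) T(2)] by metis
    then show False using D sy by metis
  qed
  obtain r where r: "r \<in> \<xi>" "col r t" "col r k" "\<not> col r x" using rank2_triangle ab by metis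
  obtain \<eta> where e: "high_rank \<eta>" "t \<in> \<eta>" "r \<in> \<eta>" using setting_big_line[OF S r(1,2,4)] by metis
  have xe: "x \<notin> \<eta>" using Sy_eq[OF high_rankD(1)[OF e(1)] D(1) e(3) _ r(1) D(4) r(4)] high_rankD e D by metis
  have rt: "r \<noteq> t" using r D by metis
  have S': "setting \<xi> \<eta> t r x" unfolding setting_def using D e r xe rt sy by metis
  obtain \<theta> where h: "high_rank \<theta>" "x \<in> \<theta>" "y \<in> \<theta>" using setting_big_line[OF S' y(1,2) yt] by metis
  have "\<theta> = \<zeta>" using setting_big_unique[OF S h(1,2)] .
  then show False using h y by metis
qed

text \<open>If \<open>m\<close> misses \<open>t\<close>, the symp on \<open>m\<close> and
  \<open>t\<close> forms another setting with \<zeta>, and \<open>setting_grid\<close> applies. If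
  \<open>m\<close> sees \<open>t\<close>, rank-2 symps on \<open>t\<close>, \<open>z1\<close> and on
  \<open>m\<close>, \<open>z2\<close> share a line through \<open>x\<close>. Outside \<zeta> it
  would be both \<open>T\<close> and the line \<open>mx\<close>; inside \<zeta> it would contain the
  noncollinear points \<open>z1\<close> and \<open>z2\<close>.\<close>

lemma setting_lines:
  assumes S: "setting \<xi> \<zeta> x k t" and T: "T \<in> Ln" "t \<in> T" "x \<in> T" and m: "m \<in> P" "col m x" "m \<notin> \<zeta>"
  shows "m \<in> T"
proof (rule ccontr)
  assume mT: "m \<notin> T"
  note D = settingD[OF S]
  have mx: "m \<noteq> x" using m D by metis
  show False
  proof (cases "col m t")
    case False
    obtain \<tau> where t: "\<tau> \<in> Sy" "m \<in> \<tau>" "t \<in> \<tau>" "x \<in> \<tau>"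
      using Sy_exE[OF m(1) D(18,16) False] m(2) D(10) sy by metis
    have tz: "\<tau> \<noteq> \<zeta>" using t m by metis
    obtain c where c: "c \<in> \<tau>" "c \<in> \<zeta>" "c \<noteq> x" using meet0[OF t(1) D(12) tz t(4) D(5)] by metis
    have cx: "col c x" using Sy_clique[OF t(1) D(12) tz c(1) t(4) c(2) D(5)] .
    obtain \<theta> where h: "\<theta> \<in> Sy" "rank2 \<theta>" "t \<in> \<theta>" "c \<in> \<theta>" "x \<in> \<theta>" using setting_rank2(2)[OF S c(2) cx c(3)] by metis
    have "\<theta> = \<tau>" using Sy_eq[OF h(1) t(1) h(3,4) t(3) c(1)] setting_rank2(1)[OF S c(2) cx c(3)] by metis
    then have S': "setting \<tau> \<zeta> x c t" unfolding setting_def using D h c t by metis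
    show False using setting_grid[OF S' T t(2) m(2,3)] mT by metis
  next
    case mt: True
    obtain z1 z2 where z: "z1 \<in> \<zeta>" "z2 \<in> \<zeta>" "col z1 x" "col z2 x" "\<not> col z1 z2" using Sy_two[OF D(12,5)] .
    have zx: "z1 \<noteq> x" "z2 \<noteq> x" using z sy by metis+
    obtain \<tau>1 where t1: "\<tau>1 \<in> Sy" "rank2 \<tau>1" "t \<in> \<tau>1" "z1 \<in> \<tau>1" "x \<in> \<tau>1"
      using setting_rank2(2)[OF S z(1,3) zx(1)] by metis
    have S1: "setting \<tau>1 \<zeta> x z1 t" unfolding setting_def using D t1 z zx by metis
    have mz: "\<not> col m z2" using setting_far[OF S m z(2,4)] zx by metis
    obtain \<tau>2 where t2: "\<tau>2 \<in> Sy" "m \<in> \<tau>2" "z2 \<in> \<tau>2" "x \<in> \<tau>2"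
      using Sy_exE[OF m(1) Sy_P[OF D(12) z(2)] D(16) mz] m(2) z(4) sy by metis
    have r2: "rank2 \<tau>2"
    proof (rule ccontr)
      assume "\<not> rank2 \<tau>2"
      then have "high_rank \<tau>2" using t2 high_rank_def by metis
      then have "\<tau>2 = \<zeta>" using setting_big_unique[OF S _ t2(4)] by metis
      then show False using t2 m by metis
    qed
    have S2: "setting \<tau>2 \<zeta> x z2 m" unfolding setting_def using D t2 z zx m r2 by metis
    obtain M where M: "M \<in> Ln" "m \<in> M" "x \<in> M" "M \<subseteq> \<tau>2" using line_through[OF t2(1,2,4) mx m(2)] .
    have t12: "\<tau>1 \<noteq> \<tau>2"
    proof
      assume "\<tau>1 = \<tau>2"
      then show False using rank2D[OF t1(2,1) T D(14) t1(3,5) _ mt m(2)] t2 mT by metis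
    qed
    obtain c where c: "c \<in> \<tau>1" "c \<in> \<tau>2" "c \<noteq> x" using meet0[OF t1(1) t2(1) t12 t1(5) t2(4)] by metis
    have cx: "col c x" using Sy_clique[OF t1(1) t2(1) t12 c(1) t1(5) c(2) t2(4)] .
    show False
    proof (cases "c \<in> \<zeta>")
      case False
      have "c \<in> T" using setting_grid[OF S1 T c(1) cx False] .
      moreover have "c \<in> M" using setting_grid[OF S2 M(1-3) c(2) cx False] .
      ultimately have "T = M" using ln_uniq[OF T(1) M(1) _ T(3) _ M(3) c(3)] by metis
      then show False using M mT by metis
    next
      case True
      have ne: "\<tau>1 \<noteq> \<zeta>" "\<tau>2 \<noteq> \<zeta>" using t1 t2 D m by metis+
      have c1: "col c z1" using Sy_clique[OF t1(1) D(12) ne(1) c(1) t1(4) True z(1)] .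
      have c2: "col c z2" using Sy_clique[OF t2(1) D(12) ne(2) c(2) t2(3) True z(2)] .
      obtain C where C: "C \<in> Ln" "c \<in> C" "x \<in> C" "C \<subseteq> \<zeta>" using line_through[OF D(12) True D(5) c(3) cx] .
      have "z1 \<in> C" using rank2D[OF t1(2,1) C(1-3) c(3,1) t1(5,4) sy[OF c1] z(3)] .
      moreover have "z2 \<in> C" using rank2D[OF r2 t2(1) C(1-3) c(3,2) t2(4,3) sy[OF c2] z(4)] .
      ultimately show False using ln_col[OF C(1)] z by metis
    qed
  qed
qed

lemma setting_ex:
  assumes X: "\<xi> \<in> Sy" "rank2 \<xi>" and Z: "high_rank \<zeta>"
  shows "\<exists>\<xi> \<zeta> x k t. setting \<xi> \<zeta> x k t"
proof -
  have ZS: "\<zeta> \<in> Sy" using high_rankD Z by metis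
  have go: "\<exists>\<xi> \<zeta> x k t. setting \<xi> \<zeta> x k t" if X: "\<xi> \<in> Sy" "rank2 \<xi>" and Z: "high_rank \<zeta>" and x: "x \<in> \<xi>" "x \<in> \<zeta>" for \<xi> \<zeta> x
  proof -
    have ZS: "\<zeta> \<in> Sy" using high_rankD Z by metis
    have ne: "\<xi> \<noteq> \<zeta>" using X high_rankD Z by metis
    obtain k where k: "k \<in> \<xi>" "k \<in> \<zeta>" "k \<noteq> x" using meet0[OF X(1) ZS ne x] by metis
    obtain t where t: "t \<in> \<xi>" "col t x" "\<not> col t k" using polar_sep[OF Sy_polar[OF X(1)] x(1) k(1) k(3)[symmetric]] by metis
    have "t \<notin> \<zeta>" using Sy_clique[OF X(1) ZS ne t(1) k(1) _ k(2)] t by metis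
    then show ?thesis using X Z x k t unfolding setting_def by metis
  qed
  obtain z where z: "z \<in> \<zeta>" using Sy_ne[OF ZS] by metis
  have zP: "z \<in> P" using Sy_P[OF ZS z] .
  obtain w where w: "w \<in> \<xi>" "col z w" using near_symp[OF X(1) zP] by metis
  obtain \<tau> where t: "\<tau> \<in> Sy" "z \<in> \<tau>" "w \<in> \<tau>" using pair_Sy[OF zP Sy_P[OF X(1) w(1)] w(2)] .
  show ?thesis
  proof (cases "rank2 \<tau>")
    case True
    show ?thesis using go[OF t(1) True Z t(2) z] .
  next
    case False
    then have "high_rank \<tau>" using t high_rank_def by metis
    then show ?thesis using go[OF X _ w(1) t(3)] by metis
  qed
qed

end

section \<open>Spreading a local product over a symp\<close>

context symps_share_line
begin

text \<open>At the point \<open>x\<close> the geometry looks like the product of the line \<open>T\<close> and the symp \<open>\<zeta>\<close>.\<close>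

definition product_at :: "'a set \<Rightarrow> 'a \<Rightarrow> 'a set \<Rightarrow> bool" where
  "product_at \<zeta> x T \<longleftrightarrow> \<zeta> \<in> Sy \<and> x \<in> \<zeta> \<and> T \<in> Ln \<and> x \<in> T \<and>
    (\<forall>t\<in>T. t \<noteq> x \<longrightarrow> t \<notin> \<zeta> \<and> (\<forall>z\<in>\<zeta>. col t z \<longrightarrow> z = x)) \<and>
    (\<forall>m\<in>P. col m x \<longrightarrow> m \<in> \<zeta> \<or> m \<in> T)"

lemma product_atD:
  assumes "product_at \<zeta> x T"
  shows "\<zeta> \<in> Sy" "x \<in> \<zeta>" "T \<in> Ln" "x \<in> T" "\<And>t. t \<in> T \<Longrightarrow> t \<noteq> x \<Longrightarrow> t \<notin> \<zeta>"
    "\<And>t z. t \<in> T \<Longrightarrow> t \<noteq> x \<Longrightarrow> z \<in> \<zeta> \<Longrightarrow> col t z \<Longrightarrow> z = x"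
    "\<And>m. m \<in> P \<Longrightarrow> col m x \<Longrightarrow> m \<in> \<zeta> \<or> m \<in> T"
  using assms unfolding product_at_def by auto

text \<open>This gives uniqueness of the second line at \<open>y\<close>. Since \<open>x\<close>
  sees a point of every line of \<eta>, every line of \<eta> meets \<open>T\<close> or
  \<open>L\<close> by \<open>cov\<close>, and a point off the perp of \<open>x\<close> sees only one
  point of each (\<open>onT\<close>, \<open>onL\<close>). A line from \<open>u\<close> to
  \<open>M\<close>, or to a line from \<open>T\<close> to \<open>M\<close>, would have to pass
  through \<open>t\<close> or \<open>y\<close>, and both are impossible.\<close>

lemma grid_line:
  assumes e: "\<eta> \<in> Sy" and T: "T \<in> Ln" "T \<subseteq> \<eta>" "x \<in> T" "t \<in> T" "t \<noteq> x" and L: "L \<in> Ln" "L \<subseteq> \<eta>" "x \<in> L" "y \<in> L" "y \<noteq> x"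
    and Ty: "\<And>s. s \<in> T \<Longrightarrow> s \<noteq> x \<Longrightarrow> \<not> col s y"
    and cov: "\<And>s. s \<in> \<eta> \<Longrightarrow> col s x \<Longrightarrow> s \<in> T \<or> s \<in> L"
    and u: "u \<in> \<eta>" "col u y" "\<not> col u x" "col u t"
    and m: "m \<in> \<eta>" "col m y" "\<not> col m x"
    and M: "M \<in> Ln" "m \<in> M" "y \<in> M"
  shows "u \<in> M"
proof (rule ccontr)
  assume uM: "u \<notin> M"
  have te: "t \<in> \<eta>" and xe: "x \<in> \<eta>" and ye: "y \<in> \<eta>" using T L by auto
  have xy: "col x y" and xt: "col x t" using ln_col L T by metis+
  have my: "m \<noteq> y" using m xy sy by metis
  have Me: "M \<subseteq> \<eta>" using Sy_ln[OF e M m(1) ye my] .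
  have Mx: "\<not> col s x" if "s \<in> M" "s \<noteq> y" for s
    using ln_all[OF M(1) that(1) M(3) that(2) _ xy M(2)] m sy by metis
  obtain m1 where m1: "m1 \<in> M" "col t m1" using polar_one[OF Sy_polar[OF e] te M(1) Me] by metis
  have m1y: "m1 \<noteq> y" using m1 Ty T by metis
  have m1e: "m1 \<in> \<eta>" using m1 Me by auto
  have onT: "c = t" if "c \<in> T" "col w c" "col w t" "\<not> col w x" for c w
    using ln_all[OF T(1) that(1) T(4) _ that(2,3) T(3)] that(4) by metis
  have onL: "c = y" if "c \<in> L" "col w c" "col w y" "\<not> col w x" for c w
    using ln_all[OF L(1) that(1) L(4) _ that(2,3) L(3)] that(4) by metis
  have um: "\<not> col u m1"
  proof
    assume c: "col u m1"
    have ne: "u \<noteq> m1" using uM m1 by metis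
    obtain E c0 where E: "E \<in> Ln" "u \<in> E" "m1 \<in> E" "E \<subseteq> \<eta>" "c0 \<in> E" "col x c0" "c0 \<in> \<eta>"
      using Sy_hit[OF e xe u(1) m1e ne c] .
    have uc: "col u c0" using ln_col[OF E(1,2,5)] .
    have "c0 \<in> T \<or> c0 \<in> L" using cov[OF E(7)] E sy by metis
    then have "c0 = t \<or> c0 = y" using onT[OF _ uc u(4,3)] onL[OF _ uc u(2,3)] by metis
    then show False
    proof
      assume "c0 = t"
      then have "col y t" using ln_all[OF E(1-3) ne sy[OF u(2)] ln_col[OF M(1,3) m1(1)] E(5)] by metis
      then show False using Ty T sy by metis
    next
      assume "c0 = y"
      then have "E = M" using ln_uniq[OF E(1) M(1) E(3) _ m1(1) M(3) m1y] E by metis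
      then show False using E uM by metis
    qed
  qed
  obtain s where s: "s \<in> M" "s \<noteq> y" "s \<noteq> m1" using ln_thick[OF M(1)] by metis
  have se: "s \<in> \<eta>" using s Me by auto
  have sx: "\<not> col s x" using Mx s by metis
  have us: "\<not> col u s" using ln_all[OF M(1) s(1) M(3) s(2) _ u(2) m1(1)] um by metis
  have ts: "\<not> col t s" using ln_all[OF M(1) s(1) m1(1) s(3) _ m1(2) M(3)] Ty T by metis
  obtain r where r: "r \<in> T" "col s r" using polar_one[OF Sy_polar[OF e] se T(1,2)] by metis
  have rx: "r \<noteq> x" and rt: "r \<noteq> t" using r sx ts sy by metis+
  have re: "r \<in> \<eta>" using r T by auto
  have sr: "s \<noteq> r" using ln_col[OF T(1) r(1) T(3)] sx by metis
  have ur: "\<not> col u r" using onT[OF r(1) _ u(4,3)] rt by metis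
  obtain E q where E: "E \<in> Ln" "s \<in> E" "r \<in> E" "E \<subseteq> \<eta>" "q \<in> E" "col u q" "q \<in> \<eta>"
    using Sy_hit[OF e u(1) se re sr r(2)] .
  have qr: "q \<noteq> r" and qs: "q \<noteq> s" using E ur us by metis+
  have uq: "u \<noteq> q" using ln_col[OF E(1,5,2)] us by metis
  obtain F c0 where F: "F \<in> Ln" "u \<in> F" "q \<in> F" "F \<subseteq> \<eta>" "c0 \<in> F" "col x c0" "c0 \<in> \<eta>"
    using Sy_hit[OF e xe u(1) E(7) uq E(6)] .
  have uc: "col u c0" using ln_col[OF F(1,2,5)] .
  have qc: "col c0 q" using ln_col[OF F(1,5,3)] .
  have "c0 \<in> T \<or> c0 \<in> L" using cov[OF F(7)] F sy by metis
  then have "c0 = t \<or> c0 = y" using onT[OF _ uc u(4,3)] onL[OF _ uc u(2,3)] by metis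
  then show False
  proof
    assume "c0 = t"
    then have "col t s" using ln_all[OF E(1,5,3) qr _ ln_col[OF T(1,4) r(1)] E(2)] qc by metis
    then show False using ts by metis
  next
    assume "c0 = y"
    then have "col y r" using ln_all[OF E(1,5,2) qs _ ln_col[OF M(1,3) s(1)] E(3)] qc by metis
    then show False using Ty r rx sy by metis
  qed
qed

text \<open>The new fibre \<open>T'\<close> joins \<open>y\<close> to a common neighbour
  \<open>u\<close> of \<open>t\<close> and \<open>y\<close> other than \<open>x\<close>, so it lies
  in the symp \<eta> on \<open>t\<close> and \<open>y\<close>.\<close>

lemma product_at_step:
  assumes A: "product_at \<zeta> x T" and y: "y \<in> \<zeta>" "col y x" "y \<noteq> x"
  shows "\<exists>T'. product_at \<zeta> y T'"
proof -
  note D = product_atD[OF A]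
  obtain t where t: "t \<in> T" "t \<noteq> x" using ln_other[OF D(3)] by metis
  have Ty: "\<not> col s y" if "s \<in> T" "s \<noteq> x" for s using D(6)[OF that y(1)] y by metis
  have inP: "t \<in> P" "y \<in> P" "x \<in> P" using Ln_P[OF D(3)] t D(4) Sy_P[OF D(1) y(1)] by metis+
  have tx: "col t x" using ln_col[OF D(3) t(1) D(4)] .
  obtain \<eta> where e: "\<eta> \<in> Sy" "t \<in> \<eta>" "y \<in> \<eta>" "x \<in> \<eta>"
    using Sy_exE[OF inP Ty[OF t]] tx y sy by metis
  have tz: "t \<notin> \<zeta>" using D(5)[OF t] .
  have ne: "\<eta> \<noteq> \<zeta>" using e tz by metis
  have Te: "T \<subseteq> \<eta>" using Sy_ln[OF e(1) D(3) t(1) D(4) e(2,4) t(2)] .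
  obtain L where L: "L \<in> Ln" "y \<in> L" "x \<in> L" "L \<subseteq> \<zeta>" using line_through[OF D(1) y(1) D(2) y(3,2)] .
  have Le: "L \<subseteq> \<eta>" using Sy_ln[OF e(1) L(1-3) e(3,4) y(3)] .
  have eL: "z \<in> L" if z: "z \<in> \<eta>" "z \<in> \<zeta>" for z
  proof (cases "z = y")
    case False
    obtain l c where l: "l \<in> Ln" "z \<in> l" "y \<in> l" "l \<subseteq> \<eta>" "c \<in> l" "col t c" "c \<in> \<eta>"
      using Sy_hit[OF e(1,2) z(1) e(3) False Sy_clique[OF e(1) D(1) ne z(1) e(3) z(2) y(1)]] .
    have "c \<in> \<zeta>" using Sy_lnD[OF D(1) l(1-3) z(2) y(1) False l(5)] .
    then have "x \<in> l" using D(6)[OF t _ l(6)] l by metis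
    then show ?thesis using ln_uniq[OF l(1) L(1) l(3) _ L(2,3) y(3)] l by metis
  qed (use L in metis)
  have cov: "s \<in> T \<or> s \<in> L" if "s \<in> \<eta>" "col s x" for s
    using D(7)[OF Sy_P[OF e(1) that(1)] that(2)] eL that by metis
  obtain a b where ab: "a \<in> \<eta>" "b \<in> \<eta>" "col a t" "col a y" "col b t" "col b y" "\<not> col a b"
    using Sy_noncol_pair[OF e(1-3) Ty[OF t]] .
  then obtain u where u: "u \<in> \<eta>" "col u t" "col u y" "u \<noteq> x" by (metis rf)
  have uz: "u \<notin> \<zeta>" using D(6)[OF t _ sy[OF u(2)]] u by metis
  have ux: "\<not> col u x" using cov[OF u(1)] Ty u eL L uz by (metis subsetD)
  have uy: "u \<noteq> y" using u y ux by metis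
  obtain T' where T': "T' \<in> Ln" "u \<in> T'" "y \<in> T'" "T' \<subseteq> \<eta>" using line_through[OF e(1) u(1) e(3) uy u(3)] .
  \<comment> \<open>The symp through \<open>m\<close> and \<open>x\<close> contains a neighbour of
    \<open>x\<close> that misses \<open>y\<close>. This neighbour lies on \<open>T\<close>, so the
    symp contains \<open>T\<close> and equals \<eta>, where \<open>grid_line\<close>
    applies.\<close>
  have all: "m \<in> T'" if m: "m \<in> P" "col m y" "m \<notin> \<zeta>" for m
  proof -
    have mx: "\<not> col m x"
    proof
      assume "col m x"
      then have "m \<in> T" using D(7)[OF m(1)] m by metis
      then show False using Ty m D(2) by metis
    qed
    obtain \<tau> where h: "\<tau> \<in> Sy" "m \<in> \<tau>" "x \<in> \<tau>" "y \<in> \<tau>"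
      using Sy_exE[OF m(1) inP(3,2) mx] m(2) y(2) sy by metis
    obtain z where z: "z \<in> \<tau>" "col z x" "\<not> col z y" using polar_sep[OF Sy_polar[OF h(1)] h(3,4) y(3)[symmetric]] by metis
    have zT: "z \<in> T"
    proof (rule ccontr)
      assume "z \<notin> T"
      then have "z \<in> \<zeta>" using D(7)[OF Sy_P[OF h(1) z(1)] z(2)] by metis
      then have "\<tau> = \<zeta>" using Sy_eq[OF h(1) D(1) z(1) h(4) _ y(1) z(3)] by metis
      then show False using h m by metis
    qed
    have zx: "z \<noteq> x" using z y sy by metis
    have "t \<in> \<tau>" using Sy_lnD[OF h(1) D(3) zT D(4) z(1) h(3) zx t(1)] .
    then have "\<tau> = \<eta>" using Sy_eq[OF h(1) e(1) _ h(4) e(2,3) Ty[OF t]] by metis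
    then have me: "m \<in> \<eta>" using h by metis
    have my: "m \<noteq> y" using m y by metis
    obtain M where M: "M \<in> Ln" "m \<in> M" "y \<in> M" "M \<subseteq> \<eta>" using line_through[OF e(1) me e(3) my m(2)] .
    have "u \<in> M" using grid_line[OF e(1) D(3) Te D(4) t L(1) Le L(3,2) y(3) Ty cov u(1,3) ux u(2) me m(2) mx M(1-3)] by metis
    then have "M = T'" using ln_uniq[OF M(1) T'(1) _ M(3) T'(2,3) uy] by metis
    then show ?thesis using M by metis
  qed
  have out: "s \<notin> \<zeta> \<and> (\<forall>z\<in>\<zeta>. col s z \<longrightarrow> z = y)" if s: "s \<in> T'" "s \<noteq> y" for s
  proof -
    have sz: "s \<notin> \<zeta>" using Sy_lnD[OF D(1) T'(1) s(1) T'(3) _ y(1) s(2) T'(2)] uz by metis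
    have sP: "s \<in> P" using Ln_P[OF T'(1) s(1)] .
    have "z = y" if z: "z \<in> \<zeta>" "col s z" for z
    proof (rule ccontr)
      assume zy: "z \<noteq> y"
      have yz: "col y z" using Sy_perp_clique[OF D(1) sP sz y(1) z(1) ln_col[OF T'(1) s(1) T'(3)] z(2)] .
      have uz': "col u z" using ln_all[OF T'(1) s(1) T'(3) s(2) sy[OF z(2)] sy[OF yz] T'(2)] sy by metis
      have tnz: "\<not> col t z" if "z \<noteq> x" using D(6)[OF t z(1)] that by metis
      have zx: "z \<noteq> x" using uz' ux by metis
      have inP': "z \<in> P" "u \<in> P" using Sy_P[OF D(1) z(1)] Sy_P[OF e(1) u(1)] .
      obtain \<sigma> where g: "\<sigma> \<in> Sy" "t \<in> \<sigma>" "z \<in> \<sigma>" "u \<in> \<sigma>"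
        using Sy_exE[OF inP(1) inP'(1,2) tnz[OF zx] u(2) uz'] .
      have gz: "\<sigma> \<noteq> \<zeta>" using g tz by metis
      have xg: "x \<in> \<sigma>"
      proof -
        obtain l c d where "c \<in> \<zeta>" "c \<in> \<sigma>" "col t c" using meet_hit[OF g(1) D(1) gz g(3) z(1) g(2)] by metis
        then show ?thesis using D(6)[OF t] by metis
      qed
      have yg: "y \<in> \<sigma>" using Sy_conv[OF g(1,4) xg ux inP(2) sy[OF u(3)] y(2)] .
      have "\<sigma> = \<eta>" using Sy_eq[OF g(1) e(1) g(2) yg e(2,3) Ty[OF t]] .
      then have "z \<in> L" using eL g z by metis
      then have "col u x" using ln_all[OF L(1) _ L(2) zy uz' u(3) L(3)] by metis
      then show False using ux by metis
    qed
    then show ?thesis using sz by metis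
  qed
  have "product_at \<zeta> y T'" unfolding product_at_def using D(1) y(1) T' out all by metis
  then show ?thesis by metis
qed

lemma product_at_all:
  assumes A: "product_at \<zeta> x T" and y: "y \<in> \<zeta>"
  shows "\<exists>T'. product_at \<zeta> y T'"
proof -
  note D = product_atD[OF A]
  have s: "\<exists>T'. product_at \<zeta> y T'" if "product_at \<zeta> x T" "y \<in> \<zeta>" "col y x" for x T y
    using product_at_step[OF that] that by metis
  show ?thesis
  proof (cases "col y x")
    case False
    obtain r where "r \<in> \<zeta>" "col r y" "col r x" using Sy_noncol_pair[OF D(1) y D(2) False] by metis
    then show ?thesis using s A y sy by metis
  qed (use s[OF A y] in metis)
qed

end

section \<open>Products of a line and a polar space\<close>

locale local_product = symps_share_line +
  fixes \<zeta> :: "'a set" and T :: "'a \<Rightarrow> 'a set"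
  assumes Z: "\<zeta> \<in> Sy" and T: "x \<in> \<zeta> \<Longrightarrow> product_at \<zeta> x (T x)"
begin

lemma fibreD:
  assumes "x \<in> \<zeta>"
  shows "T x \<in> Ln" "x \<in> T x" "\<And>t. t \<in> T x \<Longrightarrow> t \<in> \<zeta> \<Longrightarrow> t = x"
    "\<And>t z. t \<in> T x \<Longrightarrow> t \<noteq> x \<Longrightarrow> z \<in> \<zeta> \<Longrightarrow> col t z \<Longrightarrow> z = x"
    "\<And>m. m \<in> P \<Longrightarrow> col m x \<Longrightarrow> m \<in> \<zeta> \<or> m \<in> T x"
  using product_atD[OF T[OF assms]] by metis+

lemma fibre_ex: "q \<in> P \<Longrightarrow> \<exists>x. x \<in> \<zeta> \<and> q \<in> T x"
  using near_symp[OF Z, of q] fibreD(2,5) by metis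

definition proj :: "'a \<Rightarrow> 'a" where
  "proj q = (SOME x. x \<in> \<zeta> \<and> q \<in> T x)"

lemma proj: assumes "q \<in> P" shows "proj q \<in> \<zeta>" "q \<in> T (proj q)"
  using someI_ex[OF fibre_ex[OF assms]] unfolding proj_def by auto

lemma proj_col: "q \<in> P \<Longrightarrow> col q (proj q)"
  using ln_col[OF fibreD(1) _ fibreD(2)] proj by metis

lemma proj_eq: assumes "x \<in> \<zeta>" "q \<in> T x" shows "proj q = x"
proof -
  have qP: "q \<in> P" using Ln_P[OF fibreD(1)[OF assms(1)] assms(2)] .
  show ?thesis
  proof (cases "q \<in> \<zeta>")
    case True
    then show ?thesis using fibreD(3)[OF assms(1)] fibreD(3)[OF proj(1)[OF qP]] proj(2)[OF qP] assms(2) by metis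
  next
    case False
    have "q \<noteq> x" using False assms by metis
    then show ?thesis using fibreD(4)[OF assms(1,2) _ proj(1)[OF qP] proj_col[OF qP]] by metis
  qed
qed

lemma proj_self: "q \<in> \<zeta> \<Longrightarrow> proj q = q"
  using proj_eq fibreD(2) by metis

lemma proj_near: assumes "q \<in> P" "q \<notin> \<zeta>" "z \<in> \<zeta>" "col q z" shows "proj q = z"
proof -
  have "q \<noteq> proj q" using proj(1)[OF assms(1)] assms(2) by metis
  then show ?thesis using fibreD(4)[OF proj(1,2)[OF assms(1)] _ assms(3,4)] by metis
qed

text \<open>Outside \<zeta> the symp on \<open>q\<close> and \<open>proj v\<close> shares with
  \<zeta> a line through \<open>proj v\<close>. The point of this line seen by \<open>q\<close> can
  only be \<open>proj q\<close>.\<close>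

lemma proj_mono: assumes q: "q \<in> P" "v \<in> P" "col q v" shows "col (proj q) (proj v)"
proof -
  consider "q \<in> \<zeta>" "v \<in> \<zeta>" | "q \<in> \<zeta>" "v \<notin> \<zeta>" | "q \<notin> \<zeta>" "v \<in> \<zeta>" | "q \<notin> \<zeta>" "v \<notin> \<zeta>" by metis
  then show ?thesis
  proof cases
    case 4
    show ?thesis
    proof (rule ccontr)
      assume n: "\<not> ?thesis"
      have qv: "\<not> col q (proj v)" using proj_near[OF q(1) 4(1) proj(1)[OF q(2)]] n rf by metis
      have pP: "proj v \<in> P" using Sy_P[OF Z proj(1)[OF q(2)]] .
      obtain \<tau> where t: "\<tau> \<in> Sy" "q \<in> \<tau>" "proj v \<in> \<tau>" "v \<in> \<tau>"
        using Sy_exE[OF q(1) pP q(2) qv sy[OF q(3)] proj_col[OF q(2)]] .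
      have tz: "\<tau> \<noteq> \<zeta>" using t 4 by metis
      obtain l c d where l: "l \<in> Ln" "proj v \<in> l" "c \<in> l" "col q c" "c \<in> \<zeta>"
        using meet_hit[OF t(1) Z tz t(3) proj(1)[OF q(2)] t(2)] by metis
      have "proj q = c" using proj_near[OF q(1) 4(1) l(5,4)] .
      then show False using n ln_col[OF l(1,3,2)] by metis
    qed
  next
    case 1
    then show ?thesis using proj_self q by metis
  next
    case 2
    then have "proj v = q" using proj_near[OF q(2) _ _ sy[OF q(3)]] by metis
    then show ?thesis using proj_self[OF 2(1)] rf by metis
  next
    case 3
    then have "proj q = v" using proj_near[OF q(1) _ _ q(3)] by metis
    then show ?thesis using proj_self[OF 3(2)] rf by metis
  qed
qed

text \<open>Collinearity matches the fibres over collinear points. The symp on \<open>q\<close> and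
  \<open>y\<close> contains a point that sees \<open>y\<close> but not \<open>x\<close>; it cannot
  lie in \<zeta>, so it lies on \<open>T y\<close>. Hence \<open>T y\<close> is in that symp and
  \<open>q\<close> sees one of its points.\<close>

lemma fibre_match:
  assumes x: "x \<in> \<zeta>" "y \<in> \<zeta>" "col x y" "x \<noteq> y" and q: "q \<in> T x"
  shows "\<exists>v\<in>T y. col q v" and "v \<in> T y \<Longrightarrow> w \<in> T y \<Longrightarrow> col q v \<Longrightarrow> col q w \<Longrightarrow> v = w"
proof -
  note X = fibreD[OF x(1)] and Y = fibreD[OF x(2)]
  have qP: "q \<in> P" using Ln_P[OF X(1) q] .
  have inP: "x \<in> P" "y \<in> P" using Sy_P[OF Z] x by metis+
  show "\<exists>v\<in>T y. col q v"
  proof (cases "q = x")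
    case True
    then show ?thesis using Y x by metis
  next
    case False
    have qz: "q \<notin> \<zeta>" using X(3)[OF q] False by metis
    have qy: "\<not> col q y" using X(4)[OF q False x(2)] x by metis
    obtain \<tau> where t: "\<tau> \<in> Sy" "q \<in> \<tau>" "y \<in> \<tau>" "x \<in> \<tau>"
      using Sy_exE[OF qP inP(2,1) qy ln_col[OF X(1,2) q] x(3)] .
    obtain z where z: "z \<in> \<tau>" "col z y" "\<not> col z x" using polar_sep[OF Sy_polar[OF t(1)] t(3,4) x(4)[symmetric]] by metis
    have zY: "z \<in> T y"
    proof (rule ccontr)
      assume "z \<notin> T y"
      then have "z \<in> \<zeta>" using Y(5)[OF Sy_P[OF t(1) z(1)] z(2)] by metis
      then have "\<tau> = \<zeta>" using Sy_eq[OF t(1) Z z(1) t(4) _ x(1) z(3)] by metis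
      then show False using t qz by metis
    qed
    have zy: "z \<noteq> y" using z x sy by metis
    have "T y \<subseteq> \<tau>" using Sy_ln[OF t(1) Y(1) zY Y(2) z(1) t(3) zy] .
    then show ?thesis using polar_one[OF Sy_polar[OF t(1)] t(2) Y(1)] by metis
  qed
  show "v = w" if v: "v \<in> T y" "w \<in> T y" "col q v" "col q w"
  proof (rule ccontr)
    assume vw: "v \<noteq> w"
    have c: "col q e" if "e \<in> T y" for e using ln_all[OF Y(1) v(1,2) vw v(3,4) that] .
    show False
    proof (cases "q = x")
      case True
      obtain e where "e \<in> T y" "e \<noteq> y" using ln_other[OF Y(1)] by metis
      then show False using Y(4) c True x sy by metis
    next
      case False
      then show False using X(4)[OF q False x(2) c[OF Y(2)]] x by metis
    qed
  qed
qed

text \<open>The sheets are the copies \<open>{t} \<times> \<zeta>\<close> in the product to be constructed.\<close>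

definition sheet :: "'a set \<Rightarrow> bool" where
  "sheet \<sigma> \<longleftrightarrow> \<sigma> \<in> Sy \<and> (\<sigma> = \<zeta> \<or> (\<forall>s\<in>\<sigma>. s \<notin> \<zeta>))"

text \<open>A sheet other than \<zeta> contains a neighbour of \<open>x\<close> by
  \<open>near_symp\<close>. Being off \<zeta>, this neighbour is on the fibre. Two points on one
  fibre would bring \<open>x\<close> into the sheet.\<close>

lemma sheet_section:
  assumes s: "sheet \<sigma>" and x: "x \<in> \<zeta>"
  shows "\<exists>q. q \<in> \<sigma> \<and> q \<in> T x" and "q \<in> \<sigma> \<Longrightarrow> q \<in> T x \<Longrightarrow> v \<in> \<sigma> \<Longrightarrow> v \<in> T x \<Longrightarrow> q = v"
proof -
  note X = fibreD[OF x]
  have sS: "\<sigma> \<in> Sy" using s sheet_def by metis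
  show "\<exists>q. q \<in> \<sigma> \<and> q \<in> T x"
  proof (cases "\<sigma> = \<zeta>")
    case False
    then have d: "\<And>s. s \<in> \<sigma> \<Longrightarrow> s \<notin> \<zeta>" using s sheet_def by metis
    obtain q where q: "q \<in> \<sigma>" "col x q" using near_symp[OF sS Sy_P[OF Z x]] by metis
    then show ?thesis using X(5)[OF Sy_P[OF sS q(1)] sy[OF q(2)]] d by metis
  qed (use X x in metis)
  show "q = v" if q: "q \<in> \<sigma>" "q \<in> T x" "v \<in> \<sigma>" "v \<in> T x"
  proof (cases "\<sigma> = \<zeta>")
    case True
    then show ?thesis using X(3) q by metis
  next
    case False
    then have "x \<notin> \<sigma>" using s x sheet_def by metis
    then show ?thesis using Sy_lnD[OF sS X(1) q(2,4,1,3) _ X(2)] by metis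
  qed
qed

text \<open>Over noncollinear neighbours \<open>a\<close>, \<open>b\<close> of
  \<open>x = proj q\<close> lie points \<open>u\<close>, \<open>v\<close> matched to
  \<open>q\<close>. They span a symp through \<open>q\<close>. If it contained \<open>x\<close>, it
  would contain \<open>a\<close> and \<open>b\<close> and equal \<zeta>; if it met \<zeta> at all,
  \<open>q\<close> would see a common point, which is \<open>x\<close>.\<close>

lemma sheet_ex:
  assumes q: "q \<in> P"
  shows "\<exists>\<sigma>. sheet \<sigma> \<and> q \<in> \<sigma>"
proof (cases "q \<in> \<zeta>")
  case False
  define x where "x = proj q"
  have x: "x \<in> \<zeta>" "q \<in> T x" using proj[OF q] x_def by auto
  obtain a b where ab: "a \<in> \<zeta>" "b \<in> \<zeta>" "col a x" "col b x" "\<not> col a b" using Sy_two[OF Z x(1)] .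
  have abx: "a \<noteq> x" "b \<noteq> x" using ab sy by metis+
  obtain u where u: "u \<in> T a" "col q u" using fibre_match(1)[OF x(1) ab(1) sy[OF ab(3)] abx(1)[symmetric] x(2)] by metis
  obtain v where v: "v \<in> T b" "col q v" using fibre_match(1)[OF x(1) ab(2) sy[OF ab(4)] abx(2)[symmetric] x(2)] by metis
  have uvP: "u \<in> P" "v \<in> P" using Ln_P[OF fibreD(1)] u v ab by metis+
  have uv: "\<not> col u v" using proj_mono[OF uvP] proj_eq ab u v by metis
  obtain \<sigma> where s: "\<sigma> \<in> Sy" "u \<in> \<sigma>" "v \<in> \<sigma>" "q \<in> \<sigma>" using Sy_exE[OF uvP q uv u(2) v(2)] .
  have qx: "q \<noteq> x" using False x by metis
  have xs: "x \<notin> \<sigma>"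
  proof
    assume xs: "x \<in> \<sigma>"
    have "c \<in> \<sigma>" if c: "c \<in> \<zeta>" "col c x" "c \<noteq> x" "w \<in> T c" "w \<in> \<sigma>" "col q w" for c w
    proof -
      have "\<not> col x w"
      proof
        assume xw: "col x w"
        have "w = c" using fibre_match(2)[OF x(1) c(1) sy[OF c(2)] c(3)[symmetric] fibreD(2)[OF x(1)] c(4) fibreD(2)[OF c(1)] xw sy[OF c(2)]] .
        then have "proj q = c" using proj_near[OF q False c(1)] c by metis
        then show False using c x_def by metis
      qed
      then show ?thesis using Sy_conv[OF s(1) xs c(5) _ Sy_P[OF Z c(1)] c(2) ln_col[OF fibreD(1)[OF c(1)] fibreD(2)[OF c(1)] c(4)]] by metis
    qed
    then have "a \<in> \<sigma>" "b \<in> \<sigma>" using ab abx u v s by metis+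
    then have "\<sigma> = \<zeta>" using Sy_eq[OF s(1) Z _ _ ab(1,2,5)] by metis
    then show False using s False by metis
  qed
  have sz: "\<sigma> \<noteq> \<zeta>" using s False by metis
  have "w \<notin> \<zeta>" if w: "w \<in> \<sigma>" for w
  proof
    assume wz: "w \<in> \<zeta>"
    obtain l c d where "c \<in> \<sigma>" "c \<in> \<zeta>" "col q c" using meet_hit[OF s(1) Z sz w wz s(4)] by metis
    then show False using proj_near[OF q False] xs x_def by metis
  qed
  then show ?thesis using s sheet_def by metis
qed (use Z sheet_def in metis)

text \<open>The symp through \<open>q\<close> and \<open>proj v\<close> shares a line with \<sigma>.
  The point of this line seen by \<open>proj v\<close> is on the fibre of \<open>v\<close>, and
  uniqueness in \<open>fibre_match\<close> identifies it with \<open>v\<close>.\<close>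

lemma sheet_closed:
  assumes s: "sheet \<sigma>" "q \<in> \<sigma>" "q \<notin> \<zeta>" and v: "v \<in> P" "col v q" "v \<notin> T (proj q)"
  shows "v \<in> \<sigma>"
proof -
  have sS: "\<sigma> \<in> Sy" and d: "\<And>s. s \<in> \<sigma> \<Longrightarrow> s \<notin> \<zeta>" using s sheet_def by metis+
  have qP: "q \<in> P" using Sy_P[OF sS s(2)] .
  have vz: "v \<notin> \<zeta>" using proj_near[OF qP s(3) _ sy[OF v(2)]] v fibreD(2) by metis
  have xy: "proj q \<noteq> proj v" using proj[OF v(1)] v by metis
  have x: "proj q \<in> \<zeta>" "proj v \<in> \<zeta>" using proj qP v by metis+
  have xyc: "col (proj q) (proj v)" using proj_mono[OF qP v(1) sy[OF v(2)]] .
  have qy: "\<not> col q (proj v)" using proj_near[OF qP s(3) x(2)] xy by metis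
  obtain \<eta> where e: "\<eta> \<in> Sy" "q \<in> \<eta>" "proj v \<in> \<eta>" "proj q \<in> \<eta>"
    using Sy_exE[OF qP Sy_P[OF Z x(2)] Sy_P[OF Z x(1)] qy sy[OF proj_col[OF qP]] xyc] .
  have es: "\<eta> \<noteq> \<sigma>" using e d x by metis
  obtain l c d0 where l: "l \<in> Ln" "q \<in> l" "c \<in> l" "col (proj v) c" "c \<in> \<sigma>"
    using meet_hit[OF e(1) sS es e(2) s(2) e(3)] by metis
  have cT: "c \<in> T (proj v)" using fibreD(5)[OF x(2) Sy_P[OF sS l(5)] sy[OF l(4)]] d[OF l(5)] by metis
  have "c = v" using fibre_match(2)[OF x xyc xy proj(2)[OF qP] cT proj(2)[OF v(1)] ln_col[OF l(1-3)] sy[OF v(2)]] .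
  then show ?thesis using l by metis
qed

lemma sheet_uniq:
  assumes s: "sheet \<sigma>" "sheet \<sigma>'" and q: "q \<in> \<sigma>" "q \<in> \<sigma>'"
  shows "\<sigma> = \<sigma>'"
proof (cases "q \<in> \<zeta>")
  case False
  have sS: "\<sigma> \<in> Sy" "\<sigma>' \<in> Sy" using s sheet_def by metis+
  have qP: "q \<in> P" using Sy_P sS q by metis
  obtain a b where ab: "a \<in> \<sigma>" "b \<in> \<sigma>" "col a q" "col b q" "\<not> col a b" using Sy_two[OF sS(1) q(1)] .
  have "a \<notin> T (proj q)" "b \<notin> T (proj q)"
    using sheet_section(2)[OF s(1) proj(1)[OF qP] _ _ q(1) proj(2)[OF qP]] ab sy by metis+
  then have "a \<in> \<sigma>'" "b \<in> \<sigma>'" using sheet_closed[OF s(2) q(2) False] Sy_P[OF sS(1)] ab by metis+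
  then show ?thesis using Sy_eq[OF sS ab(1,2) _ _ ab(5)] by metis
qed (use assms sheet_def in metis)

text \<open>The coordinate along the reference fibre \<open>T x0\<close>: the point where the sheet
  through \<open>q\<close> crosses it.\<close>

definition level :: "'a \<Rightarrow> 'a \<Rightarrow> 'a" where
  "level x0 q = (SOME t. t \<in> T x0 \<and> (\<exists>\<sigma>. sheet \<sigma> \<and> q \<in> \<sigma> \<and> t \<in> \<sigma>))"

lemma level:
  assumes x0: "x0 \<in> \<zeta>" and q: "q \<in> P"
  shows "level x0 q \<in> T x0" "\<exists>\<sigma>. sheet \<sigma> \<and> q \<in> \<sigma> \<and> level x0 q \<in> \<sigma>"
proof -
  obtain \<sigma> where s: "sheet \<sigma>" "q \<in> \<sigma>" using sheet_ex[OF q] by metis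
  obtain t where "t \<in> \<sigma>" "t \<in> T x0" using sheet_section(1)[OF s(1) x0] by metis
  then have "\<exists>t. t \<in> T x0 \<and> (\<exists>\<sigma>. sheet \<sigma> \<and> q \<in> \<sigma> \<and> t \<in> \<sigma>)" using s by metis
  from someI_ex[OF this] show "level x0 q \<in> T x0" "\<exists>\<sigma>. sheet \<sigma> \<and> q \<in> \<sigma> \<and> level x0 q \<in> \<sigma>"
    unfolding level_def by auto
qed

lemma level_eq:
  assumes x0: "x0 \<in> \<zeta>" and s: "sheet \<sigma>" "q \<in> \<sigma>" "t \<in> \<sigma>" "t \<in> T x0"
  shows "level x0 q = t"
proof -
  have "q \<in> P" using s Sy_P sheet_def by metis
  then show ?thesis using level[OF x0] sheet_uniq[OF s(1) _ s(2)] sheet_section(2)[OF s(1) x0 _ _ s(3,4)] by metis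
qed

lemma level_sheet:
  assumes x0: "x0 \<in> \<zeta>" and q: "q \<in> P" "v \<in> P" "level x0 q = level x0 v" and s: "sheet \<sigma>" "q \<in> \<sigma>"
  shows "v \<in> \<sigma>"
  using level(2)[OF x0 q(1)] level(2)[OF x0 q(2)] q(3) sheet_uniq s by metis

text \<open>One symp contains both \<open>N\<close> and the line \<open>L\<close> joining two
  projections. One-or-all in that symp, used from \<open>N\<close> to \<open>L\<close> and back,
  shows that \<open>proj\<close> maps \<open>N\<close> onto \<open>L\<close>.\<close>

lemma line_in_sheet:
  assumes N: "N \<in> Ln" and no: "\<And>z. z \<in> \<zeta> \<Longrightarrow> N \<noteq> T z"
  shows "\<exists>\<sigma>. sheet \<sigma> \<and> N \<subseteq> \<sigma>" and "proj ` N \<in> Ln \<and> proj ` N \<subseteq> \<zeta>"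
proof -
  have NP: "\<And>n. n \<in> N \<Longrightarrow> n \<in> P" using Ln_P N by metis
  show "\<exists>\<sigma>. sheet \<sigma> \<and> N \<subseteq> \<sigma>"
  proof (cases "N \<subseteq> \<zeta>")
    case False
    then obtain q where q: "q \<in> N" "q \<notin> \<zeta>" by auto
    have qP: "q \<in> P" using NP q by metis
    obtain \<sigma> where s: "sheet \<sigma>" "q \<in> \<sigma>" using sheet_ex[OF qP] by metis
    have "v \<in> \<sigma>" if v: "v \<in> N" for v
    proof (cases "v = q")
      case False
      have "v \<notin> T (proj q)"
        using ln_uniq[OF N fibreD(1)[OF proj(1)[OF qP]] v q(1) _ proj(2)[OF qP] False] no proj(1)[OF qP] by metis
      then show ?thesis using sheet_closed[OF s q(2) NP[OF v] ln_col[OF N v q(1)]] by metis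
    qed (use s in metis)
    then show ?thesis using s by auto
  qed (use Z sheet_def in metis)
  then obtain \<sigma> where s: "sheet \<sigma>" "N \<subseteq> \<sigma>" by metis
  show "proj ` N \<in> Ln \<and> proj ` N \<subseteq> \<zeta>"
  proof (cases "\<sigma> = \<zeta>")
    case True
    have "proj ` N = N"
    proof -
      have "proj n = n" if "n \<in> N" for n using proj_self that s True by auto
      then show ?thesis by (simp cong: image_cong)
    qed
    then show ?thesis using N s True by metis
  next
    case False
    have d: "n \<notin> \<zeta>" if "n \<in> N" for n using that s False unfolding sheet_def by auto
    obtain q where q: "q \<in> N" using ln_other N by metis
    obtain v where v: "v \<in> N" "v \<noteq> q" using ln_other N by metis
    have qP: "q \<in> P" and vP: "v \<in> P" using NP q v by metis+
    have vT: "v \<notin> T (proj q)"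
      using ln_uniq[OF N fibreD(1)[OF proj(1)[OF qP]] v(1) q _ proj(2)[OF qP] v(2)] no proj(1)[OF qP] by metis
    have xy: "proj q \<noteq> proj v" using proj[OF vP] vT by metis
    have x: "proj q \<in> \<zeta>" "proj v \<in> \<zeta>" using proj qP vP by metis+
    have xyc: "col (proj q) (proj v)" using proj_mono[OF qP vP ln_col[OF N q v(1)]] .
    have qy: "\<not> col q (proj v)" using proj_near[OF qP d[OF q] x(2)] xy by metis
    obtain \<eta> where e: "\<eta> \<in> Sy" "q \<in> \<eta>" "proj v \<in> \<eta>" "proj q \<in> \<eta>"
      using Sy_exE[OF qP Sy_P[OF Z x(2)] Sy_P[OF Z x(1)] qy sy[OF proj_col[OF qP]] xyc] .
    have ve: "v \<in> \<eta>" using Sy_conv[OF e(1-3) qy vP ln_col[OF N v(1) q] proj_col[OF vP]] .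
    have Ne: "N \<subseteq> \<eta>" using Sy_ln[OF e(1) N v(1) q ve e(2) v(2)] .
    obtain L where L: "L \<in> Ln" "proj q \<in> L" "proj v \<in> L" "L \<subseteq> \<zeta>" using line_through[OF Z x xy xyc] .
    have Le: "L \<subseteq> \<eta>" using Sy_ln[OF e(1) L(1-3) e(4,3) xy] .
    have "proj n \<in> L" if n: "n \<in> N" for n
    proof -
      have ne: "n \<in> \<eta>" using n Ne by auto
      obtain c where c: "c \<in> L" "col n c" using polar_one[OF Sy_polar[OF e(1)] ne L(1) Le] by metis
      have "c \<in> \<zeta>" using c L by auto
      then show ?thesis using proj_near[OF NP[OF n] d[OF n] _ c(2)] c by metis
    qed
    moreover have "l \<in> proj ` N" if l: "l \<in> L" for l
    proof -
      have le: "l \<in> \<eta>" and lz: "l \<in> \<zeta>" using l Le L by auto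
      obtain n where n: "n \<in> N" "col l n" using polar_one[OF Sy_polar[OF e(1)] le N Ne] by metis
      have "proj n = l" using proj_near[OF NP[OF n(1)] d[OF n(1)] lz sy[OF n(2)]] .
      then show ?thesis using n by auto
    qed
    ultimately have "proj ` N = L" by auto
    then show ?thesis using L by metis
  qed
qed

text \<open>A sheet and a fibre cross in exactly one point, so the sheet and the fibre through a
  point are its coordinates. Lines are fibres or lie in sheets.\<close>

lemma product_iso:
  assumes x0: "x0 \<in> \<zeta>"
  shows "\<exists>f. bij_betw f P (T x0 \<times> \<zeta>) \<and>
    (`) f ` Ln = {{p} \<times> M | p M. p \<in> T x0 \<and> M \<in> Ln \<and> M \<subseteq> \<zeta>} \<union> {T x0 \<times> {q} | q. q \<in> \<zeta>}"
proof -
  define f where "f q = (level x0 q, proj q)" for q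
  have inj: "inj_on f P"
  proof (rule inj_onI)
    fix q v assume q: "q \<in> P" "v \<in> P" "f q = f v"
    then have e: "level x0 q = level x0 v" "proj q = proj v" unfolding f_def by auto
    obtain \<sigma> where s: "sheet \<sigma>" "q \<in> \<sigma>" using sheet_ex[OF q(1)] by metis
    have "v \<in> \<sigma>" using level_sheet[OF x0 q(1,2) e(1) s] .
    then show "q = v" using sheet_section(2)[OF s(1) proj(1)[OF q(1)] s(2) proj(2)[OF q(1)]] proj(2)[OF q(2)] e by metis
  qed
  have hit: "\<exists>q\<in>P. q \<in> T z \<and> q \<in> \<sigma> \<and> f q = (t, z)" if t: "t \<in> T x0" "z \<in> \<zeta>" "sheet \<sigma>" "t \<in> \<sigma>" for t z \<sigma>
  proof -
    obtain q where q: "q \<in> \<sigma>" "q \<in> T z" using sheet_section(1)[OF t(3,2)] by metis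
    have "q \<in> P" using Ln_P[OF fibreD(1)[OF t(2)] q(2)] .
    then show ?thesis using level_eq[OF x0 t(3) q(1) t(4,1)] proj_eq[OF t(2) q(2)] q f_def by metis
  qed
  have T0P: "t \<in> P" if "t \<in> T x0" for t using Ln_P[OF fibreD(1)[OF x0] that] .
  have img: "f ` P = T x0 \<times> \<zeta>"
  proof
    show "f ` P \<subseteq> T x0 \<times> \<zeta>" using level(1)[OF x0] proj(1) unfolding f_def by auto
    show "T x0 \<times> \<zeta> \<subseteq> f ` P"
    proof
      fix w assume "w \<in> T x0 \<times> \<zeta>"
      then obtain t z where w: "w = (t, z)" "t \<in> T x0" "z \<in> \<zeta>" by auto
      obtain \<sigma> where "sheet \<sigma>" "t \<in> \<sigma>" using sheet_ex[OF T0P[OF w(2)]] by metis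
      then obtain q where "q \<in> P" "f q = w" using hit w by metis
      then show "w \<in> f ` P" by auto
    qed
  qed
  have fib: "f ` T z = T x0 \<times> {z}" if z: "z \<in> \<zeta>" for z
  proof
    show "f ` T z \<subseteq> T x0 \<times> {z}"
      using level(1)[OF x0] Ln_P[OF fibreD(1)[OF z]] proj_eq[OF z] unfolding f_def by auto
    show "T x0 \<times> {z} \<subseteq> f ` T z"
    proof
      fix w assume "w \<in> T x0 \<times> {z}"
      then obtain t where w: "w = (t, z)" "t \<in> T x0" by auto
      obtain \<sigma> where "sheet \<sigma>" "t \<in> \<sigma>" using sheet_ex[OF T0P[OF w(2)]] by metis
      then obtain q where "q \<in> T z" "f q = w" using hit w z by metis
      then show "w \<in> f ` T z" by auto
    qed
  qed
  have hor: "\<exists>t\<in>T x0. f ` N = {t} \<times> proj ` N" if N: "N \<in> Ln" "\<And>z. z \<in> \<zeta> \<Longrightarrow> N \<noteq> T z" for N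
  proof -
    obtain \<sigma> where s: "sheet \<sigma>" "N \<subseteq> \<sigma>" using line_in_sheet(1)[OF N] by metis
    obtain t where t: "t \<in> \<sigma>" "t \<in> T x0" using sheet_section(1)[OF s(1) x0] by metis
    have "level x0 n = t" if "n \<in> N" for n using level_eq[OF x0 s(1) _ t] that s by auto
    then have "f ` N = {t} \<times> proj ` N" unfolding f_def by auto
    then show ?thesis using t by metis
  qed
  have lines: "(`) f ` Ln = {{p} \<times> M | p M. p \<in> T x0 \<and> M \<in> Ln \<and> M \<subseteq> \<zeta>} \<union> {T x0 \<times> {q} | q. q \<in> \<zeta>}"
    (is "?A = ?B \<union> ?C")
  proof
    show "?A \<subseteq> ?B \<union> ?C"
    proof
      fix W assume "W \<in> ?A"
      then obtain N where N: "N \<in> Ln" "W = f ` N" by auto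
      show "W \<in> ?B \<union> ?C"
      proof (cases "\<exists>z\<in>\<zeta>. N = T z")
        case True
        then obtain z where z: "z \<in> \<zeta>" "N = T z" by metis
        then have "W = T x0 \<times> {z}" using fib N by metis
        then show ?thesis using z by auto
      next
        case False
        then obtain t where t: "t \<in> T x0" "f ` N = {t} \<times> proj ` N" using hor[OF N(1)] by metis
        have "proj ` N \<in> Ln \<and> proj ` N \<subseteq> \<zeta>" using line_in_sheet(2)[OF N(1)] False by metis
        then have "W \<in> ?B" unfolding N(2) t(2) using t(1) by auto
        then show ?thesis by (rule UnI1)
      qed
    qed
    show "?B \<union> ?C \<subseteq> ?A"
    proof
      fix W assume "W \<in> ?B \<union> ?C"
      then consider p M where "W = {p} \<times> M" "p \<in> T x0" "M \<in> Ln" "M \<subseteq> \<zeta>" | q where "W = T x0 \<times> {q}" "q \<in> \<zeta>" by auto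
      then show "W \<in> ?A"
      proof cases
        case 1
        \<comment> \<open>The preimage of a horizontal line joins the point at level
          \<open>p\<close> over \<open>x\<close> to its match over a second point \<open>y\<close>
          of \<open>M\<close>.\<close>
        obtain x where x: "x \<in> M" using ln_other 1 by metis
        obtain y where y: "y \<in> M" "y \<noteq> x" using ln_other 1 by metis
        have xyz: "x \<in> \<zeta>" "y \<in> \<zeta>" using x y 1 by auto
        have xy: "col x y" using ln_col[OF 1(3) x y(1)] .
        obtain \<sigma> where s: "sheet \<sigma>" "p \<in> \<sigma>" using sheet_ex[OF T0P[OF 1(2)]] by metis
        obtain q where q: "q \<in> P" "q \<in> T x" "q \<in> \<sigma>" "f q = (p, x)" using hit[OF 1(2) xyz(1) s] by metis
        obtain v where v: "v \<in> T y" "col q v" using fibre_match(1)[OF xyz xy y(2)[symmetric] q(2)] by metis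
        have vP: "v \<in> P" using Ln_P[OF fibreD(1)[OF xyz(2)] v(1)] .
        have pq: "proj q = x" "proj v = y" using proj_eq xyz q v by metis+
        have qv: "q \<noteq> v" using pq y by metis
        obtain N where N: "N \<in> Ln" "q \<in> N" "v \<in> N" using pair_line[OF q(1) vP v(2) qv] .
        have no: "N \<noteq> T z" if "z \<in> \<zeta>" for z
          using proj_eq[OF that] N pq y by metis
        obtain t where t: "t \<in> T x0" "f ` N = {t} \<times> proj ` N" using hor[OF N(1) no] by metis
        have pN: "proj ` N \<in> Ln" using line_in_sheet(2)[OF N(1) no] by metis
        have "x \<in> proj ` N" "y \<in> proj ` N" using N pq by auto
        then have NM: "proj ` N = M" using ln_uniq[OF pN 1(3) _ _ x y(1)] y by metis
        have "(p, x) \<in> {t} \<times> M" using q N t NM by (metis imageI)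
        then have "W = f ` N" using t NM 1 by auto
        then show ?thesis using N by auto
      next
        case 2
        then have "W = f ` T q" using fib by metis
        then show ?thesis using fibreD(1)[OF 2(2)] by auto
      qed
    qed
  qed
  have "bij_betw f P (T x0 \<times> \<zeta>)" using inj img unfolding bij_betw_def by metis
  then show ?thesis using lines by metis
qed

end

lemma (in symps_share_line) product_at_iso:
  assumes "product_at \<zeta> x T"
  shows "\<exists>T f. T \<in> Ln \<and> \<zeta> \<in> Sy \<and> bij_betw f P (T \<times> \<zeta>) \<and>
    (`) f ` Ln = {{p} \<times> M | p M. p \<in> T \<and> M \<in> Ln \<and> M \<subseteq> \<zeta>} \<union> {T \<times> {q} | q. q \<in> \<zeta>}"
proof -
  note D = product_atD[OF assms]
  define F where "F y = (SOME T'. product_at \<zeta> y T')" for y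
  have F: "product_at \<zeta> y (F y)" if "y \<in> \<zeta>" for y
    using someI_ex[OF product_at_all[OF assms that]] unfolding F_def .
  have ps: "local_product col Ln P Sy \<zeta> F"
    by (rule local_product.intro[OF symps_share_line_axioms local_product_axioms.intro[OF D(1) F]])
  interpret local_product col Ln P Sy \<zeta> F by (rule ps)
  obtain f where "bij_betw f P (F x \<times> \<zeta>) \<and>
    (`) f ` Ln = {{p} \<times> M | p M. p \<in> F x \<and> M \<in> Ln \<and> M \<subseteq> \<zeta>} \<union> {F x \<times> {q} | q. q \<in> \<zeta>}"
    using product_iso[OF D(2)] by (rule exE)
  with fibreD(1)[OF D(2)] D(1) have "F x \<in> Ln \<and> \<zeta> \<in> Sy \<and> bij_betw f P (F x \<times> \<zeta>) \<and>
    (`) f ` Ln = {{p} \<times> M | p M. p \<in> F x \<and> M \<in> Ln \<and> M \<subseteq> \<zeta>} \<union> {F x \<times> {q} | q. q \<in> \<zeta>}"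
    by (intro conjI) (elim conjE; assumption)+
  then show ?thesis by (intro exI)
qed

lemma (in symps_share_line) setting_product_at:
  assumes S: "setting \<xi> \<zeta> x k t"
  shows "\<exists>T. product_at \<zeta> x T"
proof -
  note D = settingD[OF S]
  obtain T where T: "T \<in> Ln" "t \<in> T" "x \<in> T" using pair_line[OF D(18,16,10,14)] .
  have out: "s \<notin> \<zeta>" if "s \<in> T" "s \<noteq> x" for s
    using Sy_lnD[OF D(12) T(1) that(1) T(3) _ D(5) that(2) T(2)] D(11) by metis
  have far: "z = x" if s: "s \<in> T" "s \<noteq> x" "z \<in> \<zeta>" "col s z" for s z
  proof -
    have sx: "col s x" using ln_col[OF T(1) s(1) T(3)] .
    have sP: "s \<in> P" using Ln_P[OF T(1) s(1)] .
    have "col z x" using Sy_perp_clique[OF D(12) sP out[OF s(1,2)] s(3) D(5) s(4) sx] .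
    then show ?thesis using setting_far[OF S sP sx out[OF s(1,2)] s(3) _ s(4)] by metis
  qed
  have "m \<in> \<zeta> \<or> m \<in> T" if "m \<in> P" "col m x" for m
    using setting_lines[OF S T that] by metis
  then have "product_at \<zeta> x T" unfolding product_at_def using D(12,5) T out far by metis
  then show ?thesis by metis
qed

section \<open>The quadrangle of maximal cliques\<close>

locale quadrangle_symps = symp_space_rank2 +
  assumes G: "\<eta> \<in> Sy \<Longrightarrow> p \<in> P \<Longrightarrow> p \<notin> \<eta> \<Longrightarrow> x \<in> \<eta> \<Longrightarrow> col p x \<Longrightarrow> \<exists>x'\<in>\<eta>. x' \<noteq> x \<and> col p x'"
    and qconn: "S \<subseteq> P \<Longrightarrow> s \<in> S \<Longrightarrow> (\<And>p q. p \<in> S \<Longrightarrow> q \<in> P \<Longrightarrow> col q p \<Longrightarrow> q \<in> S) \<Longrightarrow> S = P"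
begin

text \<open>Let \<open>r\<close> link \<open>p\<close> to \<open>q\<close> and let \<open>q'\<close>
  be next to \<open>q\<close>. If \<open>p\<close> is off the symp on \<open>r\<close> and
  \<open>q'\<close>, then \<open>G\<close> gives it a second neighbour \<open>r'\<close> there. It
  sees the whole line \<open>rr'\<close>, and \<open>q'\<close> sees a point of that line.\<close>

lemma common_nbr:
  assumes p: "p \<in> P" and q: "q \<in> P"
  shows "\<exists>r\<in>P. col r p \<and> col r q"
proof -
  let ?S = "{q \<in> P. \<exists>r\<in>P. col r p \<and> col r q}"
  have "?S = P"
  proof (rule qconn)
    show "p \<in> ?S" using p rf by blast
  next
    show "?S \<subseteq> P" by auto
  next
    fix q q' assume "q \<in> ?S" and q': "q' \<in> P" "col q' q"
    then obtain r where r: "q \<in> P" "r \<in> P" "col r p" "col r q" by auto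
    have "\<exists>r\<in>P. col r p \<and> col r q'"
    proof (cases "col r q'")
      case False
      obtain \<tau> where t: "\<tau> \<in> Sy" "r \<in> \<tau>" "q' \<in> \<tau>" "q \<in> \<tau>"
        using Sy_exE[OF r(2) q'(1) r(1) False sy[OF r(4)] sy[OF q'(2)]] .
      have tP: "c \<in> P" if "c \<in> \<tau>" for c using Sy_P[OF t(1) that] .
      show ?thesis
      proof (cases "p \<in> \<tau>")
        case True
        then show ?thesis using Sy_noncol_pair[OF t(1) True t(3)] tP p rf by metis
      next
        case False
        obtain r' where r': "r' \<in> \<tau>" "r' \<noteq> r" "col p r'" using G[OF t(1) p False t(2) sy[OF r(3)]] by metis
        have "col r r'" using Sy_perp_clique[OF t(1) p False t(2) r'(1) sy[OF r(3)] r'(3)] .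
        then obtain l c where l: "l \<in> Ln" "r \<in> l" "r' \<in> l" "c \<in> l" "col q' c" "c \<in> \<tau>"
          using Sy_hit[OF t(1,3,2) r'(1) r'(2)[symmetric]] by metis
        have "col p c" using ln_all[OF l(1-3) r'(2)[symmetric] sy[OF r(3)] r'(3) l(4)] .
        then show ?thesis using l(5) sy tP[OF l(6)] by metis
      qed
    qed (use r in metis)
    then show "q' \<in> ?S" using q' by auto
  qed
  then show ?thesis using q by auto
qed

lemma max_clique_two: "max_clique S \<Longrightarrow> \<exists>s\<in>S. s \<noteq> p"
  unfolding max_clique_def using sy rf by (metis (mono_tags, lifting) mem_Collect_eq)

text \<open>If the chosen \<open>s\<close> in \<open>S\<close> is off \<xi>, then \<open>G\<close>
  gives it a second neighbour \<open>a\<close> in \<xi>, which \<open>S\<close> absorbs. Rank 2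
  reduces the intersection with \<xi> to the line \<open>ap\<close>.\<close>

lemma max_clique_symp_line:
  assumes x: "\<xi> \<in> Sy" "p \<in> \<xi>" and S: "max_clique S" "p \<in> S"
  shows "\<exists>l\<in>Ln. p \<in> l \<and> l = S \<inter> \<xi>"
proof -
  obtain s where s: "s \<in> S" "s \<noteq> p" using max_clique_two[OF S(1)] by metis
  have symp_space: "col s p" using max_clique_col[OF S(1) s(1) S(2)] .
  have sP: "s \<in> P" using max_clique_P[OF S(1) s(1)] .
  obtain a where a: "a \<in> S" "a \<in> \<xi>" "a \<noteq> p"
  proof (cases "s \<in> \<xi>")
    case False
    obtain a where a: "a \<in> \<xi>" "a \<noteq> p" "col s a" using G[OF x(1) sP False x(2) symp_space] by metis
    have "col a p" using Sy_perp_clique[OF x(1) sP False a(1) x(2) a(3) symp_space] .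
    then have "a \<in> S" using max_clique_in[OF S(1) s(1) S(2) s(2) Sy_P[OF x(1) a(1)] sy[OF a(3)]] by metis
    then show ?thesis using a that by metis
  qed (use s that in metis)
  have ap: "col a p" using max_clique_col[OF S(1) a(1) S(2)] .
  obtain l where l: "l \<in> Ln" "a \<in> l" "p \<in> l" "l \<subseteq> \<xi>" using polar_line[OF Sy_polar[OF x(1)] a(2) x(2) a(3) ap] .
  have "l \<subseteq> S" using max_clique_ln[OF S(1) a(1) S(2) a(3) l(1-3)] .
  moreover have "c \<in> l" if "c \<in> S" "c \<in> \<xi>" for c
    using rank2_triangle[OF x(1) l(1-3) a(3,2) x(2) that(2)] max_clique_col[OF S(1) that(1)] a S by metis
  ultimately have "l = S \<inter> \<xi>" using l(4) by blast
  then show ?thesis using l(1,3) by metis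
qed

text \<open>The existence half of the quadrangle axiom. By \<open>common_nbr\<close> some symp
  contains \<open>p\<close> and a point of \<open>S\<close>, so it contains a line of
  \<open>S\<close>, on which \<open>p\<close> sees a point.\<close>

lemma max_clique_hit:
  assumes S: "max_clique S" and p: "p \<in> P"
  shows "\<exists>q\<in>S. col p q"
proof -
  obtain a where a: "a \<in> S" using max_clique_two[OF S] by metis
  have aP: "a \<in> P" using max_clique_P[OF S a] .
  show ?thesis
  proof (cases "col p a")
    case False
    obtain r where r: "r \<in> P" "col r p" "col r a" using common_nbr[OF p aP] by metis
    obtain \<xi> where x: "\<xi> \<in> Sy" "p \<in> \<xi>" "a \<in> \<xi>" using Sy_exE[OF p aP r(1) False r(2,3)] .
    obtain l where l: "l \<in> Ln" "l = S \<inter> \<xi>" using max_clique_symp_line[OF x(1,3) S a] by metis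
    have lx: "l \<subseteq> \<xi>" "l \<subseteq> S" using l by auto
    show ?thesis using polar_one[OF Sy_polar[OF x(1)] x(2) l(1) lx(1)] lx(2) by (metis subsetD)
  qed (use a in metis)
qed

text \<open>A neighbour \<open>q\<close> of \<open>p\<close> in the maximal clique on
  \<open>a\<close> and \<open>b\<close> is a common neighbour of \<open>p\<close>, \<open>a\<close>
  and of \<open>p\<close>, \<open>b\<close>. Convexity puts \<open>q\<close> in both symps, and
  \<open>pq\<close> is the common line.\<close>

lemma imbrex:
  assumes x: "\<xi> \<in> Sy" "\<zeta> \<in> Sy" "p \<in> \<xi>" "p \<in> \<zeta>" and L: "L \<in> Ln" "a \<in> L" "b \<in> L"
    and a: "a \<in> \<xi>" "\<not> col a p" and b: "b \<in> \<zeta>" "\<not> col b p"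
  shows "\<exists>K\<in>Ln. K \<subseteq> \<xi> \<and> K \<subseteq> \<zeta>"
proof -
  have inP: "a \<in> P" "b \<in> P" "p \<in> P" using Ln_P[OF L(1)] L Sy_P[OF x(1,3)] by metis+
  have "\<exists>q\<in>P. col p q \<and> col q a \<and> col q b"
  proof (cases "a = b")
    case True
    obtain r where "r \<in> \<xi>" "col r a" "col r p" using Sy_noncol_pair[OF x(1) a(1) x(3) a(2)] by metis
    then show ?thesis using True sy Sy_P[OF x(1)] by metis
  next
    case False
    have m: "max_clique {c \<in> P. col c a \<and> col c b}" using max_cliqueI[OF inP(1,2) False ln_col[OF L]] .
    show ?thesis using max_clique_hit[OF m inP(3)] by auto
  qed
  then obtain q where q: "q \<in> P" "col p q" "col q a" "col q b" by metis
  have qx: "q \<in> \<xi>" using Sy_conv[OF x(1) a(1) x(3) a(2) q(1,3) sy[OF q(2)]] .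
  have qz: "q \<in> \<zeta>" using Sy_conv[OF x(2) b(1) x(4) b(2) q(1,4) sy[OF q(2)]] .
  have qp: "p \<noteq> q" using q a sy by metis
  obtain l where l: "l \<in> Ln" "p \<in> l" "q \<in> l" "l \<subseteq> \<xi>" using polar_line[OF Sy_polar[OF x(1)] x(3) qx qp q(2)] .
  have "l \<subseteq> \<zeta>" using Sy_ln[OF x(2) l(1-3) x(4) qz qp] .
  then show ?thesis using l by metis
qed

lemma max_clique_eq:
  assumes S: "max_clique S" "max_clique S'" and ab: "a \<in> S" "b \<in> S" "a \<in> S'" "b \<in> S'" "a \<noteq> b"
  shows "S = S'"
proof
  show "S \<subseteq> S'" using max_clique_in[OF S(2) ab(3-5) max_clique_P[OF S(1)]] max_clique_col[OF S(1)] ab by (metis subsetI)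
  show "S' \<subseteq> S" using max_clique_in[OF S(1) ab(1,2,5) max_clique_P[OF S(2)]] max_clique_col[OF S(2)] ab by (metis subsetI)
qed

lemma max_clique_ex:
  assumes "a \<in> P" "b \<in> P" "a \<noteq> b" "col a b"
  obtains S where "max_clique S" "a \<in> S" "b \<in> S"
  by (rule that[OF max_cliqueI[OF assms]]) (use assms sy[OF assms(4)] in auto)

lemma max_clique_two_at:
  assumes p: "p \<in> P"
  shows "\<exists>S S'. max_clique S \<and> max_clique S' \<and> S \<noteq> S' \<and> p \<in> S \<and> p \<in> S'"
proof -
  obtain \<xi> where x: "\<xi> \<in> Sy" "p \<in> \<xi>" using P_Sy[OF p] by metis
  obtain c d where c: "c \<in> \<xi>" "d \<in> \<xi>" "col c p" "col d p" "\<not> col c d" using Sy_two[OF x] .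
  have ne: "c \<noteq> p" "d \<noteq> p" using c sy by metis+
  obtain S where S: "max_clique S" "c \<in> S" "p \<in> S" using max_clique_ex[OF Sy_P[OF x(1) c(1)] p ne(1) c(3)] .
  obtain S' where S': "max_clique S'" "d \<in> S'" "p \<in> S'" using max_clique_ex[OF Sy_P[OF x(1) c(2)] p ne(2) c(4)] .
  have "S \<noteq> S'" using max_clique_col[OF S(1,2)] S' c by metis
  then show ?thesis using S S' by metis
qed

end

section \<open>Triangle-free geometries and dual polar spaces\<close>

locale triangle_free_symps = symps_share_line_rank2 +
  assumes notwo: "\<eta> \<in> Sy \<Longrightarrow> p \<in> P \<Longrightarrow> p \<notin> \<eta> \<Longrightarrow> a \<in> \<eta> \<Longrightarrow> b \<in> \<eta> \<Longrightarrow> col p a \<Longrightarrow> col p b \<Longrightarrow> a = b"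
    and outside: "\<eta> \<in> Sy \<Longrightarrow> \<exists>p\<in>P. p \<notin> \<eta>"
begin

lemma triangle_in_line:
  assumes l: "l \<in> Ln" "a \<in> l" "b \<in> l" "a \<noteq> b" and c: "c \<in> P" "col c a" "col c b"
  shows "c \<in> l"
proof -
  obtain \<eta> where e: "\<eta> \<in> Sy" "l \<subseteq> \<eta>" using Ln_Sy[OF l(1)] by metis
  have ab: "a \<in> \<eta>" "b \<in> \<eta>" using e l by auto
  show ?thesis
  proof (cases "c \<in> \<eta>")
    case True
    then show ?thesis using rank2_triangle[OF e(1) l ab True c(2,3)] by metis
  next
    case False
    then show ?thesis using notwo[OF e(1) c(1) False ab c(2,3)] l by metis
  qed
qed

lemma meet_line:
  assumes e: "\<eta> \<in> Sy" "\<theta> \<in> Sy" "\<eta> \<noteq> \<theta>" "x \<in> \<eta>" "x \<in> \<theta>"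
  shows "\<exists>l\<in>Ln. x \<in> l \<and> l = \<eta> \<inter> \<theta>"
proof -
  obtain y where y: "y \<in> \<eta>" "y \<in> \<theta>" "y \<noteq> x" using meet0[OF e] by metis
  have xy: "col y x" using Sy_clique[OF e(1-3) y(1) e(4) y(2) e(5)] .
  obtain l where l: "l \<in> Ln" "y \<in> l" "x \<in> l" "l \<subseteq> \<eta>" using line_through[OF e(1) y(1) e(4) y(3) xy] .
  have "l \<subseteq> \<theta>" using Sy_ln[OF e(2) l(1-3) y(2) e(5) y(3)] .
  moreover have "c \<in> l" if c: "c \<in> \<eta>" "c \<in> \<theta>" for c
    using rank2_triangle[OF e(1) l(1-3) y(3,1) e(4) c(1)] Sy_clique[OF e(1-3) c(1) _ c(2)] y e by metis
  ultimately have "l = \<eta> \<inter> \<theta>" using l(4) by blast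
  then show ?thesis using l(1,3) by metis
qed

text \<open>The common line of \<tau> and \<xi> contains a neighbour of \<open>l\<close>, and by
  \<open>notwo\<close> there is only one in \<xi>.\<close>

lemma near_in:
  assumes t: "\<tau> \<in> Sy" "\<xi> \<in> Sy" "y \<in> \<tau>" "y \<in> \<xi>" and l: "l \<in> \<tau>" "l \<notin> \<xi>" and c: "c \<in> \<xi>" "col l c"
  shows "c \<in> \<tau>"
proof -
  have ne: "\<tau> \<noteq> \<xi>" using l by metis
  obtain d where d: "col l d" "d \<in> \<tau>" "d \<in> \<xi>" using meet_hit[OF t(1,2) ne t(3,4) l(1)] by metis
  have "c = d" using notwo[OF t(2) Sy_P[OF t(1) l(1)] l(2) c(1) d(3) c(2) d(1)] .
  then show ?thesis using d by metis
qed

text \<open>A neighbour of a point of \<open>L\<close> outside \<xi> would span a second symp on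
  \<open>L\<close>. Without one, \<xi> contains all neighbours of points of \<open>L\<close>
  (\<open>at\<close>). Then a symp joining an outside point to a point \<open>c\<close> of
  \<open>L\<close> shares with \<xi> two noncollinear neighbours of \<open>c\<close>.\<close>

lemma two_symps:
  assumes L: "L \<in> Ln" "L \<subseteq> \<xi>" "\<xi> \<in> Sy"
  shows "\<exists>\<theta>\<in>Sy. L \<subseteq> \<theta> \<and> \<theta> \<noteq> \<xi>"
proof (rule ccontr)
  assume "\<not> ?thesis"
  then have only: "\<And>\<theta>. \<theta> \<in> Sy \<Longrightarrow> L \<subseteq> \<theta> \<Longrightarrow> \<theta> = \<xi>" by metis
  have at: "m \<in> \<xi>" if x: "x \<in> L" and m: "m \<in> P" "col m x" for x m
  proof (rule ccontr)
    assume mx: "m \<notin> \<xi>"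
    obtain l where l: "l \<in> L" "l \<noteq> x" using ln_thick[OF L(1)] by metis
    have ml: "\<not> col m l"
    proof
      assume "col m l"
      then have "m \<in> L" using triangle_in_line[OF L(1) l(1) x l(2) m(1) _ m(2)] by metis
      then show False using mx L by auto
    qed
    obtain \<tau> where t: "\<tau> \<in> Sy" "m \<in> \<tau>" "l \<in> \<tau>" "x \<in> \<tau>"
      using Sy_exE[OF m(1) Ln_P[OF L(1) l(1)] Ln_P[OF L(1) x] ml sy[OF m(2)] ln_col[OF L(1) x l(1)]] .
    have "L \<subseteq> \<tau>" using Sy_ln[OF t(1) L(1) l(1) x t(3,4) l(2)] .
    then show False using only[OF t(1)] t mx by metis
  qed
  obtain p where p: "p \<in> P" "p \<notin> \<xi>" using outside[OF L(3)] by metis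
  obtain z where z: "z \<in> \<xi>" "col p z" using near_symp[OF L(3) p(1)] by metis
  obtain c where c: "c \<in> L" "col z c" using polar_one[OF Sy_polar[OF L(3)] z(1) L(1,2)] by metis
  have cx: "c \<in> \<xi>" using c L by auto
  have pc: "\<not> col p c" using at[OF c(1) p(1)] p by metis
  obtain \<tau> where t: "\<tau> \<in> Sy" "p \<in> \<tau>" "c \<in> \<tau>"
    using Sy_exE[OF p(1) Sy_P[OF L(3) cx] Sy_P[OF L(3) z(1)] pc sy[OF z(2)] c(2)] .
  obtain a b where ab: "a \<in> \<tau>" "b \<in> \<tau>" "col a c" "col b c" "\<not> col a b" using Sy_two[OF t(1,3)] .
  have "\<tau> = \<xi>" using Sy_eq[OF t(1) L(3) ab(1,2) at[OF c(1) Sy_P[OF t(1) ab(1)] ab(3)] at[OF c(1) Sy_P[OF t(1) ab(2)] ab(4)] ab(5)] .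
  then show False using t p by metis
qed

text \<open>Every line through \<open>x\<close> spans with \<open>L\<close> a symp on
  \<open>L\<close>, so it lies in \<open>A\<close> or \<open>B\<close>. If both had two further
  lines through \<open>x\<close>, symps joining them in pairs would share a line through
  \<open>x\<close>, and inside \<open>A\<close> or \<open>B\<close> this line would be two different
  ones. So one symp has a single further line, which is the fibre over the other symp.\<close>

lemma few_symps_product_at:
  assumes L: "L \<in> Ln" and few: "\<forall>A B C. A \<in> Sy \<longrightarrow> B \<in> Sy \<longrightarrow> C \<in> Sy \<longrightarrow> L \<subseteq> A \<longrightarrow> L \<subseteq> B \<longrightarrow> L \<subseteq> C \<longrightarrow> A = B \<or> B = C \<or> A = C"
  shows "\<exists>\<zeta> x T. product_at \<zeta> x T"
proof -
  obtain A where A: "A \<in> Sy" "L \<subseteq> A" using Ln_Sy[OF L] by metis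
  obtain B where B: "B \<in> Sy" "L \<subseteq> B" "B \<noteq> A" using two_symps[OF L A(2,1)] by metis
  obtain x where xL: "x \<in> L" using ln_thick[OF L] by metis
  obtain l where l: "l \<in> L" "l \<noteq> x" using ln_thick[OF L] by metis
  have in': "x \<in> A" "x \<in> B" "l \<in> A" "l \<in> B" using xL l A B by auto
  have xP: "x \<in> P" and lP: "l \<in> P" using Ln_P[OF L] xL l by metis+
  have lines: "m \<in> A \<or> m \<in> B" if m: "m \<in> P" "col m x" for m
  proof (cases "m \<in> L")
    case True
    then show ?thesis using A by auto
  next
    case False
    have ml: "\<not> col m l" using triangle_in_line[OF L l(1) xL l(2) m(1) _ m(2)] False by metis
    obtain \<tau> where t: "\<tau> \<in> Sy" "m \<in> \<tau>" "l \<in> \<tau>" "x \<in> \<tau>"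
      using Sy_exE[OF m(1) lP xP ml sy[OF m(2)] ln_col[OF L xL l(1)]] .
    have "L \<subseteq> \<tau>" using Sy_ln[OF t(1) L l(1) xL t(3,4) l(2)] .
    then have "\<tau> = A \<or> \<tau> = B" using few A B t(1) by metis
    then show ?thesis using t by metis
  qed
  have AB: "y \<in> L" if y: "y \<in> A" "y \<in> B" for y
    using triangle_in_line[OF L l(1) xL l(2) Sy_P[OF A(1) y(1)]] Sy_clique[OF A(1) B(1) B(3)[symmetric] y(1) _ y(2)] in' by metis
  have fin: "product_at X x T" if h: "X \<in> Sy" "L \<subseteq> X" "Y \<in> Sy" "L \<subseteq> Y" "X \<noteq> Y" "m \<in> Y" "m \<notin> X" "T \<in> Ln" "x \<in> T" "m \<in> T"
    "\<forall>n\<in>Y. col n x \<longrightarrow> n \<in> L \<or> n \<in> T" "\<forall>m\<in>P. col m x \<longrightarrow> m \<in> X \<or> m \<in> Y" for X Y m T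
  proof -
    have xX: "x \<in> X" using h xL by auto
    have o: "t \<notin> X" if "t \<in> T" "t \<noteq> x" for t using Sy_lnD[OF h(1,8) that(1) h(9) _ xX that(2) h(10)] h(7) by metis
    have f: "z = x" if "t \<in> T" "t \<noteq> x" "z \<in> X" "col t z" for t z
      using notwo[OF h(1) Ln_P[OF h(8) that(1)] o[OF that(1,2)] that(3) xX that(4) ln_col[OF h(8) that(1) h(9)]] .
    have "m \<in> X \<or> m \<in> T" if "m \<in> P" "col m x" for m using h(2,11,12) that by (metis subsetD)
    then show ?thesis unfolding product_at_def using h(1,8,9) xX o f by metis
  qed
  obtain m1 where m1: "m1 \<in> A" "col m1 x" "\<not> col m1 l" using polar_sep[OF Sy_polar[OF A(1)] in'(1,3) l(2)[symmetric]] by metis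
  obtain m2 where m2: "m2 \<in> B" "col m2 x" "\<not> col m2 l" using polar_sep[OF Sy_polar[OF B(1)] in'(2,4) l(2)[symmetric]] by metis
  have nL: "m1 \<notin> L" "m2 \<notin> L" using m1 m2 ln_col[OF L _ l(1)] by metis+
  have nx: "m1 \<noteq> x" "m2 \<noteq> x" using nL xL by metis+
  have inP: "m1 \<in> P" "m2 \<in> P" using Sy_P A(1) B(1) m1 m2 by metis+
  obtain T1 where T1: "T1 \<in> Ln" "m1 \<in> T1" "x \<in> T1" using pair_line[OF inP(1) xP m1(2) nx(1)] .
  obtain T2 where T2: "T2 \<in> Ln" "m2 \<in> T2" "x \<in> T2" using pair_line[OF inP(2) xP m2(2) nx(2)] .
  have mB: "m1 \<notin> B" "m2 \<notin> A" using AB nL m1 m2 by metis+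
  have "(\<forall>n\<in>A. col n x \<longrightarrow> n \<in> L \<or> n \<in> T1) \<or> (\<forall>n\<in>B. col n x \<longrightarrow> n \<in> L \<or> n \<in> T2)"
  proof (rule ccontr)
    assume "\<not> ?thesis"
    then obtain n1 n2 where n: "n1 \<in> A" "col n1 x" "n1 \<notin> L" "n1 \<notin> T1" "n2 \<in> B" "col n2 x" "n2 \<notin> L" "n2 \<notin> T2" by metis
    have nP: "n1 \<in> P" "n2 \<in> P" using Sy_P A(1) B(1) n by metis+
    have nB: "n1 \<notin> B" "n2 \<notin> A" using AB n by metis+
    have far: "\<not> col a b" if "a \<in> A" "b \<in> B" "b \<notin> A" "a \<noteq> x" "col b x" for a b
      using notwo[OF A(1) Sy_P[OF B(1) that(2)] that(3) that(1) in'(1) _ that(5)] that(4) sy by metis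
    have nnx: "n1 \<noteq> x" "n2 \<noteq> x" using n xL by metis+
    obtain C where C: "C \<in> Sy" "m1 \<in> C" "m2 \<in> C" "x \<in> C"
      using Sy_exE[OF inP xP far[OF m1(1) m2(1) mB(2) nx(1) m2(2)] sy[OF m1(2)] sy[OF m2(2)]] .
    obtain C' where C': "C' \<in> Sy" "n1 \<in> C'" "n2 \<in> C'" "x \<in> C'"
      using Sy_exE[OF nP xP far[OF n(1,5) nB(2) nnx(1) n(6)] sy[OF n(2)] sy[OF n(6)]] .
    have ne: "C \<noteq> A" "C \<noteq> B" "C' \<noteq> A" "C' \<noteq> B" using C C' mB nB by metis+
    have cA: "col y m1" if "y \<in> A" "y \<in> C" for y using Sy_clique[OF C(1) A(1) ne(1) that(2) C(2) that(1) m1(1)] .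
    have cB: "col y m2" if "y \<in> B" "y \<in> C" for y using Sy_clique[OF C(1) B(1) ne(2) that(2) C(3) that(1) m2(1)] .
    have "C \<noteq> C'"
    proof
      assume "C = C'"
      then have "col n1 m1" using cA n C' by metis
      then show False using triangle_in_line[OF T1 nx(1) nP(1) _ n(2)] n by metis
    qed
    then obtain y where y: "y \<in> C" "y \<in> C'" "y \<noteq> x" using meet0[OF C(1) C'(1) _ C(4) C'(4)] by metis
    have yP: "y \<in> P" using Sy_P[OF C(1) y(1)] .
    have yx: "col y x" using Sy_clique[OF C(1) C'(1) \<open>C \<noteq> C'\<close> y(1) C(4) y(2) C'(4)] .
    show False
    proof (cases "y \<in> A")
      case True
      have yT: "y \<in> T1" using triangle_in_line[OF T1 nx(1) yP cA[OF True y(1)] yx] .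
      have "col n1 y" using Sy_clique[OF C'(1) A(1) ne(3) C'(2) y(2) n(1) True] .
      then show False using triangle_in_line[OF T1(1) yT T1(3) y(3) nP(1) _ n(2)] n by metis
    next
      case False
      then have yB: "y \<in> B" using lines[OF yP yx] by metis
      have yT: "y \<in> T2" using triangle_in_line[OF T2 nx(2) yP cB[OF yB y(1)] yx] .
      have "col n2 y" using Sy_clique[OF C'(1) B(1) ne(4) C'(3) y(2) n(5) yB] .
      then show False using triangle_in_line[OF T2(1) yT T2(3) y(3) nP(2) _ n(6)] n by metis
    qed
  qed
  then show ?thesis
  proof
    assume "\<forall>n\<in>A. col n x \<longrightarrow> n \<in> L \<or> n \<in> T1"
    then have "product_at B x T1" using fin[OF B(1,2) A B(3) m1(1) mB(1) T1(1,3,2)] lines by metis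
    then show ?thesis by metis
  next
    assume "\<forall>n\<in>B. col n x \<longrightarrow> n \<in> L \<or> n \<in> T2"
    then have "product_at A x T2" using fin[OF A B(1,2) B(3)[symmetric] m2(1) mB(2) T2(1,3,2)] lines by metis
    then show ?thesis by metis
  qed
qed

end

section \<open>The polar space whose points are the symps\<close>

locale dual_polar_symps = triangle_free_symps +
  assumes thick3: "L \<in> Ln \<Longrightarrow> \<exists>A B C. A \<in> Sy \<and> B \<in> Sy \<and> C \<in> Sy \<and> L \<subseteq> A \<and> L \<subseteq> B \<and> L \<subseteq> C \<and> A \<noteq> B \<and> B \<noteq> C \<and> A \<noteq> C"
    and P_ne: "\<exists>x. x \<in> P"
begin

definition pencil :: "'a set \<Rightarrow> 'a set set" where
  "pencil L = {\<xi> \<in> Sy. L \<subseteq> \<xi>}"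

definition star :: "'a \<Rightarrow> 'a set set" where
  "star x = {\<xi> \<in> Sy. x \<in> \<xi>}"

definition dual :: "'a set geometry" where
  "dual = \<lparr>Points = Sy, Lines = pencil ` Ln\<rparr>"

lemma dual_sel [simp]: "Points dual = Sy" "Lines dual = pencil ` Ln"
  unfolding dual_def by simp_all

lemma pencilD: "A \<in> pencil L \<Longrightarrow> A \<in> Sy" "A \<in> pencil L \<Longrightarrow> L \<subseteq> A"
  unfolding pencil_def by auto

lemma pencilI: "A \<in> Sy \<Longrightarrow> L \<subseteq> A \<Longrightarrow> A \<in> pencil L"
  unfolding pencil_def by auto

lemma starD: "A \<in> star x \<Longrightarrow> A \<in> Sy" "A \<in> star x \<Longrightarrow> x \<in> A"
  unfolding star_def by auto

lemma starI: "A \<in> Sy \<Longrightarrow> x \<in> A \<Longrightarrow> A \<in> star x"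
  unfolding star_def by auto

lemma pencil_star: "x \<in> L \<Longrightarrow> pencil L \<subseteq> star x"
  unfolding pencil_def star_def by auto

lemma pencil_three:
  assumes "L \<in> Ln"
  obtains A B C where "A \<in> pencil L" "B \<in> pencil L" "C \<in> pencil L" "A \<noteq> B" "B \<noteq> C" "A \<noteq> C"
  using thick3[OF assms] pencilI by metis

lemma pencil_int:
  assumes L: "L \<in> Ln" and AB: "A \<in> pencil L" "B \<in> pencil L" "A \<noteq> B"
  shows "A \<inter> B = L"
proof -
  obtain a where a: "a \<in> L" using ln_thick[OF L] by metis
  obtain b where b: "b \<in> L" "b \<noteq> a" using ln_thick[OF L] by metis
  have i: "a \<in> A" "a \<in> B" "b \<in> A" "b \<in> B" using a b pencilD(2)[OF AB(1)] pencilD(2)[OF AB(2)] by auto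
  obtain l where l: "l \<in> Ln" "a \<in> l" "l = A \<inter> B"
    using meet_line[OF pencilD(1)[OF AB(1)] pencilD(1)[OF AB(2)] AB(3) i(1,2)] by metis
  have bl: "b \<in> l" using i l(3) by auto
  show ?thesis using ln_uniq[OF l(1) L l(2) bl a b(1) b(2)[symmetric]] l(3) by metis
qed

lemma ln_two: assumes "L \<in> Ln" obtains a b where "a \<in> L" "b \<in> L" "a \<noteq> b"
  using ln_thick[OF assms] by metis

lemma col_dual:
  "collinear_in dual A B \<longleftrightarrow> A \<noteq> B \<and> A \<in> Sy \<and> B \<in> Sy \<and> (\<exists>x. x \<in> A \<and> x \<in> B)"
proof
  assume "collinear_in dual A B"
  then obtain L where L: "A \<noteq> B" "L \<in> Ln" "A \<in> pencil L" "B \<in> pencil L" unfolding collinear_in_def by auto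
  obtain a where "a \<in> L" using ln_thick[OF L(2)] by metis
  then show "A \<noteq> B \<and> A \<in> Sy \<and> B \<in> Sy \<and> (\<exists>x. x \<in> A \<and> x \<in> B)"
    using L(1) pencilD[OF L(3)] pencilD[OF L(4)] by auto
next
  assume "A \<noteq> B \<and> A \<in> Sy \<and> B \<in> Sy \<and> (\<exists>x. x \<in> A \<and> x \<in> B)"
  then obtain x where x: "A \<noteq> B" "A \<in> Sy" "B \<in> Sy" "x \<in> A" "x \<in> B" by metis
  obtain l where l: "l \<in> Ln" "l = A \<inter> B" using meet_line[OF x(2,3,1,4,5)] by metis
  have "A \<in> pencil l" "B \<in> pencil l" using l x(2,3) by (auto intro: pencilI)
  then show "collinear_in dual A B" unfolding collinear_in_def using x(1) l(1) by auto
qed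

lemma perp_dual: "A \<in> Sy \<Longrightarrow> B \<in> perp dual A \<longleftrightarrow> B \<in> Sy \<and> (\<exists>x. x \<in> A \<and> x \<in> B)"
  unfolding perp_def using col_dual[of A B] Sy_ne by auto

text \<open>On another line \<open>M\<close> through \<open>x\<close> two symps intersect in exactly
  \<open>M\<close>, so they cannot both contain \<open>L\<close>.\<close>

lemma avoid_line:
  assumes L: "L \<in> Ln" "x \<in> L"
  shows "\<exists>\<tau>\<in>Sy. x \<in> \<tau> \<and> \<not> L \<subseteq> \<tau>"
proof -
  have xP: "x \<in> P" using Ln_P[OF L] .
  obtain \<xi> where x: "\<xi> \<in> Sy" "x \<in> \<xi>" using P_Sy[OF xP] by metis
  obtain c d where cd: "c \<in> \<xi>" "d \<in> \<xi>" "col c x" "col d x" "\<not> col c d" using Sy_two[OF x] .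
  have "c \<notin> L \<or> d \<notin> L" using ln_col[OF L(1)] cd by metis
  then obtain m where m: "m \<in> \<xi>" "col m x" "m \<notin> L" using cd by metis
  have mx: "m \<noteq> x" using m L by metis
  obtain M where M: "M \<in> Ln" "m \<in> M" "x \<in> M" using pair_line[OF Sy_P[OF x(1) m(1)] xP m(2) mx] .
  obtain A B C where A: "A \<in> pencil M" "B \<in> pencil M" "A \<noteq> B" using pencil_three[OF M(1)] .
  show ?thesis
  proof (rule ccontr)
    assume "\<not> ?thesis"
    then have "L \<subseteq> A" "L \<subseteq> B" using pencilD[OF A(1)] pencilD[OF A(2)] M by auto
    then have LM: "L \<subseteq> M" using pencil_int[OF M(1) A] by auto
    obtain l where l: "l \<in> L" "l \<noteq> x" using ln_thick[OF L(1)] by metis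
    have "L = M" using ln_uniq[OF L(1) M(1) l(1) L(2) _ M(3) l(2)] l(1) LM by (metis subsetD)
    then show False using M m by metis
  qed
qed

text \<open>If \<open>x\<close> and \<open>y\<close> are noncollinear, at most one symp contains
  both, whereas a line through \<open>x\<close> is in two symps. If they are collinear,
  \<open>avoid_line\<close> applies.\<close>

lemma avoid_point:
  assumes xy: "x \<in> P" "y \<in> P" "x \<noteq> y"
  shows "\<exists>\<tau>\<in>Sy. x \<in> \<tau> \<and> y \<notin> \<tau>"
proof (cases "col x y")
  case True
  obtain L where L: "L \<in> Ln" "x \<in> L" "y \<in> L" using pair_line[OF xy(1,2) True xy(3)] .
  obtain \<tau> where t: "\<tau> \<in> Sy" "x \<in> \<tau>" "\<not> L \<subseteq> \<tau>" using avoid_line[OF L(1,2)] by metis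
  then show ?thesis using Sy_ln[OF t(1) L t(2) _ xy(3)] by metis
next
  case False
  obtain \<xi> where x: "\<xi> \<in> Sy" "x \<in> \<xi>" using P_Sy[OF xy(1)] by metis
  obtain u where u: "u \<in> \<xi>" "u \<noteq> x" "col u x" using Sy_line[OF x] by metis
  obtain M where M: "M \<in> Ln" "u \<in> M" "x \<in> M" "M \<subseteq> \<xi>" using line_through[OF x(1) u(1) x(2) u(2,3)] .
  obtain \<theta> where t: "\<theta> \<in> Sy" "M \<subseteq> \<theta>" "\<theta> \<noteq> \<xi>" using two_symps[OF M(1,4) x(1)] by metis
  have xt: "x \<in> \<theta>" using t M by auto
  show ?thesis using Sy_eq[OF x(1) t(1) x(2) _ xt _ False] x t xt by metis
qed

text \<open>Nondegeneracy of \<open>dual\<close>. A symp through an outside point \<open>p\<close>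
  that avoids the neighbour of \<open>p\<close> in \<xi> cannot meet \<xi>, by
  \<open>near_in\<close>.\<close>

lemma disjoint_symp:
  assumes X: "\<xi> \<in> Sy"
  shows "\<exists>\<tau>\<in>Sy. \<nexists>y. y \<in> \<xi> \<and> y \<in> \<tau>"
proof -
  obtain p where p: "p \<in> P" "p \<notin> \<xi>" using outside[OF X] by metis
  obtain x where x: "x \<in> \<xi>" "col p x" using near_symp[OF X p(1)] by metis
  have px: "p \<noteq> x" using p x by metis
  obtain \<tau> where t: "\<tau> \<in> Sy" "p \<in> \<tau>" "x \<notin> \<tau>" using avoid_point[OF p(1) Sy_P[OF X x(1)] px] by metis
  then show ?thesis using near_in[OF t(1) X _ _ t(2) p(2) x] by metis
qed

text \<open>The "all" half of one-or-all. The neighbour in \<xi> of a point of \<open>L\<close> off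
  \<xi> lies in \<open>A\<close> and in \<open>B\<close> by \<open>near_in\<close>, hence on
  \<open>L\<close>, which is their intersection.\<close>

lemma dual_all:
  assumes L: "L \<in> Ln" and AB: "A \<in> pencil L" "B \<in> pencil L" "A \<noteq> B" and X: "\<xi> \<in> Sy"
    and a: "a \<in> A" "a \<in> \<xi>" and b: "b \<in> B" "b \<in> \<xi>"
  shows "\<exists>x\<in>L. x \<in> \<xi>"
proof -
  obtain l where l: "l \<in> L" using ln_thick[OF L] by metis
  show ?thesis
  proof (cases "l \<in> \<xi>")
    case False
    have lAB: "l \<in> A" "l \<in> B" using l pencilD(2)[OF AB(1)] pencilD(2)[OF AB(2)] by auto
    obtain c where c: "c \<in> \<xi>" "col l c" using near_symp[OF X Ln_P[OF L l]] by metis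
    have "c \<in> A" "c \<in> B"
      using near_in[OF pencilD(1)[OF AB(1)] X a lAB(1) False c]
        near_in[OF pencilD(1)[OF AB(2)] X b lAB(2) False c] .
    then have "c \<in> L" using pencil_int[OF L AB] by auto
    then show ?thesis using c by metis
  qed (use l in metis)
qed

text \<open>If \<open>L\<close> misses \<xi>, let \<open>c\<close> in \<xi> be seen by the point
  \<open>m\<close> of \<open>L\<close>. The symp through another point of \<open>L\<close> and
  \<open>c\<close> contains \<open>m\<close>, hence \<open>L\<close>.\<close>

lemma dual_one:
  assumes L: "L \<in> Ln" and X: "\<xi> \<in> Sy"
  shows "\<exists>\<tau>\<in>pencil L. \<exists>x. x \<in> \<tau> \<and> x \<in> \<xi>"
proof (cases "\<exists>x\<in>L. x \<in> \<xi>")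
  case True
  then obtain x where x: "x \<in> L" "x \<in> \<xi>" by metis
  obtain \<tau> B C where "\<tau> \<in> pencil L" using pencil_three[OF L] .
  then show ?thesis using x pencilD(2) by (metis subsetD)
next
  case False
  obtain l m where lm: "l \<in> L" "m \<in> L" "l \<noteq> m" using ln_two[OF L] .
  have lP: "l \<in> P" "m \<in> P" using Ln_P[OF L] lm by metis+
  obtain c where c: "c \<in> \<xi>" "col m c" using near_symp[OF X lP(2)] by metis
  have cP: "c \<in> P" using Sy_P[OF X c(1)] .
  have lc: "\<not> col l c" using triangle_in_line[OF L lm cP] c False sy by metis
  obtain \<tau> where t: "\<tau> \<in> Sy" "l \<in> \<tau>" "c \<in> \<tau>" "m \<in> \<tau>"
    using Sy_exE[OF lP(1) cP lP(2) lc ln_col[OF L lm(2,1)] c(2)] .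
  have "L \<subseteq> \<tau>" using Sy_ln[OF t(1) L lm(1,2) t(2,4) lm(3)] .
  then show ?thesis using pencilI[OF t(1)] t(3) c(1) by metis
qed

lemma subspace_line:
  assumes "pl_subspace dual S" "A \<in> S" "B \<in> S" "A \<noteq> B" "L \<in> Ln" "L \<subseteq> A" "L \<subseteq> B"
  shows "pencil L \<subseteq> S"
proof -
  have "A \<in> Sy" "B \<in> Sy" using assms(1-3) unfolding pl_subspace_def by auto
  then show ?thesis using assms pencilI unfolding pl_subspace_def by (metis dual_sel(2) imageI)
qed

text \<open>Any \<eta> through \<open>x\<close> meets \<open>C\<close> in a line \<open>N\<close>
  through \<open>x\<close>. The symp spanned by \<open>N\<close> and \<open>L\<close> is in the
  pencil of \<open>L\<close>, hence in \<open>S\<close>. Together with \<open>C\<close> it generates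
  the pencil of \<open>N\<close>, which contains \<eta>.\<close>

lemma star_generated:
  assumes S: "pl_subspace dual S" and ABC: "A \<in> S" "B \<in> S" "C \<in> S" "A \<noteq> B"
    and L: "L \<in> Ln" "L \<subseteq> A" "L \<subseteq> B" "x \<in> L" and C: "x \<in> C" "\<not> L \<subseteq> C"
  shows "star x \<subseteq> S"
proof
  fix \<eta> assume "\<eta> \<in> star x"
  then have e: "\<eta> \<in> Sy" "x \<in> \<eta>" using starD by metis+
  have CS: "C \<in> Sy" using S ABC unfolding pl_subspace_def by auto
  have pL: "pencil L \<subseteq> S" using subspace_line[OF S ABC(1,2,4) L(1-3)] .
  show "\<eta> \<in> S"
  proof (cases "\<eta> = C")
    case False
    obtain N where N: "N \<in> Ln" "x \<in> N" "N = \<eta> \<inter> C" using meet_line[OF e(1) CS False e(2) C(1)] by metis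
    obtain l where l: "l \<in> L" "l \<noteq> x" using ln_thick[OF L(1)] by metis
    obtain n where n: "n \<in> N" "n \<noteq> x" using ln_thick[OF N(1)] by metis
    have inP: "l \<in> P" "n \<in> P" "x \<in> P" using Ln_P L l N n by metis+
    have lC: "l \<notin> C" using Sy_ln[OF CS L(1) l(1) L(4) _ C(1) l(2)] C by metis
    have nC: "n \<in> C" "n \<in> \<eta>" using n N by auto
    have nx: "col n x" "col l x" using ln_col[OF N(1) n(1) N(2)] ln_col[OF L(1) l(1) L(4)] .
    have "\<not> col n l"
    proof
      assume "col n l"
      then have "l \<in> N" using triangle_in_line[OF N(1) n(1) N(2) n(2) inP(1) _ nx(2)] sy by metis
      then show False using lC N by auto
    qed
    then obtain \<kappa> where k: "\<kappa> \<in> Sy" "n \<in> \<kappa>" "l \<in> \<kappa>" "x \<in> \<kappa>"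
      using Sy_exE[OF inP(2,1,3) _ sy[OF nx(1)] sy[OF nx(2)]] by metis
    have "L \<subseteq> \<kappa>" "N \<subseteq> \<kappa>"
      using Sy_ln[OF k(1) L(1) l(1) L(4) k(3,4) l(2)] Sy_ln[OF k(1) N(1) n(1) N(2) k(2,4) n(2)] .
    then have kS: "\<kappa> \<in> S" using pL pencilI[OF k(1)] by auto
    have "\<kappa> \<noteq> C" using k lC by metis
    moreover have "N \<subseteq> C" "N \<subseteq> \<eta>" using N by auto
    ultimately have "pencil N \<subseteq> S" using subspace_line[OF S kS ABC(3) _ N(1) \<open>N \<subseteq> \<kappa>\<close>] by metis
    then show ?thesis using pencilI[OF e(1) \<open>N \<subseteq> \<eta>\<close>] by auto
  qed (use ABC in metis)
qed

lemma pencil_subspace: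
  assumes "L \<in> Ln"
  shows "pl_subspace dual (pencil L)"
  unfolding pl_subspace_def
proof (intro conjI ballI impI)
  show "pencil L \<subseteq> Points dual" using pencilD(1) by auto
next
  fix A B M assume AB: "A \<in> pencil L" "B \<in> pencil L" "M \<in> Lines dual" "A \<noteq> B \<and> A \<in> M \<and> B \<in> M"
  then obtain N where N: "N \<in> Ln" "M = pencil N" by auto
  have "A \<inter> B = L" "A \<inter> B = N" using pencil_int[OF assms AB(1,2)] pencil_int[OF N(1)] AB(4) N(2) by metis+
  then show "M \<subseteq> pencil L" using N(2) by simp
qed

lemma star_singular:
  shows "singular_subspace dual (star x)"
  unfolding singular_subspace_def pl_subspace_def
proof (intro conjI ballI impI)
  show "star x \<subseteq> Points dual" using starD(1) by auto
next
  fix A B M assume AB: "A \<in> star x" "B \<in> star x" "M \<in> Lines dual" "A \<noteq> B \<and> A \<in> M \<and> B \<in> M"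
  then obtain N where N: "N \<in> Ln" "M = pencil N" by auto
  have "A \<inter> B = N" using pencil_int[OF N(1)] AB(4) N(2) by metis
  then have "x \<in> N" using starD(2)[OF AB(1)] starD(2)[OF AB(2)] by auto
  then show "M \<subseteq> star x" using pencil_star N(2) by metis
next
  fix A B assume "A \<in> star x" "B \<in> star x" "A \<noteq> B"
  then show "collinear_in dual A B" unfolding col_dual using starD by metis
qed

lemma singular_meet:
  assumes "singular_subspace dual S" "A \<in> S" "B \<in> S"
  shows "A \<in> Sy" "B \<in> Sy" "\<exists>x. x \<in> A \<and> x \<in> B"
proof -
  show s: "A \<in> Sy" "B \<in> Sy" using assms unfolding singular_subspace_def pl_subspace_def by auto
  show "\<exists>x. x \<in> A \<and> x \<in> B"
  proof (cases "A = B")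
    case True
    then show ?thesis using Sy_ne s by metis
  next
    case False
    then have "collinear_in dual A B" using assms unfolding singular_subspace_def by metis
    then show ?thesis unfolding col_dual by metis
  qed
qed

text \<open>For \<sigma> missing \<open>x\<close>, a symp through \<open>x\<close> that avoids the
  neighbour of \<open>x\<close> in \<sigma> is disjoint from \<sigma> by \<open>near_in\<close>. So
  \<sigma> is not collinear in \<open>dual\<close> with every member of the star.\<close>

lemma star_maximal:
  assumes S: "singular_subspace dual S" and x: "x \<in> P" "star x \<subseteq> S"
  shows "S = star x"
proof
  show "S \<subseteq> star x"
  proof
    fix \<sigma> assume s: "\<sigma> \<in> S"
    have sS: "\<sigma> \<in> Sy" using singular_meet(1)[OF S s s] .
    have "x \<in> \<sigma>"
    proof (rule ccontr)
      assume xs: "x \<notin> \<sigma>"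
      obtain y where y: "y \<in> \<sigma>" "col x y" using near_symp[OF sS x(1)] by metis
      have xy: "x \<noteq> y" using xs y by metis
      obtain \<tau> where t: "\<tau> \<in> Sy" "x \<in> \<tau>" "y \<notin> \<tau>" using avoid_point[OF x(1) Sy_P[OF sS y(1)] xy] by metis
      have "\<tau> \<in> S" using starI[OF t(1,2)] x(2) by auto
      then obtain z where "z \<in> \<tau>" "z \<in> \<sigma>" using singular_meet(3)[OF S _ s] by metis
      then show False using near_in[OF t(1) sS _ _ t(2) xs y] t(3) by metis
    qed
    then show "\<sigma> \<in> star x" using starI[OF sS] by metis
  qed
qed (rule x)

text \<open>With \<open>L\<close> the intersection of two members, a member \<open>C\<close> not on
  \<open>L\<close> meets both, so \<open>dual_all\<close> gives it a point \<open>x\<close> of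
  \<open>L\<close>. Then \<open>star_generated\<close> yields the whole star of
  \<open>x\<close>.\<close>

lemma singular_cases:
  assumes S: "singular_subspace dual S"
  shows "S = {} \<or> (\<exists>\<xi>\<in>Sy. S = {\<xi>}) \<or> (\<exists>L\<in>Ln. S = pencil L) \<or> (\<exists>x\<in>P. S = star x)"
proof (cases "\<exists>A\<in>S. \<exists>B\<in>S. A \<noteq> B")
  case True
  then obtain A B where AB: "A \<in> S" "B \<in> S" "A \<noteq> B" by metis
  have sub: "pl_subspace dual S" using S unfolding singular_subspace_def by metis
  note m = singular_meet[OF S]
  obtain y where y: "y \<in> A" "y \<in> B" using m(3)[OF AB(1,2)] by metis
  obtain L where L: "L \<in> Ln" "L = A \<inter> B" using meet_line[OF m(1,2)[OF AB(1,2)] AB(3) y] by metis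
  have Ls: "L \<subseteq> A" "L \<subseteq> B" using L by auto
  show ?thesis
  proof (cases "\<forall>C\<in>S. L \<subseteq> C")
    case True
    have "S \<subseteq> pencil L" using True m(1) pencilI by (metis subsetI)
    then have "S = pencil L" using subspace_line[OF sub AB L(1) Ls] by auto
    then show ?thesis using L(1) by metis
  next
    case False
    then obtain C where C: "C \<in> S" "\<not> L \<subseteq> C" by metis
    obtain a where a: "a \<in> A" "a \<in> C" using m(3)[OF AB(1) C(1)] by metis
    obtain b where b: "b \<in> B" "b \<in> C" using m(3)[OF AB(2) C(1)] by metis
    obtain x where x: "x \<in> L" "x \<in> C"
      using dual_all[OF L(1) pencilI[OF m(1)[OF AB(1,1)] Ls(1)] pencilI[OF m(1)[OF AB(2,2)] Ls(2)] AB(3) m(1)[OF C(1,1)] a b] by metis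
    have xP: "x \<in> P" using Ln_P[OF L(1) x(1)] .
    have "star x \<subseteq> S" using star_generated[OF sub AB(1,2) C(1) AB(3) L(1) Ls x C(2)] .
    then show ?thesis using star_maximal[OF S xP] xP by metis
  qed
next
  case False
  show ?thesis
  proof (cases "S = {}")
    case ne: False
    then obtain A where A: "A \<in> S" by auto
    then have "S = {A}" using False by auto
    then show ?thesis using singular_meet(1)[OF S A A] by metis
  qed metis
qed

lemma pencil_inj:
  assumes L: "L \<in> Ln" "M \<in> Ln" and s: "pencil L \<subseteq> pencil M"
  shows "L = M"
proof -
  obtain A B C where A: "A \<in> pencil L" "B \<in> pencil L" "A \<noteq> B" using pencil_three[OF L(1)] .
  have "A \<in> pencil M" "B \<in> pencil M" using A s by auto
  then show ?thesis using pencil_int[OF L(1) A] pencil_int[OF L(2)] A(3) by metis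
qed

lemma star_inj:
  assumes "x \<in> P" "y \<in> P" "star x \<subseteq> star y"
  shows "x = y"
  using avoid_point[OF assms(1,2)] starI starD(2) assms(3) by (metis subsetD)

lemma star_pencil:
  assumes "L \<in> Ln"
  shows "pencil L \<subseteq> star x \<longleftrightarrow> x \<in> L"
proof
  assume s: "pencil L \<subseteq> star x"
  obtain A B C where A: "A \<in> pencil L" "B \<in> pencil L" "A \<noteq> B" using pencil_three[OF assms] .
  have "x \<in> A" "x \<in> B" using A s starD(2) by auto
  then show "x \<in> L" using pencil_int[OF assms A] by auto
qed (rule pencil_star)

lemma singular_in_star:
  assumes S: "singular_subspace dual S"
  shows "\<exists>x\<in>P. S \<subseteq> star x"
  using singular_cases[OF S]
proof (elim disjE bexE)
  assume "S = {}"
  then show ?thesis using P_ne by auto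
next
  fix \<xi> assume x: "\<xi> \<in> Sy" "S = {\<xi>}"
  obtain y where "y \<in> \<xi>" using Sy_ne[OF x(1)] by metis
  then show ?thesis using x Sy_P[OF x(1)] starI by auto
next
  fix L assume L: "L \<in> Ln" "S = pencil L"
  obtain y where y: "y \<in> L" using ln_thick[OF L(1)] by metis
  show ?thesis using Ln_P[OF L(1) y] pencil_star[OF y] L(2) by metis
next
  fix x assume "x \<in> P" "S = star x"
  then show ?thesis by auto
qed

lemma dual_maximal: "maximal_singular_subspaces dual = star ` P"
proof
  show "maximal_singular_subspaces dual \<subseteq> star ` P"
  proof
    fix S assume "S \<in> maximal_singular_subspaces dual"
    then have S: "singular_subspace dual S" "\<And>T. singular_subspace dual T \<Longrightarrow> S \<subseteq> T \<Longrightarrow> T = S"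
      unfolding maximal_singular_subspaces_def by auto
    obtain x where "x \<in> P" "S \<subseteq> star x" using singular_in_star[OF S(1)] by metis
    then show "S \<in> star ` P" using S(2)[OF star_singular] by auto
  qed
  show "star ` P \<subseteq> maximal_singular_subspaces dual"
    unfolding maximal_singular_subspaces_def using star_singular star_maximal by auto
qed

lemma line_plane_exists:
  assumes x: "x \<in> P"
  shows "\<exists>A B C L. A \<in> star x \<and> B \<in> star x \<and> C \<in> star x \<and> A \<noteq> B \<and> L \<in> Ln \<and> L \<subseteq> A \<and> L \<subseteq> B \<and> x \<in> L \<and> \<not> L \<subseteq> C"
proof -
  obtain \<xi> where xi: "\<xi> \<in> Sy" "x \<in> \<xi>" using P_Sy[OF x] by metis
  obtain u where u: "u \<in> \<xi>" "u \<noteq> x" "col u x" using Sy_line[OF xi] by metis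
  obtain L where L: "L \<in> Ln" "u \<in> L" "x \<in> L" using line_through[OF xi(1) u(1) xi(2) u(2,3)] by metis
  obtain A B C where A: "A \<in> pencil L" "B \<in> pencil L" "A \<noteq> B" using pencil_three[OF L(1)] .
  obtain \<tau> where t: "\<tau> \<in> Sy" "x \<in> \<tau>" "\<not> L \<subseteq> \<tau>" using avoid_line[OF L(1,3)] by metis
  have "A \<in> star x" "B \<in> star x" "L \<subseteq> A" "L \<subseteq> B" using A pencil_star[OF L(3)] pencilD(2) by auto
  then show ?thesis using starI[OF t(1,2)] t(3) A(3) L(1,3) by metis
qed

lemma pencil_pair:
  assumes L: "L \<in> Ln" and A: "A \<in> pencil L" "B \<in> pencil L" "A \<noteq> B"
  shows "pl_subspace dual hull {A, B} = pencil L"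
proof
  show "pl_subspace dual hull {A, B} \<subseteq> pencil L"
    using A by (intro hull_minimal) (auto intro: pencil_subspace[OF L])
  show "pencil L \<subseteq> pl_subspace dual hull {A, B}"
    unfolding hull_def
  proof (rule Inter_greatest)
    fix S assume "S \<in> {t. pl_subspace dual t \<and> {A, B} \<subseteq> t}"
    then show "pencil L \<subseteq> S" using subspace_line[of S A B L] A(3) L pencilD(2)[OF A(1)] pencilD(2)[OF A(2)] by simp
  qed
qed

lemma star_few:
  assumes x: "x \<in> P" and A: "A \<subseteq> star x" "finite A" "card A \<le> 2"
  shows "\<exists>L\<in>Ln. x \<in> L \<and> A \<subseteq> pencil L"
proof -
  have one: "\<exists>L\<in>Ln. x \<in> L \<and> \<xi> \<in> pencil L" if xi: "\<xi> \<in> Sy" "x \<in> \<xi>" for \<xi>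
  proof -
    obtain u where u: "u \<in> \<xi>" "u \<noteq> x" "col u x" using Sy_line[OF xi] by metis
    obtain L where L: "L \<in> Ln" "u \<in> L" "x \<in> L" "L \<subseteq> \<xi>" using line_through[OF xi(1) u(1) xi(2) u(2,3)] .
    then show ?thesis using pencilI[OF xi(1)] by metis
  qed
  consider "A = {}" | B where "A = {B}" | B C where "A = {B, C}" "B \<noteq> C"
  proof -
    have "card A = 0 \<or> card A = 1 \<or> card A = 2" using A(3) by linarith
    then show ?thesis using that A(2) by (metis card_0_eq card_1_singletonE card_2_iff)
  qed
  then show ?thesis
  proof cases
    case 1
    then show ?thesis using P_Sy[OF x] one by (metis empty_subsetI)
  next
    case 2
    then show ?thesis using one starD A(1) by (metis empty_subsetI insert_subset)
  next
    case 3
    then have s: "B \<in> star x" "C \<in> star x" using A(1) by auto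
    note BC = starD[OF s(1)] starD[OF s(2)]
    obtain L where L: "L \<in> Ln" "x \<in> L" "L = B \<inter> C" using meet_line[OF BC(1,3) 3(2) BC(2,4)] by metis
    have "B \<in> pencil L" "C \<in> pencil L" using L(3) pencilI BC by auto
    then show ?thesis using L 3(1) by auto
  qed
qed

text \<open>At most two symps through \<open>x\<close> lie in a common pencil of a line through
  \<open>x\<close>, and this pencil is a subspace that misses some symp through
  \<open>x\<close>.\<close>

lemma star_hull_card:
  assumes x: "x \<in> P" and A: "A \<subseteq> star x" "finite A" "pl_subspace dual hull A = star x"
  shows "3 \<le> card A"
proof (rule ccontr)
  assume "\<not> 3 \<le> card A"
  then have "card A \<le> 2" by linarith
  then obtain L where L: "L \<in> Ln" "x \<in> L" "A \<subseteq> pencil L" using star_few[OF x A(1,2)] by metis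
  have "star x \<subseteq> pencil L" using hull_minimal[of A "pencil L" "pl_subspace dual", OF L(3) pencil_subspace[OF L(1)]] A(3) by simp
  then show False using avoid_line[OF L(1,2)] starI pencilD(2) by (metis subsetD)
qed

lemma star_dim:
  assumes x: "x \<in> P"
  shows "has_dim dual (star x) 2"
proof -
  obtain A B C L where A: "A \<in> star x" "B \<in> star x" "C \<in> star x" "A \<noteq> B" "L \<in> Ln" "L \<subseteq> A" "L \<subseteq> B" "x \<in> L" "\<not> L \<subseteq> C"
    using line_plane_exists[OF x] by metis
  have "pl_subspace dual hull {A, B, C} = star x"
  proof
    show "pl_subspace dual hull {A, B, C} \<subseteq> star x"
      using A(1-3) star_singular[of x] by (intro hull_minimal) (auto simp: singular_subspace_def)
    show "star x \<subseteq> pl_subspace dual hull {A, B, C}"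
      unfolding hull_def
    proof (rule Inter_greatest)
      fix S assume "S \<in> {t. pl_subspace dual t \<and> {A, B, C} \<subseteq> t}"
      then show "star x \<subseteq> S" using star_generated[of S A B C L x] A(4-9) starD(2)[OF A(3)] by simp
    qed
  qed
  moreover have "card {A, B, C} = 3" using A(4,6,7,9) by auto
  moreover have "{A, B, C} \<subseteq> star x" using A(1-3) by simp
  moreover have "3 \<le> card D" if "D \<subseteq> star x" "finite D" "pl_subspace dual hull D = star x" for D
    using star_hull_card[OF x that] .
  ultimately show ?thesis unfolding has_dim_def
    by (intro conjI exI[of _ "{A, B, C}"]) auto
qed

text \<open>Upper bounds suffice: with \<open>singular_cases\<close> they leave only stars in
  dimension 2, and only pencils and stars in dimension 1.\<close>

lemma small_dim:
  shows "has_dim dual {} n \<Longrightarrow> n \<le> -1" and "\<xi> \<in> Sy \<Longrightarrow> has_dim dual {\<xi>} n \<Longrightarrow> n \<le> 0"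
    and "L \<in> Ln \<Longrightarrow> has_dim dual (pencil L) n \<Longrightarrow> n \<le> 1"
proof -
  assume h: "has_dim dual {} n"
  have "pl_subspace dual hull {} = {}" by (intro hull_unique) (auto simp: pl_subspace_def)
  then have "n + 1 \<le> int (card ({} :: 'a set set))" using h unfolding has_dim_def by blast
  then show "n \<le> -1" by simp
next
  assume x: "\<xi> \<in> Sy" and h: "has_dim dual {\<xi>} n"
  have "pl_subspace dual hull {\<xi>} = {\<xi>}" by (intro hull_unique) (auto simp: pl_subspace_def x)
  then have "n + 1 \<le> int (card {\<xi>})" using h unfolding has_dim_def by blast
  then show "n \<le> 0" by simp
next
  assume L: "L \<in> Ln" and h: "has_dim dual (pencil L) n"
  obtain A B C where A: "A \<in> pencil L" "B \<in> pencil L" "A \<noteq> B" using pencil_three[OF L] .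
  have "{A, B} \<subseteq> pencil L" using A by simp
  then have "n + 1 \<le> int (card {A, B})" using h pencil_pair[OF L A] unfolding has_dim_def by blast
  then show "n \<le> 1" using A(3) by simp
qed

lemma dual_planes: "singular_planes dual = star ` P"
proof
  show "singular_planes dual \<subseteq> star ` P"
  proof
    fix S assume "S \<in> singular_planes dual"
    then have S: "singular_subspace dual S" "has_dim dual S 2" unfolding singular_planes_def by auto
    show "S \<in> star ` P" using singular_cases[OF S(1)] small_dim[where n = 2] S(2) by auto
  qed
  show "star ` P \<subseteq> singular_planes dual" unfolding singular_planes_def using star_singular star_dim by auto
qed

lemma dual_chain_finite:
  assumes C: "C \<subseteq> Collect (singular_subspace dual)" "chain\<^sub>\<subseteq> C"
  shows "finite C"
proof -
  \<comment> \<open>\<open>h\<close> is the projective dimension plus one. It is injective on a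
    chain of singular subspaces and takes only four values.\<close>
  define h :: "'a set set \<Rightarrow> nat" where
    "h S = (if S = {} then 0 else if \<exists>\<xi>. S = {\<xi>} then 1 else if \<exists>L\<in>Ln. S = pencil L then 2 else 3)" for S
  have h0: "S = {}" if "h S = 0" for S using that unfolding h_def by (simp split: if_split_asm)
  have h1: "\<exists>\<xi>. S = {\<xi>}" if "h S = 1" for S using that unfolding h_def by (simp split: if_split_asm)
  have h2: "\<exists>L\<in>Ln. S = pencil L" if "h S = 2" for S using that unfolding h_def by (simp split: if_split_asm)
  have h3: "\<exists>x\<in>P. S = star x" if "h S = 3" "singular_subspace dual S" for S
  proof -
    have "S \<noteq> {} \<and> (\<nexists>\<xi>. S = {\<xi>}) \<and> \<not> (\<exists>L\<in>Ln. S = pencil L)" using that(1) unfolding h_def by (simp split: if_split_asm)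
    then show ?thesis using singular_cases[OF that(2)] by metis
  qed
  have hc: "h S = 0 \<or> h S = 1 \<or> h S = 2 \<or> h S = 3" for S unfolding h_def by simp
  have sub: "S = T" if ST: "S \<in> C" "T \<in> C" "S \<subseteq> T" and e: "h S = h T" for S T
  proof -
    have s: "singular_subspace dual S" "singular_subspace dual T" using ST C by auto
    consider "h S = 0" | "h S = 1" | "h S = 2" | "h S = 3" using hc by metis
    then show ?thesis
    proof cases
      case 1
      then show ?thesis using h0 e by metis
    next
      case 2
      then obtain \<xi> \<tau> where "S = {\<xi>}" "T = {\<tau>}" using h1 e by metis
      then show ?thesis using ST(3) by simp
    next
      case 3
      then obtain L M where "L \<in> Ln" "M \<in> Ln" "S = pencil L" "T = pencil M" using h2 e by metis
      then show ?thesis using ST(3) pencil_inj by metis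
    next
      case 4
      then obtain x y where "x \<in> P" "y \<in> P" "S = star x" "T = star y" using h3 s e by metis
      then show ?thesis using ST(3) star_inj by metis
    qed
  qed
  have inj: "inj_on h C"
  proof (rule inj_onI)
    fix S T assume st: "S \<in> C" "T \<in> C" "h S = h T"
    have "S \<subseteq> T \<or> T \<subseteq> S" using C(2) st unfolding chain_subset_def by metis
    then show "S = T" using sub st by metis
  qed
  have "h S \<in> {..3}" for S using hc[of S] by auto
  then have "h ` C \<subseteq> {..3}" by blast
  then show ?thesis using inj finite_subset[of "h ` C" "{..3}"] finite_imageD by blast
qed

lemma three_at_least:
  assumes "a \<in> A" "b \<in> A" "c \<in> A" "a \<noteq> b" "b \<noteq> c" "a \<noteq> c"
  shows "has_at_least 3 A"
proof -
  have "card {a, b, c} = 3" using assms by simp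
  moreover have "{a, b, c} \<subseteq> A" using assms by simp
  ultimately show ?thesis unfolding has_at_least_def by (metis card_mono)
qed

lemma dual_lines_thick:
  assumes "L \<in> Lines dual" shows "has_at_least 3 L"
proof -
  obtain M where M: "M \<in> Ln" "L = pencil M" using assms by auto
  obtain A B C where "A \<in> pencil M" "B \<in> pencil M" "C \<in> pencil M" "A \<noteq> B" "B \<noteq> C" "A \<noteq> C"
    using pencil_three[OF M(1)] .
  then show ?thesis unfolding M(2) by (rule three_at_least)
qed

lemma dual_geometry: "point_line_geometry dual"
  unfolding point_line_geometry_def
proof (intro conjI ballI)
  fix L assume L: "L \<in> Lines dual"
  then show "L \<subseteq> Points dual" using pencilD(1) by auto
  show "has_at_least 2 L" using dual_lines_thick[OF L] unfolding has_at_least_def by linarith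
next
  show "\<Union> (Lines dual) = Points dual"
  proof
    show "\<Union> (Lines dual) \<subseteq> Points dual" using pencilD(1) by auto
    show "Points dual \<subseteq> \<Union> (Lines dual)"
    proof
      fix \<xi> assume "\<xi> \<in> Points dual"
      then have x: "\<xi> \<in> Sy" by simp
      obtain a where a: "a \<in> \<xi>" using Sy_ne[OF x] by metis
      obtain u where u: "u \<in> \<xi>" "u \<noteq> a" "col u a" using Sy_line[OF x a] by metis
      obtain L where "L \<in> Ln" "L \<subseteq> \<xi>" using line_through[OF x u(1) a u(2,3)] .
      then show "\<xi> \<in> \<Union> (Lines dual)" using pencilI[OF x] by auto
    qed
  qed
qed

lemma dual_polar: "polar_space dual"
  unfolding polar_space_def
proof (intro conjI ballI allI impI)
  show "point_line_geometry dual" by (rule dual_geometry)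
  show "\<And>L. L \<in> Lines dual \<Longrightarrow> has_at_least 3 L" by (rule dual_lines_thick)
  show "Points dual \<noteq> {}" using P_ne P_Sy by auto
next
  fix \<xi> assume "\<xi> \<in> Points dual"
  then have x: "\<xi> \<in> Sy" by simp
  obtain \<tau> where "\<tau> \<in> Sy" "\<nexists>y. y \<in> \<xi> \<and> y \<in> \<tau>" using disjoint_symp[OF x] by metis
  then show "\<exists>y\<in>Points dual. y \<notin> perp dual \<xi>" using perp_dual[OF x] by auto
next
  fix C assume "C \<subseteq> Collect (singular_subspace dual) \<and> chain\<^sub>\<subseteq> C"
  then show "finite C" using dual_chain_finite by metis
next
  fix \<xi> M assume "\<xi> \<in> Points dual" "M \<in> Lines dual"
  then have x: "\<xi> \<in> Sy" and "M \<in> pencil ` Ln" by simp_all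
  then obtain L where L: "L \<in> Ln" "M = pencil L" by (metis imageE)
  show "(\<exists>!y. y \<in> M \<inter> perp dual \<xi>) \<or> M \<subseteq> perp dual \<xi>"
  proof (cases "\<exists>y\<in>L. y \<in> \<xi>")
    case True
    then obtain y where y: "y \<in> L" "y \<in> \<xi>" by metis
    have "\<tau> \<in> perp dual \<xi>" if "\<tau> \<in> pencil L" for \<tau>
      using perp_dual[OF x, of \<tau>] pencilD[OF that] y by (metis subsetD)
    then have "M \<subseteq> perp dual \<xi>" unfolding L(2) by (rule subsetI)
    then show ?thesis by metis
  next
    case False
    obtain \<tau> where t: "\<tau> \<in> pencil L" "\<tau> \<in> perp dual \<xi>" using dual_one[OF L(1) x] perp_dual[OF x] pencilD(1) by metis
    have u: "\<sigma> = \<tau>" if "\<sigma> \<in> pencil L \<inter> perp dual \<xi>" for \<sigma>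
    proof -
      have s: "\<sigma> \<in> pencil L" "\<sigma> \<in> Sy" "\<sigma> \<in> perp dual \<xi>" using that pencilD(1) by auto
      show ?thesis using dual_all[OF L(1) s(1) t(1) _ x] s(3) t(2) perp_dual[OF x] False by metis
    qed
    have "\<exists>!y. y \<in> pencil L \<inter> perp dual \<xi>" by (rule ex1I[of _ \<tau>]) (rule IntI[OF t], rule u)
    then show ?thesis unfolding L(2) by (rule disjI1)
  qed
qed

text \<open>The planes containing the pencil of \<open>L\<close> are the stars of the points of
  \<open>L\<close>. So thickness is the fact that lines have three points, and \<open>thick3\<close>
  is spent on the lines of \<open>dual\<close>.\<close>

lemma dual_thick: "thick_polar_space_of_rank dual 3"
  unfolding thick_polar_space_of_rank_def polar_space_of_rank_def
proof (intro conjI ballI allI impI)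
  fix M assume "M \<in> maximal_singular_subspaces dual"
  then show "has_dim dual M (int 3 - 1)" unfolding dual_maximal using star_dim by auto
next
  fix S assume "singular_subspace dual S \<and> has_dim dual S (int 3 - 2)"
  then have S: "singular_subspace dual S" "has_dim dual S 1" by auto
  have "S \<noteq> star x" if x: "x \<in> P" for x
  proof
    assume "S = star x"
    then obtain A where "A \<subseteq> star x" "finite A" "pl_subspace dual hull A = star x" "int (card A) = 1 + 1"
      using S(2) unfolding has_dim_def by auto
    then show False using star_hull_card[OF x, of A] by simp
  qed
  then obtain L where L: "L \<in> Ln" "S = pencil L" using singular_cases[OF S(1)] small_dim[where n = 1] S(2) by auto
  obtain a b where ab: "a \<in> L" "b \<in> L" "a \<noteq> b" using ln_two[OF L(1)] .
  obtain c where c: "c \<in> L" "c \<noteq> a" "c \<noteq> b" using ln_thick[OF L(1)] by metis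
  have i: "star x \<in> {M \<in> maximal_singular_subspaces dual. S \<subseteq> M}" if "x \<in> L" for x
    unfolding dual_maximal L(2) using pencil_star[OF that] Ln_P[OF L(1) that] by auto
  have ne: "star x \<noteq> star y" if "x \<in> L" "y \<in> L" "x \<noteq> y" for x y
    using star_inj[OF Ln_P[OF L(1) that(1)] Ln_P[OF L(1) that(2)]] that by auto
  show "has_at_least 3 {M \<in> maximal_singular_subspaces dual. S \<subseteq> M}"
    using three_at_least[OF i[OF ab(1)] i[OF ab(2)] i[OF c(1)] ne[OF ab] ne[OF ab(2) c(1) c(3)[symmetric]] ne[OF ab(1) c(1) c(2)[symmetric]]] .
qed (auto intro: dual_polar)

lemma dual_iso: "pl_isomorphic \<lparr>Points = P, Lines = Ln\<rparr> (dual_polar_space_rank3 dual)"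
proof -
  have "inj_on star P" by (rule inj_onI) (use star_inj in auto)
  then have "bij_betw star P (star ` P)" by (rule inj_on_imp_bij_betw)
  moreover have "star ` L = {\<pi> \<in> star ` P. pencil L \<subseteq> \<pi>}" if "L \<in> Ln" for L
    using star_pencil[OF that] Ln_P[OF that] by auto
  then have "(`) star ` Ln = {{\<pi> \<in> star ` P. M \<subseteq> \<pi>} | M. M \<in> pencil ` Ln}" by (auto simp: image_iff)
  ultimately show ?thesis unfolding pl_isomorphic_def dual_polar_space_rank3_def dual_planes
    by (intro exI[of _ star]) simp
qed

end

section \<open>Strong parapolar spaces\<close>

definition colr :: "'a geometry \<Rightarrow> 'a \<Rightarrow> 'a \<Rightarrow> bool" where
  "colr \<Omega> x y \<longleftrightarrow> x = y \<or> collinear_in \<Omega> x y"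

lemma perp_colr: "y \<in> perp \<Omega> x \<longleftrightarrow> y \<in> Points \<Omega> \<and> colr \<Omega> x y"
  unfolding perp_def colr_def by auto

lemma colr_sym: "colr \<Omega> x y \<Longrightarrow> colr \<Omega> y x"
  unfolding colr_def collinear_in_def by auto

lemma colr_line: "colr \<Omega> x y \<Longrightarrow> x \<noteq> y \<Longrightarrow> \<exists>L\<in>Lines \<Omega>. x \<in> L \<and> y \<in> L"
  unfolding colr_def collinear_in_def by auto

lemma colrI: "L \<in> Lines \<Omega> \<Longrightarrow> x \<in> L \<Longrightarrow> y \<in> L \<Longrightarrow> colr \<Omega> x y"
  unfolding colr_def collinear_in_def by auto

lemma colr_induced:
  assumes "pl_subspace \<Omega> S" "x \<in> S" "y \<in> S"
  shows "colr (induced_geometry \<Omega> S) x y \<longleftrightarrow> colr \<Omega> x y"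
proof
  assume c: "colr \<Omega> x y"
  show "colr (induced_geometry \<Omega> S) x y"
  proof (cases "x = y")
    case False
    then obtain L where L: "L \<in> Lines \<Omega>" "x \<in> L" "y \<in> L" using colr_line[OF c] by metis
    then have "L \<subseteq> S" using assms False unfolding pl_subspace_def by metis
    then show ?thesis using L colrI[of L "induced_geometry \<Omega> S"] unfolding induced_geometry_def by simp
  qed (simp add: colr_def)
qed (auto simp: colr_def collinear_in_def induced_geometry_def)

lemma has_at_least_3: "has_at_least 3 L \<Longrightarrow> \<exists>c\<in>L. c \<noteq> a \<and> c \<noteq> b"
proof (rule ccontr)
  assume h: "has_at_least 3 L" and "\<not> (\<exists>c\<in>L. c \<noteq> a \<and> c \<noteq> b)"
  then have s: "L \<subseteq> {a, b}" by auto
  have "card L \<le> card {a, b}" using card_mono[OF _ s] by simp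
  also have "\<dots> \<le> 2" by (simp add: card_insert_if)
  finally show False using h finite_subset[OF s] unfolding has_at_least_def by simp
qed

text \<open>\<open>hull\<close> is an intersection, which would be the whole type if no convex
  subspace contained \<open>A\<close>. The set \<open>M\<close> excludes this.\<close>

lemma convex_subspace_hull:
  assumes "convex_subspace \<Omega> M" "A \<subseteq> M"
  shows "convex_subspace \<Omega> (convex_subspace \<Omega> hull A)"
proof -
  let ?H = "convex_subspace \<Omega> hull A"
  have sub: "?H \<subseteq> t" if "convex_subspace \<Omega> t" "A \<subseteq> t" for t
    using that(2,1) by (rule hull_minimal)
  have inH: "B \<subseteq> ?H" if "\<And>t. convex_subspace \<Omega> t \<Longrightarrow> A \<subseteq> t \<Longrightarrow> B \<subseteq> t" for B
    unfolding hull_def by (rule Inter_greatest) (use that in simp)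
  have "M \<subseteq> Points \<Omega>" using assms(1) unfolding convex_subspace_def pl_subspace_def by simp
  then have "?H \<subseteq> Points \<Omega>" using sub[OF assms] by (rule order_trans[rotated])
  moreover have "L \<subseteq> ?H" if h: "x \<in> ?H" "y \<in> ?H" "L \<in> Lines \<Omega>" "x \<noteq> y \<and> x \<in> L \<and> y \<in> L" for x y L
  proof (rule inH)
    fix t assume t: "convex_subspace \<Omega> t" "A \<subseteq> t"
    note xy = subsetD[OF sub[OF t] h(1)] subsetD[OF sub[OF t] h(2)]
    show "L \<subseteq> t" using xy t(1) h(3,4) unfolding convex_subspace_def pl_subspace_def by metis
  qed
  moreover have "set xs \<subseteq> ?H" if h: "x \<in> ?H" "y \<in> ?H" "is_shortest_path \<Omega> x xs y" for x y xs
  proof (rule inH)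
    fix t assume t: "convex_subspace \<Omega> t" "A \<subseteq> t"
    note xy = subsetD[OF sub[OF t] h(1)] subsetD[OF sub[OF t] h(2)]
    show "set xs \<subseteq> t" using xy t(1) h(3) unfolding convex_subspace_def by metis
  qed
  ultimately show ?thesis unfolding convex_subspace_def pl_subspace_def by simp
qed

lemma convex_closure_subspace:
  assumes \<Omega>: "point_line_geometry \<Omega>" and A: "A \<subseteq> Points \<Omega>"
  shows "convex_subspace \<Omega> (convex_closure \<Omega> A)" and "A \<subseteq> convex_closure \<Omega> A"
proof -
  have P: "convex_subspace \<Omega> (Points \<Omega>)"
    using \<Omega> unfolding convex_subspace_def pl_subspace_def is_shortest_path_def is_path_def point_line_geometry_def by auto
  show "A \<subseteq> convex_closure \<Omega> A" unfolding convex_closure_def by (rule hull_subset)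
  show "convex_subspace \<Omega> (convex_closure \<Omega> A)"
    using P A unfolding convex_closure_def by (rule convex_subspace_hull)
qed

lemma is_path_induct:
  assumes "successively (collinear_in \<Omega>) xs" "set xs \<subseteq> Points \<Omega>" "xs \<noteq> []" "hd xs \<in> S"
    and "\<And>p q. p \<in> S \<Longrightarrow> q \<in> Points \<Omega> \<Longrightarrow> colr \<Omega> q p \<Longrightarrow> q \<in> S"
  shows "last xs \<in> S"
  using assms(1-4)
proof (induction xs)
  case (Cons x xs)
  show ?case
  proof (cases xs)
    case Nil
    then show ?thesis using Cons by simp
  next
    case (Cons y ys)
    have "colr \<Omega> y x" using Cons.prems(1) Cons colr_sym unfolding colr_def by (metis successively.simps(3))
    then have "y \<in> S" using assms(5)[of x y] Cons.prems(2,4) Cons by simp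
    then show ?thesis using Cons.IH Cons.prems(1,2) Cons by simp
  qed
qed simp

lemma path_length:
  assumes "is_path \<Omega> p xs q" "\<not> colr \<Omega> p q"
  shows "3 \<le> length xs"
proof (rule ccontr)
  assume n: "\<not> 3 \<le> length xs"
  have ne: "xs \<noteq> []" using assms(1) unfolding is_path_def by metis
  then obtain a ys where a: "xs = a # ys" by (cases xs) auto
  show False
  proof (cases ys)
    case Nil
    then have "p = q" using a assms(1) unfolding is_path_def by auto
    then show False using assms(2) unfolding colr_def by simp
  next
    case (Cons b zs)
    then have "zs = []" using n a by (cases zs) auto
    then have "collinear_in \<Omega> p q" using a Cons assms(1) unfolding is_path_def by auto
    then show False using assms(2) unfolding colr_def by simp
  qed
qed

lemma distance_two:
  assumes n: "\<not> colr \<Omega> p q" and r: "colr \<Omega> r p" "colr \<Omega> r q" and P: "p \<in> Points \<Omega>" "q \<in> Points \<Omega>" "r \<in> Points \<Omega>"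
  shows "is_path \<Omega> p [p, r, q] q" and "pl_distance \<Omega> p q = 2"
proof -
  have "collinear_in \<Omega> p r" "collinear_in \<Omega> r q" using n r colr_sym unfolding colr_def by metis+
  then show a: "is_path \<Omega> p [p, r, q] q" using P unfolding is_path_def by simp
  show "pl_distance \<Omega> p q = 2" unfolding pl_distance_def
  proof (rule antisym)
    have "(INF xs\<in>{xs. is_path \<Omega> p xs q}. enat (length xs - 1)) \<le> enat (length [p, r, q] - 1)"
      by (rule INF_lower) (use a in simp)
    moreover have "enat (length [p, r, q] - 1) = 2" by (simp add: numeral_eq_enat)
    ultimately show "(INF xs\<in>{xs. is_path \<Omega> p xs q}. enat (length xs - 1)) \<le> 2" by metis
    show "2 \<le> (INF xs\<in>{xs. is_path \<Omega> p xs q}. enat (length xs - 1))"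
    proof (rule INF_greatest)
      fix xs assume "xs \<in> {xs. is_path \<Omega> p xs q}"
      then have "2 \<le> length xs - 1" using path_length[OF _ n, of xs] by simp
      then show "2 \<le> enat (length xs - 1)" by (simp add: numeral_eq_enat)
    qed
  qed
qed

lemma distance_le_two:
  assumes "r \<in> Points \<Omega>" "colr \<Omega> r p" "colr \<Omega> r q" "p \<in> Points \<Omega>" "q \<in> Points \<Omega>"
  shows "pl_distance \<Omega> p q \<le> 2"
proof (cases "colr \<Omega> p q")
  case False
  then show ?thesis using distance_two(2)[OF False assms(2,3,4,5,1)] by simp
next
  case True
  have "\<exists>xs. is_path \<Omega> p xs q \<and> length xs - 1 \<le> 2"
  proof (cases "p = q")
    case True
    then have "is_path \<Omega> p [p] q" using assms unfolding is_path_def by simp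
    then show ?thesis by (intro exI[of _ "[p]"]) simp
  next
    case False
    then have "is_path \<Omega> p [p, q] q" using True assms unfolding is_path_def colr_def by simp
    then show ?thesis by (intro exI[of _ "[p, q]"]) simp
  qed
  then obtain xs where xs: "is_path \<Omega> p xs q" "length xs - 1 \<le> 2" by metis
  have "pl_distance \<Omega> p q \<le> enat (length xs - 1)" unfolding pl_distance_def
    by (rule INF_lower) (use xs in simp)
  also have "\<dots> \<le> 2" using xs by (simp add: numeral_eq_enat)
  finally show ?thesis .
qed

section \<open>Strong parapolar spaces as models of the locales\<close>

locale strong_parapolar =
  fixes \<Omega> :: "'a geometry"
  assumes strong: "strong_parapolar_space \<Omega>"
begin

abbreviation "P \<equiv> Points \<Omega>"
abbreviation "Ln \<equiv> Lines \<Omega>"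
abbreviation "Sy \<equiv> symps \<Omega>"
abbreviation "col \<equiv> colr \<Omega>"

lemma para: "parapolar_space \<Omega>"
  using strong unfolding strong_parapolar_space_def by metis

lemma plg: "point_line_geometry \<Omega>"
  using para unfolding parapolar_space_def by metis

lemma line_sub: "L \<in> Ln \<Longrightarrow> L \<subseteq> P"
  using plg unfolding point_line_geometry_def by metis

lemma symp_convex:
  assumes "\<xi> \<in> Sy"
  shows "convex_subspace \<Omega> \<xi>" "pl_subspace \<Omega> \<xi>" "\<xi> \<subseteq> P" "polar_space (induced_geometry \<Omega> \<xi>)"
proof -
  obtain p q where pq: "p \<in> P" "q \<in> P" "\<xi> = convex_closure \<Omega> {p, q}" and po: "polar_space (induced_geometry \<Omega> \<xi>)"
    using assms unfolding symps_def by auto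
  show c: "convex_subspace \<Omega> \<xi>" using convex_closure_subspace(1)[OF plg, of "{p, q}"] pq by simp
  then show s: "pl_subspace \<Omega> \<xi>" unfolding convex_subspace_def by metis
  show "\<xi> \<subseteq> P" using s unfolding pl_subspace_def by metis
  show "polar_space (induced_geometry \<Omega> \<xi>)" by (rule po)
qed

lemma line_symp: "L \<in> Ln \<Longrightarrow> \<exists>\<xi>\<in>Sy. L \<subseteq> \<xi>"
  using para unfolding parapolar_space_def by metis

lemma line_thick3:
  assumes L: "L \<in> Ln" shows "has_at_least 3 L"
proof -
  obtain \<xi> where x: "\<xi> \<in> Sy" "L \<subseteq> \<xi>" using line_symp[OF L] by metis
  have "L \<in> Lines (induced_geometry \<Omega> \<xi>)" using L x unfolding induced_geometry_def by simp
  then show ?thesis using symp_convex(4)[OF x(1)] unfolding polar_space_def by metis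
qed

sublocale collinearity col Ln
proof
  show "col x x" for x unfolding colr_def by simp
  show "col x y \<Longrightarrow> col y x" for x y by (rule colr_sym)
  show "l \<in> Ln \<Longrightarrow> a \<in> l \<Longrightarrow> b \<in> l \<Longrightarrow> col a b" for l a b by (rule colrI)
  show "l \<in> Ln \<Longrightarrow> \<exists>c\<in>l. c \<noteq> a \<and> c \<noteq> b" for l a b using has_at_least_3[OF line_thick3] by metis
  fix l a b p c
  assume h: "l \<in> Ln" "a \<in> l" "b \<in> l" "a \<noteq> b" "col p a" "col p b" "c \<in> l"
  show "col p c"
  proof (cases "p \<in> l")
    case True
    then show ?thesis using colrI h by metis
  next
    case False
    have ne: "p \<noteq> a" using False h by metis
    obtain m where "m \<in> Ln" "p \<in> m" using colr_line[OF h(5) ne] by metis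
    then have pP: "p \<in> P - l" using line_sub False by auto
    have ab: "a \<in> l \<inter> perp \<Omega> p" "b \<in> l \<inter> perp \<Omega> p" using h line_sub[OF h(1)] by (auto simp: perp_colr)
    have "l \<inter> perp \<Omega> p = {} \<or> is_singleton (l \<inter> perp \<Omega> p) \<or> l \<subseteq> perp \<Omega> p"
      using para h(1) pP unfolding parapolar_space_def by metis
    moreover have "\<not> is_singleton (l \<inter> perp \<Omega> p)" using ab h(4) unfolding is_singleton_def by (metis singletonD)
    ultimately have "c \<in> perp \<Omega> p" using ab(1) h(7) by (metis empty_iff subsetD)
    then show ?thesis unfolding perp_colr by metis
  qed
qed

lemma symp_polar:
  assumes x: "\<xi> \<in> Sy" shows "polar \<xi>"
  unfolding polar_def
proof (intro conjI ballI impI)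
  fix a b assume "a \<in> \<xi>" "b \<in> \<xi>" "a \<noteq> b \<and> col a b"
  then show "\<exists>l\<in>Ln. a \<in> l \<and> b \<in> l" using colr_line by metis
next
  fix l a b assume "l \<in> Ln" "a \<in> l \<inter> \<xi>" "b \<in> l \<inter> \<xi>" "a \<noteq> b"
  then show "l \<subseteq> \<xi>" using symp_convex(2)[OF x] unfolding pl_subspace_def by (metis IntD1 IntD2)
next
  note po = symp_convex(4)[OF x]
  fix p assume p: "p \<in> \<xi>"
  have pp: "y \<in> perp (induced_geometry \<Omega> \<xi>) p \<longleftrightarrow> y \<in> \<xi> \<and> col p y" for y
    using colr_induced[OF symp_convex(2)[OF x] p, of y] unfolding perp_colr by (auto simp: induced_geometry_def)
  have pI: "p \<in> Points (induced_geometry \<Omega> \<xi>)" using p unfolding induced_geometry_def by simp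
  {
    fix l assume l: "l \<in> Ln" "l \<subseteq> \<xi>"
    have "l \<in> Lines (induced_geometry \<Omega> \<xi>)" using l unfolding induced_geometry_def by simp
    then have "(\<exists>!y. y \<in> l \<inter> perp (induced_geometry \<Omega> \<xi>) p) \<or> l \<subseteq> perp (induced_geometry \<Omega> \<xi>) p"
      using po pI unfolding polar_space_def by metis
    moreover obtain c where "c \<in> l" using ln_thick[OF l(1)] by metis
    ultimately show "\<exists>a\<in>l. col p a" using pp by (metis IntD1 IntD2 subsetD)
  next
    have "\<exists>y\<in>Points (induced_geometry \<Omega> \<xi>). y \<notin> perp (induced_geometry \<Omega> \<xi>) p"
      using po pI unfolding polar_space_def by metis
    then show "\<exists>q\<in>\<xi>. \<not> col p q" using pp unfolding induced_geometry_def by auto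
  }
qed

lemma symp_cover:
  assumes x: "\<xi> \<in> Sy" "p \<in> \<xi>"
  shows "\<exists>l\<in>Ln. l \<subseteq> \<xi> \<and> p \<in> l"
proof -
  have "\<Union> (Lines (induced_geometry \<Omega> \<xi>)) = Points (induced_geometry \<Omega> \<xi>)"
    using symp_convex(4)[OF x(1)] unfolding polar_space_def point_line_geometry_def by metis
  then show ?thesis using x(2) unfolding induced_geometry_def by auto
qed

sublocale symp_space col Ln P Sy
proof
  show "\<eta> \<subseteq> P" if "\<eta> \<in> Sy" for \<eta> by (rule symp_convex(3)[OF that])
  show "polar \<eta>" if "\<eta> \<in> Sy" for \<eta> by (rule symp_polar[OF that])
  show "\<exists>\<eta>\<in>Sy. l \<subseteq> \<eta>" if "l \<in> Ln" for l by (rule line_symp[OF that])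
  show "\<exists>u\<in>\<eta>. u \<noteq> p \<and> col u p" if h: "\<eta> \<in> Sy" "p \<in> \<eta>" for \<eta> p
  proof -
    obtain l where l: "l \<in> Ln" "l \<subseteq> \<eta>" "p \<in> l" using symp_cover[OF h] by metis
    obtain u where u: "u \<in> l" "u \<noteq> p" using ln_thick[OF l(1)] by metis
    show ?thesis using ln_col[OF l(1) u(1) l(3)] u l(2) by (metis subsetD)
  qed
  show "\<exists>\<eta>\<in>Sy. p \<in> \<eta>" if "p \<in> P" for p
  proof -
    have "p \<in> \<Union>Ln" using plg that unfolding point_line_geometry_def by metis
    then obtain l where "l \<in> Ln" "p \<in> l" by (rule UnionE)
    then show ?thesis using line_symp by (metis subsetD)
  qed
  show "r \<in> \<eta>" if h: "\<eta> \<in> Sy" "p \<in> \<eta>" "q \<in> \<eta>" "\<not> col p q" "r \<in> P" "col r p" "col r q" for \<eta> p q r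
  proof -
    have pq: "p \<in> P" "q \<in> P" using symp_convex(3)[OF h(1)] h(2,3) by auto
    note d = distance_two[OF h(4,6,7) pq h(5)]
    have "is_shortest_path \<Omega> p [p, r, q] q" unfolding is_shortest_path_def using d by (simp add: numeral_eq_enat)
    then have "set [p, r, q] \<subseteq> \<eta>" using symp_convex(1)[OF h(1)] h(2,3) unfolding convex_subspace_def by metis
    then show ?thesis by simp
  qed
  show "\<exists>\<eta>\<in>Sy. p \<in> \<eta> \<and> q \<in> \<eta>" if h: "p \<in> P" "q \<in> P" "r \<in> P" "\<not> col p q" "col r p" "col r q" for p q r
  proof -
    have q: "q \<notin> perp \<Omega> p" using h perp_colr by metis
    have "r \<in> perp \<Omega> p \<inter> perp \<Omega> q" using h perp_colr colr_sym by (metis IntI)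
    then have ne: "perp \<Omega> p \<inter> perp \<Omega> q \<noteq> {}" by auto
    have "\<not> is_singleton (perp \<Omega> p \<inter> perp \<Omega> q)"
      using strong h q unfolding strong_parapolar_space_def special_pair_def by metis
    moreover have "polar_space (induced_geometry \<Omega> (convex_closure \<Omega> {p, q})) \<or> is_singleton (perp \<Omega> p \<inter> perp \<Omega> q)"
      using para h(1,2) q ne unfolding parapolar_space_def by metis
    ultimately have "convex_closure \<Omega> {p, q} \<in> Sy" using h(1,2) q ne unfolding symps_def by blast
    moreover have "{p, q} \<subseteq> convex_closure \<Omega> {p, q}" using convex_closure_subspace(2)[OF plg, of "{p, q}"] h by simp
    ultimately show ?thesis by (metis insert_subset)
  qed
qed

lemma connected_closed:
  assumes "S \<subseteq> P" "s \<in> S" "\<And>p q. p \<in> S \<Longrightarrow> q \<in> P \<Longrightarrow> col q p \<Longrightarrow> q \<in> S"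
  shows "S = P"
proof
  show "P \<subseteq> S"
  proof
    fix q assume q: "q \<in> P"
    have "s \<in> P" using assms by auto
    then obtain xs where xs: "is_path \<Omega> s xs q" using para q unfolding parapolar_space_def pl_connected_def by metis
    have x: "xs \<noteq> []" "set xs \<subseteq> P" "successively (collinear_in \<Omega>) xs" "hd xs = s" "last xs = q"
      using xs unfolding is_path_def by metis+
    have "hd xs \<in> S" using x assms(2) by metis
    have "last xs \<in> S" by (rule is_path_induct[OF x(3,2,1) \<open>hd xs \<in> S\<close>]) (rule assms(3))
    then show "q \<in> S" using x by metis
  qed
qed (rule assms)

lemma symp_ne: "\<xi> \<in> Sy \<Longrightarrow> \<exists>x. x \<in> \<xi>"
  using symp_convex(4) unfolding polar_space_def induced_geometry_def by fastforce

lemma symp_outside: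
  assumes x: "\<xi> \<in> Sy" shows "\<exists>p\<in>P. p \<notin> \<xi>"
proof (rule ccontr)
  assume "\<not> ?thesis"
  then have e: "\<xi> = P" using symp_convex(3)[OF x] by auto
  obtain L p where L: "L \<in> Ln" "p \<in> P - L" "L \<inter> perp \<Omega> p = {}" using para unfolding parapolar_space_def by metis
  have pe: "p \<in> \<xi>" "L \<subseteq> \<xi>" using e L line_sub by auto
  obtain a where "a \<in> L" "col p a" using polar_one[OF symp_polar[OF x] pe(1) L(1) pe(2)] by metis
  then show False using L(3) line_sub[OF L(1)] perp_colr by (metis IntI empty_iff subsetD)
qed

lemma line_subspace: "l \<in> Ln \<Longrightarrow> pl_subspace \<Omega> l"
  unfolding pl_subspace_def using line_sub ln_uniq by (metis order_refl)

lemma line_subspace_induced: "l \<in> Ln \<Longrightarrow> l \<subseteq> \<xi> \<Longrightarrow> pl_subspace (induced_geometry \<Omega> \<xi>) l"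
  using line_subspace unfolding pl_subspace_def induced_geometry_def by simp

lemma hull_pair:
  assumes l: "l \<in> Ln" "a \<in> l" "b \<in> l" "a \<noteq> b"
  shows "pl_subspace \<Omega> hull {a, b} = l"
    and "l \<subseteq> \<xi> \<Longrightarrow> pl_subspace (induced_geometry \<Omega> \<xi>) hull {a, b} = l"
proof -
  show "pl_subspace \<Omega> hull {a, b} = l"
  proof (rule hull_unique)
    fix t assume "{a, b} \<subseteq> t" "pl_subspace \<Omega> t"
    then show "l \<subseteq> t" using l unfolding pl_subspace_def by (metis insert_subset)
  qed (use l line_subspace[OF l(1)] in auto)
  assume s: "l \<subseteq> \<xi>"
  have s': "pl_subspace (induced_geometry \<Omega> \<xi>) l" using line_subspace_induced[OF l(1) s] .
  show "pl_subspace (induced_geometry \<Omega> \<xi>) hull {a, b} = l"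
  proof (rule hull_unique)
    fix t assume "{a, b} \<subseteq> t" "pl_subspace (induced_geometry \<Omega> \<xi>) t"
    moreover have "l \<in> Lines (induced_geometry \<Omega> \<xi>)" using l(1) s unfolding induced_geometry_def by simp
    ultimately show "l \<subseteq> t" using l(2-4) unfolding pl_subspace_def by (metis insert_subset)
  qed (use l s' in auto)
qed

text \<open>A singular subspace containing \<open>l\<close> and \<open>p\<close> extends by Zorn to
  a maximal one. Rank 2 makes it the hull of two points, hence a line, and a line through two points
  of \<open>l\<close> is \<open>l\<close>.\<close>

lemma rank_two:
  assumes x: "\<xi> \<in> Sy" and r: "symp_has_rank \<Omega> \<xi> 2"
  shows "rank2 \<xi>"
  unfolding rank2_def
proof (intro ballI impI)
  let ?G = "induced_geometry \<Omega> \<xi>"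
  fix l p assume l: "l \<in> Ln" "l \<subseteq> \<xi>" and p: "p \<in> \<xi>" "\<forall>c\<in>l. col p c"
  \<comment> \<open>The double perp of \<open>l\<close> and \<open>p\<close> in \<xi> is visibly a
    singular subspace. This avoids describing the plane generated by \<open>l\<close> and
    \<open>p\<close>.\<close>
  define K where "K = {z \<in> \<xi>. \<forall>w\<in>\<xi>. col w p \<and> (\<forall>c\<in>l. col w c) \<longrightarrow> col w z}"
  have Kp: "col w z" if "z \<in> K" "w \<in> insert p l" for w z
  proof -
    have "w \<in> \<xi>" using that(2) p(1) l(2) by auto
    moreover have "col w p \<and> (\<forall>c\<in>l. col w c)" using that(2) p(2) sy ln_col[OF l(1)] rf by (metis insertE)
    ultimately show ?thesis using that(1) unfolding K_def by simp
  qed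
  have Kc: "col z w" if "z \<in> K" "w \<in> K" for z w
  proof -
    have "col z p" "\<forall>c\<in>l. col z c" using Kp[OF that(1)] sy by (metis insertI1 insertI2)+
    moreover have "z \<in> \<xi>" using that(1) unfolding K_def by simp
    ultimately show ?thesis using that(2) unfolding K_def by simp
  qed
  have pK: "insert p l \<subseteq> K" unfolding K_def using p l by auto
  have colG: "colr ?G a b \<longleftrightarrow> col a b" if "a \<in> \<xi>" "b \<in> \<xi>" for a b
    using colr_induced[OF symp_convex(2)[OF x] that] .
  have Ks: "singular_subspace ?G K" unfolding singular_subspace_def
  proof
    show "pl_subspace ?G K" unfolding pl_subspace_def
    proof (intro conjI ballI impI)
      show "K \<subseteq> Points ?G" unfolding K_def induced_geometry_def by auto
      fix a b L assume a: "a \<in> K" "b \<in> K" "L \<in> Lines ?G" "a \<noteq> b \<and> a \<in> L \<and> b \<in> L"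
      then have L: "L \<in> Ln" "L \<subseteq> \<xi>" unfolding induced_geometry_def by auto
      show "L \<subseteq> K"
      proof
        fix z assume z: "z \<in> L"
        have "col w z" if w: "w \<in> \<xi>" "col w p \<and> (\<forall>c\<in>l. col w c)" for w
        proof -
          have "col w a" "col w b" using a(1,2) w unfolding K_def by auto
          then show ?thesis using ln_all[OF L(1) _ _ _ _ _ z] a(4) by metis
        qed
        then show "z \<in> K" unfolding K_def using z L(2) by auto
      qed
    qed
    show "\<forall>x\<in>K. \<forall>y\<in>K. x \<noteq> y \<longrightarrow> collinear_in ?G x y"
    proof (intro ballI impI)
      fix a b assume ab: "a \<in> K" "b \<in> K" "a \<noteq> b"
      have "a \<in> \<xi>" "b \<in> \<xi>" using ab unfolding K_def by auto
      then have "colr ?G a b" using colG Kc ab by metis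
      then show "collinear_in ?G a b" using ab(3) unfolding colr_def by metis
    qed
  qed
  let ?A = "{S. singular_subspace ?G S \<and> K \<subseteq> S}"
  have "\<exists>M\<in>?A. \<forall>X\<in>?A. M \<subseteq> X \<longrightarrow> X = M"
  proof (rule subset_Zorn_nonempty)
    show "?A \<noteq> {}" using Ks by auto
    fix C assume C: "C \<noteq> {}" "subset.chain ?A C"
    have sub: "\<And>X. X \<in> C \<Longrightarrow> singular_subspace ?G X \<and> K \<subseteq> X" using C(2) unfolding subset.chain_def by auto
    have two_nbrs: "\<exists>X\<in>C. a \<in> X \<and> b \<in> X" if "a \<in> \<Union>C" "b \<in> \<Union>C" for a b
      using C(2) that unfolding subset_chain_def by blast
    have "pl_subspace ?G (\<Union>C)" unfolding pl_subspace_def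
    proof (intro conjI ballI impI)
      show "\<Union>C \<subseteq> Points ?G" using sub unfolding singular_subspace_def pl_subspace_def by blast
      fix a b L assume a: "a \<in> \<Union>C" "b \<in> \<Union>C" "L \<in> Lines ?G" "a \<noteq> b \<and> a \<in> L \<and> b \<in> L"
      obtain X where X: "X \<in> C" "a \<in> X" "b \<in> X" using two_nbrs[OF a(1,2)] by metis
      have "L \<subseteq> X" using sub[OF X(1)] X a(3,4) unfolding singular_subspace_def pl_subspace_def by metis
      then show "L \<subseteq> \<Union>C" using X(1) by auto
    qed
    moreover have "collinear_in ?G a b" if ab: "a \<in> \<Union>C" "b \<in> \<Union>C" "a \<noteq> b" for a b
    proof -
      obtain X where X: "X \<in> C" "a \<in> X" "b \<in> X" using two_nbrs[OF ab(1,2)] by metis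
      then show ?thesis using sub[OF X(1)] ab(3) unfolding singular_subspace_def by metis
    qed
    ultimately have "singular_subspace ?G (\<Union>C)" unfolding singular_subspace_def by metis
    moreover have "K \<subseteq> \<Union>C" using C(1) sub by blast
    ultimately show "\<Union>C \<in> ?A" by simp
  qed
  then obtain M where M: "singular_subspace ?G M" "K \<subseteq> M" "\<And>X. singular_subspace ?G X \<Longrightarrow> K \<subseteq> X \<Longrightarrow> M \<subseteq> X \<Longrightarrow> X = M"
    by auto
  have "M \<in> maximal_singular_subspaces ?G" unfolding maximal_singular_subspaces_def using M by auto
  then have "has_dim ?G M (int 2 - 1)" using r unfolding symp_has_rank_def polar_space_of_rank_def by metis
  then obtain A where A: "A \<subseteq> M" "pl_subspace ?G hull A = M" "card A = 2" unfolding has_dim_def by auto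
  obtain a b where ab: "A = {a, b}" "a \<noteq> b" using A(3) unfolding card_2_iff by metis
  have "collinear_in ?G a b" using M(1) A(1) ab unfolding singular_subspace_def by auto
  then obtain N where N: "N \<in> Ln" "N \<subseteq> \<xi>" "a \<in> N" "b \<in> N" unfolding collinear_in_def induced_geometry_def by auto
  have MN: "M = N" using hull_pair(2)[OF N(1,3,4) ab(2) N(2)] A(2) ab(1) by simp
  obtain c where c: "c \<in> l" using ln_thick[OF l(1)] by metis
  obtain d where d: "d \<in> l" "d \<noteq> c" using ln_thick[OF l(1)] by metis
  have i: "c \<in> N" "d \<in> N" "p \<in> N" using pK M(2) MN c d by auto
  show "p \<in> l" using ln_uniq[OF N(1) l(1) i(1,2) c d(1)] d(2) i(3) by metis
qed

text \<open>In a symp with \<open>rank2\<close> a line is a maximal singular subspace, and it is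
  generated by two of its points.\<close>

lemma rank_le_two:
  assumes x: "\<xi> \<in> Sy" "rank2 \<xi>" and r: "symp_has_rank \<Omega> \<xi> r"
  shows "r = 2"
proof -
  let ?G = "induced_geometry \<Omega> \<xi>"
  obtain z where z: "z \<in> \<xi>" using symp_ne[OF x(1)] by metis
  obtain l where l: "l \<in> Ln" "l \<subseteq> \<xi>" using symp_cover[OF x(1) z] by metis
  obtain a where a: "a \<in> l" using ln_thick[OF l(1)] by metis
  obtain b where b: "b \<in> l" "b \<noteq> a" using ln_thick[OF l(1)] by metis
  have lG: "l \<in> Lines ?G" using l unfolding induced_geometry_def by simp
  have s: "singular_subspace ?G l"
    using line_subspace_induced[OF l] lG unfolding singular_subspace_def collinear_in_def by metis
  have "T = l" if T: "singular_subspace ?G T" "l \<subseteq> T" for T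
  proof
    show "T \<subseteq> l"
    proof
      fix t assume t: "t \<in> T"
      have tx: "t \<in> \<xi>" using T t unfolding singular_subspace_def pl_subspace_def induced_geometry_def by auto
      have "col t c" if "c \<in> l" for c
      proof -
        have "c \<in> T" using that T by auto
        then have "colr ?G t c" using T(1) t unfolding singular_subspace_def colr_def by metis
        then show ?thesis using colr_induced[OF symp_convex(2)[OF x(1)] tx] l(2) that by (metis subsetD)
      qed
      then show "t \<in> l" using x(2) l tx unfolding rank2_def by metis
    qed
  qed (rule T)
  then have "l \<in> maximal_singular_subspaces ?G" using s unfolding maximal_singular_subspaces_def by auto
  then have "has_dim ?G l (int r - 1)" using r unfolding symp_has_rank_def polar_space_of_rank_def by metis
  moreover have "{a, b} \<subseteq> l" "finite {a, b}" using a b by auto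
  ultimately have "int r - 1 + 1 \<le> int (card {a, b})"
    using hull_pair(2)[OF l(1) a b(1) b(2)[symmetric] l(2)] unfolding has_dim_def by metis
  moreover have "2 \<le> r" using r unfolding symp_has_rank_def polar_space_of_rank_def by metis
  ultimately show ?thesis using b(2) by (simp add: card_insert_if)
qed

lemma hull_small:
  shows "pl_subspace \<Omega> hull {} = {}" and "x \<in> P \<Longrightarrow> pl_subspace \<Omega> hull {x} = {x}"
  by (rule hull_unique; auto simp: pl_subspace_def)+

lemma lacunary_empty:
  assumes k: "k_lacunary (-1) \<Omega>" and e: "\<eta> \<in> Sy" "\<theta> \<in> Sy"
  shows "\<exists>x. x \<in> \<eta> \<and> x \<in> \<theta>"
proof (cases "\<eta> = \<theta>")
  case False
  have "singular_subspace \<Omega> {}" unfolding singular_subspace_def pl_subspace_def by simp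
  moreover have "has_dim \<Omega> {} (-1)" unfolding has_dim_def using hull_small(1) by simp
  ultimately have "\<eta> \<inter> \<theta> \<noteq> {}" using k e False unfolding k_lacunary_def by metis
  then show ?thesis by auto
qed (use symp_ne e in metis)

lemma lacunary_point:
  assumes k: "k_lacunary 0 \<Omega>" and e: "\<eta> \<in> Sy" "\<theta> \<in> Sy" "\<eta> \<noteq> \<theta>" "x \<in> \<eta>" "x \<in> \<theta>"
  shows "\<exists>y. y \<in> \<eta> \<and> y \<in> \<theta> \<and> y \<noteq> x"
proof (rule ccontr)
  assume "\<not> ?thesis"
  then have "\<forall>y. y \<in> \<eta> \<inter> \<theta> \<longleftrightarrow> y = x" using e(4,5) by (metis IntD1 IntD2 IntI)
  then have i: "\<eta> \<inter> \<theta> = {x}" by auto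
  have xP: "x \<in> P" using symp_convex(3)[OF e(1)] e by auto
  have "singular_subspace \<Omega> {x}" unfolding singular_subspace_def pl_subspace_def using xP by auto
  moreover have "has_dim \<Omega> {x} 0" unfolding has_dim_def
  proof (intro conjI allI impI)
    show "\<exists>A\<subseteq>{x}. finite A \<and> pl_subspace \<Omega> hull A = {x} \<and> int (card A) = 0 + 1"
      using hull_small(2)[OF xP] by (intro exI[of _ "{x}"]) simp
    fix A assume A: "A \<subseteq> {x}" "finite A \<and> pl_subspace \<Omega> hull A = {x}"
    have "A \<noteq> {}" using A hull_small(1) by auto
    then show "0 + 1 \<le> int (card A)" using A by (simp add: Suc_leI card_gt_0_iff)
  qed
  ultimately show False using k e(1-3) i unfolding k_lacunary_def by metis
qed

lemma lacunary_line:
  assumes k: "k_lacunary 1 \<Omega>" and e: "\<eta> \<in> Sy" "\<theta> \<in> Sy" "\<eta> \<noteq> \<theta>" and l: "l \<in> Ln"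
  shows "\<eta> \<inter> \<theta> \<noteq> l"
proof
  assume i: "\<eta> \<inter> \<theta> = l"
  obtain a where a: "a \<in> l" using ln_thick[OF l] by metis
  obtain b where b: "b \<in> l" "b \<noteq> a" using ln_thick[OF l] by metis
  have "singular_subspace \<Omega> l" unfolding singular_subspace_def using line_subspace[OF l] l
    unfolding collinear_in_def by metis
  moreover have "has_dim \<Omega> l 1" unfolding has_dim_def
  proof (intro conjI allI impI)
    show "\<exists>A\<subseteq>l. finite A \<and> pl_subspace \<Omega> hull A = l \<and> int (card A) = 1 + 1"
      using hull_pair(1)[OF l a b(1) b(2)[symmetric]] a b by (intro exI[of _ "{a, b}"]) simp
    fix A assume A: "A \<subseteq> l" "finite A \<and> pl_subspace \<Omega> hull A = l"
    have "A \<noteq> {}" using A a hull_small(1) by auto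
    moreover have "A \<noteq> {x}" for x
    proof
      assume x: "A = {x}"
      then have "x \<in> P" using A line_sub[OF l] by auto
      then have "l = {x}" using A hull_small(2) x by simp
      then show False using a b by auto
    qed
    ultimately have "card A \<noteq> 0" "card A \<noteq> 1" using A(2) by (metis card_0_eq, metis card_1_singletonE)
    then show "1 + 1 \<le> int (card A)" by linarith
  qed
  ultimately show False using k e i unfolding k_lacunary_def by metis
qed

end

lemma two_at_least:
  assumes "a \<in> A" "b \<in> A" "a \<noteq> b"
  shows "has_at_least 2 A"
proof -
  have "card {a, b} = 2" "{a, b} \<subseteq> A" using assms by simp_all
  then show ?thesis unfolding has_at_least_def by (metis card_mono)
qed

section \<open>The generalized quadrangle of maximal singular subspaces\<close>

locale strong_parapolar_quadrangle = strong_parapolar +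
  assumes all_rank2: "\<xi> \<in> Sy \<Longrightarrow> rank2 \<xi>"
    and all_symp_rank2: "\<xi> \<in> Sy \<Longrightarrow> symp_has_rank \<Omega> \<xi> 2"
    and second_nbr: "\<eta> \<in> Sy \<Longrightarrow> p \<in> P \<Longrightarrow> p \<notin> \<eta> \<Longrightarrow> x \<in> \<eta> \<Longrightarrow> col p x \<Longrightarrow> \<exists>x'\<in>\<eta>. x' \<noteq> x \<and> col p x'"
begin

sublocale quadrangle_symps col Ln P Sy
proof
  show "rank2 \<eta>" if "\<eta> \<in> Sy" for \<eta> by (rule all_rank2[OF that])
  show "\<exists>x'\<in>\<eta>. x' \<noteq> x \<and> col p x'" if "\<eta> \<in> Sy" "p \<in> P" "p \<notin> \<eta>" "x \<in> \<eta>" "col p x" for \<eta> p x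
    by (rule second_nbr[OF that])
  show "S = P" if "S \<subseteq> P" "s \<in> S" "\<And>p q. p \<in> S \<Longrightarrow> q \<in> P \<Longrightarrow> col q p \<Longrightarrow> q \<in> S" for S s
    by (rule connected_closed[OF that(1,2)]) (rule that(3))
qed

lemma symp_exists: "\<exists>\<xi>. \<xi> \<in> Sy"
proof -
  obtain L where "L \<in> Ln" using para unfolding parapolar_space_def by metis
  then show ?thesis using line_symp by metis
qed

lemma max_clique_singular: assumes S: "max_clique S" shows "singular_subspace \<Omega> S"
  unfolding singular_subspace_def pl_subspace_def
proof (intro conjI ballI impI)
  show "S \<subseteq> P" using max_clique_P[OF S] by (rule subsetI)
  show "L \<subseteq> S" if "x \<in> S" "y \<in> S" "L \<in> Ln" "x \<noteq> y \<and> x \<in> L \<and> y \<in> L" for x y L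
    using max_clique_ln[OF S that(1,2)] that(3,4) by metis
  show "collinear_in \<Omega> x y" if "x \<in> S" "y \<in> S" "x \<noteq> y" for x y
    using max_clique_col[OF S that(1,2)] that(3) unfolding colr_def by metis
qed

lemma singular_in_mc:
  assumes S: "singular_subspace \<Omega> S"
  shows "\<exists>M. max_clique M \<and> S \<subseteq> M"
proof -
  have SP: "c \<in> P" if "c \<in> S" for c using S that unfolding singular_subspace_def pl_subspace_def by auto
  have Sc: "col c d" if "c \<in> S" "d \<in> S" for c d using S that unfolding singular_subspace_def colr_def by metis
  show ?thesis
  proof (cases "\<exists>a\<in>S. \<exists>b\<in>S. a \<noteq> b")
    case True
    then obtain a b where ab: "a \<in> S" "b \<in> S" "a \<noteq> b" by metis
    obtain M where M: "max_clique M" "a \<in> M" "b \<in> M" using max_clique_ex[OF SP[OF ab(1)] SP[OF ab(2)] ab(3) Sc[OF ab(1,2)]] .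
    have "c \<in> M" if "c \<in> S" for c using max_clique_in[OF M ab(3) SP[OF that] Sc[OF that ab(1)] Sc[OF that ab(2)]] .
    then show ?thesis using M(1) by (metis subsetI)
  next
    case False
    obtain p where p: "p \<in> P" "\<forall>c\<in>S. c = p"
    proof (cases "S = {}")
      case True
      obtain \<xi> where x: "\<xi> \<in> Sy" using symp_exists by metis
      obtain p where p: "p \<in> \<xi>" using symp_ne[OF x] by metis
      show ?thesis by (rule that[OF Sy_P[OF x p]]) (simp add: True)
    next
      case ne: False
      then obtain p where "p \<in> S" by auto
      then show ?thesis using False that SP by metis
    qed
    obtain M where "max_clique M" "p \<in> M" using max_clique_two_at[OF p(1)] by metis
    then show ?thesis using p(2) by (metis subsetI)
  qed
qed

lemma maximal_mc: "maximal_singular_subspaces \<Omega> = Collect max_clique"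
proof
  show "maximal_singular_subspaces \<Omega> \<subseteq> Collect max_clique"
  proof
    fix S assume "S \<in> maximal_singular_subspaces \<Omega>"
    then have S: "singular_subspace \<Omega> S" "\<And>T. singular_subspace \<Omega> T \<Longrightarrow> S \<subseteq> T \<Longrightarrow> T = S"
      unfolding maximal_singular_subspaces_def by auto
    obtain M where M: "max_clique M" "S \<subseteq> M" using singular_in_mc[OF S(1)] by metis
    then have "M = S" using S(2)[OF max_clique_singular] by metis
    then show "S \<in> Collect max_clique" using M(1) by simp
  qed
  show "Collect max_clique \<subseteq> maximal_singular_subspaces \<Omega>"
  proof
    fix S assume "S \<in> Collect max_clique"
    then have S: "max_clique S" by simp
    have "T = S" if T: "singular_subspace \<Omega> T" "S \<subseteq> T" for T
    proof -
      obtain M where M: "max_clique M" "T \<subseteq> M" using singular_in_mc[OF T(1)] by metis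
      obtain a where a: "a \<in> S" using max_clique_two[OF S] by metis
      obtain b where b: "b \<in> S" "b \<noteq> a" using max_clique_two[OF S] by metis
      have "a \<in> M" "b \<in> M" using a b T(2) M(2) by auto
      then have "S = M" using max_clique_eq[OF S M(1) a b(1)] b(2) by metis
      then show ?thesis using T(2) M(2) by simp
    qed
    then show "S \<in> maximal_singular_subspaces \<Omega>" unfolding maximal_singular_subspaces_def using max_clique_singular[OF S] by simp
  qed
qed

abbreviation "Q \<equiv> \<lparr>Points = P, Lines = maximal_singular_subspaces \<Omega>\<rparr>"

lemma collinear_Q: "collinear_in Q p q \<longleftrightarrow> p \<noteq> q \<and> p \<in> P \<and> q \<in> P \<and> col p q"
proof
  assume "collinear_in Q p q"
  then obtain S where S: "p \<noteq> q" "max_clique S" "p \<in> S" "q \<in> S" unfolding collinear_in_def maximal_mc by auto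
  show "p \<noteq> q \<and> p \<in> P \<and> q \<in> P \<and> col p q" using S(1) max_clique_P[OF S(2)] max_clique_col[OF S(2-4)] S(3,4) by metis
next
  assume h: "p \<noteq> q \<and> p \<in> P \<and> q \<in> P \<and> col p q"
  obtain S where "max_clique S" "p \<in> S" "q \<in> S" using max_clique_ex[of p q] h by metis
  then show "collinear_in Q p q" unfolding collinear_in_def maximal_mc using h by auto
qed

lemma gq_Q: "generalized_quadrangle Q"
  unfolding generalized_quadrangle_def
proof (intro conjI ballI impI)
  show "point_line_geometry Q" unfolding point_line_geometry_def
  proof (intro conjI ballI)
    fix S assume "S \<in> Lines Q"
    then have S: "max_clique S" using maximal_mc by simp
    show "S \<subseteq> Points Q" using max_clique_P[OF S] by auto
    obtain a where a: "a \<in> S" using max_clique_two[OF S] by metis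
    obtain b where b: "b \<in> S" "b \<noteq> a" using max_clique_two[OF S] by metis
    show "has_at_least 2 S" by (rule two_at_least[OF b(1) a b(2)])
  next
    show "\<Union> (Lines Q) = Points Q"
    proof
      show "\<Union> (Lines Q) \<subseteq> Points Q" using max_clique_P unfolding maximal_mc by auto
      show "Points Q \<subseteq> \<Union> (Lines Q)"
      proof
        fix p assume "p \<in> Points Q"
        then obtain S where "max_clique S" "p \<in> S" using max_clique_two_at[of p] by auto
        then show "p \<in> \<Union> (Lines Q)" unfolding maximal_mc by auto
      qed
    qed
  qed
  obtain \<xi> where x: "\<xi> \<in> Sy" using symp_exists by metis
  show "Points Q \<noteq> {}" using symp_ne[OF x] Sy_P[OF x] by auto
next
  fix L M x y assume "L \<in> Lines Q" "M \<in> Lines Q" "x \<in> L \<inter> M" "y \<in> L \<inter> M" "x \<noteq> y"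
  then show "L = M" using max_clique_eq[of L M x y] unfolding maximal_mc by simp
next
  fix p assume "p \<in> Points Q"
  then have p: "p \<in> P" by simp
  obtain S S' where S: "max_clique S" "max_clique S'" "S \<noteq> S'" "p \<in> S" "p \<in> S'" using max_clique_two_at[OF p] by metis
  show "has_at_least 2 {L \<in> Lines Q. p \<in> L}"
    by (rule two_at_least[OF _ _ S(3)]) (use S maximal_mc in simp_all)
next
  fix S p assume h: "S \<in> Lines Q" "p \<in> Points Q - S"
  then have S: "max_clique S" and p: "p \<in> P" "p \<notin> S" using maximal_mc by simp_all
  obtain q where q: "q \<in> S" "col p q" using max_clique_hit[OF S p(1)] by metis
  show "\<exists>!q. q \<in> S \<and> collinear_in Q p q"
  proof (rule ex1I[of _ q])
    show "q \<in> S \<and> collinear_in Q p q" unfolding collinear_Q using q p max_clique_P[OF S q(1)] by metis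
    fix r assume "r \<in> S \<and> collinear_in Q p r"
    then have "r \<in> S" "col p r" unfolding collinear_Q by metis+
    then show "r = q" using max_clique_in[OF S _ q(1) _ p(1) _ q(2)] p(2) by metis
  qed
qed

lemma gq_symp:
  assumes x: "\<xi> \<in> Sy"
  shows "generalized_quadrangle (induced_geometry \<Omega> \<xi>)"
  unfolding generalized_quadrangle_def
proof (intro conjI ballI impI)
  let ?G = "induced_geometry \<Omega> \<xi>"
  have sel: "Points ?G = \<xi>" "Lines ?G = {L \<in> Ln. L \<subseteq> \<xi>}" unfolding induced_geometry_def by simp_all
  show "point_line_geometry ?G" "Points ?G \<noteq> {}" using symp_convex(4)[OF x] unfolding polar_space_def by metis+
  show "L = M" if "L \<in> Lines ?G" "M \<in> Lines ?G" "a \<in> L \<inter> M" "b \<in> L \<inter> M" "a \<noteq> b" for L M a b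
    using that ln_uniq[of L M a b] unfolding sel by simp
  show "has_at_least 2 {L \<in> Lines ?G. p \<in> L}" if "p \<in> Points ?G" for p
  proof -
    have p: "p \<in> \<xi>" using that sel by simp
    obtain c d where cd: "c \<in> \<xi>" "d \<in> \<xi>" "col c p" "col d p" "\<not> col c d" using Sy_two[OF x p] .
    have ne: "c \<noteq> p" "d \<noteq> p" using cd sy by metis+
    obtain l where l: "l \<in> Ln" "c \<in> l" "p \<in> l" "l \<subseteq> \<xi>" using polar_line[OF Sy_polar[OF x] cd(1) p ne(1) cd(3)] .
    obtain m where m: "m \<in> Ln" "d \<in> m" "p \<in> m" "m \<subseteq> \<xi>" using polar_line[OF Sy_polar[OF x] cd(2) p ne(2) cd(4)] .
    have lm: "l \<noteq> m" using ln_col[OF l(1,2)] m(2) cd(5) by metis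
    show ?thesis by (rule two_at_least[OF _ _ lm]) (use l m sel in simp_all)
  qed
  show "\<exists>!q. q \<in> L \<and> collinear_in ?G p q" if h: "L \<in> Lines ?G" "p \<in> Points ?G - L" for L p
  proof -
    have L: "L \<in> Ln" "L \<subseteq> \<xi>" and p: "p \<in> \<xi>" "p \<notin> L" using h sel by simp_all
    have cG: "collinear_in ?G p q \<longleftrightarrow> col p q" if "q \<in> L" for q
    proof -
      have "q \<in> \<xi>" using that L by auto
      then have "colr ?G p q \<longleftrightarrow> col p q" using colr_induced[OF symp_convex(2)[OF x] p(1)] by metis
      then show ?thesis using that p(2) unfolding colr_def by metis
    qed
    obtain q where q: "q \<in> L" "col p q" using polar_one[OF Sy_polar[OF x] p(1) L] by metis
    show ?thesis
    proof (rule ex1I[of _ q])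
      show "q \<in> L \<and> collinear_in ?G p q" using q cG by metis
      fix r assume "r \<in> L \<and> collinear_in ?G p r"
      then have r: "r \<in> L" "col p r" using cG by metis+
      show "r = q"
      proof (rule ccontr)
        assume "r \<noteq> q"
        moreover have "r \<in> \<xi>" "q \<in> \<xi>" using r q L by auto
        ultimately show False using rank2_triangle[OF x L(1) r(1) q(1) _ _ _ p(1) r(2) q(2)] p(2) by metis
      qed
    qed
  qed
qed

text \<open>Both parts rest on \<open>max_clique_symp_line\<close>: a maximal clique through a point
  of \<xi> cuts out a line of \<xi>, and every line of \<xi> arises this way.\<close>

lemma ideal_symp:
  assumes x: "\<xi> \<in> Sy"
  shows "ideal_subquadrangle (induced_geometry \<Omega> \<xi>) Q"
  unfolding ideal_subquadrangle_def subquadrangle_def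
proof (intro conjI ballI impI)
  let ?G = "induced_geometry \<Omega> \<xi>"
  have sel: "Points ?G = \<xi>" "Lines ?G = {L \<in> Ln. L \<subseteq> \<xi>}" unfolding induced_geometry_def by simp_all
  show "generalized_quadrangle ?G" by (rule gq_symp[OF x])
  show "generalized_quadrangle Q" by (rule gq_Q)
  show "Points ?G \<subseteq> Points Q" using symp_convex(3)[OF x] sel by simp
  show "\<exists>L\<in>Lines Q. K = L \<inter> Points ?G" if "K \<in> Lines ?G" for K
  proof -
    have K: "K \<in> Ln" "K \<subseteq> \<xi>" using that sel by simp_all
    obtain a where a: "a \<in> K" using ln_thick[OF K(1)] by metis
    obtain b where b: "b \<in> K" "b \<noteq> a" using ln_thick[OF K(1)] by metis
    have ax: "a \<in> \<xi>" and bx: "b \<in> \<xi>" using a b K by auto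
    obtain S where S: "max_clique S" "a \<in> S" "b \<in> S"
      using max_clique_ex[OF Ln_P[OF K(1) a] Ln_P[OF K(1) b(1)] b(2)[symmetric] ln_col[OF K(1) a b(1)]] .
    obtain l where l: "l \<in> Ln" "a \<in> l" "l = S \<inter> \<xi>" using max_clique_symp_line[OF x ax S(1,2)] by metis
    have "b \<in> l" using l(3) S(3) bx by simp
    then have "K = l" using ln_uniq[OF K(1) l(1) a b(1) l(2) _ b(2)[symmetric]] by metis
    then show ?thesis using l(3) S(1) maximal_mc sel by (intro bexI[of _ S]) simp_all
  qed
  show "L \<inter> Points ?G \<in> Lines ?G" if h: "p \<in> Points ?G" "L \<in> Lines Q" "p \<in> L" for p L
  proof -
    have L: "max_clique L" and p: "p \<in> \<xi>" using h maximal_mc sel by simp_all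
    obtain l where "l \<in> Ln" "p \<in> l" "l = L \<inter> \<xi>" using max_clique_symp_line[OF x p L h(3)] by metis
    then show ?thesis using sel by simp
  qed
qed

lemma diameter_two: "pl_diameter \<Omega> = 2"
  unfolding pl_diameter_def
proof (rule antisym)
  show "(SUP x\<in>P. SUP y\<in>P. pl_distance \<Omega> x y) \<le> 2"
  proof (intro SUP_least)
    fix p q assume pq: "p \<in> P" "q \<in> P"
    obtain r where r: "r \<in> P" "col r p" "col r q" using common_nbr[OF pq] by metis
    show "pl_distance \<Omega> p q \<le> 2" by (rule distance_le_two[OF r pq])
  qed
  obtain \<xi> where x: "\<xi> \<in> Sy" using symp_exists by metis
  obtain p where p: "p \<in> \<xi>" using symp_ne[OF x] by metis
  obtain q where q: "q \<in> \<xi>" "\<not> col p q" using polar_nd[OF Sy_polar[OF x] p] by metis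
  have pq: "p \<in> P" "q \<in> P" using Sy_P[OF x p] Sy_P[OF x q(1)] .
  obtain r where r: "r \<in> P" "col r p" "col r q" using common_nbr[OF pq] by metis
  have "pl_distance \<Omega> p q = 2" by (rule distance_two(2)[OF q(2) r(2,3) pq r(1)])
  then have "2 \<le> (SUP y\<in>P. pl_distance \<Omega> p y)" using SUP_upper[OF pq(2), of "pl_distance \<Omega> p"] by simp
  then show "2 \<le> (SUP x\<in>P. SUP y\<in>P. pl_distance \<Omega> x y)"
    using SUP_upper[OF pq(1), of "\<lambda>x. SUP y\<in>P. pl_distance \<Omega> x y"] by (rule order_trans)
qed

lemma imbrex_geom: "imbrex_geometry \<Omega>"
  unfolding imbrex_geometry_def
proof (intro conjI ballI impI)
  show "strong_parapolar_space \<Omega>" by (rule strong)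
  show "pl_diameter \<Omega> = 2" by (rule diameter_two)
  show "symplectic_rank \<Omega> 2" unfolding symplectic_rank_def using all_symp_rank2 by (rule ballI)
  fix \<xi> \<zeta> p L assume h: "\<xi> \<in> Sy" "\<zeta> \<in> Sy" "p \<in> \<xi> \<inter> \<zeta>" "L \<in> Ln"
    and ab: "L \<inter> \<xi> - perp \<Omega> p \<noteq> {} \<and> L \<inter> \<zeta> - perp \<Omega> p \<noteq> {}"
  obtain a b where a: "a \<in> L" "a \<in> \<xi>" "a \<notin> perp \<Omega> p" and b: "b \<in> L" "b \<in> \<zeta>" "b \<notin> perp \<Omega> p" using ab by auto
  have n: "\<not> col a p" "\<not> col b p" using a b Ln_P[OF h(4)] sy unfolding perp_colr by metis+
  have p: "p \<in> \<xi>" "p \<in> \<zeta>" using h(3) by simp_all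
  obtain K where "K \<in> Ln" "K \<subseteq> \<xi>" "K \<subseteq> \<zeta>" using imbrex[OF h(1,2) p h(4) a(1) b(1) a(2) n(1) b(2) n(2)] by metis
  then show "\<exists>K\<in>Ln. K \<subseteq> \<xi> \<inter> \<zeta>" by auto
qed

lemma gq_outcome:
  "imbrex_geometry \<Omega> \<and> generalized_quadrangle Q \<and> (\<forall>\<xi>\<in>Sy. ideal_subquadrangle (induced_geometry \<Omega> \<xi>) Q)"
  using imbrex_geom gq_Q ideal_symp by metis

end

locale strong_parapolar_0 = strong_parapolar +
  assumes lac0: "k_lacunary 0 \<Omega>"
begin

sublocale symps_share_line col Ln P Sy
proof
  show "\<exists>y. y \<in> \<eta> \<and> y \<in> \<theta> \<and> y \<noteq> x" if "\<eta> \<in> Sy" "\<theta> \<in> Sy" "\<eta> \<noteq> \<theta>" "x \<in> \<eta>" "x \<in> \<theta>" for \<eta> \<theta> x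
    by (rule lacunary_point[OF lac0 that])
  show "S = P" if "S \<subseteq> P" "s \<in> S" "\<And>p q. p \<in> S \<Longrightarrow> q \<in> P \<Longrightarrow> col q p \<Longrightarrow> q \<in> S" for S s
    by (rule connected_closed[OF that(1,2)]) (rule that(3))
  show "\<exists>x. x \<in> \<eta>" if "\<eta> \<in> Sy" for \<eta> by (rule symp_ne[OF that])
qed

lemma product_outcome:
  assumes "product_at \<zeta> x T"
  shows "\<exists>(T :: 'a geometry) (\<Gamma> :: 'a geometry).
    thick_line T \<and> (linear_space \<Gamma> \<and> has_thick_lines \<Gamma> \<or> polar_space \<Gamma>) \<and> pl_isomorphic \<Omega> (cartesian_product T \<Gamma>)"
proof -
  obtain T f where T: "T \<in> Ln" and z: "\<zeta> \<in> Sy" and f: "bij_betw f P (T \<times> \<zeta>)"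
    and l: "(`) f ` Ln = {{p} \<times> M | p M. p \<in> T \<and> M \<in> Ln \<and> M \<subseteq> \<zeta>} \<union> {T \<times> {q} | q. q \<in> \<zeta>}"
    using product_at_iso[OF assms] by (elim exE conjE)
  let ?T = "\<lparr>Points = T, Lines = {T}\<rparr>"
  let ?G = "induced_geometry \<Omega> \<zeta>"
  have "thick_line ?T" unfolding thick_line_def using line_thick3[OF T] by simp
  moreover have "polar_space ?G" by (rule symp_convex(4)[OF z])
  moreover have "pl_isomorphic \<Omega> (cartesian_product ?T ?G)"
    unfolding pl_isomorphic_def
  proof (intro exI[of _ f] conjI)
    show "bij_betw f P (Points (cartesian_product ?T ?G))"
      using f unfolding cartesian_product_def induced_geometry_def by simp
    show "(`) f ` Ln = Lines (cartesian_product ?T ?G)"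
      unfolding l cartesian_product_def induced_geometry_def by simp
  qed
  ultimately show ?thesis by (intro exI[of _ ?T] exI[of _ ?G]) simp
qed

end

locale strong_parapolar_0_rank2 = strong_parapolar_0 +
  assumes rank2_all0: "\<xi> \<in> Sy \<Longrightarrow> rank2 \<xi>"
    and symp_rank2_all: "\<xi> \<in> Sy \<Longrightarrow> symp_has_rank \<Omega> \<xi> 2"
begin

sublocale symps_share_line_rank2 col Ln P Sy
  by unfold_locales (rule rank2_all0)

text \<open>The case split is all or nothing: by \<open>two_nbrs_everywhere\<close> a single point
  with two neighbours in a symp yields the quadrangle hypothesis everywhere, and without such a
  point there are no triangles off lines.\<close>

lemma outcome:
  "(imbrex_geometry \<Omega> \<and>
      generalized_quadrangle \<lparr>Points = Points \<Omega>, Lines = maximal_singular_subspaces \<Omega>\<rparr> \<and>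
      (\<forall>\<xi>\<in>symps \<Omega>. ideal_subquadrangle (induced_geometry \<Omega> \<xi>) \<lparr>Points = Points \<Omega>, Lines = maximal_singular_subspaces \<Omega>\<rparr>)) \<or>
   (\<exists>(T :: 'a geometry) (\<Gamma> :: 'a geometry).
      thick_line T \<and> (linear_space \<Gamma> \<and> has_thick_lines \<Gamma> \<or> polar_space \<Gamma>) \<and> pl_isomorphic \<Omega> (cartesian_product T \<Gamma>)) \<or>
   (\<exists>\<Delta> :: 'a set geometry. thick_polar_space_of_rank \<Delta> 3 \<and> pl_isomorphic \<Omega> (dual_polar_space_rank3 \<Delta>))"
proof (cases "\<exists>\<xi>\<in>Sy. \<exists>p. two_nbrs \<xi> p")
  case True
  then obtain \<xi> p where x: "\<xi> \<in> Sy" "two_nbrs \<xi> p" by metis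
  have g: "\<exists>x'\<in>\<eta>. x' \<noteq> y \<and> col q x'" if "\<eta> \<in> Sy" "q \<in> P" "q \<notin> \<eta>" for \<eta> q y
    using two_nbrs_everywhere[OF x that] unfolding two_nbrs_def by metis
  have "strong_parapolar_quadrangle \<Omega>"
    by (intro strong_parapolar_quadrangle.intro strong_parapolar_quadrangle_axioms.intro strong_parapolar_axioms) (fact rank2_all0, fact symp_rank2_all, rule g)
  from strong_parapolar_quadrangle.gq_outcome[OF this] show ?thesis by (rule disjI1)
next
  case False
  have "triangle_free_symps_axioms col P Sy"
  proof
    show "a = b" if "\<eta> \<in> Sy" "p \<in> P" "p \<notin> \<eta>" "a \<in> \<eta>" "b \<in> \<eta>" "col p a" "col p b" for \<eta> p a b
      using two_nbrsI[OF that(2-5) _ that(6,7)] False that(1) by metis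
    show "\<exists>p\<in>P. p \<notin> \<eta>" if "\<eta> \<in> Sy" for \<eta> by (rule symp_outside[OF that])
  qed
  then have "triangle_free_symps col Ln P Sy" using symps_share_line_rank2_axioms by (intro triangle_free_symps.intro)
  then interpret triangle_free_symps col Ln P Sy .
  show ?thesis
  proof (cases "\<exists>L\<in>Ln. \<forall>A B C. A \<in> Sy \<longrightarrow> B \<in> Sy \<longrightarrow> C \<in> Sy \<longrightarrow> L \<subseteq> A \<longrightarrow> L \<subseteq> B \<longrightarrow> L \<subseteq> C \<longrightarrow> A = B \<or> B = C \<or> A = C")
    case True
    then obtain L where L: "L \<in> Ln" "\<forall>A B C. A \<in> Sy \<longrightarrow> B \<in> Sy \<longrightarrow> C \<in> Sy \<longrightarrow> L \<subseteq> A \<longrightarrow> L \<subseteq> B \<longrightarrow> L \<subseteq> C \<longrightarrow> A = B \<or> B = C \<or> A = C"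
      by (elim bexE)
    obtain \<zeta> x T where "product_at \<zeta> x T" using few_symps_product_at[OF L] by (elim exE)
    from product_outcome[OF this] show ?thesis by (rule disjI2[OF disjI1])
  next
    case False
    have t: "\<exists>A B C. A \<in> Sy \<and> B \<in> Sy \<and> C \<in> Sy \<and> L \<subseteq> A \<and> L \<subseteq> B \<and> L \<subseteq> C \<and> A \<noteq> B \<and> B \<noteq> C \<and> A \<noteq> C" if "L \<in> Ln" for L
      using bspec[OF False[unfolded bex_simps] that] False that by metis
    obtain L p where "L \<in> Ln" "p \<in> P - L" using para unfolding parapolar_space_def by metis
    then have ne: "\<exists>p. p \<in> P" by auto
    have "dual_polar_symps col Ln P Sy"
      by (intro dual_polar_symps.intro dual_polar_symps_axioms.intro triangle_free_symps_axioms) (rule t, assumption, rule ne)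
    then interpret dual_polar_symps col Ln P Sy .
    have eq: "\<lparr>Points = P, Lines = Ln\<rparr> = \<Omega>" by simp
    have "pl_isomorphic \<Omega> (dual_polar_space_rank3 dual)" using dual_iso unfolding eq .
    then show ?thesis using dual_thick by (intro disjI2) (rule exI[of _ dual], rule conjI)
  qed
qed

end

text \<open>Connectedness gives a neighbour \<open>p\<close> of \<xi> outside it. The symp through
  \<open>p\<close> and a suitable \<open>c\<close> contains a line of \<xi>. All common points of
  the two symps form a clique, which rank 2 confines to that line.\<close>

lemma (in strong_parapolar) not_lacunary_line:
  assumes x: "\<xi> \<in> Sy" "rank2 \<xi>" and k: "k_lacunary 1 \<Omega>"
  shows False
proof -
  have "\<exists>p q. p \<in> \<xi> \<and> q \<in> P \<and> col q p \<and> q \<notin> \<xi>"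
  proof (rule ccontr)
    assume n: "\<not> ?thesis"
    obtain s where s: "s \<in> \<xi>" using symp_ne[OF x(1)] by metis
    have "\<xi> = P" by (rule connected_closed[OF symp_convex(3)[OF x(1)] s]) (use n in metis)
    then show False using symp_outside[OF x(1)] by metis
  qed
  then obtain p a where p: "p \<in> P" "p \<notin> \<xi>" "a \<in> \<xi>" "col p a" by metis
  obtain c where c: "c \<in> \<xi>" "col c a" "\<not> col p c" using Sy_away[OF x(1) p(3,1,2)] .
  obtain \<tau> where t: "\<tau> \<in> Sy" "p \<in> \<tau>" "c \<in> \<tau>" "a \<in> \<tau>"
    using Sy_exE[OF p(1) Sy_P[OF x(1) c(1)] Sy_P[OF x(1) p(3)] c(3) sy[OF p(4)] sy[OF c(2)]] .
  have ca: "c \<noteq> a" using c p by metis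
  obtain l where l: "l \<in> Ln" "c \<in> l" "a \<in> l" "l \<subseteq> \<xi>" using polar_line[OF Sy_polar[OF x(1)] c(1) p(3) ca c(2)] .
  have lt: "l \<subseteq> \<tau>" using Sy_ln[OF t(1) l(1-3) t(3,4) ca] .
  have ne: "\<xi> \<noteq> \<tau>" using t p by metis
  have "z \<in> l" if z: "z \<in> \<xi>" "z \<in> \<tau>" for z
  proof -
    have "col z c" "col z a" using Sy_eq[OF x(1) t(1) z(1) _ z(2)] ne c(1) p(3) t(3,4) by metis+
    then show ?thesis using rank2D[OF x(2,1) l(1-3) ca c(1) p(3) z(1)] by metis
  qed
  then have "\<xi> \<inter> \<tau> = l" using l(4) lt by auto
  then show False using lacunary_line[OF k x(1) t(1) ne l(1)] by metis
qed

theorem mainTheorem2: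
  fixes \<Omega> :: "'a geometry" and \<Xi> \<S> :: "'a set set"
  assumes "strong_parapolar_space \<Omega>"
    and "lacunary \<Omega>"
    and "minimum_symplectic_rank \<Omega> 2"
    and "\<Xi> = symps \<Omega>"
    and "\<S> = maximal_singular_subspaces \<Omega>"
  shows
    "(\<exists>(\<Pi>\<^sub>1 :: 'a geometry) (\<Pi>\<^sub>2 :: 'a geometry).
        projective_plane \<Pi>\<^sub>1 \<and> projective_plane \<Pi>\<^sub>2 \<and>
        pl_isomorphic \<Omega> (cartesian_product \<Pi>\<^sub>1 \<Pi>\<^sub>2)) \<or>
     (imbrex_geometry \<Omega> \<and>
        generalized_quadrangle \<lparr>Points = Points \<Omega>, Lines = \<S>\<rparr> \<and>
        (\<forall>\<xi>\<in>\<Xi>. ideal_subquadrangle (induced_geometry \<Omega> \<xi>)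
                 \<lparr>Points = Points \<Omega>, Lines = \<S>\<rparr>)) \<or>
     (\<exists>(T :: 'a geometry) (\<Gamma> :: 'a geometry).
        thick_line T \<and> (linear_space \<Gamma> \<and> has_thick_lines \<Gamma> \<or> polar_space \<Gamma>) \<and>
        pl_isomorphic \<Omega> (cartesian_product T \<Gamma>)) \<or>
     (\<exists>\<Delta> :: 'a set geometry.
        thick_polar_space_of_rank \<Delta> 3 \<and> pl_isomorphic \<Omega> (dual_polar_space_rank3 \<Delta>))"
proof -
  interpret strong_parapolar \<Omega> by (rule strong_parapolar.intro[OF assms(1)])
  obtain \<xi> where x: "\<xi> \<in> Sy" "symp_has_rank \<Omega> \<xi> 2" using assms(3) unfolding minimum_symplectic_rank_def by metis
  have xr: "rank2 \<xi>" by (rule rank_two[OF x])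
  have rk: "symp_has_rank \<Omega> \<eta> 2" if e: "\<eta> \<in> Sy" "rank2 \<eta>" for \<eta>
  proof -
    obtain r where r: "symp_has_rank \<Omega> \<eta> r" using assms(3) e(1) unfolding minimum_symplectic_rank_def by metis
    show ?thesis using rank_le_two[OF e r] r by simp
  qed
  obtain k where k: "k \<ge> -1" "k_lacunary k \<Omega>" using assms(2) unfolding lacunary_def by metis
  \<comment> \<open>Lacunarity requires rank at least \<open>k + 1\<close> of every symp, and \<xi>
    has rank 2.\<close>
  have "k \<le> 1"
  proof -
    obtain r where r: "k + 1 \<le> int r" "symp_has_rank \<Omega> \<xi> r" using k(2) x(1) unfolding k_lacunary_def by metis
    show ?thesis using rank_le_two[OF x(1) xr r(2)] r(1) by simp
  qed
  moreover have "k \<noteq> 1" using not_lacunary_line[OF x(1) xr] k(2) by metis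
  ultimately consider "k = -1" | "k = 0" using k(1) by linarith
  then show ?thesis
  proof cases
    case 1
    have "meeting_symps_axioms Sy"
      by (rule meeting_symps_axioms.intro) (rule lacunary_empty[OF k(2)[unfolded 1]])
    then have "meeting_symps col Ln P Sy" using symp_space_axioms by (intro meeting_symps.intro)
    then interpret meeting_symps col Ln P Sy .
    have r2: "rank2 \<eta>" if "\<eta> \<in> Sy" for \<eta> by (rule rank2_all[OF x(1) xr that])
    have "strong_parapolar_quadrangle \<Omega>"
    proof (intro strong_parapolar_quadrangle.intro strong_parapolar_quadrangle_axioms.intro strong_parapolar_axioms)
      show "rank2 \<eta>" if "\<eta> \<in> Sy" for \<eta> by (rule r2[OF that])
      show "symp_has_rank \<Omega> \<eta> 2" if "\<eta> \<in> Sy" for \<eta> by (rule rk[OF that r2[OF that]])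
      show "\<exists>x'\<in>\<eta>. x' \<noteq> x \<and> col p x'" if "\<eta> \<in> Sy" "p \<in> P" "p \<notin> \<eta>" "x \<in> \<eta>" "col p x" for \<eta> p x
        by (rule not_singleton[OF that(2,3,1,4,5)])
    qed
    from strong_parapolar_quadrangle.gq_outcome[OF this] show ?thesis unfolding assms(4,5) by (rule disjI2[OF disjI1])
  next
    case 2
    have "strong_parapolar_0 \<Omega>" by (intro strong_parapolar_0.intro strong_parapolar_0_axioms.intro strong_parapolar_axioms k(2)[unfolded 2])
    then interpret strong_parapolar_0 \<Omega> .
    show ?thesis
    proof (cases "\<forall>\<eta>\<in>Sy. rank2 \<eta>")
      case True
      have "strong_parapolar_0_rank2 \<Omega>" by (intro strong_parapolar_0_rank2.intro strong_parapolar_0_rank2_axioms.intro strong_parapolar_0_axioms) (use True rk in metis)+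
      from strong_parapolar_0_rank2.outcome[OF this] show ?thesis unfolding assms(4,5) by (rule disjI2)
    next
      case False
      then obtain \<zeta> where "high_rank \<zeta>" unfolding high_rank_def by metis
      then obtain \<xi>' \<zeta>' x' k' t where "setting \<xi>' \<zeta>' x' k' t" using setting_ex[OF x(1) xr] by metis
      then obtain T where "product_at \<zeta>' x' T" using setting_product_at by metis
      from product_outcome[OF this] show ?thesis by (rule disjI2[OF disjI2[OF disjI1]])
    qed
  qed
qed

end
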